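(* Let $L$ be a Lévy process with Lévy–Khintchine triplet $(b,\sigma^2,\mu)$ with $\sigma^2>0$ and finite Lévy measure, $\lambda=\mu(\mathbb R)<\infty$, and let $X$ be the Ornstein–Uhlenbeck type process solving $dX_t=-aX_t\,dt+dL_t$, $X_0$ independent of $L$. Suppose that: (i) $a>0$, $\int_{|x|>1}\log|x|\,\mu(dx)<\infty$, $b=0$, and $\sup_{t\ge0}E_a[X_t^2]<\infty$; (ii) the jump-height distribution $F$ satisfies $F\big((-2\Delta_n^\beta,2\Delta_n^\beta)\big)=o(T_n^{-1})$; (iii) $\beta\in(0,1/2)$ is such that $T_n\Delta_n^{(1-2\beta)\wedge(1/2)}=o(1)$ as $n\to\infty$. Set $v_n=\Delta_n^\beta$ with this $\beta$. Then under $P^a$, $$T_n^{1/2}(\bar a_n-a)\xrightarrow{\mathcal D}N\Big(0,\frac{\sigma^2}{E_a[X_\infty^2]}\Big)\quad\text{as }n\to\infty,$$ and the estimator $\bar a_n$ is asymptotically efficient in the sense of Hájek–Le Cam.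
   Context: $L$ is defined on a filtered probability space; $P^a$ denotes the law when the drift parameter is $a$ and $E_a$ the corresponding expectation. Since $\mu$ is finite and $b=0$, $L_t=\sigma W_t+J_t$ with $W$ a standard Brownian motion and $J_t=\sum_{k=1}^{N_t}Z_k$ an independent compound Poisson process, where $N$ is a Poisson process of intensity $\lambda$ and the jump heights $Z_k$ are i.i.d. with distribution $F$ (so $\mu=\lambda F$). Under $a>0$ and the log-moment condition, $X$ has a unique invariant distribution $G$, $X_\infty\sim G$, and $E_a[X_\infty^2]$ is its second moment. Observation scheme: for each $n$, times $0=t_0<t_1<\dots<t_n=T_n$ with $T_n\to\infty$, $\Delta_n=\max_i(t_{i+1}-t_i)\downarrow0$ and $n\Delta_nT_n^{-1}=O(1)$. For a process $Y$, $\Delta_iY=Y_{t_{i+1}}-Y_{t_i}$. The jump-filtered estimator is $$\bar a_n=-\frac{\sum_{i=0}^{n-1}X_{t_i}\,\Delta_iX\,\mathbf 1_{\{|\Delta_iX|\le v_n\}}}{\sum_{i=0}^{n-1}X_{t_i}^2(t_{i+1}-t_i)}.$$ *)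

theory Defs
  imports "HOL-Probability.Probability" "HOL-Library.Landau_Symbols"
begin

definition brownian_motion :: "'a measure \<Rightarrow> (real \<Rightarrow> 'a \<Rightarrow> real) \<Rightarrow> bool" where
  "brownian_motion M W \<longleftrightarrow>
     (\<forall>t. W t \<in> borel_measurable M) \<and>
     (\<forall>\<omega>\<in>space M. W 0 \<omega> = 0 \<and> continuous_on {0..} (\<lambda>t. W t \<omega>)) \<and>
     (\<forall>s t. 0 \<le> s \<longrightarrow> s < t \<longrightarrow>
        distributed M lborel (\<lambda>\<omega>. W t \<omega> - W s \<omega>) (\<lambda>x. ennreal (normal_density 0 (sqrt (t - s)) x))) \<and>
     (\<forall>(k::nat) (\<tau>::nat \<Rightarrow> real). 0 \<le> \<tau> 0 \<and> (\<forall>i. \<tau> i \<le> \<tau> (Suc i)) \<longrightarrow>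
        prob_space.indep_vars M (\<lambda>_. borel) (\<lambda>i \<omega>. W (\<tau> (Suc i)) \<omega> - W (\<tau> i) \<omega>) {..<k})"

definition poisson_process :: "'a measure \<Rightarrow> real \<Rightarrow> (real \<Rightarrow> 'a \<Rightarrow> real) \<Rightarrow> bool" where
  "poisson_process M lam N \<longleftrightarrow>
     (\<forall>t. N t \<in> borel_measurable M) \<and>
     (\<forall>\<omega>\<in>space M. N 0 \<omega> = 0 \<and> (\<forall>t\<ge>0. N t \<omega> \<in> \<nat>) \<and> mono_on {0..} (\<lambda>t. N t \<omega>) \<and>
        (\<forall>t\<ge>0. continuous (at_right t) (\<lambda>s. N s \<omega>))) \<and>
     (\<forall>s t (k::nat). 0 \<le> s \<longrightarrow> s \<le> t \<longrightarrow>
        measure M {\<omega>\<in>space M. N t \<omega> - N s \<omega> = real k} =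
          (lam * (t - s)) ^ k / fact k * exp (- (lam * (t - s)))) \<and>
     (\<forall>(k::nat) (\<tau>::nat \<Rightarrow> real). 0 \<le> \<tau> 0 \<and> (\<forall>i. \<tau> i \<le> \<tau> (Suc i)) \<longrightarrow>
        prob_space.indep_vars M (\<lambda>_. borel) (\<lambda>i \<omega>. N (\<tau> (Suc i)) \<omega> - N (\<tau> i) \<omega>) {..<k})"

datatype ingredient = IX0 | IW | IN | IZ nat

definition ingredients ::
  "('a \<Rightarrow> real) \<Rightarrow> (real \<Rightarrow> 'a \<Rightarrow> real) \<Rightarrow> (real \<Rightarrow> 'a \<Rightarrow> real) \<Rightarrow> (nat \<Rightarrow> 'a \<Rightarrow> real)
    \<Rightarrow> ingredient \<Rightarrow> 'a \<Rightarrow> real \<Rightarrow> real" where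
  "ingredients X0 W N Z i \<omega> = (case i of
      IX0 \<Rightarrow> (\<lambda>_. X0 \<omega>) | IW \<Rightarrow> (\<lambda>t. W t \<omega>) | IN \<Rightarrow> (\<lambda>t. N t \<omega>) | IZ k \<Rightarrow> (\<lambda>_. Z k \<omega>))"

definition levy_L ::
  "real \<Rightarrow> (real \<Rightarrow> 'a \<Rightarrow> real) \<Rightarrow> (real \<Rightarrow> 'a \<Rightarrow> real) \<Rightarrow> (nat \<Rightarrow> 'a \<Rightarrow> real) \<Rightarrow> real \<Rightarrow> 'a \<Rightarrow> real" where
  "levy_L \<sigma> W N Z t \<omega> = \<sigma> * W t \<omega> + (\<Sum>k\<in>{1..nat \<lfloor>N t \<omega>\<rfloor>}. Z k \<omega>)"

text \<open>G is invariant: if X_0 ~ G independent of L, then X_t ~ G for all t \<ge> 0, i.e.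
  G = law(e^{-at} X_0) convolved with law(X_t - e^{-at} X_0) (the part driven by L).\<close>
definition ou_invariant ::
  "'a measure \<Rightarrow> (real \<Rightarrow> real \<Rightarrow> 'a \<Rightarrow> real) \<Rightarrow> ('a \<Rightarrow> real) \<Rightarrow> real \<Rightarrow> real measure \<Rightarrow> bool" where
  "ou_invariant M X X0 a G \<longleftrightarrow> prob_space G \<and> sets G = sets borel \<and>
     (\<forall>t\<ge>0. distr G borel (\<lambda>x. exp (- a * t) * x) \<star>
               distr M borel (\<lambda>\<omega>. X a t \<omega> - exp (- a * t) * X0 \<omega>) = G)"

definition ou_second_moment_inf ::
  "'a measure \<Rightarrow> (real \<Rightarrow> real \<Rightarrow> 'a \<Rightarrow> real) \<Rightarrow> ('a \<Rightarrow> real) \<Rightarrow> real \<Rightarrow> real" where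
  "ou_second_moment_inf M X X0 a = (\<integral>x. x ^ 2 \<partial>(THE G. ou_invariant M X X0 a G))"

definition grid_T :: "(nat \<Rightarrow> nat \<Rightarrow> real) \<Rightarrow> nat \<Rightarrow> real" where
  "grid_T t n = t n n"

definition grid_mesh :: "(nat \<Rightarrow> nat \<Rightarrow> real) \<Rightarrow> nat \<Rightarrow> real" where
  "grid_mesh t n = Max {t n (Suc i) - t n i | i. i < n}"

definition obs_law ::
  "'a measure \<Rightarrow> (real \<Rightarrow> real \<Rightarrow> 'a \<Rightarrow> real) \<Rightarrow> (nat \<Rightarrow> nat \<Rightarrow> real) \<Rightarrow> nat \<Rightarrow> real
     \<Rightarrow> (nat \<Rightarrow> real) measure" where
  "obs_law M X t n \<theta> = distr M (Pi\<^sub>M {..n} (\<lambda>_. borel)) (\<lambda>\<omega>. \<lambda>i\<in>{..n}. X \<theta> (t n i) \<omega>)"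

text \<open>Jump-filtered estimator as a function of the observations x_i = X_{t_i}.\<close>
definition abar ::
  "(nat \<Rightarrow> nat \<Rightarrow> real) \<Rightarrow> (nat \<Rightarrow> real) \<Rightarrow> nat \<Rightarrow> (nat \<Rightarrow> real) \<Rightarrow> real" where
  "abar t v n x =
     - (\<Sum>i<n. x i * (x (Suc i) - x i) * indicator {y. \<bar>y\<bar> \<le> v n} (x (Suc i) - x i))
     / (\<Sum>i<n. (x i)\<^sup>2 * (t n (Suc i) - t n i))"

definition LAN ::
  "(nat \<Rightarrow> real \<Rightarrow> 'b measure) \<Rightarrow> real \<Rightarrow> (nat \<Rightarrow> real) \<Rightarrow> real \<Rightarrow> bool" where
  "LAN P \<theta> r I \<longleftrightarrow> 0 < I \<and>
     (\<exists>S :: nat \<Rightarrow> 'b \<Rightarrow> real.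
        (\<forall>n. S n \<in> borel_measurable (P n \<theta>)) \<and>
        weak_conv_m (\<lambda>n. distr (P n \<theta>) borel (S n)) (density lborel (normal_density 0 (sqrt I))) \<and>
        (\<forall>h. (\<forall>\<^sub>F n in sequentially. absolutely_continuous (P n \<theta>) (P n (\<theta> + h * r n))) \<and>
             (\<forall>\<epsilon>>0. (\<lambda>n. measure (P n \<theta>)
                 {x\<in>space (P n \<theta>). \<bar>ln (enn2real (RN_deriv (P n \<theta>) (P n (\<theta> + h * r n)) x))
                     - h * S n x + h\<^sup>2 * I / 2\<bar> > \<epsilon>}) \<longlonglongrightarrow> 0)))"

definition regular_estimator ::
  "(nat \<Rightarrow> real \<Rightarrow> 'b measure) \<Rightarrow> (nat \<Rightarrow> 'b \<Rightarrow> real) \<Rightarrow> real \<Rightarrow> (nat \<Rightarrow> real) \<Rightarrow> real measure \<Rightarrow> bool" where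
  "regular_estimator P est \<theta> r Q \<longleftrightarrow>
     (\<forall>h. weak_conv_m (\<lambda>n. distr (P n (\<theta> + h * r n)) borel
                              (\<lambda>x. (est n x - (\<theta> + h * r n)) / r n)) Q)"

text \<open>Asymptotically efficient in the sense of Hajek--Le Cam: the model is LAN with some
  information I and the estimator is regular with the optimal limit N(0, 1/I)
  (optimal by the convolution theorem).\<close>
definition hajek_lecam_efficient ::
  "(nat \<Rightarrow> real \<Rightarrow> 'b measure) \<Rightarrow> (nat \<Rightarrow> 'b \<Rightarrow> real) \<Rightarrow> real \<Rightarrow> (nat \<Rightarrow> real) \<Rightarrow> bool" where
  "hajek_lecam_efficient P est \<theta> r \<longleftrightarrow>
     (\<exists>I. LAN P \<theta> r I \<and>
          regular_estimator P est \<theta> r (density lborel (normal_density 0 (sqrt (1 / I)))))"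

end

theory Submission
  imports Defs 
begin

text \<open>The observations satisfy an exact autoregression whose innovations are the sum of a Gaussian
  variable, independent of the past and of all jumps, and of the discounted jumps in the interval.
  The rate conditions make the threshold remove exactly the intervals with jumps outside an event of
  vanishing probability, so that the error of the estimator is a sum of past observations weighted by
  independent Gaussians. An energy identity gives the law of large numbers for its bracket, and
  conditional characteristic functions give its normal limit, along drift parameters converging to the
  true one as well; this is regularity. For local asymptotic normality, conditionally on the jumps and
  the initial value the likelihood ratio is an explicit Gaussian one. It depends on the unobserved
  jumps, but it is asymptotically a function of the observations, hence close in mean to the density
  of the laws of the observations.\<close>

text \<open>Solutions for all drifts share one noise, so the law for drift theta is the law of
  \<open>X theta\<close>, and local alternatives become sequences \<open>th n\<close> tending to
  \<open>a\<close>. Stochastic integrals are avoided: integration by parts leaves an ordinary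
  integral of the path, whose law and independence properties come from Riemann sums. An observation
  depends on earlier Gaussian and jump innovations alike. Hence two filtrations: \<open>HG\<close>
  reveals all jumps at the start, \<open>HJ\<close> the whole Brownian path; observations are
  adapted to both, and each centred error sum is orthogonal in one of them. Only second moments of
  the jumps are available, and they must themselves be extracted from the bound on the second moment
  of \<open>X\<close>. So squared jump innovations are truncated in the law of large numbers, and
  the innovation moments are read off from invariance. That identity holds at \<open>a\<close> only,
  whence the errors of size \<open>|th n - a|\<close>. The likelihood given the jumps and the
  density of the observed laws are never compared directly, but both with a bounded truncation of
  \<open>exp (h S - h^2 I / 2)\<close>.\<close>

abbreviation (input) "bmeas \<equiv> borel_measurable"
abbreviation (input) along_sequence (binder "EVN " 10) where "along_sequence P \<equiv> eventually P sequentially"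
abbreviation (input) converges_to (infix "--->" 60) where "f ---> l \<equiv> filterlim f (nhds l) sequentially"

section \<open>Independence of a random variable from a sigma-algebra\<close>

text \<open>Independence from a sigma-algebra, kept as a plain product formula on events;
  \<open>H\<close> will be the past of a filtration and \<open>V\<close> the next
  innovation.\<close>

definition indep_alg :: "'a measure => 'a measure => 'b measure => ('a => 'b) => bool" where
 "indep_alg M H S V \<longleftrightarrow> subalgebra M H & V \<in> measurable M S \<and>
  (\<forall>A\<in>sets H. \<forall>B\<in>sets S. measure M (A \<inter> (V -` B \<inter> space M)) = measure M A * measure M (V -` B \<inter> space M))"

lemma indep_algD:
 assumes "indep_alg M H S V"
 shows "subalgebra M H" "V \<in> measurable M S" "(%om. om) \<in> measurable M H"
  and "f \<in> measurable H T ==> f \<in> measurable M T"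
 using assms unfolding indep_alg_def
 by (auto intro: measurable_from_subalg measurable_ident)

text \<open>The identity, read as a map into the space carrying the smaller sigma-algebra
  \<open>H\<close>, is a random element generating \<open>H\<close>. Independence then says that its
  joint law with \<open>V\<close> is a product measure, and conditioning becomes Fubini.\<close>

lemma (in prob_space) indep_alg_distr:
 assumes ind: "indep_alg M H S V"
 shows "distr M H (%om. om) \<Otimes>\<^sub>M distr M S V = distr M (H \<Otimes>\<^sub>M S) (%x. (x, V x))"
proof -
 note [measurable] = indep_algD(2,3)[OF ind]
 interpret V: prob_space "distr M S V" by (rule prob_space_distr) measurable
 interpret Id: prob_space "distr M H (%om. om)" by (rule prob_space_distr) measurable
 show ?thesis
 proof (rule pair_measure_eqI)
  fix A B assume A: "A \<in> sets (distr M H (%om. om))" and B: "B \<in> sets (distr M S V)"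
  then have A': "A \<in> sets H" "A \<in> events" "A \<subseteq> space M" and B': "B \<in> sets S"
  using indep_algD(1)[OF ind] sets.sets_into_space[of A H] by (auto simp: subalgebra_def)
  have "emeasure (distr M (H \<Otimes>\<^sub>M S) (%x. (x, V x))) (A \<times> B) = emeasure M (A \<inter> (V -` B \<inter> space M))"
  using A' B' by (subst emeasure_distr) (auto intro!: arg_cong[where f="emeasure M"])
  also have "... = emeasure M A * emeasure M (V -` B \<inter> space M)"
  using ind A' B' by (simp add: emeasure_eq_measure indep_alg_def ennreal_mult'')
  also have "... = emeasure (distr M H (%om. om)) A * emeasure (distr M S V) B"
  using A' B' by (simp add: emeasure_distr Int_absorb2)
  finally show "emeasure (distr M H (%om. om)) A * emeasure (distr M S V) B =
  emeasure (distr M (H \<Otimes>\<^sub>M S) (%x. (x, V x))) (A \<times> B)" by simp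
 qed (auto intro: V.sigma_finite_measure_axioms Id.sigma_finite_measure_axioms)
qed

lemma (in prob_space) indep_alg_indep_var:
 assumes ind: "indep_alg M H S V" and f: "f \<in> measurable H T" and g: "g \<in> measurable S T'"
 shows "indep_var T f T' (%om. g (V om))"
proof -
 note V[measurable] = indep_algD(2,3)[OF ind]
 have fM[measurable]: "f \<in> measurable M T" using indep_algD(4)[OF ind f] .
 note g[measurable]
 have "indep_set {f -` A \<inter> space M | A. A \<in> sets T} {(%om. g (V om)) -` A \<inter> space M | A. A \<in> sets T'}"
  unfolding indep_sets2_eq
 proof (intro conjI ballI)
  fix a b assume "a \<in> {f -` A \<inter> space M | A. A \<in> sets T}" "b \<in> {(%om. g (V om)) -` A \<inter> space M | A. A \<in> sets T'}"
  then obtain A B where AB: "a = f -` A \<inter> space M" "A \<in> sets T" "b = (%om. g (V om)) -` B \<inter> space M" "B \<in> sets T'" by auto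
  have "a \<in> sets H" using measurable_sets[OF f AB(2)] indep_algD(1)[OF ind] AB by (simp add: subalgebra_def)
  moreover have "b = V -` (g -` B \<inter> space S) \<inter> space M" using AB measurable_space[OF V(1)] by auto
  moreover have "g -` B \<inter> space S \<in> sets S" using AB g by auto
  ultimately show "prob (a \<inter> b) = prob a * prob b" using ind unfolding indep_alg_def by blast
 qed auto
 moreover have "(%i. {case_bool f (%om. g (V om)) i -` A \<inter> space M | A. A \<in> sets (case_bool T T' i)})
  = case_bool {f -` A \<inter> space M | A. A \<in> sets T} {(%om. g (V om)) -` A \<inter> space M | A. A \<in> sets T'}"
  by (rule ext) (simp split: bool.split)
 ultimately show ?thesis
  unfolding indep_var_def indep_vars_def2 indep_set_def by (simp add: split: bool.split)
qed

text \<open>Averaging over \<open>V\<close> while the point \<open>om\<close> of the past is held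
  fixed is what a conditional expectation given \<open>H\<close> would do; the explicit inner
  integral takes its place throughout.\<close>

lemma (in prob_space) freezing_nn:
 assumes ind: "indep_alg M H S V" and f[measurable]: "f : bmeas (H \<Otimes>\<^sub>M S)"
 shows "(\<integral>\<^sup>+om. f (om, V om) \<partial>M) = (\<integral>\<^sup>+om. (\<integral>\<^sup>+y. f (om, y) \<partial>distr M S V) \<partial>M)"
proof -
 have id[measurable]: "(%om. om) \<in> measurable M H" and V[measurable]: "V \<in> measurable M S"
  using indep_algD[OF ind] by auto
 interpret V: prob_space "distr M S V" by (rule prob_space_distr) fact
 have eq: "distr M H (%om. om) \<Otimes>\<^sub>M distr M S V = distr M (H \<Otimes>\<^sub>M S) (%x. (x, V x))"
  by (rule indep_alg_distr[OF ind])
 have f': "f : bmeas (distr M H (%om. om) \<Otimes>\<^sub>M distr M S V)"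
  using f by (simp cong: measurable_cong_sets sets_pair_measure_cong)
 have f2: "(%x. \<integral>\<^sup>+ y. f (x, y) \<partial>distr M S V) : bmeas H"
  using V.borel_measurable_nn_integral_fst[OF f']
  by (simp cong: measurable_cong_sets)
 have "(\<integral>\<^sup>+om. f (om, V om) \<partial>M) = integral\<^sup>N (distr M (H \<Otimes>\<^sub>M S) (%x. (x, V x))) f"
  by (subst nn_integral_distr) auto
 also have "... = integral\<^sup>N (distr M H (%om. om) \<Otimes>\<^sub>M distr M S V) f" by (simp add: eq)
 also have "... = (\<integral>\<^sup>+x. \<integral>\<^sup>+y. f (x, y) \<partial>distr M S V \<partial>distr M H (%om. om))"
  by (rule V.nn_integral_fst[OF f', symmetric])
 also have "... = (\<integral>\<^sup>+om. (\<integral>\<^sup>+y. f (om, y) \<partial>distr M S V) \<partial>M)"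
  using f2 by (subst nn_integral_distr) auto
 finally show ?thesis .
qed

lemma (in prob_space) freezing:
 fixes f :: "'a \<times> 'b => 'c::{banach, second_countable_topology}"
 assumes ind: "indep_alg M H S V" and f[measurable]: "f : bmeas (H \<Otimes>\<^sub>M S)"
  and bnd: "\<And>om y. om : space M ==> y \<in> space S ==> norm (f (om, y)) <= B"
 shows "(LINT om|M. f (om, V om)) = (LINT om|M. (\<integral>y. f (om, y) \<partial>distr M S V))"
proof -
 have id[measurable]: "(%om. om) \<in> measurable M H" and V[measurable]: "V \<in> measurable M S"
  using indep_algD[OF ind] by auto
 interpret V: prob_space "distr M S V" by (rule prob_space_distr) fact
 interpret Id: prob_space "distr M H (%om. om)" by (rule prob_space_distr) fact
 interpret P: pair_prob_space "distr M H (%om. om)" "distr M S V" ..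
 have eq: "distr M H (%om. om) \<Otimes>\<^sub>M distr M S V = distr M (H \<Otimes>\<^sub>M S) (%x. (x, V x))"
  by (rule indep_alg_distr[OF ind])
 have f': "f : bmeas (distr M H (%om. om) \<Otimes>\<^sub>M distr M S V)"
  using f by (simp cong: measurable_cong_sets sets_pair_measure_cong)
 have f2: "(%x. \<integral> y. f (x, y) \<partial>distr M S V) : bmeas H"
  using V.borel_measurable_lebesgue_integral[of "%x y. f (x, y)" "distr M H (%om. om)"] f'
  by (simp cong: measurable_cong_sets)
 have "(LINT om|M. f (om, V om)) = integral\<^sup>L (distr M (H \<Otimes>\<^sub>M S) (%x. (x, V x))) f"
  by (subst integral_distr) auto
 also have "... = integral\<^sup>L (distr M H (%om. om) \<Otimes>\<^sub>M distr M S V) f" by (simp add: eq)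
 also have "... = (\<integral>x. \<integral>y. f (x, y) \<partial>distr M S V \<partial>distr M H (%om. om))"
  by (rule P.integral_fst'[symmetric], rule P.integrable_const_bound[where B=B]) (use f' bnd indep_algD(1)[OF ind] in \<open>auto simp: subalgebra_def space_pair_measure intro!: AE_I2\<close>)
 also have "... = (LINT om|M. (\<integral>y. f (om, y) \<partial>distr M S V))"
  using f2 by (subst integral_distr) auto
 finally show ?thesis .
qed

text \<open>The product formula for expectations of bounded continuous functions survives pointwise
  limits by dominated convergence. Indicators of half-lines are limits of such functions, and
  half-lines form a generating pi-system, which gives back independence.\<close>

lemma (in prob_space) indep_vars_limit:
 fixes Y :: "nat => 'a => real"
 assumes ind: "\<And>m. indep_vars (%_. borel) (Ym m) I" and fin: "finite I" "I ~= {}"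
  and lim: "\<And>i om. i \<in> I ==> om : space M ==> (%m. Ym m i om) ---> Y i om"
 shows "indep_vars (%_. borel) Y I"
proof -
 have Ym[measurable]: "i \<in> I ==> Ym m i : bmeas M" for i m
  using ind[of m] by (auto simp: indep_vars_def)
 have Y[measurable]: "i \<in> I ==> Y i : bmeas M" for i
  by (rule borel_measurable_LIMSEQ_real[OF lim]) auto
 \<comment> \<open>\<open>UNIV\<close> is added because the generator has to contain the whole
   space.\<close>
 define E where "E = insert UNIV (range (%x::real. {..x}))"
 have step: "(LINT om|M. (\<Prod>i\<in>I. f i (Y i om))) = (\<Prod>i\<in>I. \<integral>om. f i (Y i om) \<partial>M)"
  if c: "\<And>i. continuous_on UNIV (f i)" and b: "\<And>i x. \<bar>f i x\<bar> <= 1" for f :: "nat => real => real"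
 proof -
  have [measurable]: "f i : bmeas borel" for i using c by (rule borel_measurable_continuous_onI)
  have cl: "(%m. f i (Ym m i om)) ---> f i (Y i om)" if "i \<in> I" "om : space M" for i om
  using c[of i] lim[OF that] by (metis continuous_on_eq_continuous_at isCont_tendsto_compose open_UNIV UNIV_I)
  have "(%m. \<integral>om. (\<Prod>i\<in>I. f i (Ym m i om)) \<partial>M) ---> (LINT om|M. (\<Prod>i\<in>I. f i (Y i om)))"
  proof (rule integral_dominated_convergence[where w="%_. 1"])
  show "AE x in M. (%m. \<Prod>i\<in>I. f i (Ym m i x)) ---> (\<Prod>i\<in>I. f i (Y i x))"
  by (intro AE_I2 tendsto_prod cl)
  show "AE x in M. norm (\<Prod>i\<in>I. f i (Ym m i x)) <= 1" for m
  by (intro AE_I2) (auto simp: abs_prod intro!: prod_le_1 b)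
  qed auto
  moreover have "(LINT om|M. (\<Prod>i\<in>I. f i (Ym m i om))) = (\<Prod>i\<in>I. \<integral>om. f i (Ym m i om) \<partial>M)" for m
  by (intro indep_vars_lebesgue_integral fin indep_vars_compose2[OF ind] integrable_const_bound[where B=1])
  (auto simp: b)
  moreover have "(%m. \<Prod>i\<in>I. \<integral>om. f i (Ym m i om) \<partial>M) ---> (\<Prod>i\<in>I. \<integral>om. f i (Y i om) \<partial>M)"
  by (intro tendsto_prod integral_dominated_convergence[where w="%_. 1"]) (auto simp: b cl)
  ultimately show ?thesis using LIMSEQ_unique by fastforce
 qed
 have approx: "\<exists>h::nat=>real=>real. (\<forall>k. continuous_on UNIV (h k)) & (\<forall>k x. \<bar>h k x\<bar> <= 1) & (\<forall>x. (%k. h k x) ---> indicator A x)"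
  if AE: "A \<in> E" for A
 proof -
  consider "A = UNIV" | a where "A = {..a}" using AE by (auto simp: E_def)
  then show ?thesis
  proof cases
  case 1 then show ?thesis by (intro exI[of _ "%_ _. 1"]) auto
  next
  case (2 a)
  \<comment> \<open>For positive \<open>k\<close> this is a ramp equal to 1 up to \<open>a\<close>
    and falling to 0 over a length \<open>1 / k\<close>.\<close>
  define h where "h k x = max 0 (min 1 (1 - real k * (x - a)))" for k :: nat and x
  have "(%k. h k x) ---> indicator A x" for x
  proof (cases "x <= a")
  case True
  then have "h k x = 1" for k by (auto simp: h_def mult_nonneg_nonpos)
  then show ?thesis using True 2 by auto
  next
  case False
  then obtain k0 :: nat where k0: "real k0 * (x - a) > 1"
  using reals_Archimedean3[of "x - a"] by auto
  have "h k x = 0" if "k >= k0" for k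
  proof -
  have "real k * (x - a) >= real k0 * (x - a)" using that False by (intro mult_right_mono) auto
  with k0 show ?thesis by (auto simp: h_def)
  qed
  then have "EVN k. h k x = 0" by (auto simp: eventually_sequentially)
  then show ?thesis using False 2 by (auto intro: tendsto_eventually)
  qed
  then show ?thesis
  by (intro exI[of _ h]) (auto simp: h_def intro!: continuous_intros)
  qed
 qed
 have prob_E: "prob (\<Inter>j\<in>I. Y j -` A j \<inter> space M) = (\<Prod>j\<in>I. prob (Y j -` A j \<inter> space M))"
  if A: "\<And>i. i \<in> I ==> A i \<in> E" for A
 proof -
  define A' where "A' i = (if i \<in> I then A i else UNIV)" for i
  have "\<exists>h::nat=>real=>real. (\<forall>k. continuous_on UNIV (h k)) & (\<forall>k x. \<bar>h k x\<bar> <= 1) & (\<forall>x. (%k. h k x) ---> indicator (A' i) x)" for i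
  by (rule approx) (use A in \<open>auto simp: A'_def E_def\<close>)
  then obtain h where h: "\<And>i k. continuous_on UNIV (h i k)" "\<And>i k x. \<bar>h i k x\<bar> <= (1::real)"
  "\<And>i x. (%k. h i k x) ---> indicator (A' i) x" by metis
  have [measurable]: "h i k : bmeas borel" for i k using h(1) by (rule borel_measurable_continuous_onI)
  have [measurable]: "A' i \<in> sets borel" for i using A[of i] by (fastforce simp: A'_def E_def)
  have "(%k. \<integral>om. (\<Prod>i\<in>I. h i k (Y i om)) \<partial>M) ---> (LINT om|M. (\<Prod>i\<in>I. indicator (A' i) (Y i om)))"
  by (rule integral_dominated_convergence[where w="%_. 1"])
  (auto simp: abs_prod intro!: prod_le_1 h tendsto_prod)
  moreover have "(%k. \<Prod>i\<in>I. \<integral>om. h i k (Y i om) \<partial>M) ---> (\<Prod>i\<in>I. \<integral>om. indicator (A' i) (Y i om) \<partial>M)"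
  by (intro tendsto_prod integral_dominated_convergence[where w="%_. 1"]) (auto simp: h)
  moreover have "(LINT om|M. (\<Prod>i\<in>I. h i k (Y i om))) = (\<Prod>i\<in>I. \<integral>om. h i k (Y i om) \<partial>M)" for k
  by (rule step) (auto simp: h)
  ultimately have eq: "(LINT om|M. (\<Prod>i\<in>I. indicator (A' i) (Y i om))) = (\<Prod>i\<in>I. \<integral>om. indicator (A' i) (Y i om) \<partial>M :: real)"
  using LIMSEQ_unique by fastforce
  have "(LINT om|M. (\<Prod>i\<in>I. indicator (A' i) (Y i om))) = (\<integral>om. indicator (\<Inter>j\<in>I. Y j -` A' j \<inter> space M) om \<partial>M :: real)"
  proof (intro Bochner_Integration.integral_cong refl)
  fix om assume w: "om : space M"
  show "(\<Prod>i\<in>I. indicator (A' i) (Y i om)) = (indicator (\<Inter>j\<in>I. Y j -` A' j \<inter> space M) om :: real)"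
  using w fin by (auto simp: indicator_def)
  qed
  also have "... = prob (\<Inter>j\<in>I. Y j -` A' j \<inter> space M)" using fin by (auto intro!: sets.finite_INT)
  finally have 1: "prob (\<Inter>j\<in>I. Y j -` A' j \<inter> space M) = (\<Prod>i\<in>I. \<integral>om. indicator (A' i) (Y i om) \<partial>M)" using eq by simp
  have "(LINT om|M. indicator (A' i) (Y i om)) = prob (Y i -` A' i \<inter> space M)" if "i \<in> I" for i
  proof -
  have "(LINT om|M. indicator (A' i) (Y i om)) = (\<integral>om. indicator (Y i -` A' i \<inter> space M) om \<partial>M :: real)"
  by (intro Bochner_Integration.integral_cong refl) (auto simp: indicator_def)
  then show ?thesis using that by simp
  qed
  with 1 show ?thesis by (simp add: A'_def cong: INF_cong prod.cong)
 qed
 show ?thesis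
 proof (subst indep_vars_finite[where E="%_. E"])
  show "sets borel = sigma_sets (space borel) E" for i :: nat
  proof -
  have "sets (borel::real measure) = sigma_sets UNIV (range (%x. {..x}))"
  by (subst borel_eq_atMost) auto
  also have "... = sigma_sets UNIV E"
  unfolding E_def by (rule sigma_sets_eqI) (auto intro: sigma_sets_top)
  finally show ?thesis by simp
  qed
  show "Int_stable E" unfolding Int_stable_def E_def by auto
  show "\<forall>A\<in>I \<rightarrow> E. prob (\<Inter>j\<in>I. Y j -` A j \<inter> space M) = (\<Prod>j\<in>I. prob (Y j -` A j \<inter> space M))"
  by (intro ballI prob_E) (rule Pi_mem)
 qed (use fin in \<open>auto simp: E_def\<close>)
qed

section \<open>Filtrations generated by successive innovations\<close>

definition augment :: "'a measure => 'a measure => (nat => 'a => real) => nat => 'a measure" where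
 "augment M S Y i = sigma (space M) (sets S \<union> {Y l -` B \<inter> space M | l B. l < i & B \<in> sets borel})"

text \<open>The innovation \<open>V i\<close> is independent of \<open>H i\<close> and becomes known
  at \<open>Suc i\<close>. Full independence is kept rather than mere centring, since it is what
  freezing needs.\<close>

definition adapted_indep :: "'a measure => (nat => 'a measure) => (nat => 'a => real) => nat => bool" where
 "adapted_indep M H V k \<longleftrightarrow>
  (\<forall>i\<le>k. subalgebra M (H i)) \<and>
  (\<forall>i l. i <= l --> l <= k --> sets (H i) \<subseteq> sets (H l)) \<and>
  (\<forall>i<k. V i : bmeas (H (Suc i))) \<and>
  (\<forall>i<k. indep_alg M (H i) borel (V i))"

lemma adapted_indep_mono: "adapted_indep M H V k ==> l <= k ==> adapted_indep M H V l"
 unfolding adapted_indep_def by auto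

lemma adapted_indepD:
 assumes "adapted_indep M H V k"
 shows "i <= k ==> subalgebra M (H i)"
  and "i < k ==> V i : bmeas (H (Suc i))"
  and "i < k ==> indep_alg M (H i) borel (V i)"
  and "i <= l ==> l <= k ==> f \<in> measurable (H i) S ==> f \<in> measurable (H l) S"
proof -
 show "i <= l ==> l <= k ==> f \<in> measurable (H i) S ==> f \<in> measurable (H l) S"
  using assms unfolding adapted_indep_def
  by (intro measurable_from_subalg[of "H l" "H i"]) (auto simp: subalgebra_def)
qed (use assms in \<open>auto simp: adapted_indep_def\<close>)

lemma adapted_indep_measurable:
 assumes "adapted_indep M H V k" "i <= k" "f \<in> measurable (H i) S"
 shows "f \<in> measurable M S"
 using assms measurable_from_subalg[of M "H i"] by (auto simp: adapted_indep_def)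

lemma (in prob_space) augment_sets:
 assumes "subalgebra M S0" "\<And>l. l < n ==> Y l : bmeas M" "i <= n"
 shows "sets (augment M S0 Y i) = sigma_sets (space M) (sets S0 \<union> {Y l -` B \<inter> space M | l B. l < i & B \<in> sets borel})"
  and "space (augment M S0 Y i) = space M" and "subalgebra M (augment M S0 Y i)"
proof -
 have *: "sets S0 \<union> {Y l -` B \<inter> space M | l B. l < i & B \<in> sets borel} \<subseteq> events"
  using assms by (auto simp: subalgebra_def)
 then have "sets S0 \<union> {Y l -` B \<inter> space M | l B. l < i & B \<in> sets borel} \<subseteq> Pow (space M)"
  using sets.sets_into_space by blast
 then show 1: "sets (augment M S0 Y i) = sigma_sets (space M) (sets S0 \<union> {Y l -` B \<inter> space M | l B. l < i & B \<in> sets borel})"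
  and 2: "space (augment M S0 Y i) = space M"
  unfolding augment_def by auto
 show "subalgebra M (augment M S0 Y i)" unfolding subalgebra_def 1 2
  using sets.sigma_sets_subset[OF *] by auto
qed

text \<open>The initial sigma-algebra is treated as one more member of the independent family, at
  index 0, with \<open>Y l\<close> at index \<open>Suc l\<close>. Grouping the indices up to
  \<open>i\<close> against the single index \<open>Suc i\<close> separates \<open>Y i\<close> from
  its past.\<close>

lemma (in prob_space) adapted_indep_augment:
 assumes ind: "indep_set (sets S0) (sets S1)" and sub: "subalgebra M S0" "subalgebra M S1"
  and Y: "indep_vars (%_. borel) Y {..<n}" and YS: "\<And>l. l < n ==> Y l : bmeas S1"
 shows "adapted_indep M (augment M S0 Y) Y n"
  and "i <= n ==> sets S0 \<subseteq> sets (augment M S0 Y i)"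
proof -
 have Ym[measurable]: "l < n ==> Y l : bmeas M" for l
  using YS sub by (auto intro: measurable_from_subalg)
 have A: "sets (augment M S0 Y i) = sigma_sets (space M) (sets S0 \<union> {Y l -` B \<inter> space M | l B. l < i & B \<in> sets borel})"
  "space (augment M S0 Y i) = space M" "subalgebra M (augment M S0 Y i)" if "i <= n" for i
  using augment_sets[OF sub(1), of n Y i] Ym that by auto
 show S0: "i <= n ==> sets S0 \<subseteq> sets (augment M S0 Y i)" for i
  by (subst A) auto
 define E where "E j = (case j of 0 => sets S0 | Suc l => {Y l -` B \<inter> space M | B. B \<in> sets borel})" for j
 have E_ev: "E j \<subseteq> events" if "j <= n" for j
  using that sub(1) by (cases j) (auto simp: E_def subalgebra_def)
 have sp: "space M \<in> E j" for j
 proof (cases j)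
  case 0
  then show ?thesis using sub(1) sets.top[of S0] by (simp add: E_def subalgebra_def)
 next
  case (Suc l)
  then show ?thesis by (auto simp: E_def intro!: exI[of _ UNIV])
 qed
 have indE: "indep_sets E {..n}"
 proof (subst indep_sets_finite)
  show "\<forall>A\<in>Pi {..n} E. prob (\<Inter>j\<in>{..n}. A j) = (\<Prod>j\<in>{..n}. prob (A j))"
  proof
  fix A assume A: "A \<in> Pi {..n} E"
  have A0: "A 0 \<in> sets S0" using A by (auto simp: E_def Pi_def split: nat.splits)
  have AS: "A (Suc l) \<in> {Y l -` B \<inter> space M | B. B \<in> sets borel}" if "l < n" for l
  using Pi_mem[OF A, of "Suc l"] that by (simp add: E_def)
  show "prob (\<Inter>j\<in>{..n}. A j) = (\<Prod>j\<in>{..n}. prob (A j))"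
  proof (cases "n = 0")
  case False
  have inS1: "(\<Inter>l\<in>{..<n}. A (Suc l)) \<in> sets S1"
  proof (intro sets.finite_INT)
  fix l assume "l \<in> {..<n}"
  then obtain B where "A (Suc l) = Y l -` B \<inter> space M" "B \<in> sets borel" using AS by blast
  then show "A (Suc l) \<in> sets S1" using measurable_sets[OF YS, of l B] \<open>l \<in> _\<close> sub(2)
  by (auto simp: subalgebra_def)
  qed (use False in auto)
  have "(\<Inter>j\<in>{..n}. A j) = A 0 \<inter> (\<Inter>l\<in>{..<n}. A (Suc l))"
  by (simp add: lessThan_Suc_atMost[symmetric] lessThan_Suc_eq_insert_0 image_image)
  then have "prob (\<Inter>j\<in>{..n}. A j) = prob (A 0) * prob (\<Inter>l\<in>{..<n}. A (Suc l))"
  using ind A0 inS1 by (simp add: indep_sets2_eq)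
  also have "prob (\<Inter>l\<in>{..<n}. A (Suc l)) = (\<Prod>l\<in>{..<n}. prob (A (Suc l)))"
  proof -
  have "indep_sets (%i. { Y i -` A \<inter> space M | A. A \<in> sets borel}) {..<n}"
  using Y unfolding indep_vars_def2 by auto
  then show ?thesis
  by (rule indep_setsD) (use False AS in auto)
  qed
  also have "prob (A 0) * ... = (\<Prod>j\<in>{..n}. prob (A j))"
  unfolding lessThan_Suc_atMost[symmetric] prod.lessThan_Suc_shift by simp
  finally show ?thesis .
  qed simp
  qed
 qed (use E_ev sp in auto)
 have ivar: "indep_alg M (augment M S0 Y i) borel (Y i)" if i: "i < n" for i
 proof -
  let ?I = "case_bool {..i} {Suc i}"
  have "indep_sets (%b. sigma_sets (space M) (\<Union>i\<in>?I b. E i)) UNIV"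
  proof (rule indep_sets_collect_sigma)
  show "indep_sets E (\<Union>j\<in>UNIV. ?I j)"
  by (rule indep_sets_mono_index[OF _ indE]) (use i in \<open>auto simp: UNIV_bool\<close>)
  show "Int_stable (E k)" for k
  proof (cases k)
  case 0
  then show ?thesis by (auto simp: E_def Int_stable_def)
  next
  case (Suc l)
  show ?thesis unfolding Int_stable_def E_def Suc
  proof (safe, simp, safe)
  fix B B' :: "real set" assume "B \<in> sets borel" "B' \<in> sets borel"
  then show "\<exists>C. Y l -` B \<inter> space M \<inter> (Y l -` B' \<inter> space M) = Y l -` C \<inter> space M & C \<in> sets borel"
  by (intro exI[of _ "B \<inter> B'"]) auto
  qed
  qed
  show "disjoint_family_on ?I UNIV"
  by (auto simp: disjoint_family_on_def split: bool.splits)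
  qed
  moreover have "(%b. sigma_sets (space M) (\<Union>i\<in>?I b. E i)) =
  case_bool (sigma_sets (space M) (\<Union>k\<in>{..i}. E k)) (sigma_sets (space M) (E (Suc i)))"
  by (rule ext) (simp split: bool.split)
  ultimately have *: "indep_set (sigma_sets (space M) (\<Union>k\<in>{..i}. E k)) (sigma_sets (space M) (E (Suc i)))"
  unfolding indep_set_def by simp
  have "(\<Union>k\<in>{..i}. E k) = sets S0 \<union> {Y l -` B \<inter> space M | l B. l < i & B \<in> sets borel}"
  by (simp add: lessThan_Suc_atMost[symmetric] lessThan_Suc_eq_insert_0 E_def) blast
  then have eq: "sigma_sets (space M) (\<Union>k\<in>{..i}. E k) = sets (augment M S0 Y i)"
  using A(1)[of i] i by simp
  have "prob (a \<inter> (Y i -` B \<inter> space M)) = prob a * prob (Y i -` B \<inter> space M)"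
  if "a \<in> sets (augment M S0 Y i)" "B \<in> sets borel" for a B
  proof -
  have "Y i -` B \<inter> space M \<in> sigma_sets (space M) (E (Suc i))"
  by (rule sigma_sets.Basic) (use that in \<open>auto simp: E_def\<close>)
  then show ?thesis using * that unfolding eq indep_sets2_eq by blast
  qed
  then show ?thesis
  using A(3)[of i] i Ym[of i] unfolding indep_alg_def by simp
 qed
 show "adapted_indep M (augment M S0 Y) Y n"
  unfolding adapted_indep_def
 proof (intro conjI allI impI)
  fix i l assume "i <= l" "l <= n"
  then show "sets (augment M S0 Y i) \<subseteq> sets (augment M S0 Y l)"
  by (simp add: A) (rule sigma_sets_mono', fastforce)
 next
  fix i assume i: "i < n"
  show "Y i : bmeas (augment M S0 Y (Suc i))"
  proof (rule measurableI)
  fix B :: "real set" assume B: "B \<in> sets borel"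
  show "Y i -` B \<inter> space (augment M S0 Y (Suc i)) \<in> sets (augment M S0 Y (Suc i))"
  using i A(1,2)[of "Suc i"] B by (auto intro!: sigma_sets.Basic)
  qed auto
 qed (use A ivar in auto)
qed

text \<open>Sums of conditionally centred terms have orthogonal increments.\<close>
lemma (in prob_space) adapted_sum_L2:
 fixes c V :: "nat => 'a => real"
 assumes ad: "adapted_indep M H V k"
  and c: "\<And>i. i < k ==> c i : bmeas (H i)" "\<And>i. i < k ==> integrable M (%om. (c i om)\<^sup>2)"
  and V: "\<And>i. i < k ==> integrable M (%om. (V i om)\<^sup>2)" "\<And>i. i < k ==> (LINT om|M. V i om) = 0"
 shows "integrable M (%om. (\<Sum>i<k. c i om * V i om)\<^sup>2) \<and>
  (LINT om|M. (\<Sum>i<k. c i om * V i om)\<^sup>2) = (\<Sum>i<k. (LINT om|M. (c i om)\<^sup>2) * (LINT om|M. (V i om)\<^sup>2))"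
 using assms
proof (induction k)
 case (Suc k)
 let ?S = "%om. \<Sum>i<k. c i om * V i om"
 have IH: "integrable M (%om. (?S om)\<^sup>2)" "(LINT om|M. (?S om)\<^sup>2) = (\<Sum>i<k. (LINT om|M. (c i om)\<^sup>2) * (LINT om|M. (V i om)\<^sup>2))"
  using Suc.IH[OF adapted_indep_mono[OF Suc.prems(1)]] Suc.prems by auto
 have SH[measurable]: "?S : bmeas (H k)"
 proof (intro borel_measurable_sum borel_measurable_times)
  fix i assume i: "i \<in> {..<k}"
  show "c i : bmeas (H k)" using i Suc.prems(2)[of i] by (auto intro!: adapted_indepD(4)[OF Suc.prems(1), of i])
  show "V i : bmeas (H k)" using i by (auto intro!: adapted_indepD(4)[OF Suc.prems(1), of "Suc i"] adapted_indepD(2)[OF Suc.prems(1), of i])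
 qed
 have ck[measurable]: "c k : bmeas (H k)" using Suc.prems by auto
 have ind: "indep_alg M (H k) borel (V k)" using adapted_indepD(3)[OF Suc.prems(1)] by auto
 have Vm[measurable]: "V k : bmeas M" using indep_algD(2)[OF ind] .
 have Sm[measurable]: "?S : bmeas M" "c k : bmeas M"
  by (rule adapted_indep_measurable[OF Suc.prems(1) _ SH], simp, rule adapted_indep_measurable[OF Suc.prems(1) _ ck], simp)
 have Vi: "integrable M (V k)" using square_integrable_imp_integrable[OF Vm Suc.prems(4)[of k]] by simp
 have Sc: "integrable M (%om. ?S om * c k om)"
 proof (rule Bochner_Integration.integrable_bound[OF Bochner_Integration.integrable_add[OF IH(1) Suc.prems(3)[of k]]])
  show "AE x in M. norm (?S x * c k x) <= norm ((?S x)^2 + (c k x)^2)"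
  proof (intro AE_I2)
  fix x
  have "2 * \<bar>?S x\<bar> * \<bar>c k x\<bar> <= \<bar>?S x\<bar>\<^sup>2 + \<bar>c k x\<bar>\<^sup>2" by (rule sum_squares_bound)
  moreover have "\<bar>?S x\<bar> * \<bar>c k x\<bar> >= 0" by auto
  ultimately show "norm (?S x * c k x) <= norm ((?S x)^2 + (c k x)^2)"
  unfolding real_norm_def abs_mult by (simp only: power2_abs)
  qed
 qed auto
 have i1: "indep_var borel (%om. ?S om * c k om) borel (V k)"
  by (rule indep_alg_indep_var[OF ind borel_measurable_times[OF SH ck] measurable_ident_sets[OF refl]])
 have i2: "indep_var borel (%om. (c k om)\<^sup>2) borel (%om. (V k om)\<^sup>2)"
  by (rule indep_alg_indep_var[OF ind borel_measurable_power[OF ck] borel_measurable_power[OF measurable_ident_sets[OF refl]]])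
 have I1: "integrable M (%om. ?S om * c k om * V k om)" "(LINT om|M. ?S om * c k om * V k om) = 0"
  using indep_var_integrable[OF i1 Sc Vi] indep_var_lebesgue_integral[OF i1 Sc Vi] Suc.prems(5)[of k] by auto
 have I2: "integrable M (%om. (c k om)\<^sup>2 * (V k om)^2)"
  "(LINT om|M. (c k om)\<^sup>2 * (V k om)^2) = (LINT om|M. (c k om)\<^sup>2) * (LINT om|M. (V k om)\<^sup>2)"
  using indep_var_integrable[OF i2] indep_var_lebesgue_integral[OF i2] Suc.prems by auto
 have eq: "(\<Sum>i<Suc k. c i om * V i om)^2 = (?S om)^2 + 2 * (?S om * c k om * V k om) + (c k om)^2 * (V k om)^2" for om
  by (simp add: power2_eq_square algebra_simps)
 show ?case unfolding eq using IH I1 I2 by simp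
qed simp

section \<open>Convergence in probability\<close>

text \<open>Convergence to 0 in probability, with the exceptional event as an explicit measurable
  set: \<open>X n\<close> itself need not be measurable, and estimates valid off a bad event
  transfer directly. One \<open>e\<close> bounds both the probability and the deviation.\<close>

definition oP :: "'a measure => (nat => 'a => real) => bool" where
 "oP M X \<longleftrightarrow> (\<forall>e>0. EVN n. \<exists>A\<in>sets M. measure M A <= e & (\<forall>om\<in>space M - A. \<bar>X n om\<bar> <= e))"

text \<open>Tightness for large \<open>n\<close>; the bound \<open>K\<close> may depend on
  \<open>e\<close>, and finitely many terms are left free.\<close>

definition bP :: "'a measure => (nat => 'a => real) => bool" where
 "bP M X \<longleftrightarrow> (\<forall>e>0. \<exists>K. EVN n. \<exists>A\<in>sets M. measure M A <= e & (\<forall>om\<in>space M - A. \<bar>X n om\<bar> <= K))"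

lemma oPI:
 assumes "\<And>e. e > 0 ==> EVN n. \<exists>A\<in>sets M. measure M A <= e & (\<forall>om\<in>space M - A. \<bar>X n om\<bar> <= e)"
 shows "oP M X"
 using assms unfolding oP_def by blast

lemma oPD: "oP M X ==> e > 0 ==> EVN n. \<exists>A\<in>sets M. measure M A <= e & (\<forall>om\<in>space M - A. \<bar>X n om\<bar> <= e)"
 unfolding oP_def by blast

lemma oPD2:
 assumes "oP M X" "e > 0" "d > 0"
 shows "EVN n. \<exists>A\<in>sets M. measure M A <= e & (\<forall>om\<in>space M - A. \<bar>X n om\<bar> <= d)"
 using oPD[OF assms(1), of "min e d"] assms(2,3) by (force elim!: eventually_mono)

lemma oP_mono:
 assumes "oP M Y" "EVN n. \<forall>om\<in>space M. \<bar>X n om\<bar> <= \<bar>Y n om\<bar>"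
 shows "oP M X"
proof (rule oPI)
 fix e :: real assume "e > 0"
 from oPD[OF assms(1) this] assms(2)
 show "EVN n. \<exists>A\<in>sets M. measure M A <= e & (\<forall>om\<in>space M - A. \<bar>X n om\<bar> <= e)"
  by eventually_elim force
qed

lemma oP_cong_eventually:
 assumes "oP M Y" "EVN n. \<forall>om\<in>space M. X n om = Y n om"
 shows "oP M X"
 by (rule oP_mono[OF assms(1)]) (use assms(2) in \<open>auto elim: eventually_mono\<close>)

lemma oP_const:
 assumes "c ---> 0"
 shows "oP M (%n om. c n)"
proof (rule oPI)
 fix e :: real assume "e > 0"
 from tendstoD[OF assms this]
 show "EVN n. \<exists>A\<in>sets M. measure M A <= e & (\<forall>om\<in>space M - A. \<bar>c n\<bar> <= e)"
  by eventually_elim (use \<open>e > 0\<close> in \<open>auto intro!: bexI[of _ "{}"]\<close>)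
qed

context prob_space
begin

lemma oP_add:
 assumes "oP M X" "oP M Y"
 shows "oP M (%n om. X n om + Y n om)"
proof (rule oPI)
 fix e :: real assume "e > 0"
 then have "e / 2 > 0" by simp
 from oPD[OF assms(1) this] oPD[OF assms(2) this]
 show "EVN n. \<exists>A\<in>sets M. measure M A <= e & (\<forall>om\<in>space M - A. \<bar>X n om + Y n om\<bar> <= e)"
 proof eventually_elim
  case (elim n)
  then obtain A B where "A \<in> sets M" "measure M A <= e/2" "\<And>om. om : space M - A ==> \<bar>X n om\<bar> <= e/2"
  "B \<in> sets M" "measure M B <= e/2" "\<And>om. om : space M - B ==> \<bar>Y n om\<bar> <= e/2" by blast
  then show ?case
  using measure_Un_le[of A M B]
  by (intro bexI[of _ "A \<union> B"] conjI ballI) (auto intro: order_trans[OF abs_triangle_ineq] add_mono[of _ "e/2" _ "e/2", simplified])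
 qed
qed

lemma oP_uminus: "oP M X ==> oP M (%n om. - X n om)"
 by (rule oP_mono) auto

lemma oP_diff: "oP M X ==> oP M Y ==> oP M (%n om. X n om - Y n om)"
 using oP_add[OF _ oP_uminus] by simp

lemma oP_bP_mult:
 assumes "oP M X" "bP M Y"
 shows "oP M (%n om. X n om * Y n om)"
proof (rule oPI)
 fix e :: real assume e: "e > 0"
 then obtain K where K: "EVN n. \<exists>A\<in>sets M. measure M A <= e/2 & (\<forall>om\<in>space M - A. \<bar>Y n om\<bar> <= K)"
  using assms(2)[unfolded bP_def, rule_format, of "e/2"] by auto
 have pos: "e / (\<bar>K\<bar> + 1) > 0" "e / 2 > 0" using e by (simp_all add: add_nonneg_pos)
 from oPD2[OF assms(1) pos(2,1)] K
 show "EVN n. \<exists>A\<in>sets M. measure M A <= e & (\<forall>om\<in>space M - A. \<bar>X n om * Y n om\<bar> <= e)"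
 proof eventually_elim
  case (elim n)
  then obtain A B where AB: "A \<in> sets M" "measure M A <= e/2" "\<And>om. om : space M - A ==> \<bar>X n om\<bar> <= e / (\<bar>K\<bar> + 1)"
  "B \<in> sets M" "measure M B <= e/2" "\<And>om. om : space M - B ==> \<bar>Y n om\<bar> <= K" by blast
  have "\<bar>X n om * Y n om\<bar> <= e" if "om : space M - (A \<union> B)" for om
  proof -
  have "\<bar>X n om\<bar> * \<bar>Y n om\<bar> <= e / (\<bar>K\<bar> + 1) * (\<bar>K\<bar> + 1)"
  using AB(3)[of om] AB(6)[of om] that e by (intro mult_mono) auto
  also have "... = e" by (simp add: add_nonneg_pos less_imp_neq[symmetric])
  finally show ?thesis by (simp add: abs_mult)
  qed
  then show ?case
  using measure_Un_le[of A M B] AB by (intro bexI[of _ "A \<union> B"] conjI ballI) auto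
 qed
qed

lemma bP_mult:
 assumes "bP M X" "bP M Y"
 shows "bP M (%n om. X n om * Y n om)"
 unfolding bP_def
proof (intro allI impI)
 fix e :: real assume "e > 0"
 then have "e / 2 > 0" by simp
 with assms obtain K L where
  K: "EVN n. \<exists>A\<in>sets M. measure M A <= e/2 & (\<forall>om\<in>space M - A. \<bar>X n om\<bar> <= K)"
  and L: "EVN n. \<exists>A\<in>sets M. measure M A <= e/2 & (\<forall>om\<in>space M - A. \<bar>Y n om\<bar> <= L)"
  unfolding bP_def by meson
 show "\<exists>K. EVN n. \<exists>A\<in>sets M. measure M A <= e & (\<forall>om\<in>space M - A. \<bar>X n om * Y n om\<bar> <= K)"
 proof (rule exI[of _ "\<bar>K\<bar> * \<bar>L\<bar>"], use K L in eventually_elim)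
  case (elim n)
  then obtain A B where AB: "A \<in> sets M" "measure M A <= e/2" "\<And>om. om : space M - A ==> \<bar>X n om\<bar> <= K"
  "B \<in> sets M" "measure M B <= e/2" "\<And>om. om : space M - B ==> \<bar>Y n om\<bar> <= L" by blast
  have "\<bar>X n om * Y n om\<bar> <= \<bar>K\<bar> * \<bar>L\<bar>" if "om : space M - (A \<union> B)" for om
  using AB(3)[of om] AB(6)[of om] that unfolding abs_mult by (intro mult_mono) auto
  then show ?case
  using measure_Un_le[of A M B] AB by (intro bexI[of _ "A \<union> B"] conjI ballI) auto
 qed
qed

lemma bP_const: "EVN n. \<bar>c n\<bar> <= C ==> bP M (%n om. c n)"
 unfolding bP_def by (intro allI impI exI[of _ C]) (auto intro!: bexI[of _ "{}"] elim: eventually_mono)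

lemma oP_cmult:
 assumes "oP M X" "EVN n. \<bar>c n\<bar> <= C"
 shows "oP M (%n om. c n * X n om)"
 using oP_bP_mult[OF assms(1) bP_const[OF assms(2)]] by (simp add: mult.commute)

text \<open>Events of vanishing probability may be ignored; identities that hold only where the jump
  filter is correct, or where a denominator is nonzero, enter through this rule.\<close>

lemma oP_except:
 assumes "oP M Y" "EVN n. B n \<in> sets M" "(%n. measure M (B n)) ---> 0"
  and "EVN n. \<forall>om\<in>space M - B n. \<bar>X n om\<bar> <= \<bar>Y n om\<bar>"
 shows "oP M X"
proof (rule oPI)
 fix e :: real assume "e > 0"
 then have e: "e / 2 > 0" by simp
 from oPD[OF assms(1) e] assms(2) tendstoD[OF assms(3) e] assms(4)
 show "EVN n. \<exists>A\<in>sets M. measure M A <= e & (\<forall>om\<in>space M - A. \<bar>X n om\<bar> <= e)"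
 proof eventually_elim
  case (elim n)
  then obtain A where A: "A \<in> sets M" "measure M A <= e/2" "\<And>om. om : space M - A ==> \<bar>Y n om\<bar> <= e/2" by blast
  then show ?case using elim measure_Un_le[of A M "B n"] \<open>e > 0\<close>
  by (intro bexI[of _ "A \<union> B n"] conjI ballI) (force simp: dist_real_def)+
 qed
qed

lemma oP_L1:
 assumes "EVN n. integrable M (X n) & (LINT om|M. \<bar>X n om\<bar>) <= b n" "b ---> 0"
 shows "oP M X"
proof (rule oPI)
 fix e :: real assume e: "e > 0"
 \<comment> \<open>With a mean below \<open>e * e\<close>, Markov's inequality at level
   \<open>e\<close> gives a probability of at most \<open>e\<close>.\<close>
 then have "e * e > 0" by simp
 from assms(1) tendstoD[OF assms(2) this]
 show "EVN n. \<exists>A\<in>sets M. measure M A <= e & (\<forall>om\<in>space M - A. \<bar>X n om\<bar> <= e)"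
 proof eventually_elim
  case (elim n)
  have "measure M {om\<in>space M. \<bar>X n om\<bar> >= e} <= (LINT om|M. \<bar>X n om\<bar>) / e"
  by (rule integral_Markov_inequality_measure[where A="{}"]) (use elim e in auto)
  also have "... <= e" using elim e by (auto simp: dist_real_def field_simps)
  finally show ?case using elim
  by (intro bexI[of _ "{om\<in>space M. \<bar>X n om\<bar> >= e}"]) auto
 qed
qed

lemma oP_L2:
 assumes "EVN n. integrable M (%om. (X n om)\<^sup>2) & (LINT om|M. (X n om)\<^sup>2) <= b n" "b ---> 0"
 shows "oP M X"
proof (rule oPI)
 fix e :: real assume e: "e > 0"
 have "oP M (%n om. (X n om)\<^sup>2)" by (rule oP_L1[OF _ assms(2)]) (use assms(1) in simp)
 moreover have "((X n om)^2 <= e^2) = (\<bar>X n om\<bar> <= e)" for n om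
  using e abs_le_square_iff[of "X n om" e] by simp
 ultimately have "EVN n. \<exists>A\<in>sets M. measure M A <= e & (\<forall>om\<in>space M - A. \<bar>X n om\<bar> <= e)"
  using oPD2[of M "%n om. (X n om)\<^sup>2" e "e^2"] e by simp
 then   show "EVN n. \<exists>A\<in>sets M. measure M A <= e & (\<forall>om\<in>space M - A. \<bar>X n om\<bar> <= e)" .
qed

lemma bP_L2:
 assumes "EVN n. integrable M (%om. (X n om)\<^sup>2) & (LINT om|M. (X n om)\<^sup>2) <= C"
 shows "bP M X"
 unfolding bP_def
proof (intro allI impI)
 fix e :: real assume e: "e > 0"
 define K where "K = (\<bar>C\<bar> + 1) / e"
 have K: "K > 0" using e by (simp add: K_def add_nonneg_pos)
 show "\<exists>K. EVN n. \<exists>A\<in>sets M. measure M A <= e & (\<forall>om\<in>space M - A. \<bar>X n om\<bar> <= K)"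
 proof (rule exI[of _ "sqrt K"], use assms in eventually_elim)
  case (elim n)
  have "measure M {om\<in>space M. (X n om)\<^sup>2 >= K} <= (LINT om|M. (X n om)\<^sup>2) / K"
  by (rule integral_Markov_inequality_measure[where A="{}"]) (use elim K in auto)
  also have "... <= (\<bar>C\<bar> + 1) / K" using elim K by (intro divide_right_mono) auto
  also have "... = e" using e by (simp add: K_def add_nonneg_pos less_imp_neq[symmetric])
  finally have "measure M {om\<in>space M. (X n om)\<^sup>2 >= K} <= e" .
  moreover have "{om\<in>space M. (X n om)\<^sup>2 >= K} \<in> sets M"
  using borel_measurable_integrable[OF conjunct1[OF elim]] by measurable
  ultimately show ?case using K
  by (intro bexI[of _ "{om\<in>space M. (X n om)\<^sup>2 >= K}"]) (auto intro!: real_le_rsqrt)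
 qed
qed

lemma oP_cont:
 fixes g :: "real => real"
 assumes "oP M (%n om. X n om - c)" "isCont g c"
 shows "oP M (%n om. g (X n om) - g c)"
proof (rule oPI)
 fix e :: real assume e: "e > 0"
 with assms(2) obtain d where d: "d > 0" "\<And>x. dist x c < d ==> dist (g x) (g c) < e"
  unfolding continuous_at_eps_delta by blast
 have d2: "d / 2 > 0" using d(1) by simp
 from oPD2[OF assms(1) e d2]
 show "EVN n. \<exists>A\<in>sets M. measure M A <= e & (\<forall>om\<in>space M - A. \<bar>g (X n om) - g c\<bar> <= e)"
 proof eventually_elim
  case (elim n)
  then obtain A where "A \<in> sets M" "prob A <= e" "\<And>om. om : space M - A ==> \<bar>X n om - c\<bar> <= d / 2" by auto
  then show ?case using d by (intro bexI[of _ A] conjI ballI) (force simp: dist_real_def intro!: less_imp_le)+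
 qed
qed

lemma oP_prob:
 assumes "oP M X" "e > 0"
 shows "(%n. prob {om\<in>space M. \<bar>X n om\<bar> > e}) ---> 0"
proof (rule tendstoI)
 fix d :: real assume d: "d > 0"
 then have d2: "d / 2 > 0" by simp
 from oPD2[OF assms(1) d2 assms(2)]
 show "EVN n. dist (prob {om\<in>space M. \<bar>X n om\<bar> > e}) 0 < d"
 proof eventually_elim
  case (elim n)
  then obtain A where A: "A \<in> sets M" "prob A <= d / 2" "\<And>om. om : space M - A ==> \<bar>X n om\<bar> <= e" by auto
  have "prob {om\<in>space M. \<bar>X n om\<bar> > e} <= prob A"
  by (rule finite_measure_mono[OF _ A(1)]) (use A(3) in force)
  with A(2) d show ?case by simp
 qed
qed

lemma oP_bounded_integral:
 assumes "oP M X" "\<And>n. X n : bmeas M" "\<And>n om. om : space M ==> \<bar>X n om\<bar> <= B"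
 shows "(%n. \<integral>om. \<bar>X n om\<bar> \<partial>M) ---> 0"
proof (rule tendstoI)
 fix d :: real assume d: "d > 0"
 define C where "C = \<bar>B\<bar> + 1"
 have C: "C > 0" by (simp add: C_def add_nonneg_pos)
 define e where "e = d / (4 * C)"
 have e: "e > 0" "C * e = d / 4" using d C by (auto simp: e_def)
 have d4: "d / 4 > 0" using d by simp
 from oPD2[OF assms(1) e(1) d4]
 show "EVN n. dist (LINT om|M. \<bar>X n om\<bar>) 0 < d"
 proof eventually_elim
  case (elim n)
  then obtain A where A: "A \<in> sets M" "prob A <= e" "\<And>om. om : space M - A ==> \<bar>X n om\<bar> <= d / 4" by auto
  have "(LINT om|M. \<bar>X n om\<bar>) <= (LINT om|M. d / 4 + C * indicator A om)"
  proof (rule integral_mono)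
  show "integrable M (%om. \<bar>X n om\<bar>)" using assms by (intro integrable_const_bound[where B=B]) auto
  show "\<bar>X n om\<bar> <= d / 4 + C * indicator A om" if "om : space M" for om
  using A(3)[of om] assms(3)[OF that, of n] that d by (cases "om \<in> A") (auto simp: C_def)
  show "integrable M (%om. d / 4 + C * indicator A om)"
  using A(1) C d by (intro integrable_const_bound[where B="d / 4 + C"]) (auto split: split_indicator)
  qed
  also have "... = d / 4 + C * prob A"
  proof -
  have "integrable M (indicat_real A)" using A by (intro integrable_const_bound[where B=1]) auto
  then show ?thesis using A(1) by (simp add: prob_space)
  qed
  also have "... <= d / 4 + C * e" using A C by simp
  also have "... < d" using e d by simp
  finally show ?case by simp
 qed
qed

text \<open>Slutsky's argument on characteristic functions: those of \<open>A n\<close> and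
  \<open>B n\<close> differ by at most the mean of \<open>min 2 |u (B - A)|\<close>, which vanishes,
  and Levy's continuity theorem concludes. Convergence of \<open>A\<close> is asked for in the form
  in which the central limit theorem below delivers it.\<close>

lemma weak_conv_oP:
 assumes [measurable]: "\<And>n. A n : bmeas M" "\<And>n. B n : bmeas M"
  and o: "oP M (%n om. B n om - A n om)"
  and ch: "\<And>u. (%n. \<integral>om. iexp (u * A n om) \<partial>M) ---> char \<mu> u" and \<mu>: "real_distribution \<mu>"
 shows "weak_conv_m (%n. distr M borel (B n)) \<mu>"
proof (rule levy_continuity[OF _ \<mu>])
 fix u
 have "oP M (%n om. u * (B n om - A n om))" by (rule oP_cmult[OF o, of _ "\<bar>u\<bar>"]) auto
 then have "oP M (%n om. min 2 \<bar>u * (B n om - A n om)\<bar>)" by (rule oP_mono) auto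
 then have lim: "(%n. \<integral>om. \<bar>min 2 \<bar>u * (B n om - A n om)\<bar>\<bar> \<partial>M) ---> 0"
  by (rule oP_bounded_integral[where B=2]) auto
 have bound: "cmod (iexp (u * y) - iexp (u * x)) <= min 2 \<bar>u * (y - x)\<bar>" for x y :: real
 proof -
  have "iexp (u * y) - iexp (u * x) = iexp (u * x) * (iexp (u * (y - x)) - 1)"
  by (simp add: algebra_simps flip: exp_add)
  then have "cmod (iexp (u * y) - iexp (u * x)) = cmod (iexp (u * (y - x)) - 1)"
  by (simp add: norm_mult)
  also have "... <= \<bar>u * (y - x)\<bar>" using iexp_approx1[of "u * (y - x)" 0] by simp
  finally have 1: "cmod (iexp (u * y) - iexp (u * x)) <= \<bar>u * (y - x)\<bar>" .
  have "cmod (iexp (u * y) - iexp (u * x)) <= cmod (iexp (u * y)) + cmod (iexp (u * x))" by (rule norm_triangle_ineq4)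
  then have "cmod (iexp (u * y) - iexp (u * x)) <= 2" by simp
  with 1 show ?thesis by simp
 qed
 have "(%n. (LINT om|M. iexp (u * B n om)) - (LINT om|M. iexp (u * A n om))) ---> 0"
 proof (rule Lim_null_comparison[OF _ lim], intro always_eventually allI)
  fix n
  have "(LINT om|M. iexp (u * B n om)) - (LINT om|M. iexp (u * A n om)) = (LINT om|M. iexp (u * B n om) - iexp (u * A n om))"
  by (rule Bochner_Integration.integral_diff[symmetric]) (auto intro!: integrable_iexp)
  also have "cmod ... <= (LINT om|M. cmod (iexp (u * B n om) - iexp (u * A n om)))"
  by (rule integral_norm_bound)
  also have "... <= (LINT om|M. \<bar>min 2 \<bar>u * (B n om - A n om)\<bar>\<bar>)"
  proof (rule integral_mono)
  show "integrable M (%om. cmod (iexp (u * B n om) - iexp (u * A n om)))"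
  using order_trans[OF bound min.cobounded1] by (intro integrable_const_bound[where B=2] AE_I2) auto
  show "integrable M (%om. \<bar>min 2 \<bar>u * (B n om - A n om)\<bar>\<bar>)"
  by (intro integrable_const_bound[where B=2]) auto
  qed (use bound in auto)
  finally show "cmod ((LINT om|M. iexp (u * B n om)) - (LINT om|M. iexp (u * A n om))) <= (LINT om|M. \<bar>min 2 \<bar>u * (B n om - A n om)\<bar>\<bar>)" .
 qed
 from tendsto_add[OF this ch[of u]]
 show "(%n. char (distr M borel (B n)) u) ---> char \<mu> u"
  by (simp add: char_def integral_distr)
qed (auto intro!: real_distribution_distr)

section \<open>A central limit theorem for conditionally Gaussian sums\<close>

text \<open>With the past frozen, the last Gaussian factor contributes
  \<open>exp (- u^2 c^2 / 2)\<close>, which cancels the new part of the compensator. The bound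
  \<open>K\<close> keeps the compensated variable bounded, as freezing requires.\<close>

lemma exp_martingale:
 assumes ad: "adapted_indep M H g k"
  and g: "\<And>i. i < k ==> distr M borel (g i) = std_normal_distribution"
  and c: "\<And>i. i < k ==> c i : bmeas (H i)"
  and K: "\<And>om. om : space M ==> (\<Sum>i<k. (c i om)\<^sup>2) <= K"
 shows "(LINT om|M. iexp (u * (\<Sum>i<k. c i om * g i om)) * exp (complex_of_real (u^2 * (\<Sum>i<k. (c i om)\<^sup>2) / 2))) = 1"
 using assms
proof (induction k)
 case (Suc k)
 let ?S = "%om. \<Sum>i<k. c i om * g i om" and ?Q = "%om. \<Sum>i<k. (c i om)\<^sup>2"
 note ad = Suc.prems(1)
 have K: "?Q om <= K" "?Q om + (c k om)^2 <= K" if "om : space M" for om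
  using Suc.prems(4)[OF that] by (auto intro: order_trans[rotated])
 have IH: "(LINT om|M. iexp (u * ?S om) * exp (complex_of_real (u^2 * ?Q om / 2))) = 1"
  using Suc.prems K by (intro Suc.IH adapted_indep_mono[OF ad]) auto
 have ci: "c i : bmeas (H k)" if "i <= k" for i
  using that Suc.prems(3)[of i] by (auto intro!: adapted_indepD(4)[OF ad, of i])
 have gi: "g i : bmeas (H k)" if "i < k" for i
  using that by (auto intro!: adapted_indepD(4)[OF ad, of "Suc i"] adapted_indepD(2)[OF ad, of i])
 have [measurable]: "?S : bmeas (H k)" "?Q : bmeas (H k)" "c k : bmeas (H k)"
  using ci gi by (auto intro!: borel_measurable_sum borel_measurable_times borel_measurable_power)
 have ind: "indep_alg M (H k) borel (g k)" using adapted_indepD(3)[OF ad] by auto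
 define f where "f = (%(om, y). iexp (u * ?S om) * exp (complex_of_real (u^2 * (?Q om + (c k om)^2) / 2)) * iexp (u * c k om * y))"
 have fm: "f : bmeas (H k \<Otimes>\<^sub>M borel)"
  unfolding f_def case_prod_beta by measurable
 have fb: "norm (f (om, y)) <= exp (u^2 * K / 2)" if "om : space M" for om y
  using K(2)[OF that] by (auto simp: f_def norm_mult intro!: mult_left_mono)
 have "(LINT om|M. iexp (u * (\<Sum>i<Suc k. c i om * g i om)) * exp (complex_of_real (u^2 * (\<Sum>i<Suc k. (c i om)\<^sup>2) / 2)))
  = (LINT om|M. f (om, g k om))"
  by (intro Bochner_Integration.integral_cong refl) (simp add: f_def algebra_simps exp_add[symmetric])
 also have "... = (LINT om|M. (\<integral>y. f (om, y) \<partial>std_normal_distribution))"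
  using freezing[OF ind fm fb] Suc.prems(2)[of k] by simp
 also have "... = (LINT om|M. iexp (u * ?S om) * exp (complex_of_real (u^2 * ?Q om / 2)))"
 proof (intro Bochner_Integration.integral_cong refl)
  fix om
  have "(\<integral>y. f (om, y) \<partial>std_normal_distribution) = iexp (u * ?S om) * exp (complex_of_real (u^2 * (?Q om + (c k om)^2) / 2)) * char std_normal_distribution (u * c k om)"
  unfolding f_def char_def by simp
  also have "... = iexp (u * ?S om) * exp (complex_of_real (u^2 * ?Q om / 2))"
  unfolding char_std_normal_distribution
  by (simp add: exp_of_real[symmetric] exp_add[symmetric] power_mult_distrib algebra_simps add_divide_distrib)
  finally show "(\<integral>y. f (om, y) \<partial>std_normal_distribution) = ..." .
 qed
 finally show ?case using IH by simp
qed (simp add: prob_space)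

lemma cmod_mult_diff_le:
 assumes "cmod b = 1" "e >= 0"
 shows "cmod (a * complex_of_real e - b * complex_of_real f) <= e * \<bar>cmod (a - b)\<bar> + \<bar>f - e\<bar>"
proof -
 have "a * complex_of_real e - b * complex_of_real f = (a - b) * complex_of_real e - b * complex_of_real (f - e)"
  by (simp add: algebra_simps)
 also have "cmod ... <= cmod ((a - b) * complex_of_real e) + cmod (b * complex_of_real (f - e))"
  by (rule norm_triangle_ineq4)
 also have "... = e * \<bar>cmod (a - b)\<bar> + \<bar>f - e\<bar>"
  using assms unfolding norm_mult norm_of_real by simp
 finally show ?thesis .
qed

text \<open>A term is kept only while the running sum, its own square included, stays below
  \<open>L\<close>, so the kept terms form an initial segment. The test at \<open>i\<close> looks at
  coefficients up to \<open>i\<close> only, hence stopping preserves adaptedness.\<close>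

lemma stopped_sum_le:
 fixes c :: "nat => real"
 assumes "0 <= L"
 shows "(\<Sum>i<k. (if (\<Sum>l\<le>i. (c l)\<^sup>2) <= L then c i else 0)\<^sup>2) <= L"
proof (induction k)
 case (Suc k)
 show ?case
 proof (cases "(\<Sum>l\<le>k. (c l)\<^sup>2) <= L")
  case True
  have "(\<Sum>i<Suc k. (if (\<Sum>l\<le>i. (c l)\<^sup>2) <= L then c i else 0)\<^sup>2) <= (\<Sum>i<Suc k. (c i)\<^sup>2)"
  by (intro sum_mono) auto
  then show ?thesis using True by (simp add: lessThan_Suc_atMost)
 next
  case False
  then show ?thesis using Suc by simp
 qed
qed (use assms in simp)

text \<open>The brackets converge only in probability, so the coefficients are stopped at bracket
  level \<open>I + 1\<close>. The stopped sums have a bounded bracket, agree with the original ones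
  unless the bracket is off by more than 1, and obey the exponential identity; replacing the random
  compensator by \<open>exp (u^2 I / 2)\<close> costs a vanishing mean.\<close>

lemma gaussian_sum_char:
 assumes ad: "\<And>n. adapted_indep M (H n) (g n) (k n)"
  and g: "\<And>n i. i < k n ==> distr M borel (g n i) = std_normal_distribution"
  and c: "\<And>n i. i < k n ==> c n i : bmeas (H n i)"
  and I: "I >= 0" and Q: "oP M (%n om. (\<Sum>i<k n. (c n i om)\<^sup>2) - I)"
 shows "(%n. \<integral>om. iexp (u * (\<Sum>i<k n. c n i om * g n i om)) \<partial>M) ---> exp (- complex_of_real (u^2 * I / 2))"
proof -
 define c' where "c' n i om = (if (\<Sum>l\<le>i. (c n l om)\<^sup>2) <= I + 1 then c n i om else 0)" for n i om
 define S where "S n om = (\<Sum>i<k n. c n i om * g n i om)" for n om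
 define S' where "S' n om = (\<Sum>i<k n. c' n i om * g n i om)" for n om
 define Q where "Q n om = (\<Sum>i<k n. (c n i om)\<^sup>2)" for n om
 define Q' where "Q' n om = (\<Sum>i<k n. (c' n i om)\<^sup>2)" for n om
 have c'm: "c' n i : bmeas (H n i)" if "i < k n" for n i
 proof -
  have [measurable]: "c n l : bmeas (H n i)" if "l <= i" for l
  using that \<open>i < k n\<close> c[of l n] by (auto intro: adapted_indepD(4)[OF ad])
  have "(%om. \<Sum>l\<le>i. (c n l om)\<^sup>2) : bmeas (H n i)"
  by (intro borel_measurable_sum borel_measurable_power) auto
  then show ?thesis unfolding c'_def by measurable
 qed
 have gm: "g n i : bmeas M" if "i < k n" for n i
  using indep_algD(2)[OF adapted_indepD(3)[OF ad that]] .
 have cm: "c n i : bmeas M" "c' n i : bmeas M" if "i < k n" for n i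
  using that adapted_indep_measurable[OF ad _ c[OF that]] adapted_indep_measurable[OF ad _ c'm[OF that]] by auto
 have [measurable]: "S n : bmeas M" "S' n : bmeas M" "Q n : bmeas M" "Q' n : bmeas M" for n
  unfolding S_def S'_def Q_def Q'_def using gm cm
  by (auto intro!: borel_measurable_sum borel_measurable_times borel_measurable_power)
 have Q'le: "Q' n om <= I + 1" for n om
  unfolding Q'_def c'_def by (rule stopped_sum_le) (use I in auto)
 have Q'0: "Q' n om >= 0" for n om unfolding Q'_def by (intro sum_nonneg) auto
 have same: "S' n om = S n om" "Q' n om = Q n om" if "Q n om <= I + 1" for n om
 proof -
  have "c' n i om = c n i om" if "i < k n" for i
  proof -
  have "(\<Sum>l\<le>i. (c n l om)\<^sup>2) <= Q n om"
  unfolding Q_def using that by (intro sum_mono2) auto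
  then show ?thesis using \<open>Q n om <= I + 1\<close> by (auto simp: c'_def)
  qed
  then show "S' n om = S n om" "Q' n om = Q n om" unfolding S_def S'_def Q_def Q'_def by auto
 qed
 have oQ: "oP M (%n om. Q n om - I)" using Q unfolding Q_def .
 have lim0: "(%n. prob {om\<in>space M. \<bar>Q n om - I\<bar> > 1}) ---> 0" by (rule oP_prob[OF oQ]) simp
 have oQ': "oP M (%n om. Q' n om - I)"
 proof (rule oP_except[OF oQ _ lim0])
  have "Q n om <= I + 1" if "om : space M - {om : space M. 1 < \<bar>Q n om - I\<bar>}" for n om
  using that by auto
  then show "EVN n. \<forall>om\<in>space M - {om : space M. 1 < \<bar>Q n om - I\<bar>}. \<bar>Q' n om - I\<bar> <= \<bar>Q n om - I\<bar>"
  by (intro always_eventually allI ballI) (simp add: same(2))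
 qed auto
 have "oP M (%n om. exp (u^2 / 2 * Q' n om) - exp (u^2 / 2 * I))"
  by (rule oP_cont[OF oQ', of "%x. exp (u^2 / 2 * x)"]) (intro continuous_intros)
 then have lim2: "(%n. \<integral>om. \<bar>exp (u^2 / 2 * Q' n om) - exp (u^2 / 2 * I)\<bar> \<partial>M) ---> 0"
 proof (rule oP_bounded_integral[where B="exp (u^2 / 2 * (I + 1))"])
  fix n om
  have "exp (u^2 / 2 * Q' n om) <= exp (u^2 / 2 * (I + 1))" "exp (u^2 / 2 * I) <= exp (u^2 / 2 * (I + 1))"
  using Q'le[of n om] I by (auto intro!: mult_left_mono)
  then show "\<bar>exp (u^2 / 2 * Q' n om) - exp (u^2 / 2 * I)\<bar> <= exp (u^2 / 2 * (I + 1))"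
  using exp_gt_zero[of "u^2 / 2 * Q' n om"] exp_gt_zero[of "u^2 / 2 * I"] by (simp only: abs_le_iff) linarith
 qed auto
 have "oP M (%n om. cmod (iexp (u * S n om) - iexp (u * S' n om)))"
 proof (rule oP_except[OF oP_const[of "%_. 0"] _ lim0])
  have "Q n om <= I + 1" if "om : space M - {om : space M. 1 < \<bar>Q n om - I\<bar>}" for n om
  using that by auto
  then show "EVN n. \<forall>om\<in>space M - {om : space M. 1 < \<bar>Q n om - I\<bar>}. \<bar>cmod (iexp (u * S n om) - iexp (u * S' n om))\<bar> <= \<bar>0\<bar>"
  by (intro always_eventually allI ballI) (simp add: same(1))
 qed auto
 then have lim1: "(%n. \<integral>om. \<bar>cmod (iexp (u * S n om) - iexp (u * S' n om))\<bar> \<partial>M) ---> 0"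
 proof (rule oP_bounded_integral[where B=2])
  fix n om
  show "\<bar>cmod (iexp (u * S n om) - iexp (u * S' n om))\<bar> <= 2"
  using norm_triangle_ineq4[of "iexp (u * S n om)" "iexp (u * S' n om)"] by simp
 qed auto
 let ?e = "exp (u^2 / 2 * I)"
 \<comment> \<open>Here 1 is the mean of the stopped exponential with its random compensator; the
   two error terms below come from stopping and from replacing that compensator by a
   constant.\<close>
 have "(%n. (LINT om|M. iexp (u * S n om)) * ?e - 1) ---> 0"
 proof (rule Lim_null_comparison[OF always_eventually])
  show "(%n. ?e * (LINT om|M. \<bar>cmod (iexp (u * S n om) - iexp (u * S' n om))\<bar>)
  + (LINT om|M. \<bar>exp (u^2 / 2 * Q' n om) - exp (u^2 / 2 * I)\<bar>)) ---> 0"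
  using tendsto_add[OF tendsto_mult_left[OF lim1, of ?e] lim2] by simp
  show "\<forall>n. cmod ((LINT om|M. iexp (u * S n om)) * ?e - 1) <= ?e * (LINT om|M. \<bar>cmod (iexp (u * S n om) - iexp (u * S' n om))\<bar>)
  + (LINT om|M. \<bar>exp (u^2 / 2 * Q' n om) - exp (u^2 / 2 * I)\<bar>)"
  proof
  fix n
  have Eb: "integrable M (%om. exp (u^2 / 2 * Q' n om))"
  using Q'le by (intro integrable_const_bound[where B="exp (u^2 / 2 * (I + 1))"]) (auto intro!: mult_left_mono)
  have E1: "integrable M (%om. iexp (u * S' n om) * complex_of_real (exp (u^2 / 2 * Q' n om)))"
  by (rule Bochner_Integration.integrable_bound[OF Eb]) (auto simp: norm_mult)
  have 1: "(LINT om|M. iexp (u * S' n om) * complex_of_real (exp (u^2 / 2 * Q' n om))) = 1"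
  using exp_martingale[where u=u and K="I + 1" and H="H n" and k="k n" and g="g n" and c="c' n", OF ad g c'm Q'le[unfolded Q'_def]]
  unfolding S'_def Q'_def by (simp add: exp_of_real[symmetric])
  have iS: "integrable M (%om. iexp (u * S n om))" "integrable M (%om. iexp (u * S' n om))"
  by (auto intro!: integrable_iexp)
  have eq: "(LINT om|M. iexp (u * S n om)) * ?e - 1 = (LINT om|M. iexp (u * S n om) * complex_of_real ?e - iexp (u * S' n om) * complex_of_real (exp (u^2 / 2 * Q' n om)))"
  using 1 E1 iS by (subst Bochner_Integration.integral_diff) auto
  have "cmod ((LINT om|M. iexp (u * S n om)) * ?e - 1) <= (LINT om|M. cmod (iexp (u * S n om) * complex_of_real ?e - iexp (u * S' n om) * complex_of_real (exp (u^2 / 2 * Q' n om))))"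
  unfolding eq by (rule integral_norm_bound)
  also have "... <= (LINT om|M. ?e * \<bar>cmod (iexp (u * S n om) - iexp (u * S' n om))\<bar> + \<bar>exp (u^2 / 2 * Q' n om) - exp (u^2 / 2 * I)\<bar>)"
  proof (rule integral_mono)
  show "cmod (iexp (u * S n om) * complex_of_real ?e - iexp (u * S' n om) * complex_of_real (exp (u^2 / 2 * Q' n om)))
  <= ?e * \<bar>cmod (iexp (u * S n om) - iexp (u * S' n om))\<bar> + \<bar>exp (u^2 / 2 * Q' n om) - ?e\<bar>" for om
  by (rule cmod_mult_diff_le) simp_all
  next
  show "integrable M (%om. cmod (iexp (u * S n om) * complex_of_real ?e - iexp (u * S' n om) * complex_of_real (exp (u^2 / 2 * Q' n om))))"
  by (intro integrable_norm Bochner_Integration.integrable_diff E1 integrable_mult_left iS)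
  show "integrable M (%om. ?e * \<bar>cmod (iexp (u * S n om) - iexp (u * S' n om))\<bar> + \<bar>exp (u^2 / 2 * Q' n om) - exp (u^2 / 2 * I)\<bar>)"
  by (intro Bochner_Integration.integrable_add integrable_mult_right integrable_abs integrable_norm Bochner_Integration.integrable_diff iS Eb integrable_const)
  qed
  also have "... = ?e * (LINT om|M. \<bar>cmod (iexp (u * S n om) - iexp (u * S' n om))\<bar>)
  + (LINT om|M. \<bar>exp (u^2 / 2 * Q' n om) - exp (u^2 / 2 * I)\<bar>)"
  by (subst Bochner_Integration.integral_add)
  (intro integrable_mult_right integrable_abs integrable_norm Bochner_Integration.integrable_diff iS Eb integrable_const | simp)+
  finally show "cmod ((LINT om|M. iexp (u * S n om)) * ?e - 1) <= ..." .
  qed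
 qed
 from tendsto_mult_right[OF tendsto_add[OF this tendsto_const[of 1]], of "exp (- complex_of_real (u^2 * I / 2))"]
 show ?thesis unfolding S_def by (simp add: exp_of_real[symmetric] exp_add[symmetric] mult.assoc)
qed

end

section \<open>Variation of constants\<close>

text \<open>After integration by parts, \<open>ou_int tt f s t\<close> is the Stieltjes integral of
 \<open>exp (- tt * (t - u))\<close> against \<open>df(u)\<close> over \<open>(s, t]\<close>.\<close>
definition ou_int :: "real => (real => real) => real => real => real" where
 "ou_int tt f s t = f t - f s - tt * integral {s..t} (%u. exp (- tt * (t - u)) * (f u - f s))"

text \<open>A class containing Brownian as well as compound Poisson paths: right continuity and
  local bounds make Riemann sums converge, and finitely many discontinuities on bounded intervals
  allow the fundamental theorem of calculus.\<close>

definition pw_reg :: "(real => real) => bool" where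
 "pw_reg f \<longleftrightarrow> (\<forall>u\<ge>0. (f \<longlongrightarrow> f u) (at_right u)) & (\<forall>T. \<exists>B. \<forall>u\<in>{0..T}. \<bar>f u\<bar> <= B)
  & (\<forall>T. finite {u\<in>{0<..T}. \<not> isCont f u})"

lemma pw_reg_add:
 assumes "pw_reg f" "pw_reg g"
 shows "pw_reg (%u. f u + g u)"
 unfolding pw_reg_def
proof (intro conjI allI impI)
 fix u :: real assume "u >= 0"
 then show "((%u. f u + g u) \<longlongrightarrow> f u + g u) (at_right u)"
  using assms unfolding pw_reg_def by (intro tendsto_add) auto
next
 fix T
 obtain B C where "\<forall>u\<in>{0..T}. \<bar>f u\<bar> <= B" "\<forall>u\<in>{0..T}. \<bar>g u\<bar> <= C"
  using assms unfolding pw_reg_def by meson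
 then show "\<exists>B. \<forall>u\<in>{0..T}. \<bar>f u + g u\<bar> <= B"
  by (intro exI[of _ "B + C"] ballI order_trans[OF abs_triangle_ineq] add_mono) auto
next
 fix T
 have "{u\<in>{0<..T}. \<not> isCont (%u. f u + g u) u} \<subseteq> {u\<in>{0<..T}. \<not> isCont f u} \<union> {u\<in>{0<..T}. \<not> isCont g u}"
  by (auto intro: continuous_add)
 then show "finite {u\<in>{0<..T}. \<not> isCont (%u. f u + g u) u}"
  using assms unfolding pw_reg_def by (metis (no_types, lifting) finite_Un finite_subset)
qed

lemma pw_reg_continuous:
 assumes "continuous_on {0..} f"
 shows "pw_reg f"
 unfolding pw_reg_def
proof (intro conjI allI impI)
 fix u :: real assume u: "u >= 0"
 have "(f \<longlongrightarrow> f u) (at u within {0..})" using assms u by (auto simp: continuous_on_def)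
 then show "(f \<longlongrightarrow> f u) (at_right u)" by (rule tendsto_within_subset) (use u in auto)
next
 fix T :: real
 have "compact (f ` {0..T})"
  by (rule compact_continuous_image[OF continuous_on_subset[OF assms]]) auto
 then have "bounded (f ` {0..T})" by (rule compact_imp_bounded)
 then show "\<exists>B. \<forall>u\<in>{0..T}. \<bar>f u\<bar> <= B" by (auto simp: bounded_iff)
next
 fix T :: real
 have "isCont f u" if "u > 0" for u
 proof -
  have "continuous_on {0<..} f" by (rule continuous_on_subset[OF assms]) auto
  then show ?thesis using that by (simp add: continuous_on_eq_continuous_at)
 qed
 then have E: "{u\<in>{0<..T}. \<not> isCont f u} = {}" by auto
 show "finite {u\<in>{0<..T}. \<not> isCont f u}" unfolding E by simp
qed

section \<open>Counting paths\<close>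

definition count_of :: "(real => real) => real => nat" where
 "count_of N t = nat \<lfloor>N t\<rfloor>"

locale counting_path =
 fixes N :: "real => real"
 assumes N0: "N 0 = 0" and N_nat: "\<And>t. t >= 0 ==> N t \<in> \<nat>" and N_mono: "mono_on {0..} N"
  and N_rc: "\<And>t. t >= 0 ==> continuous (at_right t) N"
begin

lemma N_count: "t >= 0 ==> N t = real (count_of N t)"
 using N_nat[of t] by (auto simp: count_of_def Nats_def)

lemma count_mono: "0 <= s ==> s <= t ==> count_of N s <= count_of N t"
 using mono_onD[OF N_mono, of s t] unfolding count_of_def by (auto intro!: nat_mono floor_mono)

text \<open>Right continuity brings two integers closer than 1 just after \<open>u\<close>, so they
  coincide.\<close>

lemma count_right: "u >= 0 ==> \<forall>\<^sub>F v in at_right u. count_of N v = count_of N u"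
proof -
 assume u: "u >= 0"
 have "(N \<longlongrightarrow> N u) (at_right u)"
  using N_rc[OF u] unfolding continuous_within .
 from tendstoD[OF this zero_less_one] eventually_at_right_less[of u]
 show ?thesis
 proof eventually_elim
  case (elim v)
  then have "\<bar>real (count_of N v) - real (count_of N u)\<bar> < 1"
  using N_count[of u] N_count[of v] u by (simp add: dist_real_def)
  then show ?case by linarith
 qed
qed

text \<open>Between passage times of its levels the count is constant, so a function of it can jump
  only at such a time, and only finitely many levels are reached by \<open>T\<close>.\<close>

lemma pw_reg_step:
 fixes S :: "nat => real"
 shows "pw_reg (%t. S (count_of N t))"
 unfolding pw_reg_def
proof (intro conjI allI impI)
 fix u :: real assume u: "u >= 0"
 show "((%t. S (count_of N t)) \<longlongrightarrow> S (count_of N u)) (at_right u)"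
  by (rule tendsto_eventually) (use count_right[OF u] in \<open>auto elim: eventually_mono\<close>)
next
 fix T :: real
 show "\<exists>B. \<forall>u\<in>{0..T}. \<bar>S (count_of N u)\<bar> <= B"
 proof (intro exI[of _ "\<Sum>k\<le>count_of N T. \<bar>S k\<bar>"] ballI)
  fix u assume "u \<in> {0..T}"
  then show "\<bar>S (count_of N u)\<bar> <= (\<Sum>k\<le>count_of N T. \<bar>S k\<bar>)"
  using count_mono[of u T] by (intro member_le_sum[of "count_of N u" _ "%k. \<bar>S k\<bar>"]) auto
 qed
next
 fix T :: real
 \<comment> \<open>The infimum is the passage time of level \<open>k\<close>. If \<open>u\<close> is
   not the passage time of its own level, some earlier \<open>v\<close> already has the same count,
   and the count is constant from \<open>v\<close> to \<open>u\<close>.\<close>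
 have "isCont (%t. S (count_of N t)) u" if u: "u \<in> {0<..T}" "u \<notin> (%k. Inf {v\<in>{0..T}. k <= count_of N v}) ` {..count_of N T}" for u
 proof -
  let ?k = "count_of N u" and ?V = "{v\<in>{0..T}. count_of N u <= count_of N v}"
  have "?k <= count_of N T" using u count_mono[of u T] by auto
  then have ne: "u ~= Inf ?V" using u by auto
  have "u \<in> ?V" using u by auto
  then have "Inf ?V <= u" by (intro cInf_lower bdd_belowI[of _ 0]) auto
  with ne have "Inf ?V < u" by simp
  moreover have "?V ~= {}" using \<open>u \<in> ?V\<close> by blast
  ultimately obtain v where v: "v \<in> ?V" "v < u" using cInf_lessD[of ?V u] by blast
  have left: "count_of N w = ?k" if "v < w" "w < u" for w
  using count_mono[of v w] count_mono[of w u] that v by auto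
  have "\<forall>\<^sub>F w in at_left u. count_of N w = ?k"
  using v(2) left by (auto simp: eventually_at_left_field intro!: exI[of _ v])
  with count_right[of u] u have "\<forall>\<^sub>F w in at u. count_of N w = ?k"
  by (auto simp: eventually_at_split)
  then show ?thesis unfolding isCont_def
  by (intro tendsto_eventually) (auto elim: eventually_mono)
 qed
 then have "{u\<in>{0<..T}. \<not> isCont (%t. S (count_of N t)) u} \<subseteq> (%k. Inf {v\<in>{0..T}. k <= count_of N v}) ` {..count_of N T}"
  by auto
 then show "finite {u\<in>{0<..T}. \<not> isCont (%t. S (count_of N t)) u}" by (rule finite_subset) auto
qed

end

section \<open>Stieltjes integrals as limits of Riemann sums\<close>

definition grid_pt :: "real => real => nat => nat => real" where
 "grid_pt s t m k = s + (t - s) * real k / real m"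

text \<open>A Riemann-Stieltjes sum with the kernel at left end points. As a linear combination of
  increments of \<open>f\<close> it makes laws and independence visible, and these pass to the limit
  \<open>ou_int\<close>.\<close>

definition rs_sum :: "real => (real => real) => real => real => nat => real" where
 "rs_sum tt f s t m = (\<Sum>k<m. exp (- tt * (t - grid_pt s t m k)) * (f (grid_pt s t m (Suc k)) - f (grid_pt s t m k)))"

lemma grid_pt_simps: "m > 0 ==> grid_pt s t m m = t" "grid_pt s t m 0 = s"
 by (auto simp: grid_pt_def)

lemma grid_pt_mono: "s <= t ==> j <= k ==> grid_pt s t m j <= grid_pt s t m k"
 by (auto simp: grid_pt_def intro!: divide_right_mono mult_left_mono)

lemma exp_kernel_integral:
 fixes a b t tt :: real
 assumes "a <= b"
 shows "((%u. tt * exp (- tt * (t - u))) has_integral (exp (- tt * (t - b)) - exp (- tt * (t - a)))) {a..b}"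
 by (rule fundamental_theorem_of_calculus[OF assms])
  (auto intro!: derivative_eq_intros simp: has_real_derivative_iff_has_vector_derivative[symmetric])

lemma summation_by_parts:
 fixes c f :: "nat => real"
 shows "(\<Sum>k<m. c k * (f (Suc k) - f k)) = c m * f m - c 0 * f 0 - (\<Sum>k<m. f (Suc k) * (c (Suc k) - c k))"
 by (induction m) (auto simp: algebra_simps)

text \<open>Summation by parts moves the differences onto the kernel: the sum becomes a final value
  minus an integral of the kernel against the path sampled at the next grid point. That point tends
  to \<open>u\<close> from the right, so right continuity and dominated convergence suffice and no
  bounded variation of the path is involved.\<close>

lemma rs_sum_tendsto:
 fixes f :: "real => real"
 assumes st: "0 <= s" "s < t" and reg: "pw_reg f"
 shows "(%u. tt * exp (- tt * (t - u)) * (f u - f s)) integrable_on {s..t}" (is ?int)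
  and "(%m. rs_sum tt f s t (Suc m)) ---> ou_int tt f s t"
proof -
 obtain B where B: "\<And>u. u \<in> {0..t} ==> \<bar>f u\<bar> <= B" using reg unfolding pw_reg_def by meson
 define g where "g u = f u - f s" for u
 \<comment> \<open>\<open>r m u\<close> is the first grid point at or after
   \<open>u\<close>.\<close>
 define r where "r m u = s + (t - s) * real (nat \<lceil>real (Suc m) * (u - s) / (t - s)\<rceil>) / real (Suc m)" for m u
 define h where "h m u = tt * exp (- tt * (t - u)) * g (r m u)" for m u
 have B0: "B >= 0" using B[of s] st by force
 have rge: "u <= r m u" and rlt: "r m u <= u + (t - s) / real (Suc m)" and rt: "r m u <= t" if u: "u \<in> {s..t}" for m u
 proof -
  define x where "x = real (Suc m) * (u - s) / (t - s)"
  have x0: "x >= 0" using u st by (auto simp: x_def)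
  have uu: "u = s + (t - s) * x / real (Suc m)" using st by (simp add: x_def del: of_nat_Suc)
  have n: "real (nat \<lceil>x\<rceil>) = of_int \<lceil>x\<rceil>" using x0 by simp
  have r: "r m u = s + (t - s) * of_int \<lceil>x\<rceil> / real (Suc m)" unfolding r_def x_def[symmetric] n ..
  show "u <= r m u" unfolding r using st by (subst uu) (auto intro!: divide_right_mono mult_left_mono)
  have "(u - s) / (t - s) <= 1" using u st by simp
  from mult_left_mono[OF this, of "real (Suc m)"] have "x <= real (Suc m)" by (simp add: x_def)
  then have "\<lceil>x\<rceil> <= int (Suc m)" by (simp add: ceiling_le_iff)
  then have "of_int \<lceil>x\<rceil> <= real (Suc m)" by linarith
  then have "(t - s) * of_int \<lceil>x\<rceil> / real (Suc m) <= (t - s) * real (Suc m) / real (Suc m)"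
  using st by (intro divide_right_mono mult_left_mono) auto
  then show "r m u <= t" unfolding r by simp
  have "of_int \<lceil>x\<rceil> <= x + 1" by linarith
  then have "(t - s) * of_int \<lceil>x\<rceil> / real (Suc m) <= (t - s) * (x + 1) / real (Suc m)"
  using st by (intro divide_right_mono mult_left_mono) auto
  then show "r m u <= u + (t - s) / real (Suc m)" unfolding r
  by (subst uu) (simp add: add_divide_distrib distrib_left)
 qed
 have rlim: "(%m. r m u) ---> u" if "u \<in> {s..t}" for u
 proof (rule tendsto_sandwich[of "%_. u" _ _ "%m. u + (t - s) / real (Suc m)"])
  show "(%m. u + (t - s) / real (Suc m)) ---> u"
  using tendsto_add[OF tendsto_const[of u] tendsto_mult[OF tendsto_const[of "t-s"] LIMSEQ_inverse_real_of_nat]]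
  by (simp add: divide_inverse)
 qed (use rge[OF that] rlt[OF that] in auto)
 have glim: "(%m. g (r m u)) ---> g u" if u: "u \<in> {s..t}" for u
 proof -
  have "(f \<longlongrightarrow> f u) (at_right u)" using reg st u unfolding pw_reg_def by auto
  then have "continuous (at u within {u..}) f"
  unfolding continuous_within at_within_Ici_at_right .
  then have "(%m. f (r m u)) ---> f u"
  unfolding continuous_within_sequentially using rlim[OF u] rge[OF u] by (auto simp: o_def)
  then show ?thesis unfolding g_def by (intro tendsto_diff) auto
 qed
 have gb: "\<bar>g u\<bar> <= 2 * B" if "u \<in> {s..t}" for u
  using B[of u] B[of s] that st by (auto simp: g_def)
 have hI: "(h m has_integral (\<Sum>k<K. g (grid_pt s t (Suc m) (Suc k)) * (exp (- tt * (t - grid_pt s t (Suc m) (Suc k))) - exp (- tt * (t - grid_pt s t (Suc m) k)))))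
  {s..grid_pt s t (Suc m) K}" for m K
 proof (induction K)
  case 0
  then show ?case by (auto simp: grid_pt_simps has_integral_refl)
 next
  case (Suc K)
  let ?a = "grid_pt s t (Suc m) K" and ?b = "grid_pt s t (Suc m) (Suc K)"
  have ab: "s <= ?a" "?a <= ?b" using st grid_pt_mono[of s t 0 K "Suc m"] grid_pt_mono[of s t K "Suc K" "Suc m"] by (auto simp: grid_pt_simps)
  have "((%u. (tt * exp (- tt * (t - u))) * g ?b) has_integral (exp (- tt * (t - ?b)) - exp (- tt * (t - ?a))) * g ?b) {?a..?b}"
  by (intro has_integral_mult_left exp_kernel_integral ab)
  then have "(h m has_integral (exp (- tt * (t - ?b)) - exp (- tt * (t - ?a))) * g ?b) {?a..?b}"
  \<comment> \<open>At the left end point itself \<open>r\<close> returns \<open>?a\<close> instead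
    of \<open>?b\<close>, so this point is removed.\<close>
  proof (rule has_integral_spike_finite[of "{?a}", rotated 2])
  fix u assume u: "u \<in> {?a..?b} - {?a}"
  have "real K < real (Suc m) * (u - s) / (t - s)" "real (Suc m) * (u - s) / (t - s) <= real K + 1"
  using u st unfolding grid_pt_def by (auto simp: field_simps simp del: of_nat_Suc) (auto simp: field_simps)
  then have "\<lceil>real (Suc m) * (u - s) / (t - s)\<rceil> = int K + 1"
  by (intro ceiling_unique) auto
  then have "r m u = ?b" by (simp add: r_def grid_pt_def nat_add_distrib)
  then show "h m u = (tt * exp (- tt * (t - u))) * g ?b" by (simp add: h_def)
  qed auto
  from has_integral_combine[OF ab Suc.IH this] show ?case by (simp add: mult.commute)
 qed
 have hI': "h m integrable_on {s..t}" "integral {s..t} (h m) =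
  (\<Sum>k<Suc m. g (grid_pt s t (Suc m) (Suc k)) * (exp (- tt * (t - grid_pt s t (Suc m) (Suc k))) - exp (- tt * (t - grid_pt s t (Suc m) k))))" for m
  using hI[of m "Suc m"] unfolding grid_pt_simps(1)[OF zero_less_Suc] by (auto intro: integral_unique)
 have hb: "norm (h m u) <= \<bar>tt\<bar> * exp (\<bar>tt\<bar> * t) * (2 * B)" if u: "u \<in> {s..t}" for m u
 proof -
  have "- tt * (t - u) <= \<bar>tt\<bar> * (t - u)" using u by (intro mult_right_mono) auto
  also have "... <= \<bar>tt\<bar> * t" using u st by (intro mult_left_mono) auto
  finally have 1: "exp (- tt * (t - u)) <= exp (\<bar>tt\<bar> * t)" by simp
  have 2: "\<bar>g (r m u)\<bar> <= 2 * B" using rge[OF u, of m] rt[OF u, of m] u st by (intro gb) auto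
  show ?thesis unfolding h_def real_norm_def abs_mult
  using 1 2 by (intro mult_mono) auto
 qed
 have lim: "(%m. h m u) ---> tt * exp (- tt * (t - u)) * g u" if "u \<in> {s..t}" for u
  unfolding h_def by (intro tendsto_mult glim[OF that]) auto
 note dc = dominated_convergence[OF hI'(1) _ hb lim]
 show int: ?int using dc(1) by (simp add: g_def integrable_const_ivl)
 have ou: "ou_int tt f s t = g t - integral {s..t} (%u. tt * exp (- tt * (t - u)) * g u)"
  unfolding ou_int_def g_def by (simp add: mult.assoc)
 have "rs_sum tt f s t (Suc m) = g t - integral {s..t} (h m)" for m
 proof -
  have "rs_sum tt f s t (Suc m) = (\<Sum>k<Suc m. exp (- tt * (t - grid_pt s t (Suc m) k)) * (g (grid_pt s t (Suc m) (Suc k)) - g (grid_pt s t (Suc m) k)))"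
  unfolding rs_sum_def g_def by simp
  also have "... = g t - integral {s..t} (h m)"
  unfolding hI'(2) by (subst summation_by_parts) (simp only: grid_pt_simps zero_less_Suc, simp add: g_def)
  finally show ?thesis .
 qed
 moreover have "(%m. g t - integral {s..t} (h m)) ---> g t - integral {s..t} (%u. tt * exp (- tt * (t - u)) * g u)"
  by (intro tendsto_diff tendsto_const dc(2)) (simp add: integrable_const_ivl)
 ultimately show "(%m. rs_sum tt f s t (Suc m)) ---> ou_int tt f s t" unfolding ou by simp
qed

text \<open>Subtracting the noise leaves \<open>y = x - f\<close>, an indefinite integral and so
  continuous, with \<open>y' = - tt (y + f)\<close> wherever \<open>f\<close> is continuous. Hence
  \<open>exp (- tt (t - u)) y(u)\<close> has derivative \<open>- tt exp (- tt (t - u)) f(u)\<close>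
  outside a finite set, and integration gives the formula.\<close>

lemma variation_of_constants:
 assumes reg: "pw_reg f" and st: "0 <= s" "s < t"
  and x: "\<And>v. 0 <= v ==> x integrable_on {0..v} & x v = x0 - tt * integral {0..v} x + f v"
 shows "x t = exp (- tt * (t - s)) * x s + ou_int tt f s t"
proof -
 define y where "y u = x0 - tt * integral {0..u} x" for u
 have xy: "x v = y v + f v" if "v >= 0" for v using x[OF that] by (simp add: y_def)
 have cy: "continuous_on {0..t} y"
  unfolding y_def using x[of t] st by (intro continuous_intros indefinite_integral_continuous_1) auto
 let ?D = "{u\<in>{0<..t}. \<not> isCont f u}"
 have fin: "finite ?D" using reg unfolding pw_reg_def by blast
 have "((%u. - (tt * exp (- tt * (t - u)) * f u)) has_integral
  (exp (- tt * (t - t)) * y t - exp (- tt * (t - s)) * y s)) {s..t}"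
 proof (rule fundamental_theorem_of_calculus_interior_strong[OF fin])
  show "continuous_on {s..t} (%u. exp (- tt * (t - u)) * y u)"
  using st by (intro continuous_intros continuous_on_subset[OF cy]) auto
  fix u assume u: "u \<in> {s<..<t} - ?D"
  then have cf: "isCont f u" using st by auto
  have u0: "u > 0" using u st by auto
  have "isCont y u" using continuous_on_interior[OF cy, of u] u st by auto
  then have "isCont (%v. y v + f v) u" using cf by (intro continuous_intros)
  moreover have "\<forall>\<^sub>F v in nhds u. y v + f v = x v"
  using eventually_nhds_in_open[of "{0<..}" u] u0 by (auto elim!: eventually_mono simp: xy)
  ultimately have cx: "isCont x u" using isCont_cong[of "%v. y v + f v" x u] by auto
  have "((%v. integral {0..v} x) has_vector_derivative x u) (at u within ({0..t} - {}))"
  by (rule integral_has_vector_derivative_continuous_at)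
  (use x[of t] u u0 st cx in \<open>auto intro: continuous_at_imp_continuous_at_within\<close>)
  then have "((%v. integral {0..v} x) has_real_derivative x u) (at u)"
  using u st by (simp add: has_real_derivative_iff_has_vector_derivative at_within_Icc_at)
  then have dy: "(y has_real_derivative (- tt * x u)) (at u)"
  unfolding y_def by (auto intro!: derivative_eq_intros)
  have "((%u. exp (- tt * (t - u)) * y u) has_real_derivative (tt * exp (- tt * (t - u)) * y u + exp (- tt * (t - u)) * (- tt * x u))) (at u)"
  by (rule derivative_eq_intros dy refl | simp)+
  moreover have "tt * exp (- tt * (t - u)) * y u + exp (- tt * (t - u)) * (- tt * x u) = - (tt * exp (- tt * (t - u)) * f u)"
  using xy[of u] u0 by (simp add: algebra_simps)
  ultimately show "((%u. exp (- tt * (t - u)) * y u) has_vector_derivative - (tt * exp (- tt * (t - u)) * f u)) (at u)"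
  by (simp add: has_real_derivative_iff_has_vector_derivative)
 qed (use st in auto)
 from has_integral_diff[OF has_integral_neg[OF this] has_integral_mult_left[OF exp_kernel_integral[of s t tt t], of "f s"]] st
 have "((%u. tt * exp (- tt * (t - u)) * (f u - f s)) has_integral
  - (y t - exp (- tt * (t - s)) * y s) - (1 - exp (- tt * (t - s))) * f s) {s..t}"
  by (simp add: algebra_simps)
 then have "tt * integral {s..t} (%u. exp (- tt * (t - u)) * (f u - f s)) = - (y t - exp (- tt * (t - s)) * y s) - (1 - exp (- tt * (t - s))) * f s"
  by (simp add: integral_unique mult.assoc flip: integral_mult_right)
 then show ?thesis unfolding ou_int_def using xy[of t] xy[of s] st by (simp add: algebra_simps)
qed

lemma ou_int_lincomb:
 assumes "0 <= s" "s < t" "pw_reg f" "pw_reg g"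
 shows "ou_int tt (%u. c * f u + g u) s t = c * ou_int tt f s t + ou_int tt g s t"
proof -
 note a = rs_sum_tendsto(1)[OF assms(1,2,3), of tt] and b = rs_sum_tendsto(1)[OF assms(1,2,4), of tt]
 have "integral {s..t} (%u. c * (tt * exp (- tt * (t - u)) * (f u - f s)) + tt * exp (- tt * (t - u)) * (g u - g s))
  = c * integral {s..t} (%u. tt * exp (- tt * (t - u)) * (f u - f s)) + integral {s..t} (%u. tt * exp (- tt * (t - u)) * (g u - g s))"
  using a b by (subst integral_add) (auto intro: integrable_on_mult_right)
 moreover have "(%u. c * (tt * exp (- tt * (t - u)) * (f u - f s)) + tt * exp (- tt * (t - u)) * (g u - g s))
  = (%u. tt * (exp (- tt * (t - u)) * (c * f u + g u - (c * f s + g s))))"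
  by (auto simp: algebra_simps)
 ultimately show ?thesis unfolding ou_int_def by (simp add: mult.assoc) (simp add: algebra_simps)
qed

text \<open>The derivative of \<open>z exp (- z v)\<close> in \<open>z\<close> is
  \<open>(1 - z v) exp (- z v)\<close>, of modulus at most 1 because \<open>|1 - w| <= exp w\<close>
  for \<open>w >= 0\<close>.\<close>

lemma exp_kernel_lipschitz:
 fixes tt tt' v :: real
 assumes "tt >= 0" "tt' >= 0" "v >= 0"
 shows "\<bar>tt * exp (- tt * v) - tt' * exp (- tt' * v)\<bar> <= \<bar>tt - tt'\<bar>"
proof -
 have "norm (tt * exp (- tt * v) - tt' * exp (- tt' * v)) <= 1 * norm (tt - tt')"
 proof (rule field_differentiable_bound[of "{0..}"])
  fix z :: real assume z: "z \<in> {0..}"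
  show "((%tt. tt * exp (- tt * v)) has_field_derivative (1 - z * v) * exp (- z * v)) (at z within {0..})"
  by (auto intro!: derivative_eq_intros simp: algebra_simps)
  have w: "z * v >= 0" using z assms by auto
  then have "\<bar>1 - z * v\<bar> <= exp (z * v)" using exp_ge_add_one_self[of "z * v"] by linarith
  then have "\<bar>1 - z * v\<bar> * exp (- (z * v)) <= exp (z * v) * exp (- (z * v))" by (intro mult_right_mono) auto
  then show "norm ((1 - z * v) * exp (- z * v)) <= 1" by (simp add: abs_mult exp_minus)
 qed (use assms in auto)
 then show ?thesis by simp
qed

lemma ou_int_bounds:
 assumes st: "0 <= s" "s < t" and reg: "pw_reg f" and A: "\<And>u. u \<in> {s..t} ==> \<bar>f u - f s\<bar> <= A"
  and th: "tt >= 0" "tt' >= 0"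
 shows "\<bar>ou_int tt f s t - ou_int tt' f s t\<bar> <= \<bar>tt - tt'\<bar> * (t - s) * A"
  and "\<bar>ou_int tt f s t - (f t - f s)\<bar> <= tt * (t - s) * A"
proof -
 have gen: "\<bar>ou_int tt f s t - ou_int tt' f s t\<bar> <= \<bar>tt - tt'\<bar> * (t - s) * A" if th: "tt >= 0" "tt' >= 0" for tt tt' :: real
 proof -
  let ?h = "%u. tt' * exp (- tt' * (t - u)) * (f u - f s) - tt * exp (- tt * (t - u)) * (f u - f s)"
  have i: "?h integrable_on {s..t}"
  by (intro integrable_diff rs_sum_tendsto(1) st reg)
  have "ou_int tt f s t - ou_int tt' f s t = integral {s..t} ?h"
  unfolding ou_int_def using rs_sum_tendsto(1)[OF st reg]
  by (subst integral_diff) (auto simp: mult.assoc)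
  moreover have "norm (integral {s..t} ?h) <= integral {s..t} (%_. \<bar>tt - tt'\<bar> * A)"
  proof (rule Henstock_Kurzweil_Integration.integral_norm_bound_integral[OF i])
  fix u assume u: "u \<in> {s..t}"
  have "norm (?h u) = \<bar>tt * exp (- tt * (t - u)) - tt' * exp (- tt' * (t - u))\<bar> * \<bar>f u - f s\<bar>"
  by (simp add: abs_mult[symmetric] algebra_simps)
  also have "... <= \<bar>tt - tt'\<bar> * A"
  using exp_kernel_lipschitz[OF th, of "t - u"] A[OF u] u by (intro mult_mono) auto
  finally show "norm (?h u) <= \<bar>tt - tt'\<bar> * A" by simp
  qed (simp add: integrable_const_ivl)
  moreover have "integral {s..t} (%_. \<bar>tt - tt'\<bar> * A) = \<bar>tt - tt'\<bar> * (t - s) * A" using st by simp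
  ultimately show ?thesis by (simp only: real_norm_def)
 qed
 show "\<bar>ou_int tt f s t - ou_int tt' f s t\<bar> <= \<bar>tt - tt'\<bar> * (t - s) * A" by (rule gen[OF th])
 \<comment> \<open>At drift 0 the kernel term disappears, so the second bound is the first one with
   \<open>tt' = 0\<close>.\<close>
 have "ou_int 0 f s t = f t - f s" by (simp add: ou_int_def)
 with gen[of tt 0] th show "\<bar>ou_int tt f s t - (f t - f s)\<bar> <= tt * (t - s) * A" by simp
qed

lemma ou_int_cong: "(\<And>u. u \<in> {s..t} ==> f u - f s = g u - g s) ==> s <= t ==> ou_int tt f s t = ou_int tt g s t"
 unfolding ou_int_def
 using Henstock_Kurzweil_Integration.integral_cong[of "{s..t}" "%u. exp (- tt * (t - u)) * (f u - f s)" "%u. exp (- tt * (t - u)) * (g u - g s)"]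
 by force

lemma ou_int_const:
 assumes "\<And>u. u \<in> {s..t} ==> f u = f s" "s <= t"
 shows "ou_int tt f s t = 0"
proof -
 have "ou_int tt f s t = ou_int tt (%_. 0) s t"
 proof (rule ou_int_cong)
  fix u assume "u \<in> {s..t}"
  from assms(1)[OF this] show "f u - f s = 0 - 0" by simp
 qed fact
 then show ?thesis by (simp add: ou_int_def)
qed

context counting_path
begin

lemma jump_increment_le:
 fixes Z :: "nat => real"
 assumes "0 <= s" "s <= u" "u <= t"
 shows "\<bar>(\<Sum>k\<in>{1..count_of N u}. Z k) - (\<Sum>k\<in>{1..count_of N s}. Z k)\<bar> <= (\<Sum>k\<in>{count_of N s<..count_of N t}. \<bar>Z k\<bar>)"
proof -
 have le: "count_of N s <= count_of N u" "count_of N u <= count_of N t" using count_mono assms by auto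
 then have "{1..count_of N u} = {1..count_of N s} \<union> {count_of N s<..count_of N u}" by auto
 then have "(\<Sum>k\<in>{1..count_of N u}. Z k) - (\<Sum>k\<in>{1..count_of N s}. Z k) = (\<Sum>k\<in>{count_of N s<..count_of N u}. Z k)"
  by (simp only:, subst sum.union_disjoint) auto
 also have "\<bar>...\<bar> <= (\<Sum>k\<in>{count_of N s<..count_of N u}. \<bar>Z k\<bar>)" by (rule sum_abs)
 also have "... <= (\<Sum>k\<in>{count_of N s<..count_of N t}. \<bar>Z k\<bar>)" using le by (intro sum_mono2) auto
 finally show ?thesis by simp
qed

lemma ou_int_no_jump:
 fixes S :: "nat => real"
 assumes "0 <= s" "s < t" "count_of N t = count_of N s"
 shows "ou_int tt (%u. S (count_of N u)) s t = 0"
proof (rule ou_int_const)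
 fix u assume "u \<in> {s..t}"
 then have "count_of N u = count_of N s" using count_mono[of s u] count_mono[of u t] assms by auto
 then show "S (count_of N u) = S (count_of N s)" by simp
qed (use assms in auto)

text \<open>A single jump enters with its height times a discount factor that depends on the jump
  time. Writing the path as the height times the counting path avoids naming that time: the factor
  is the integral of the count, caught between full discount and none.\<close>

lemma ou_int_one_jump:
 fixes Z :: "nat => real"
 assumes st: "0 <= s" "s < t" "count_of N t = Suc (count_of N s)" and th: "tt > 0"
 shows "\<exists>c\<in>{exp (- tt * (t - s))..1}. ou_int tt (%u. \<Sum>k\<in>{1..count_of N u}. Z k) s t = c * Z (count_of N t)"
proof
 let ?f = "%u. real (count_of N u)"
 have cu: "count_of N u = count_of N s \<or> count_of N u = Suc (count_of N s)" if "u \<in> {s..t}" for u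
  using count_mono[of s u] count_mono[of u t] st that by auto
 have reg: "pw_reg ?f" by (rule pw_reg_step)
 have reg0: "pw_reg (%u. 0)" by (rule pw_reg_continuous) auto
 have "ou_int tt (%u. \<Sum>k\<in>{1..count_of N u}. Z k) s t = ou_int tt (%u. Z (count_of N t) * ?f u + 0) s t"
 proof (rule ou_int_cong)
  fix u assume u: "u \<in> {s..t}"
  show "(\<Sum>k\<in>{1..count_of N u}. Z k) - (\<Sum>k\<in>{1..count_of N s}. Z k) = (Z (count_of N t) * ?f u + 0) - (Z (count_of N t) * ?f s + 0)"
  using cu[OF u] st(3) by (auto simp: algebra_simps)
 qed (use st in auto)
 also have "... = Z (count_of N t) * ou_int tt ?f s t"
  unfolding ou_int_lincomb[OF st(1,2) reg reg0] by (simp add: ou_int_def)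
 finally show "ou_int tt (%u. \<Sum>k\<in>{1..count_of N u}. Z k) s t = ou_int tt ?f s t * Z (count_of N t)" by simp
 let ?h = "%u. tt * exp (- tt * (t - u)) * (?f u - ?f s)"
 have i: "?h integrable_on {s..t}" by (rule rs_sum_tendsto(1)[OF st(1,2) reg])
 have hb: "0 <= ?h u" "?h u <= tt * exp (- tt * (t - u))" if "u \<in> {s..t}" for u
  using cu[OF that] th by auto
 have e: "((%u. tt * exp (- tt * (t - u))) has_integral (1 - exp (- tt * (t - s)))) {s..t}"
  using exp_kernel_integral[of s t tt t] st by simp
 have "0 <= integral {s..t} ?h" by (rule integral_nonneg[OF i hb(1)])
 moreover have "integral {s..t} ?h <= 1 - exp (- tt * (t - s))"
  unfolding integral_unique[OF e, symmetric]
  by (rule integral_le[OF i has_integral_integrable[OF e] hb(2)])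
 moreover have "ou_int tt ?f s t = 1 - integral {s..t} ?h"
  unfolding ou_int_def using st(3) by (simp add: mult.assoc)
 ultimately show "ou_int tt ?f s t \<in> {exp (- tt * (t - s))..1}" by simp
qed

end

section \<open>Independence and laws of the innovations\<close>

context prob_space
begin

lemma rs_sum_measurable:
 "(\<And>u. V u : bmeas H) ==> (%om. rs_sum tt (%u. V u om) s t m) : bmeas H"
 unfolding rs_sum_def by (intro borel_measurable_sum borel_measurable_times borel_measurable_diff) auto

lemma ou_int_measurable:
 assumes st: "0 <= s" "s < t" and reg: "\<And>om. om \<in> space H ==> pw_reg (%u. V u om)"
  and V: "\<And>u. V u : bmeas H"
 shows "(%om. ou_int tt (%u. V u om) s t) : bmeas H"
proof (rule borel_measurable_LIMSEQ_real)
 show "(%om. rs_sum tt (%u. V u om) s t (Suc m)) : bmeas H" for m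
  by (rule rs_sum_measurable[OF V])
qed (rule rs_sum_tendsto(2)[OF st reg])

lemma char_tendsto:
 assumes "\<And>m. Y m : bmeas M" "\<And>om. om : space M ==> (%m. Y m om) ---> Z om"
 shows "(%m. char (distr M borel (Y m)) u) ---> char (distr M borel Z) u"
proof -
 have [measurable]: "\<And>m. Y m : bmeas M" by fact
 have [measurable]: "Z : bmeas M" by (rule borel_measurable_LIMSEQ_real[OF assms(2,1)])
 have "(%m. \<integral>om. iexp (u * Y m om) \<partial>M) ---> (LINT om|M. iexp (u * Z om))"
  by (rule integral_dominated_convergence[where w="%_. 1"]) (auto intro!: tendsto_intros assms(2))
 then show ?thesis by (simp add: char_def integral_distr)
qed

lemma char_scale:
 assumes [measurable]: "Y : bmeas M"
 shows "char (distr M borel (%om. c * Y om)) u = char (distr M borel Y) (c * u)"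
 by (simp add: char_def integral_distr mult_ac)

end

text \<open>The common refinement of a partition obtained by cutting each of its intervals into \<open>m\<close> equal pieces.\<close>
definition refined :: "(nat => real) => nat => nat => nat => real" where
 "refined ta n m q = (if q >= n * m then ta n else grid_pt (ta (q div m)) (ta (Suc (q div m))) m (q mod m))"

lemma refined_eq:
 assumes "m > 0" "l < n" "k <= m"
 shows "refined ta n m (l * m + k) = grid_pt (ta l) (ta (Suc l)) m k"
proof -
 have lt: "l * m + m <= n * m" using assms(2) by (metis Suc_leI mult_le_mono1 add.commute mult_Suc)
 show ?thesis
 proof (cases "k < m")
  case True
  then show ?thesis using lt assms by (simp add: refined_def)
 next
  case False
  then have k: "k = m" using assms by simp
  have e: "l * m + m = Suc l * m" by simp
  show ?thesis
  proof (cases "Suc l = n")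
  case True
  then show ?thesis using assms(1) unfolding k e refined_def by (simp add: grid_pt_simps)
  next
  case False
  then have "Suc l < n" using assms(2) by simp
  then have "\<not> n * m <= Suc l * m" using mult_less_mono1[OF _ assms(1), of "Suc l" n] by (simp only: not_le)
  then show ?thesis using assms(1) unfolding k e refined_def by (simp add: grid_pt_simps del: mult_Suc)
  qed
 qed
qed

lemma refined_mono:
 assumes "m > 0" "\<And>i. i < n ==> ta i <= ta (Suc i)"
 shows "refined ta n m q <= refined ta n m (Suc q)"
proof (cases "q < n * m")
 case True
 define l k where "l = q div m" and "k = q mod m"
 have q: "q = l * m + k" "k < m" using assms(1) by (auto simp: l_def k_def)
 have l: "l < n" using True assms(1) by (simp add: l_def less_mult_imp_div_less)
 have "refined ta n m q = grid_pt (ta l) (ta (Suc l)) m k" unfolding q(1) by (rule refined_eq) (use assms l q in auto)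
 moreover have "refined ta n m (Suc q) = grid_pt (ta l) (ta (Suc l)) m (Suc k)"
  using refined_eq[of m l n "Suc k" ta] assms l q by simp
 ultimately show ?thesis using grid_pt_mono[OF assms(2)[OF l], of k "Suc k" m] by simp
qed (auto simp: refined_def)

context prob_space
begin

text \<open>On the common refinement the Riemann sum over the \<open>l\<close>-th interval uses only
  the increments in the \<open>l\<close>-th block of indices. Disjoint blocks of independent
  increments are independent, and independence survives the limit of the sums.\<close>

lemma indep_ou_int:
 fixes V :: "real => 'a => real"
 assumes reg: "\<And>om. om : space M ==> pw_reg (%u. V u om)"
  and inc: "\<And>(k::nat) ta. 0 <= ta 0 ==> (\<And>i. ta i <= ta (Suc i)) ==>
  indep_vars (%_. borel) (%i om. V (ta (Suc i)) om - V (ta i) om) {..<k}"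
  and ta: "\<And>i. i < n ==> 0 <= ta i" "\<And>i. i < n ==> ta i < ta (Suc i)" and n: "n > 0"
 shows "indep_vars (%_. borel) (%i om. ou_int tt (%u. V u om) (ta i) (ta (Suc i))) {..<n}"
proof (rule indep_vars_limit[where Ym="%m i om. rs_sum tt (%u. V u om) (ta i) (ta (Suc i)) (Suc m)"])
 fix m
 let ?m = "Suc m" and ?r = "refined ta n (Suc m)"
 let ?K = "%l. {l * ?m..<l * ?m + ?m}"
 have "?r 0 = ta 0" using refined_eq[of ?m 0 n 0 ta] n by (simp add: grid_pt_def)
 then have "indep_vars (%_. borel) (%i om. V (?r (Suc i)) om - V (?r i) om) {..<n * ?m}"
  by (intro inc refined_mono) (use ta n in \<open>auto intro: less_imp_le\<close>)
 then have "indep_vars (%l. PiM (?K l) (%_. borel)) (%l om. restrict (%i. V (?r (Suc i)) om - V (?r i) om) (?K l)) {..<n}"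
 proof (rule indep_vars_restrict)
  fix l assume "l \<in> {..<n}"
  then have "Suc l * ?m <= n * ?m" by (intro mult_le_mono1) auto
  then show "?K l \<subseteq> {..<n * ?m}" by auto
 next
  show "disjoint_family_on ?K {..<n}"
  unfolding disjoint_family_on_def
  proof (intro ballI impI)
  fix l l' :: nat assume "l ~= l'"
  have "l = l'" if "q \<in> ?K l" "q \<in> ?K l'" for q
  proof -
  have "q div ?m = l" "q div ?m = l'" using that by (auto intro!: div_nat_eqI simp: algebra_simps)
  then show ?thesis by simp
  qed
  with \<open>l ~= l'\<close> show "?K l \<inter> ?K l' = {}" by blast
  qed
 qed
 then have "indep_vars (%_. borel) (%l om. \<Sum>k<?m. exp (- tt * (ta (Suc l) - grid_pt (ta l) (ta (Suc l)) ?m k)) *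
  restrict (%i. V (?r (Suc i)) om - V (?r i) om) (?K l) (l * ?m + k)) {..<n}"
  by (rule indep_vars_compose2[where Y="%l x. \<Sum>k<?m. exp (- tt * (ta (Suc l) - grid_pt (ta l) (ta (Suc l)) ?m k)) * x (l * ?m + k)"])
  (intro borel_measurable_sum borel_measurable_times borel_measurable_const measurable_component_singleton, simp)
 also have "?this \<longleftrightarrow> indep_vars (%_. borel) (%i om. rs_sum tt (%u. V u om) (ta i) (ta (Suc i)) ?m) {..<n}"
 proof (rule indep_vars_cong)
  fix l assume l: "l \<in> {..<n}"
  have e: "?r (l * ?m + k) = grid_pt (ta l) (ta (Suc l)) ?m k" if "k <= ?m" for k
  using l that by (intro refined_eq) auto
  have e': "?r (Suc (l * ?m + k)) = grid_pt (ta l) (ta (Suc l)) ?m (Suc k)" if "k < ?m" for k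
  using e[of "Suc k"] that by simp
  show "(%om. \<Sum>k<?m. exp (- tt * (ta (Suc l) - grid_pt (ta l) (ta (Suc l)) ?m k)) *
  restrict (%i. V (?r (Suc i)) om - V (?r i) om) (?K l) (l * ?m + k)) = (%om. rs_sum tt (%u. V u om) (ta l) (ta (Suc l)) ?m)"
  unfolding rs_sum_def by (intro ext sum.cong refl) (simp add: e e' del: mult_Suc_right mult_Suc)
 qed auto
 finally show "indep_vars (%_. borel) (%i om. rs_sum tt (%u. V u om) (ta i) (ta (Suc i)) ?m) {..<n}" .
qed (use ta n in \<open>auto intro!: rs_sum_tendsto(2) reg\<close>)

lemma char_rs_sum:
 fixes V :: "real => 'a => real"
 assumes inc: "\<And>(k::nat) ta. 0 <= ta 0 ==> (\<And>i. ta i <= ta (Suc i)) ==>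
  indep_vars (%_. borel) (%i om. V (ta (Suc i)) om - V (ta i) om) {..<k}"
  and [measurable]: "\<And>u. V u : bmeas M" and st: "0 <= s" "s <= t"
 shows "char (distr M borel (%om. rs_sum tt (%u. V u om) s t m)) u =
  (\<Prod>k<m. char (distr M borel (%om. V (grid_pt s t m (Suc k)) om - V (grid_pt s t m k) om)) (exp (- tt * (t - grid_pt s t m k)) * u))"
proof -
 have "indep_vars (%_. borel) (%k om. V (grid_pt s t m (Suc k)) om - V (grid_pt s t m k) om) {..<m}"
  using st by (intro inc grid_pt_mono) (auto simp: grid_pt_simps)
 then have "indep_vars (%_. borel) (%k om. exp (- tt * (t - grid_pt s t m k)) * (V (grid_pt s t m (Suc k)) om - V (grid_pt s t m k) om)) {..<m}"
  by (rule indep_vars_compose2[where Y="%k x. exp (- tt * (t - grid_pt s t m k)) * x"]) auto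
 then show ?thesis unfolding rs_sum_def
  by (subst char_distr_sum) (auto intro!: prod.cong char_scale)
qed

end

text \<open>Standard deviation of a Brownian Ornstein-Uhlenbeck integral over a length \<delta>,
  without the factor \<sigma>.\<close>

definition ou_sd :: "real => real => real" where
 "ou_sd tt \<delta> = sqrt ((1 - exp (- 2 * tt * \<delta>)) / (2 * tt))"

lemma ou_sd_pos: "tt > 0 ==> \<delta> > 0 ==> ou_sd tt \<delta> > 0"
 unfolding ou_sd_def by simp

lemma ou_sd_sq: "tt > 0 ==> \<delta> > 0 ==> (ou_sd tt \<delta>)\<^sup>2 = (1 - exp (- 2 * tt * \<delta>)) / (2 * tt)"
 unfolding ou_sd_def by simp

text \<open>One noise drives the solutions for all drifts, so different drifts are compared on a
  single probability space. \<open>IZ 0\<close> is left out of the independent family because jumps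
  are numbered from 1.\<close>

locale jump_ou = prob_space M for M :: "'a measure" +
 fixes X0 :: "'a => real" and W N :: "real => 'a => real" and Z :: "nat => 'a => real"
  and F :: "real measure" and \<sigma> lam :: real and X :: "real => real => 'a => real"
 assumes sigma: "\<sigma>^2 > 0"
  and lam: "lam >= 0"
  and F: "prob_space F" "sets F = sets borel"
  and X0: "X0 : bmeas M"
  and W: "brownian_motion M W"
  and N: "poisson_process M lam N"
  and Z: "\<And>k. k >= 1 ==> distr M borel (Z k) = F"
  and Zmeas: "\<And>k. Z k : bmeas M"
  and indep: "indep_vars (%_. Pi\<^sub>M UNIV (%_. borel)) (ingredients X0 W N Z) (UNIV - {IZ 0})"
  and X_ou: "\<And>tt om s. om : space M ==> 0 <= s ==>
  (%u. X tt u om) integrable_on {0..s} \<and>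
  X tt s om = X0 om - tt * integral {0..s} (%u. X tt u om) + levy_L \<sigma> W N Z s om"
begin

text \<open>Generated by the complete trajectories of the ingredients in \<open>A\<close>, so that
  disjoint sets of ingredients give independent sigma-algebras.\<close>

definition Sig :: "ingredient set => 'a measure" where
 "Sig A = vimage_algebra (space M) (%om. \<lambda>i\<in>A. ingredients X0 W N Z i om) (Pi\<^sub>M A (%_. Pi\<^sub>M UNIV (%_. borel)))"

definition cnt :: "real => 'a => nat" where "cnt t om = count_of (%t. N t om) t"
definition J :: "real => 'a => real" where "J t om = (\<Sum>k\<in>{1..cnt t om}. Z k om)"
definition Jou :: "real => real => real => 'a => real" where "Jou tt s t om = ou_int tt (%u. J u om) s t"
definition Wou :: "real => real => real => 'a => real" where "Wou tt s t om = ou_int tt (%u. W u om) s t"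
text \<open>Total variation of the jump part on the interval, the common dominating variable of the
  jump innovations for all drifts.\<close>

definition Avar :: "real => real => 'a => real" where "Avar s t om = (\<Sum>k\<in>{cnt s om<..cnt t om}. \<bar>Z k om\<bar>)"

lemma space_Sig [simp]: "space (Sig A) = space M" by (simp add: Sig_def)

lemma ingredients_measurable: "i ~= IZ 0 ==> ingredients X0 W N Z i \<in> measurable M (Pi\<^sub>M UNIV (%_. borel))"
 using indep by (auto simp: indep_vars_def)

lemma Sig_sub: "IZ 0 \<notin> A ==> subalgebra M (Sig A)"
proof -
 assume A: "IZ 0 \<notin> A"
 have "(%om. \<lambda>i\<in>A. ingredients X0 W N Z i om) \<in> measurable M (Pi\<^sub>M A (%_. Pi\<^sub>M UNIV (%_. borel)))"
  using A by (intro measurable_restrict ingredients_measurable) auto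
 then show ?thesis unfolding subalgebra_def Sig_def sets_vimage_algebra
  by (auto intro!: sets.sigma_sets_subset measurable_sets)
qed

lemma Sig_eval:
 assumes "i \<in> A"
 shows "(%om. ingredients X0 W N Z i om t) : bmeas (Sig A)"
proof -
 have "(%om. \<lambda>i\<in>A. ingredients X0 W N Z i om) \<in> measurable (Sig A) (Pi\<^sub>M A (%_. Pi\<^sub>M UNIV (%_. borel)))"
  unfolding Sig_def by (rule measurable_vimage_algebra1) (auto simp: space_PiM)
 then have "(%om. (\<lambda>i\<in>A. ingredients X0 W N Z i om) i) \<in> measurable (Sig A) (Pi\<^sub>M UNIV (%_. borel))"
  by (rule measurable_compose[OF _ measurable_component_singleton[OF assms]])
 then have "(%om. (\<lambda>i\<in>A. ingredients X0 W N Z i om) i t) : bmeas (Sig A)"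
  by (rule measurable_compose[OF _ measurable_component_singleton]) simp
 then show ?thesis using assms by simp
qed

lemma Sig_X0: "IX0 \<in> A ==> X0 : bmeas (Sig A)"
 and Sig_W: "IW \<in> A ==> W t : bmeas (Sig A)"
 and Sig_N: "IN \<in> A ==> N t : bmeas (Sig A)"
 and Sig_Z: "IZ k \<in> A ==> Z k : bmeas (Sig A)"
 using Sig_eval[of IX0 A t] Sig_eval[of IW A t] Sig_eval[of IN A t] Sig_eval[of "IZ k" A t]
 by (auto simp: ingredients_def)

lemma Sig_indep:
 assumes "A \<inter> B = {}" "IZ 0 \<notin> A" "IZ 0 \<notin> B"
 shows "indep_set (sets (Sig A)) (sets (Sig B))"
proof -
 have "indep_var (Pi\<^sub>M A (%_. Pi\<^sub>M UNIV (%_. borel))) (%om. \<lambda>i\<in>A. ingredients X0 W N Z i om)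
  (Pi\<^sub>M B (%_. Pi\<^sub>M UNIV (%_. borel))) (%om. \<lambda>i\<in>B. ingredients X0 W N Z i om)"
  by (rule indep_var_restrict[OF indep]) (use assms in auto)
 then show ?thesis unfolding indep_var_eq Sig_def sets_vimage_algebra by simp
qed

lemma Sig_indep_alg:
 assumes "A \<inter> B = {}" "IZ 0 \<notin> A" "IZ 0 \<notin> B" "V \<in> measurable (Sig B) S"
 shows "indep_alg M (Sig A) S V"
 unfolding indep_alg_def
proof (intro conjI ballI)
 show "V \<in> measurable M S" using measurable_from_subalg[OF Sig_sub assms(4)] assms(3) by auto
 fix a b assume "a \<in> sets (Sig A)" "b \<in> sets S"
 then show "prob (a \<inter> (V -` b \<inter> space M)) = prob a * prob (V -` b \<inter> space M)"
  using Sig_indep[OF assms(1,2,3)] measurable_sets[OF assms(4)] unfolding indep_sets2_eq by auto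
qed (rule Sig_sub[OF assms(2)])

lemma N_path: "om : space M ==> counting_path (%t. N t om)"
 using N unfolding poisson_process_def by unfold_locales auto

lemma W_reg: "om : space M ==> pw_reg (%u. W u om)"
 using W unfolding brownian_motion_def by (intro pw_reg_continuous) auto

lemma J_reg: "om : space M ==> pw_reg (%u. J u om)"
 unfolding J_def cnt_def by (rule counting_path.pw_reg_step[OF N_path])

lemma J_alt: "J t om = (\<Sum>k<cnt t om. Z (Suc k) om)"
 unfolding J_def by (rule sum.reindex_bij_witness[of _ Suc "%k. k - 1"]) auto

definition SJ :: "ingredient set" where "SJ = insert IN (range (%k. IZ (Suc k)))"

lemma cnt_measurable: "IN \<in> A ==> cnt t \<in> measurable (Sig A) (count_space UNIV)"
proof -
 assume "IN \<in> A"
 then have [measurable]: "N t : bmeas (Sig A)" by (rule Sig_N)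
 show ?thesis unfolding cnt_def count_of_def by measurable
qed

lemma J_measurable: "SJ \<subseteq> A ==> J t : bmeas (Sig A)"
proof -
 assume A: "SJ \<subseteq> A"
 have [measurable]: "Z (Suc k) : bmeas (Sig A)" for k using A by (intro Sig_Z) (auto simp: SJ_def)
 have "(%om. (%n om. \<Sum>k<n. Z (Suc k) om) (cnt t om) om) : bmeas (Sig A)"
  by (rule measurable_compose_countable[OF _ cnt_measurable]) (use A in \<open>auto simp: SJ_def\<close>)
 then show ?thesis unfolding J_alt .
qed

lemma Jou_measurable: "SJ \<subseteq> A ==> 0 <= s ==> s < t ==> Jou tt s t : bmeas (Sig A)"
 unfolding Jou_def by (rule ou_int_measurable) (auto intro: J_reg J_measurable)

lemma Wou_measurable: "IW \<in> A ==> 0 <= s ==> s < t ==> Wou tt s t : bmeas (Sig A)"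
 unfolding Wou_def by (rule ou_int_measurable) (auto intro: W_reg Sig_W)

lemma Sig_M: "IZ 0 \<notin> A ==> f \<in> measurable (Sig A) S ==> f \<in> measurable M S"
 by (rule measurable_from_subalg[OF Sig_sub])

lemma SJ_notin: "IZ 0 \<notin> SJ" "IW \<notin> SJ" "IX0 \<notin> SJ" by (auto simp: SJ_def)

lemma measurable_M [measurable]:
 "X0 : bmeas M" "W t : bmeas M" "N t : bmeas M" "Z k : bmeas M"
 "cnt t \<in> measurable M (count_space UNIV)" "J t : bmeas M"
 using X0 W N Zmeas Sig_M[OF _ cnt_measurable, of SJ t] Sig_M[OF _ J_measurable, of SJ t] SJ_notin
 unfolding brownian_motion_def poisson_process_def by (auto simp: SJ_def)

lemma Jou_M: "0 <= s ==> s < t ==> Jou tt s t : bmeas M"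
 using Sig_M[OF SJ_notin(1) Jou_measurable] by auto

lemma Wou_M: "0 <= s ==> s < t ==> Wou tt s t : bmeas M"
 using Sig_M[OF _ Wou_measurable, of "{IW}"] by auto

lemma X_step:
 assumes w: "om : space M" and st: "0 <= s" "s < t"
 shows "X tt t om = exp (- tt * (t - s)) * X tt s om + Jou tt s t om + \<sigma> * Wou tt s t om"
proof -
 have L: "levy_L \<sigma> W N Z = (%u om. \<sigma> * W u om + J u om)"
  by (simp add: levy_L_def J_def cnt_def count_of_def fun_eq_iff)
 have reg0: "pw_reg (%_. 0)" by (rule pw_reg_continuous) auto
 have reg1: "pw_reg (%u. \<sigma> * W u om)"
  by (rule pw_reg_continuous) (use W w in \<open>auto simp: brownian_motion_def intro!: continuous_intros\<close>)
 have reg: "pw_reg (%u. \<sigma> * W u om + J u om)" by (rule pw_reg_add[OF reg1 J_reg[OF w]])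
 have "X tt t om = exp (- tt * (t - s)) * X tt s om + ou_int tt (%u. \<sigma> * W u om + J u om) s t"
  by (rule variation_of_constants[OF reg st, of "%u. X tt u om"])
  (use X_ou[OF w, of _ tt] in \<open>auto simp: L\<close>)
 then show ?thesis
  unfolding ou_int_lincomb[OF st W_reg[OF w] J_reg[OF w]] by (simp add: Wou_def Jou_def)
qed

lemma X_zero: "om : space M ==> X tt 0 om = X0 om"
 using X_ou[of om 0 tt] W N by (simp add: levy_L_def brownian_motion_def poisson_process_def)

lemma W_inc:
 assumes "0 <= ta 0" "\<And>i. ta i <= ta (Suc i)"
 shows "indep_vars (%_. borel) (%i om. W (ta (Suc i)) om - W (ta i) om) {..<k::nat}"
 using W assms unfolding brownian_motion_def by blast

lemma N_inc:
 assumes "0 <= ta 0" "\<And>i. ta i <= ta (Suc i)"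
 shows "indep_vars (%_. borel) (%i om. N (ta (Suc i)) om - N (ta i) om) {..<k::nat}"
 using N assms unfolding poisson_process_def by blast

lemma W_char:
 assumes "0 <= s" "s < t"
 shows "char (distr M borel (%om. W t om - W s om)) u = exp (- complex_of_real (u^2 * (t - s) / 2))"
proof -
 let ?Y = "%om. (W t om - W s om - 0) / sqrt (t - s)"
 have "distributed M lborel (%om. W t om - W s om) (%x. ennreal (normal_density 0 (sqrt (t - s)) x))"
  using W assms unfolding brownian_motion_def by blast
 then have "distributed M lborel ?Y (%x. ennreal (std_normal_density x))"
  using normal_standard_normal_convert[of "sqrt (t - s)" "%om. W t om - W s om" 0] assms by simp
 then have "distr M lborel ?Y = std_normal_distribution" by (simp add: distributed_def)
 moreover have "distr M borel ?Y = distr M lborel ?Y" by (rule distr_cong) auto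
 ultimately have d: "distr M borel ?Y = std_normal_distribution" by (simp only:)
 have "char (distr M borel (%om. W t om - W s om)) u = char (distr M borel (%om. sqrt (t - s) * ?Y om)) u"
  using assms by simp
 also have "... = char std_normal_distribution (sqrt (t - s) * u)"
  by (subst char_scale, measurable, simp only: d)
 also have "... = exp (- complex_of_real (u^2 * (t - s) / 2))"
  using assms unfolding char_std_normal_distribution
  by (simp add: power_mult_distrib exp_of_real[symmetric] mult.commute)
 finally show ?thesis .
qed

text \<open>A Riemann sum of independent Gaussian increments has as variance a sum of
  \<open>exp (- 2 tt (t - u)) du\<close>, again a Riemann sum of the same kind, with doubled drift
  and the identity path. So the limiting variance is \<open>ou_int (2 * tt)\<close> of the identity,
  and the characteristic function identifies the law.\<close>

lemma Wou_distr:
 assumes "0 <= s" "s < t" "tt > 0"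
 shows "distr M borel (%om. Wou tt s t om / ou_sd tt (t - s)) = std_normal_distribution"
proof -
 note [measurable] = Wou_M[OF assms(1,2)]
 have st: "s <= t" using assms by simp
 let ?v = "ou_sd tt (t - s)"
 have lin: "ou_int (2 * tt) (%u. u) s t = ?v\<^sup>2"
 proof -
  have "((%u. exp (- (2*tt) * (t - u)) * (u - s)) has_integral
  (exp (- (2*tt) * (t - t)) * ((t - s) / (2*tt) - 1 / (2*tt)^2) - exp (- (2*tt) * (t - s)) * ((s - s) / (2*tt) - 1 / (2*tt)^2))) {s..t}"
  proof (rule fundamental_theorem_of_calculus[OF st])
  fix u
  have "((%u. exp (- (2*tt) * (t - u)) * ((u - s) / (2*tt) - 1 / (2*tt)^2)) has_real_derivative exp (- (2*tt) * (t - u)) * (u - s)) (at u within {s..t})"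
  using assms(3) by (auto intro!: derivative_eq_intros simp: field_simps power2_eq_square)
  then show "((%u. exp (- (2*tt) * (t - u)) * ((u - s) / (2*tt) - 1 / (2*tt)^2)) has_vector_derivative exp (- (2*tt) * (t - u)) * (u - s)) (at u within {s..t})"
  by (simp add: has_real_derivative_iff_has_vector_derivative)
  qed
  then have i: "integral {s..t} (%u. exp (- (2*tt) * (t - u)) * (u - s)) = ((t - s) / (2*tt) - 1 / (2*tt)^2) + exp (- (2*tt) * (t - s)) / (2*tt)^2"
  by (simp add: integral_unique)
  have e: "exp (- (2*tt) * (t - s)) = 1 - 2 * tt * ?v\<^sup>2"
  using ou_sd_sq[OF assms(3), of "t - s"] assms by simp
  show ?thesis unfolding ou_int_def i e using assms(3)
  by (simp add: field_simps power2_eq_square)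
 qed
 have ch: "char (distr M borel (%om. rs_sum tt (%u. W u om) s t (Suc m))) u = exp (- complex_of_real (u^2 / 2 * rs_sum (2*tt) (%u. u) s t (Suc m)))" for m u
 proof -
  let ?g = "grid_pt s t (Suc m)"
  have lt: "0 <= ?g k" "?g k < ?g (Suc k)" for k
  using assms by (auto simp: grid_pt_def intro!: divide_strict_right_mono mult_strict_left_mono)
  have "char (distr M borel (%om. rs_sum tt (%u. W u om) s t (Suc m))) u =
  (\<Prod>k<Suc m. exp (- complex_of_real ((exp (- tt * (t - ?g k)) * u)^2 * (?g (Suc k) - ?g k) / 2)))"
  by (subst char_rs_sum[OF W_inc]) (use assms lt in \<open>auto simp: W_char\<close>)
  also have "... = exp (\<Sum>k<Suc m. - complex_of_real ((exp (- tt * (t - ?g k)) * u)^2 * (?g (Suc k) - ?g k) / 2))"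
  by (rule exp_sum[symmetric]) simp
  also have "(\<Sum>k<Suc m. - complex_of_real ((exp (- tt * (t - ?g k)) * u)^2 * (?g (Suc k) - ?g k) / 2)) =
  - complex_of_real (\<Sum>k<Suc m. (exp (- tt * (t - ?g k)) * u)\<^sup>2 * (?g (Suc k) - ?g k) / 2)"
  by (simp only: sum_negf of_real_sum)
  also have "(\<Sum>k<Suc m. (exp (- tt * (t - ?g k)) * u)\<^sup>2 * (?g (Suc k) - ?g k) / 2) = u^2 / 2 * rs_sum (2*tt) (%u. u) s t (Suc m)"
  unfolding rs_sum_def sum_distrib_left
  proof (intro sum.cong refl)
  fix k
  have "(exp (- tt * (t - ?g k)))^2 = exp (- (2*tt) * (t - ?g k))"
  by (simp add: power2_eq_square exp_add[symmetric])
  then show "(exp (- tt * (t - ?g k)) * u)^2 * (?g (Suc k) - ?g k) / 2 = u^2 / 2 * (exp (- (2*tt) * (t - ?g k)) * (?g (Suc k) - ?g k))"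
  by (simp only: power_mult_distrib) simp
  qed
  finally show ?thesis .
 qed
 have reg_id: "pw_reg (%u. u)" by (rule pw_reg_continuous) auto
 have chW: "char (distr M borel (Wou tt s t)) u = exp (- complex_of_real (u^2 / 2 * ?v\<^sup>2))" for u
 proof (rule LIMSEQ_unique)
  show "(%m. char (distr M borel (%om. rs_sum tt (%u. W u om) s t (Suc m))) u) ---> char (distr M borel (Wou tt s t)) u"
  unfolding Wou_def[abs_def] by (intro char_tendsto rs_sum_measurable rs_sum_tendsto(2) assms W_reg measurable_M)
  show "(%m. char (distr M borel (%om. rs_sum tt (%u. W u om) s t (Suc m))) u) ---> exp (- complex_of_real (u^2 / 2 * ?v\<^sup>2))"
  unfolding ch lin[symmetric]
  by (intro tendsto_exp tendsto_minus tendsto_of_real tendsto_mult tendsto_const rs_sum_tendsto(2) assms reg_id)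
 qed
 have vp: "?v > 0" using ou_sd_pos[of tt "t - s"] assms by simp
 show ?thesis
 proof (rule Levy_uniqueness)
  show "real_distribution (distr M borel (%om. Wou tt s t om / ?v))" by (rule real_distribution_distr) simp
  show "char (distr M borel (%om. Wou tt s t om / ?v)) = char std_normal_distribution"
  proof
  fix u
  have "char (distr M borel (%om. Wou tt s t om / ?v)) u = char (distr M borel (%om. (1 / ?v) * Wou tt s t om)) u" by simp
  also have "... = char (distr M borel (Wou tt s t)) (1 / ?v * u)" by (rule char_scale) simp
  also have "... = char std_normal_distribution u"
  using vp unfolding chW char_std_normal_distribution
  by (simp add: power_divide exp_of_real[symmetric])
  finally show "char (distr M borel (%om. Wou tt s t om / ?v)) u = char std_normal_distribution u" .
  qed
 qed (rule real_dist_normal_dist)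
qed

end

section \<open>The compound Poisson part\<close>

definition pois :: "real => nat => real" where
 "pois \<mu> k = \<mu> ^ k / fact k * exp (- \<mu>)"

lemma pois_nonneg: "\<mu> >= 0 ==> pois \<mu> k >= 0"
 by (simp add: pois_def)

lemma pois_sums: "pois \<mu> sums 1"
proof -
 have "(%k. \<mu> ^ k / fact k) sums exp \<mu>"
  using exp_converges[of \<mu>] by (simp add: divide_inverse mult.commute)
 from sums_mult2[OF this, of "exp (- \<mu>)"] show ?thesis
  by (simp add: pois_def[abs_def] exp_minus)
qed

lemma pois_Suc: "real (Suc k) * pois \<mu> (Suc k) = \<mu> * pois \<mu> k"
 unfolding pois_def fact_Suc by (simp del: of_nat_Suc)

lemma pois_sums1: "(%k. real k * pois \<mu> k) sums \<mu>"
proof -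
 have "(%k. real (Suc k) * pois \<mu> (Suc k)) sums (\<mu> * 1)"
  unfolding pois_Suc by (rule sums_mult[OF pois_sums])
 then show ?thesis by (subst (asm) sums_Suc_iff) simp
qed

lemma pois_sums2: "(%k. (real k)\<^sup>2 * pois \<mu> k) sums (\<mu> + \<mu>^2)"
proof -
 have eq: "(real (Suc k))^2 * pois \<mu> (Suc k) = \<mu> * (real k * pois \<mu> k + pois \<mu> k)" for k
 proof -
  have "(real (Suc k))^2 * pois \<mu> (Suc k) = real (Suc k) * (\<mu> * pois \<mu> k)"
  unfolding power2_eq_square mult.assoc pois_Suc ..
  then show ?thesis by (simp add: algebra_simps)
 qed
 have "(%k. (real (Suc k))\<^sup>2 * pois \<mu> (Suc k)) sums (\<mu> * (\<mu> + 1))"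
  unfolding eq by (intro sums_mult sums_add pois_sums pois_sums1)
 then show ?thesis by (subst (asm) sums_Suc_iff) (simp add: power2_eq_square algebra_simps)
qed

context jump_ou
begin

abbreviation "PZ \<equiv> Pi\<^sub>M UNIV (%_::nat. borel :: real measure)"

text \<open>The shift makes the jumps between \<open>s\<close> and \<open>t\<close> the block
  \<open>{cnt s..<cnt t}\<close> of the sequence, whose length is the increment of the
  count.\<close>

definition Zs :: "'a => nat => real" where "Zs om k = Z (Suc k) om"

definition SZ :: "ingredient set" where "SZ = range (%k. IZ (Suc k))"

lemma Zs_Sig: "Zs \<in> measurable (Sig SZ) PZ"
 unfolding Zs_def[abs_def]
 by (intro measurable_PiM_single') (auto simp: SZ_def intro: Sig_Z)

lemma Zs_M[measurable]: "Zs \<in> measurable M PZ"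
 by (rule Sig_M[OF _ Zs_Sig]) (auto simp: SZ_def)

lemma Zs_indep_alg: "indep_alg M (Sig {IN}) PZ Zs"
 by (rule Sig_indep_alg[OF _ _ _ Zs_Sig]) (auto simp: SZ_def)

lemma Zs_indep: "indep_vars (%_. borel) (%k om. Zs om k) UNIV"
proof -
 have "indep_vars (%k. Pi\<^sub>M {IZ (Suc k)} (%_. Pi\<^sub>M UNIV (%_. borel)))
  (%k om. restrict (%i. ingredients X0 W N Z i om) {IZ (Suc k)}) UNIV"
  by (rule indep_vars_restrict[OF indep]) (auto simp: disjoint_family_on_def)
 then have "indep_vars (%_. borel) (%k om. restrict (%i. ingredients X0 W N Z i om) {IZ (Suc k)} (IZ (Suc k)) 0) UNIV"
  by (rule indep_vars_compose2[where Y="%k x. x (IZ (Suc k)) 0"])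
  (rule measurable_compose[where N="Pi\<^sub>M UNIV (%_. borel)"], rule measurable_component_singleton, simp,
  rule measurable_component_singleton, simp)
 then show ?thesis by (simp add: Zs_def ingredients_def)
qed

lemma Zs_distr: "distr M borel (%om. Zs om k) = F"
 unfolding Zs_def by (rule Z) simp

lemma Zs_borel[measurable]: "(%om. Zs om k) : bmeas M"
 unfolding Zs_def by simp

text \<open>Heights and counts are independent, so the counts may be frozen at \<open>om\<close>
  while the heights are averaged over a second sample point \<open>om'\<close>.\<close>

lemma freeze:
 assumes f[measurable]: "f : bmeas (Sig {IN} \<Otimes>\<^sub>M PZ)"
 shows "(\<integral>\<^sup>+om. f (om, Zs om) \<partial>M) = (\<integral>\<^sup>+om. (\<integral>\<^sup>+om'. f (om, Zs om') \<partial>M) \<partial>M)"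
proof -
 have "(\<integral>\<^sup>+om. f (om, Zs om) \<partial>M) = (\<integral>\<^sup>+om. (\<integral>\<^sup>+y. f (om, y) \<partial>distr M PZ Zs) \<partial>M)"
  by (rule freezing_nn[OF Zs_indep_alg f])
 also have "... = (\<integral>\<^sup>+om. (\<integral>\<^sup>+om'. f (om, Zs om') \<partial>M) \<partial>M)"
 proof (rule nn_integral_cong)
  fix om assume "om : space M"
  then have "om \<in> space (Sig {IN})" by simp
  then have [measurable]: "(%y. f (om, y)) : bmeas PZ" by measurable
  show "(\<integral>\<^sup>+y. f (om, y) \<partial>distr M PZ Zs) = (\<integral>\<^sup>+om'. f (om, Zs om') \<partial>M)"
  by (rule nn_integral_distr) auto
 qed
 finally show ?thesis .
qed

lemma blk_measurable:
 fixes g :: "nat => nat => (nat => real) => 'c::topological_space"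
 assumes "\<And>a b. g a b : bmeas PZ"
 shows "(%(om, z). g (cnt s om) (cnt t om) z) : bmeas (Sig {IN} \<Otimes>\<^sub>M PZ)"
proof -
 have c: "(%p. cnt u (fst p)) \<in> measurable (Sig {IN} \<Otimes>\<^sub>M PZ) (count_space UNIV)" for u
  by (rule measurable_compose[OF measurable_fst cnt_measurable]) simp
 have "(%p. (%a p. (%b p. g a b (snd p)) (cnt t (fst p)) p) (cnt s (fst p)) p) : bmeas (Sig {IN} \<Otimes>\<^sub>M PZ)"
  by (rule measurable_compose_countable[OF measurable_compose_countable[OF _ c] c])
  (rule measurable_compose[OF measurable_snd assms])
 then show ?thesis by (simp add: case_prod_beta')
qed

lemma freeze_blk:
 assumes g: "\<And>a b. g a b : bmeas PZ"
 shows "(\<integral>\<^sup>+om. g (cnt s om) (cnt t om) (Zs om) \<partial>M) = (\<integral>\<^sup>+om. (\<integral>\<^sup>+om'. g (cnt s om) (cnt t om) (Zs om') \<partial>M) \<partial>M)"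
 using freeze[OF blk_measurable[OF g]] by simp

lemma sum_PiM_measurable:
 "finite S ==> S \<subseteq> I ==> (%z. sum z S) : bmeas (PiM I (%_::nat. borel :: real measure))"
 by (induction S rule: finite_induct) auto

definition D :: "nat => real set => real" where
 "D m B = prob {om\<in>space M. (\<Sum>k<m. Zs om k) \<in> B}"

text \<open>By independence and equality of laws the characteristic function of a block sum is a
  power of that of \<open>F\<close>, so only the length of the block matters.\<close>

lemma blk_law:
 assumes "B \<in> sets borel" "a <= b"
 shows "prob {om\<in>space M. (\<Sum>k\<in>{a..<b}. Zs om k) \<in> B} = D (b - a) B"
proof -
 have ch: "char (distr M borel (%om. \<Sum>k\<in>A. Zs om k)) u = char F u ^ card A" if "finite A" for A u
  by (subst char_distr_sum[OF indep_vars_subset[OF Zs_indep]]) (auto simp: Zs_distr)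
 have "distr M borel (%om. \<Sum>k\<in>{a..<b}. Zs om k) = distr M borel (%om. \<Sum>k<b - a. Zs om k)"
  by (rule Levy_uniqueness) (auto simp: ch fun_eq_iff intro!: real_distribution_distr)
 then have "measure (distr M borel (%om. \<Sum>k\<in>{a..<b}. Zs om k)) B = measure (distr M borel (%om. \<Sum>k<b - a. Zs om k)) B" by simp
 then show ?thesis using assms(1)
  by (simp add: measure_distr D_def vimage_def Int_def conj_commute)
qed

lemma cnt_mono: "om : space M ==> 0 <= s ==> s <= t ==> cnt s om <= cnt t om"
 unfolding cnt_def by (rule counting_path.count_mono[OF N_path])

lemma N_cnt: "om : space M ==> 0 <= s ==> N s om = real (cnt s om)"
 unfolding cnt_def by (rule counting_path.N_count[OF N_path])

lemma J_diff: "om : space M ==> 0 <= s ==> s <= t ==> J t om - J s om = (\<Sum>k\<in>{cnt s om..<cnt t om}. Zs om k)"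
 using cnt_mono[of om s t] unfolding J_alt Zs_def lessThan_atLeast0
 by (subst sum.atLeastLessThan_concat[of 0 "cnt s om" "cnt t om", symmetric]) auto

lemma Avar_alt: "Avar s t om = (\<Sum>k\<in>{cnt s om..<cnt t om}. \<bar>Zs om k\<bar>)"
 unfolding Avar_def Zs_def
 by (rule sum.reindex_bij_witness[of _ Suc "%k. k - 1"]) auto

lemma cnt_prob:
 assumes "0 <= s" "s <= t"
 shows "prob {om\<in>space M. cnt t om - cnt s om = k} = pois (lam * (t - s)) k"
proof -
 have "{om\<in>space M. cnt t om - cnt s om = k} = {om\<in>space M. N t om - N s om = real k}"
  using N_cnt cnt_mono[OF _ assms] assms by (auto simp flip: of_nat_diff)
 then show ?thesis using N assms unfolding poisson_process_def pois_def by auto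
qed

lemma cnt_nn:
 fixes h :: "nat => ennreal"
 assumes "0 <= s" "s <= t"
 shows "(\<integral>\<^sup>+om. h (cnt t om - cnt s om) \<partial>M) = (\<Sum>k. h k * ennreal (pois (lam * (t - s)) k))"
proof -
 have [measurable]: "{om\<in>space M. cnt t om - cnt s om = k} \<in> events" for k by measurable
 have "(\<integral>\<^sup>+om. h (cnt t om - cnt s om) \<partial>M) = (\<integral>\<^sup>+om. (\<Sum>k. h k * indicator {om\<in>space M. cnt t om - cnt s om = k} om) \<partial>M)"
 proof (rule nn_integral_cong)
  fix om assume w: "om : space M"
  let ?n = "cnt t om - cnt s om"
  have "(\<Sum>k. h k * indicator {om\<in>space M. cnt t om - cnt s om = k} om) = (\<Sum>k\<in>{?n}. h k * indicator {om\<in>space M. cnt t om - cnt s om = k} om)"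
  by (rule suminf_finite) auto
  then show "h ?n = (\<Sum>k. h k * indicator {om\<in>space M. cnt t om - cnt s om = k} om)" using w by simp
 qed
 also have "... = (\<Sum>k. \<integral>\<^sup>+om. h k * indicator {om\<in>space M. cnt t om - cnt s om = k} om \<partial>M)"
  by (rule nn_integral_suminf) measurable
 also have "... = (\<Sum>k. h k * ennreal (pois (lam * (t - s)) k))"
  by (simp add: nn_integral_cmult emeasure_eq_measure cnt_prob[OF assms])
 finally show ?thesis .
qed

text \<open>Given the counts, the increments are sums over disjoint blocks of heights, independent
  and with laws depending on the block lengths only; the lengths are increments of \<open>N\<close>
  and independent in turn. Freezing the counts lets the two independences act one after the other.
  \<open>Suc K\<close> keeps the index set of the intersection nonempty.\<close>

lemma J_joint:
 fixes ta :: "nat => real"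
 assumes ta: "0 <= ta 0" "\<And>i. ta i <= ta (Suc i)" and B: "\<And>q. B q \<in> sets borel"
 shows "prob (\<Inter>q\<in>{..<Suc K}. (%om. J (ta (Suc q)) om - J (ta q) om) -` B q \<inter> space M)
  = (\<Prod>q<Suc K. enn2real (\<integral>\<^sup>+om. ennreal (D (cnt (ta (Suc q)) om - cnt (ta q) om) (B q)) \<partial>M))"
proof -
 have mono: "ta i <= ta j" if "i <= j" for i j using ta(2) that by (rule lift_Suc_mono_le)
 have t0: "0 <= ta i" for i using mono[of 0 i] ta(1) by simp
 define f :: "'a \<times> (nat => real) => ennreal" where
  "f = (%p. \<Prod>q<Suc K. (%(om, z). indicator (B q) (\<Sum>k\<in>{cnt (ta q) om..<cnt (ta (Suc q)) om}. z k)) p)"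
 have fm: "f : bmeas (Sig {IN} \<Otimes>\<^sub>M PZ)"
  unfolding f_def
 proof (intro borel_measurable_prod_ennreal blk_measurable)
  fix q a b
  have [measurable]: "(%z. \<Sum>k = a..<b. z k) : bmeas PZ"
  by (rule sum_PiM_measurable) auto
  show "(%z. indicator (B q) (\<Sum>k = a..<b. z k) :: ennreal) : bmeas PZ"
  using B by measurable
 qed
 have inner: "(\<integral>\<^sup>+om'. f (om, Zs om') \<partial>M) = (\<Prod>q<Suc K. ennreal (D (cnt (ta (Suc q)) om - cnt (ta q) om) (B q)))" if w: "om : space M" for om
 proof -
  let ?K = "%q. {cnt (ta q) om..<cnt (ta (Suc q)) om}"
  have cm: "cnt (ta i) om <= cnt (ta j) om" if "i <= j" for i j
  using cnt_mono[OF w t0 mono[OF that]] .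
  have "indep_vars (%q. PiM (?K q) (%_. borel)) (%q om'. restrict (%k. Zs om' k) (?K q)) {..<Suc K}"
  proof (rule indep_vars_restrict[OF Zs_indep])
  show "disjoint_family_on ?K {..<Suc K}"
  unfolding disjoint_family_on_def
  proof (intro ballI impI)
  fix q q' :: nat assume "q ~= q'"
  then consider "Suc q <= q'" | "Suc q' <= q" by linarith
  then show "?K q \<inter> ?K q' = {}" using cm[of "Suc q" q'] cm[of "Suc q'" q] by cases auto
  qed
  qed auto
  then have "indep_vars (%_. borel) (%q om'. indicator (B q) (\<Sum>k\<in>?K q. restrict (%k. Zs om' k) (?K q) k) :: ennreal) {..<Suc K}"
  proof (rule indep_vars_compose2[where Y="%q x. indicator (B q) (\<Sum>k\<in>?K q. x k)"])
  fix q
  have [measurable]: "(%z. \<Sum>k\<in>?K q. z k :: real) : bmeas (PiM (?K q) (%_. borel))"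
  by (rule sum_PiM_measurable) auto
  show "(%z. indicator (B q) (\<Sum>k\<in>?K q. z k) :: ennreal) : bmeas (PiM (?K q) (%_. borel))"
  using B by measurable
  qed
  then have iv: "indep_vars (%_. borel) (%q om'. indicator (B q) (\<Sum>k\<in>?K q. Zs om' k) :: ennreal) {..<Suc K}" by simp
  have "(\<integral>\<^sup>+om'. f (om, Zs om') \<partial>M) = (\<Prod>q<Suc K. \<integral>\<^sup>+om'. indicator (B q) (\<Sum>k\<in>?K q. Zs om' k) \<partial>M)"
  unfolding f_def by (simp del: prod.lessThan_Suc) (rule indep_vars_nn_integral[OF _ iv], auto)
  also have "... = (\<Prod>q<Suc K. ennreal (D (cnt (ta (Suc q)) om - cnt (ta q) om) (B q)))"
  proof (intro prod.cong refl)
  fix q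
  have S: "{om'\<in>space M. (\<Sum>k\<in>?K q. Zs om' k) \<in> B q} \<in> events" using B by measurable
  have "(\<integral>\<^sup>+om'. indicator (B q) (\<Sum>k\<in>?K q. Zs om' k) \<partial>M) = (\<integral>\<^sup>+om'. indicator {om'\<in>space M. (\<Sum>k\<in>?K q. Zs om' k) \<in> B q} om' \<partial>M)"
  by (rule nn_integral_cong) (auto simp: indicator_def)
  also have "... = ennreal (prob {om'\<in>space M. (\<Sum>k\<in>?K q. Zs om' k) \<in> B q})"
  using S by (simp add: emeasure_eq_measure)
  also have "... = ennreal (D (cnt (ta (Suc q)) om - cnt (ta q) om) (B q))"
  using blk_law[OF B cm[of q "Suc q"]] by simp
  finally show "(\<integral>\<^sup>+om'. indicator (B q) (\<Sum>k\<in>?K q. Zs om' k) \<partial>M) = ..." .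
  qed
  finally show ?thesis .
 qed
 \<comment> \<open>Independence is given for the real increments of \<open>N\<close>, so the block
   lengths are first expressed through them.\<close>
 have ND: "indep_vars (%_. borel) (%q om. ennreal (D (nat \<lfloor>N (ta (Suc q)) om - N (ta q) om\<rfloor>) (B q))) {..<Suc K}"
  by (rule indep_vars_compose2[OF N_inc[OF ta], where Y="%q x. ennreal (D (nat \<lfloor>x\<rfloor>) (B q))"]) measurable
 have NDeq: "nat \<lfloor>N (ta (Suc q)) om - N (ta q) om\<rfloor> = cnt (ta (Suc q)) om - cnt (ta q) om" if "om : space M" for q om
  using N_cnt[OF that] t0 cnt_mono[OF that t0 ta(2)] by (simp flip: of_nat_diff)
 let ?A = "\<Inter>q\<in>{..<Suc K}. (%om. J (ta (Suc q)) om - J (ta q) om) -` B q \<inter> space M"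
 have Aev: "?A \<in> events" using B by (intro sets.finite_INT) auto
 have "ennreal (prob ?A) = (\<integral>\<^sup>+om. indicator ?A om \<partial>M)" using Aev by (simp add: emeasure_eq_measure)
 also have "... = (\<integral>\<^sup>+om. f (om, Zs om) \<partial>M)"
 proof (rule nn_integral_cong)
  fix om assume w: "om : space M"
  have e: "(\<Sum>k\<in>{cnt (ta q) om..<cnt (ta (Suc q)) om}. Zs om k) = J (ta (Suc q)) om - J (ta q) om" for q
  using J_diff[OF w t0 ta(2)] by simp
  show "indicator ?A om = f (om, Zs om)"
  proof (cases "om \<in> ?A")
  case True
  then have "J (ta (Suc q)) om - J (ta q) om \<in> B q" if "q < Suc K" for q
  using INT_D[OF True, of q] that by simp
  then have "f (om, Zs om) = 1" unfolding f_def by (intro prod.neutral) (simp add: e)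
  with True show ?thesis by simp
  next
  case False
  then obtain q where "q < Suc K" "J (ta (Suc q)) om - J (ta q) om \<notin> B q"
  using w by (simp only: INT_iff) auto
  then have "f (om, Zs om) = 0" unfolding f_def by (intro prod_zero) (auto simp: e intro!: bexI[of _ q])
  then show ?thesis using False by simp
  qed
 qed
 also have "... = (\<integral>\<^sup>+om. (\<integral>\<^sup>+om'. f (om, Zs om') \<partial>M) \<partial>M)" by (rule freeze[OF fm])
 also have "... = (\<integral>\<^sup>+om. (\<Prod>q<Suc K. ennreal (D (nat \<lfloor>N (ta (Suc q)) om - N (ta q) om\<rfloor>) (B q))) \<partial>M)"
  by (rule nn_integral_cong) (simp only: inner NDeq)
 also have "... = (\<Prod>q<Suc K. \<integral>\<^sup>+om. ennreal (D (nat \<lfloor>N (ta (Suc q)) om - N (ta q) om\<rfloor>) (B q)) \<partial>M)"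
  by (rule indep_vars_nn_integral[OF _ ND]) auto
 also have "... = (\<Prod>q<Suc K. \<integral>\<^sup>+om. ennreal (D (cnt (ta (Suc q)) om - cnt (ta q) om) (B q)) \<partial>M)"
  by (intro prod.cong refl nn_integral_cong) (simp only: NDeq)
 finally have E: "ennreal (prob ?A) = (\<Prod>q<Suc K. \<integral>\<^sup>+om. ennreal (D (cnt (ta (Suc q)) om - cnt (ta q) om) (B q)) \<partial>M)" .
 have "prob ?A = enn2real (ennreal (prob ?A))" by simp
 also have "... = (\<Prod>q<Suc K. enn2real (\<integral>\<^sup>+om. ennreal (D (cnt (ta (Suc q)) om - cnt (ta q) om) (B q)) \<partial>M))"
  unfolding E by (induction K) (auto simp: enn2real_mult)
 finally show ?thesis .
qed

lemma J_law:
 assumes st: "0 <= s" "s <= t" and B: "B \<in> sets borel"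
 shows "prob ((%om. J t om - J s om) -` B \<inter> space M) = enn2real (\<Sum>k. ennreal (D k B) * ennreal (pois (lam * (t - s)) k))"
proof -
 \<comment> \<open>The grid \<open>s, t, t, ...\<close> specialises the joint formula to one
   increment.\<close>
 have "(if i = 0 then s else t) <= (if Suc i = 0 then s else t)" for i using st by simp
 from J_joint[of "%i. if i = 0 then s else t", OF _ this, of "%_. B" 0] st B cnt_nn[OF st, of "%k. ennreal (D k B)"]
 show ?thesis by (simp add: lessThan_Suc)
qed

lemma J_inc:
 assumes ta: "0 <= ta 0" "\<And>i. ta i <= ta (Suc i)"
 shows "indep_vars (%_. borel) (%i om. J (ta (Suc i)) om - J (ta i) om) {..<k::nat}"
proof (cases k)
 case 0
 then show ?thesis by (simp add: indep_vars_def2 indep_sets_def)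
next
 case (Suc K)
 have t0: "0 <= ta i" for i using lift_Suc_mono_le[of ta 0 i] ta by simp
 have single: "prob ((%om. J (ta (Suc q)) om - J (ta q) om) -` B \<inter> space M) = enn2real (\<integral>\<^sup>+om. ennreal (D (cnt (ta (Suc q)) om - cnt (ta q) om) B) \<partial>M)" if "B \<in> sets borel" for q B
  using J_law[OF t0 ta(2) that] cnt_nn[OF t0 ta(2), of "%k. ennreal (D k B)"] by simp
 show ?thesis unfolding Suc
 proof (subst indep_vars_finite[where E="%_. sets borel"])
  show "\<forall>A\<in>Pi {..<Suc K} (%_. sets borel). prob (\<Inter>j\<in>{..<Suc K}. (%om. J (ta (Suc j)) om - J (ta j) om) -` A j \<inter> space M) =
  (\<Prod>j\<in>{..<Suc K}. prob ((%om. J (ta (Suc j)) om - J (ta j) om) -` A j \<inter> space M))"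
  proof
  fix A assume A: "A \<in> Pi {..<Suc K} (%_. sets (borel :: real measure))"
  \<comment> \<open>Empty sets beyond \<open>K\<close> make the family measurable at every index, as
    the joint formula demands.\<close>
  let ?A = "%q. if q < Suc K then A q else {}"
  have "?A q \<in> sets borel" for q using A by (auto dest: Pi_mem)
  note * = J_joint[OF ta, where K=K and B="?A", OF this]
  have 1: "(\<Inter>j\<in>{..<Suc K}. (%om. J (ta (Suc j)) om - J (ta j) om) -` A j \<inter> space M) =
  (\<Inter>j\<in>{..<Suc K}. (%om. J (ta (Suc j)) om - J (ta j) om) -` ?A j \<inter> space M)"
  by (intro INF_cong refl) auto
  have 2: "(\<Prod>j\<in>{..<Suc K}. prob ((%om. J (ta (Suc j)) om - J (ta j) om) -` A j \<inter> space M)) =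
  (\<Prod>q<Suc K. enn2real (\<integral>\<^sup>+om. ennreal (D (cnt (ta (Suc q)) om - cnt (ta q) om) (?A q)) \<partial>M))"
  proof (intro prod.cong refl)
  fix q assume q: "q \<in> {..<Suc K}"
  then show "prob ((%om. J (ta (Suc q)) om - J (ta q) om) -` A q \<inter> space M) =
  enn2real (\<integral>\<^sup>+om. ennreal (D (cnt (ta (Suc q)) om - cnt (ta q) om) (?A q)) \<partial>M)"
  using single[OF Pi_mem[OF A q], of q] by simp
  qed
  show "prob (\<Inter>j\<in>{..<Suc K}. (%om. J (ta (Suc j)) om - J (ta j) om) -` A j \<inter> space M) =
  (\<Prod>j\<in>{..<Suc K}. prob ((%om. J (ta (Suc j)) om - J (ta j) om) -` A j \<inter> space M))"
  unfolding 1 2 by (rule *)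
  qed
 qed (auto simp: Int_stable_def sets.sigma_sets_eq[of "borel :: real measure", simplified])
qed

lemma J_incr_distr:
 assumes "0 <= s" "s <= t" "0 <= s'" "t' - s' = t - s"
 shows "distr M borel (%om. J t om - J s om) = distr M borel (%om. J t' om - J s' om)"
proof (rule measure_eqI)
 fix B assume "B \<in> sets (distr M borel (%om. J t om - J s om))"
 then have B: "B \<in> sets borel" by simp
 then show "emeasure (distr M borel (%om. J t om - J s om)) B = emeasure (distr M borel (%om. J t' om - J s' om)) B"
  using J_law[OF assms(1,2) B] J_law[of s' t' B] assms by (simp add: emeasure_distr emeasure_eq_measure)
qed simp

text \<open>On shifted grids the Riemann sums have equal characteristic functions factor by factor:
  increments are stationary, and the kernel depends only on the distance to the right end
  point.\<close>

lemma Jou_distr: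
 assumes "0 <= s" "s < t"
 shows "distr M borel (Jou tt s t) = distr M borel (Jou tt 0 (t - s))"
proof (rule Levy_uniqueness)
 have lim: "(%m. char (distr M borel (%om. rs_sum tt (%u. J u om) s t (Suc m))) u) ---> char (distr M borel (Jou tt s t)) u"
  if "0 <= s" "s < t" for s t u
  unfolding Jou_def[abs_def] by (intro char_tendsto rs_sum_measurable rs_sum_tendsto(2) that J_reg measurable_M)
 show "char (distr M borel (Jou tt s t)) = char (distr M borel (Jou tt 0 (t - s)))"
 proof
  fix u
  have eq: "char (distr M borel (%om. rs_sum tt (%u. J u om) s t m)) u = char (distr M borel (%om. rs_sum tt (%u. J u om) 0 (t - s) m)) u" for m
  proof -
  have "distr M borel (%om. J (grid_pt s t m (Suc k)) om - J (grid_pt s t m k) om) =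
  distr M borel (%om. J (grid_pt 0 (t - s) m (Suc k)) om - J (grid_pt 0 (t - s) m k) om)" for k
  using assms by (intro J_incr_distr grid_pt_mono) (auto simp: grid_pt_def)
  moreover have "t - s - grid_pt 0 (t - s) m k = t - grid_pt s t m k" for k by (simp add: grid_pt_def)
  moreover have "char (distr M borel (%om. rs_sum tt (%u. J u om) s t m)) u =
  (\<Prod>k<m. char (distr M borel (%om. J (grid_pt s t m (Suc k)) om - J (grid_pt s t m k) om)) (exp (- tt * (t - grid_pt s t m k)) * u))"
  by (rule char_rs_sum[OF J_inc]) (use assms in auto)
  moreover have "char (distr M borel (%om. rs_sum tt (%u. J u om) 0 (t - s) m)) u =
  (\<Prod>k<m. char (distr M borel (%om. J (grid_pt 0 (t - s) m (Suc k)) om - J (grid_pt 0 (t - s) m k) om)) (exp (- tt * (t - s - grid_pt 0 (t - s) m k)) * u))"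
  by (rule char_rs_sum[OF J_inc]) (use assms in auto)
  ultimately show ?thesis by (simp only:)
  qed
  show "char (distr M borel (Jou tt s t)) u = char (distr M borel (Jou tt 0 (t - s))) u"
  using lim[OF assms, of u] lim[of 0 "t - s" u] assms unfolding eq by (auto intro: LIMSEQ_unique)
 qed
qed (use assms in \<open>auto intro!: real_distribution_distr Jou_M\<close>)

end

lemma integrable_boundI:
 fixes f :: "'a => real"
 assumes "f : bmeas M" "\<And>x. x : space M ==> 0 <= f x" "(\<integral>\<^sup>+x. ennreal (f x) \<partial>M) <= ennreal c" "c >= 0"
 shows "integrable M f" "(LINT x|M. f x) <= c"
proof -
 have fin: "(\<integral>\<^sup>+x. ennreal (f x) \<partial>M) < \<infinity>" using assms(3) by (rule order_le_less_trans) simp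
 show i: "integrable M f" by (rule integrableI_nonneg) (use assms fin in auto)
 have "ennreal (LINT x|M. f x) <= ennreal c"
  using nn_integral_eq_integral[OF i] assms by simp
 then show "(LINT x|M. f x) <= c" using assms(4) by (simp add: ennreal_le_iff)
qed

context jump_ou
begin

text \<open>Extended nonnegative, since finiteness has yet to be proved. What will be finite is
  \<open>ennreal lam * m2\<close>: for \<open>lam = 0\<close> the process has no jumps and says
  nothing about \<open>F\<close>.\<close>

definition m2 :: ennreal where "m2 = (\<integral>\<^sup>+z. ennreal (z^2) \<partial>F)"
definition tail2 :: "real => ennreal" where "tail2 K = (\<integral>\<^sup>+z. ennreal (if \<bar>z\<bar> > K then z\<^sup>2 else 0) \<partial>F)"

lemma Zs_nn:
 assumes "f : bmeas borel"
 shows "(\<integral>\<^sup>+om. f (Zs om k) \<partial>M) = (\<integral>\<^sup>+z. f z \<partial>F)"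
 using assms by (subst Zs_distr[of k, symmetric], subst nn_integral_distr) auto

lemma J_path_bound:
 assumes "om : space M" "0 <= s" "u \<in> {s..t}"
 shows "\<bar>J u om - J s om\<bar> <= Avar s t om"
 using counting_path.jump_increment_le[OF N_path[OF assms(1)], of s u t "%k. Z k om"] assms
 by (simp add: J_def Avar_def cnt_def)

lemma Jou_diff_le:
 assumes "om : space M" "0 <= s" "s < t" "tt >= 0" "tt' >= 0"
 shows "\<bar>Jou tt s t om - Jou tt' s t om\<bar> <= \<bar>tt - tt'\<bar> * (t - s) * Avar s t om"
 unfolding Jou_def by (rule ou_int_bounds(1)[OF assms(2,3) J_reg J_path_bound]) (use assms in auto)

lemma Avar_nonneg: "Avar s t om >= 0"
 unfolding Avar_def by (rule sum_nonneg) auto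

lemma Jou_le:
 assumes "om : space M" "0 <= s" "s < t" "tt >= 0"
 shows "\<bar>Jou tt s t om\<bar> <= (1 + tt * (t - s)) * Avar s t om"
proof -
 have "\<bar>Jou tt s t om - (J t om - J s om)\<bar> <= tt * (t - s) * Avar s t om"
  unfolding Jou_def by (rule ou_int_bounds(2)[OF assms(2,3) J_reg J_path_bound]) (use assms in auto)
 moreover have "\<bar>J t om - J s om\<bar> <= Avar s t om" using J_path_bound[OF assms(1,2), of t t] assms by auto
 ultimately show ?thesis unfolding distrib_right mult_1 by linarith
qed

lemma Jou_no_jump:
 assumes "om : space M" "0 <= s" "s < t" "cnt t om = cnt s om"
 shows "Jou tt s t om = 0"
 using counting_path.ou_int_no_jump[OF N_path[OF assms(1)] assms(2,3), where S="%n. \<Sum>k\<in>{1..n}. Z k om" and tt=tt] assms(4)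
 unfolding Jou_def J_def cnt_def by simp

lemma Jou_one_jump:
 assumes "om : space M" "0 <= s" "s < t" "cnt t om = Suc (cnt s om)" "tt > 0"
 shows "\<exists>c\<in>{exp (- tt * (t - s))..1}. Jou tt s t om = c * Zs om (cnt s om)"
proof -
 obtain c where "c \<in> {exp (- tt * (t - s))..1}" "Jou tt s t om = c * Z (cnt t om) om"
  using counting_path.ou_int_one_jump[OF N_path[OF assms(1)] assms(2,3), of tt "%k. Z k om"] assms(4,5)
  unfolding Jou_def J_def cnt_def by blast
 then show ?thesis unfolding Zs_def assms(4) by blast
qed

lemma Avar_measurable[measurable]: "Avar s t : bmeas M"
proof -
 have 1: "(%om. \<Sum>k\<in>{a<..cnt t om}. \<bar>Z k om\<bar>) : bmeas M" for a
  by (rule measurable_compose_countable[where f="%b om. \<Sum>k\<in>{a<..b}. \<bar>Z k om\<bar>" and g="cnt t"]) auto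
 show ?thesis unfolding Avar_def[abs_def]
  by (rule measurable_compose_countable[where f="%a om. \<Sum>k\<in>{a<..cnt t om}. \<bar>Z k om\<bar>" and g="cnt s", OF 1]) simp
qed

lemma blk_sq_le: "(\<integral>\<^sup>+om. ennreal ((\<Sum>k\<in>{a..<b}. \<bar>Zs om k\<bar>)^2) \<partial>M) <= ennreal ((real (b - a))^2) * m2"
proof -
 have "(\<integral>\<^sup>+om. ennreal ((\<Sum>k\<in>{a..<b}. \<bar>Zs om k\<bar>)^2) \<partial>M) <= (\<integral>\<^sup>+om. ennreal (real (b - a)) * (\<Sum>k\<in>{a..<b}. ennreal ((Zs om k)^2)) \<partial>M)"
 proof (rule nn_integral_mono)
  fix om
  have "(\<Sum>k\<in>{a..<b}. \<bar>Zs om k\<bar>)^2 <= real (b - a) * (\<Sum>k\<in>{a..<b}. (Zs om k)\<^sup>2)"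
  using Cauchy_Schwarz_ineq_sum[of "%_. 1" "%k. \<bar>Zs om k\<bar>" "{a..<b}"] by simp
  then have "ennreal ((\<Sum>k\<in>{a..<b}. \<bar>Zs om k\<bar>)^2) <= ennreal (real (b - a) * (\<Sum>k\<in>{a..<b}. (Zs om k)\<^sup>2))"
  by (rule ennreal_leI)
  then show "ennreal ((\<Sum>k\<in>{a..<b}. \<bar>Zs om k\<bar>)^2) <= ennreal (real (b - a)) * (\<Sum>k\<in>{a..<b}. ennreal ((Zs om k)^2))"
  by (simp add: ennreal_mult sum_nonneg sum_ennreal)
 qed
 also have "... = ennreal (real (b - a)) * (\<Sum>k\<in>{a..<b}. \<integral>\<^sup>+om. ennreal ((Zs om k)^2) \<partial>M)"
 proof -
  have m: "(%om. ennreal ((Zs om k)^2)) : bmeas M" for k by simp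
  have ms: "(%om. \<Sum>k\<in>{a..<b}. ennreal ((Zs om k)^2)) : bmeas M"
  by (rule borel_measurable_sum[OF m])
  show ?thesis unfolding nn_integral_cmult[OF ms] nn_integral_sum[OF m] ..
 qed
 also have "... = ennreal (real (b - a)) * (ennreal (real (b - a)) * m2)"
  using Zs_nn[of "%z. ennreal (z^2)"] by (simp add: m2_def ennreal_of_nat_eq_real_of_nat)
 also have "... = ennreal ((real (b - a))^2) * m2"
  by (simp add: power2_eq_square ennreal_mult mult.assoc)
 finally show ?thesis .
qed

lemma blk_abs_measurable: "(%z. \<Sum>k\<in>{a..<b}. \<bar>z k\<bar> :: real) : bmeas PZ"
 by (intro borel_measurable_sum borel_measurable_abs measurable_component_singleton) auto

text \<open>Averaging the heights first leaves the second moment \<open>\<mu> + \<mu>^2\<close> of a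
  Poisson variable, linear in the length for short intervals.\<close>

lemma Avar_sq_nn:
 assumes st: "0 <= s" "s <= t"
 shows "(\<integral>\<^sup>+om. ennreal ((Avar s t om)^2) \<partial>M) <= ennreal (lam * (t - s) + (lam * (t - s))^2) * m2"
proof -
 note [measurable] = blk_abs_measurable
 have "(\<integral>\<^sup>+om. ennreal ((Avar s t om)^2) \<partial>M) = (\<integral>\<^sup>+om. (\<integral>\<^sup>+om'. ennreal ((\<Sum>k\<in>{cnt s om..<cnt t om}. \<bar>Zs om' k\<bar>)^2) \<partial>M) \<partial>M)"
  unfolding Avar_alt by (rule freeze_blk[of "%a b z. ennreal ((\<Sum>k\<in>{a..<b}. \<bar>z k\<bar>)^2)"]) measurable
 also have "... <= (\<integral>\<^sup>+om. ennreal ((real (cnt t om - cnt s om))^2) * m2 \<partial>M)"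
  by (intro nn_integral_mono blk_sq_le)
 also have "... = (\<Sum>k. ennreal ((real k)^2 * pois (lam * (t - s)) k) * m2)"
  using lam st pois_nonneg[of "lam * (t - s)"]
  by (subst cnt_nn[OF st, of "%k. ennreal ((real k)^2) * m2"]) (simp add: ennreal_mult ac_simps)
 also have "... = ennreal (lam * (t - s) + (lam * (t - s))^2) * m2"
 proof -
  have "(\<Sum>k. ennreal ((real k)^2 * pois (lam * (t - s)) k)) = ennreal (lam * (t - s) + (lam * (t - s))^2)"
  by (rule suminf_ennreal_eq[OF _ pois_sums2]) (use lam st pois_nonneg in auto)
  then show ?thesis by (simp only: ennreal_suminf_multc)
 qed
 finally show ?thesis .
qed

lemma pois_one_le: "\<mu> >= 0 ==> pois \<mu> 1 <= \<mu>"
 by (simp add: pois_def mult_left_le)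

lemma pois_one_ge: "\<mu> >= 0 ==> pois \<mu> 1 >= \<mu> - \<mu>\<^sup>2"
 using mult_left_mono[OF exp_ge_add_one_self[of "- \<mu>"], of \<mu>] by (simp add: pois_def power2_eq_square algebra_simps)

text \<open>One jump contributes the tail of its height with probability at most \<mu>. Two or more
  jumps are so rare that their whole share of \<open>\<mu> + \<mu>^2\<close> is at most
  \<open>2 \<mu>^2\<close>, and no truncation is applied to them.\<close>

lemma Avar_tail_nn:
 assumes st: "0 <= s" "s <= t" and K: "K > 0"
 shows "(\<integral>\<^sup>+om. ennreal (if Avar s t om > K then (Avar s t om)\<^sup>2 else 0) \<partial>M)
  <= ennreal (lam * (t - s)) * tail2 K + ennreal (2 * (lam * (t - s))^2) * m2"
proof -
 note [measurable] = blk_abs_measurable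
 let ?\<mu> = "lam * (t - s)"
 have mu: "?\<mu> >= 0" using lam st by simp
 let ?g = "%a b z. ennreal (if (\<Sum>k\<in>{a..<b}. \<bar>z k\<bar>) > K then (\<Sum>k\<in>{a..<b}. \<bar>z k\<bar>)\<^sup>2 else 0)"
 let ?h = "%k::nat. (if k = 1 then tail2 K else 0) + ennreal (if k >= 2 then (real k)\<^sup>2 else 0) * m2"
 have inner: "(\<integral>\<^sup>+om'. ?g a b (Zs om') \<partial>M) <= ?h (b - a)" for a b
 proof -
  consider "b - a = 0" | "b - a = 1" | "b - a >= 2" by linarith
  then show ?thesis
  proof cases
  case 1
  then show ?thesis using K by simp
  next
  case 2
  then have *: "{a..<b} = {a}" by auto
  show ?thesis unfolding * using 2 Zs_nn[of "%z. ennreal (if K < \<bar>z\<bar> then \<bar>z\<bar>\<^sup>2 else 0)" a] by (simp add: tail2_def cong: if_cong)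
  next
  case 3
  have "(\<integral>\<^sup>+om'. ?g a b (Zs om') \<partial>M) <= (\<integral>\<^sup>+om'. ennreal ((\<Sum>k\<in>{a..<b}. \<bar>Zs om' k\<bar>)^2) \<partial>M)"
  by (intro nn_integral_mono ennreal_leI) auto
  also note blk_sq_le
  finally show ?thesis using 3 by simp
  qed
 qed
 have "(\<integral>\<^sup>+om. ennreal (if Avar s t om > K then (Avar s t om)\<^sup>2 else 0) \<partial>M) = (\<integral>\<^sup>+om. (\<integral>\<^sup>+om'. ?g (cnt s om) (cnt t om) (Zs om') \<partial>M) \<partial>M)"
  unfolding Avar_alt by (rule freeze_blk[of ?g]) measurable
 also have "... <= (\<integral>\<^sup>+om. ?h (cnt t om - cnt s om) \<partial>M)" by (intro nn_integral_mono inner)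
 also have "... = (\<Sum>k. ?h k * ennreal (pois ?\<mu> k))" by (rule cnt_nn[OF st])
 also have "... = (\<Sum>k. (if k = 1 then tail2 K else 0) * ennreal (pois ?\<mu> k)) + (\<Sum>k. ennreal ((if k >= 2 then (real k)\<^sup>2 else 0) * pois ?\<mu> k) * m2)"
 proof -
  have "?h k * ennreal (pois ?\<mu> k) = (if k = 1 then tail2 K else 0) * ennreal (pois ?\<mu> k)
  + ennreal ((if k >= 2 then (real k)\<^sup>2 else 0) * pois ?\<mu> k) * m2" for k
  using pois_nonneg[OF mu, of k] by (simp add: distrib_right ennreal_mult ac_simps)
  then show ?thesis by (simp only:) (rule suminf_add[symmetric], auto)
 qed
 also have "(\<Sum>k. (if k = 1 then tail2 K else 0) * ennreal (pois ?\<mu> k)) = tail2 K * ennreal (pois ?\<mu> 1)"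
  by (subst suminf_finite[of "{1}"]) auto
 also have "(\<Sum>k. ennreal ((if k >= 2 then (real k)\<^sup>2 else 0) * pois ?\<mu> k) * m2) = ennreal (?\<mu> + ?\<mu>\<^sup>2 - pois ?\<mu> 1) * m2"
 proof -
  have "(%k. if k = 1 then (real k)\<^sup>2 * pois ?\<mu> k else 0) sums ((real 1)^2 * pois ?\<mu> 1)"
  by (rule sums_single)
  from sums_diff[OF pois_sums2[of ?\<mu>] this]
  have "(%k. (real k)\<^sup>2 * pois ?\<mu> k - (if k = 1 then (real k)\<^sup>2 * pois ?\<mu> k else 0)) sums (?\<mu> + ?\<mu>\<^sup>2 - pois ?\<mu> 1)"
  by simp
  moreover have "(real k)^2 * pois ?\<mu> k - (if k = 1 then (real k)\<^sup>2 * pois ?\<mu> k else 0) = (if k >= 2 then (real k)\<^sup>2 else 0) * pois ?\<mu> k" for k :: nat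
  by (cases "k = 0"; cases "k = 1"; simp)
  ultimately have "(%k. (if k >= 2 then (real k)\<^sup>2 else 0) * pois ?\<mu> k) sums (?\<mu> + ?\<mu>\<^sup>2 - pois ?\<mu> 1)" by simp
  then have "(\<Sum>k. ennreal ((if k >= 2 then (real k)\<^sup>2 else 0) * pois ?\<mu> k)) = ennreal (?\<mu> + ?\<mu>\<^sup>2 - pois ?\<mu> 1)"
  by (intro suminf_ennreal_eq) (use pois_nonneg[OF mu] in auto)
  then show ?thesis by (simp only: ennreal_suminf_multc)
 qed
 also have "tail2 K * ennreal (pois ?\<mu> 1) + ennreal (?\<mu> + ?\<mu>\<^sup>2 - pois ?\<mu> 1) * m2 <= ennreal ?\<mu> * tail2 K + ennreal (2 * ?\<mu>\<^sup>2) * m2"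
  using pois_one_le[OF mu] pois_one_ge[OF mu]
  by (subst (1) mult.commute) (intro add_mono mult_right_mono ennreal_leI, auto)
 finally show ?thesis .
qed

lemma Jou_nonzero_prob:
 assumes "0 <= s" "s < t"
 shows "prob {om\<in>space M. Jou tt s t om ~= 0} <= lam * (t - s)"
proof -
 let ?\<mu> = "lam * (t - s)"
 have "prob {om\<in>space M. Jou tt s t om ~= 0} <= prob (space M - {om\<in>space M. cnt t om - cnt s om = 0})"
 proof (rule finite_measure_mono)
  show "{om\<in>space M. Jou tt s t om ~= 0} \<subseteq> space M - {om\<in>space M. cnt t om - cnt s om = 0}"
  proof safe
  fix om assume w: "om : space M" "Jou tt s t om ~= 0" "cnt t om - cnt s om = 0"
  then have "cnt t om = cnt s om" using cnt_mono[of om s t] assms by simp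
  then show False using Jou_no_jump w assms by blast
  qed
 qed measurable
 also have "... = 1 - pois ?\<mu> 0"
 proof -
  have "{om\<in>space M. cnt t om - cnt s om = 0} \<in> events" by measurable
  then show ?thesis using assms cnt_prob[of s t 0] by (simp only: prob_compl)
 qed
 also have "... <= ?\<mu>" using exp_ge_add_one_self[of "- ?\<mu>"] by (simp add: pois_def)
 finally show ?thesis .
qed

text \<open>Two or more jumps have probability at most \<open>\<mu>^2\<close>. A single height is
  multiplied by a factor of at least \<open>exp (- tt (t - s))\<close>, so an innovation of size at
  most \<open>3/2 v\<close> forces a height below \<open>2 v\<close>; the gap between 3/2 and 2
  absorbs the discount.\<close>

lemma Jou_small_prob:
 assumes st: "0 <= s" "s < t" and th: "tt > 0" and v: "v > 0" "3/2 * exp (tt * (t - s)) < 2"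
 shows "prob {om\<in>space M. Jou tt s t om ~= 0 & \<bar>Jou tt s t om\<bar> <= 3/2 * v} <= (lam * (t - s))^2 + lam * (t - s) * measure F {- 2 * v <..< 2 * v}"
proof -
 let ?\<mu> = "lam * (t - s)"
 have st': "s <= t" and mu: "?\<mu> >= 0" using lam st by auto
 let ?A = "space M - ({om\<in>space M. cnt t om - cnt s om = 0} \<union> {om\<in>space M. cnt t om - cnt s om = 1})"
 let ?B = "{om\<in>space M. cnt t om - cnt s om = 1 & Zs om (cnt s om) \<in> {- 2 * v <..< 2 * v}}"
 have zm: "(%om. Zs om (cnt s om)) : bmeas M"
  by (rule measurable_compose_countable[of "%k om. Zs om k" _ _ "cnt s"]) auto
 then have Bm: "?B \<in> events" by measurable
 have Am: "?A \<in> events" by measurable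
 have "{om\<in>space M. Jou tt s t om ~= 0 & \<bar>Jou tt s t om\<bar> <= 3/2 * v} \<subseteq> ?A \<union> ?B"
 proof
  fix om assume "om \<in> {om\<in>space M. Jou tt s t om ~= 0 & \<bar>Jou tt s t om\<bar> <= 3/2 * v}"
  then have w: "om : space M" "Jou tt s t om ~= 0" "\<bar>Jou tt s t om\<bar> <= 3/2 * v" by auto
  have c: "cnt s om <= cnt t om" "cnt t om ~= cnt s om" using cnt_mono[OF w(1) st(1) st'] Jou_no_jump[OF w(1) st] w(2) by auto
  show "om \<in> ?A \<union> ?B"
  proof (cases "cnt t om - cnt s om = 1")
  case True
  then have "cnt t om = Suc (cnt s om)" using c by simp
  from Jou_one_jump[OF w(1) st this th] obtain c where c: "exp (- tt * (t - s)) <= c" "Jou tt s t om = c * Zs om (cnt s om)" by auto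
  have "exp (- tt * (t - s)) * \<bar>Zs om (cnt s om)\<bar> <= c * \<bar>Zs om (cnt s om)\<bar>" using c(1) by (rule mult_right_mono) auto
  also have "... = \<bar>Jou tt s t om\<bar>" using c order_less_le_trans[OF exp_gt_zero c(1)] by (simp add: abs_mult)
  also have "... <= 3/2 * v" by (rule w)
  finally have "exp (- tt * (t - s)) * \<bar>Zs om (cnt s om)\<bar> <= 3/2 * v" .
  from mult_left_mono[OF this, of "exp (tt * (t - s))"]
  have "\<bar>Zs om (cnt s om)\<bar> <= exp (tt * (t - s)) * (3/2 * v)"
  by (simp add: mult.assoc[symmetric] exp_add[symmetric])
  also have "... < 2 * v" using mult_strict_right_mono[OF v(2,1)] by (simp add: mult_ac)
  finally show ?thesis using True w by auto
  qed (use w c in auto)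
 qed
 then have "prob {om\<in>space M. Jou tt s t om ~= 0 & \<bar>Jou tt s t om\<bar> <= 3/2 * v} <= prob ?A + prob ?B"
  using Am Bm by (intro order_trans[OF finite_measure_mono measure_Un_le]) auto
 also have "prob ?A = 1 - (pois ?\<mu> 0 + pois ?\<mu> 1)"
 proof -
  have ev: "{om\<in>space M. cnt t om - cnt s om = k} \<in> events" for k by measurable
  show ?thesis
  by (subst prob_compl, rule sets.Un[OF ev ev], subst finite_measure_Union[OF ev ev], force, simp only: cnt_prob[OF st(1) st'])
 qed
 \<comment> \<open>\<open>1 - (1 + \<mu>) exp (- \<mu>) <= 1 - (1 + \<mu>) (1 - \<mu>) =
   \<mu>^2\<close>.\<close>
 also have "... <= ?\<mu>\<^sup>2"
 proof -
  have "(1 - ?\<mu>) * (1 + ?\<mu>) <= exp (- ?\<mu>) * (1 + ?\<mu>)"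
  using exp_ge_add_one_self[of "- ?\<mu>"] mu by (intro mult_right_mono) auto
  then show ?thesis by (simp add: pois_def power2_eq_square algebra_simps)
 qed
 also have "prob ?B <= ?\<mu> * measure F {- 2 * v <..< 2 * v}"
 proof -
  let ?I = "{- 2 * v <..< 2 * v}"
  let ?g = "%a b z. indicator {1} (b - a :: nat) * (indicator ?I (z a) :: ennreal)"
  interpret F: prob_space F by (rule F)
  have "ennreal (prob ?B) = (\<integral>\<^sup>+om. indicator ?B om \<partial>M)" using Bm by (simp add: emeasure_eq_measure)
  also have "... = (\<integral>\<^sup>+om. ?g (cnt s om) (cnt t om) (Zs om) \<partial>M)"
  by (rule nn_integral_cong) (auto simp: indicator_def)
  also have "... = (\<integral>\<^sup>+om. (\<integral>\<^sup>+om'. ?g (cnt s om) (cnt t om) (Zs om') \<partial>M) \<partial>M)"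
  proof (rule freeze_blk[of ?g])
  fix a b
  have [measurable]: "(%z. z a) : bmeas PZ" by (rule measurable_component_singleton) simp
  show "?g a b : bmeas PZ" by measurable
  qed
  also have "... = (\<integral>\<^sup>+om. indicator {1} (cnt t om - cnt s om) * ennreal (measure F ?I) \<partial>M)"
  using F(2) by (intro nn_integral_cong, subst nn_integral_cmult, simp, subst Zs_nn[of "indicator ?I"]) (auto simp: F.emeasure_eq_measure)
  also have "... = (\<Sum>k. (indicator {1} k * ennreal (measure F ?I)) * ennreal (pois ?\<mu> k))"
  by (rule cnt_nn[OF st(1) st', of "%k. indicator {1} k * ennreal (measure F ?I)"])
  also have "... = ennreal (measure F ?I) * ennreal (pois ?\<mu> 1)"
  by (subst suminf_finite[of "{1}"]) auto
  also have "... <= ennreal (?\<mu> * measure F ?I)"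
  using mu pois_one_le[OF mu] pois_nonneg[OF mu, of 1] by (subst ennreal_mult[symmetric]) (auto intro!: ennreal_leI mult_right_mono simp: mult.commute)
  finally show ?thesis using mu by (simp add: ennreal_le_iff)
 qed
 finally show ?thesis by simp
qed

text \<open>On the event of exactly one jump the innovation is comparable to the jump height, so
 square integrability is inherited by the jump height distribution.\<close>
lemma m2_finite:
 assumes "(\<integral>\<^sup>+om. ennreal ((Jou tt 0 1 om)^2) \<partial>M) < \<infinity>" "tt > 0"
 shows "ennreal lam * m2 < \<infinity>"
proof (cases "lam = 0")
 case False
 with lam have l: "lam > 0" by simp
 let ?g = "%a b z. indicator {1} (b - a :: nat) * ennreal (exp (- 2 * tt) * (z a)^2)"
 have "(\<integral>\<^sup>+om. ?g (cnt 0 om) (cnt 1 om) (Zs om) \<partial>M) <= (\<integral>\<^sup>+om. ennreal ((Jou tt 0 1 om)^2) \<partial>M)"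
 proof (rule nn_integral_mono)
  fix om assume w: "om : space M"
  show "?g (cnt 0 om) (cnt 1 om) (Zs om) <= ennreal ((Jou tt 0 1 om)^2)"
  proof (cases "cnt 1 om - cnt 0 om = 1")
  case True
  then have "cnt 1 om = Suc (cnt 0 om)" by simp
  from Jou_one_jump[OF w _ _ this assms(2)] obtain c where c: "exp (- tt) <= c" "Jou tt 0 1 om = c * Zs om (cnt 0 om)" by auto
  have "exp (- 2 * tt) = (exp (- tt))^2" by (simp add: power2_eq_square exp_add[symmetric])
  also have "... <= c^2" using c(1) by (intro power_mono) auto
  finally have "exp (- 2 * tt) * (Zs om (cnt 0 om))^2 <= (Jou tt 0 1 om)^2"
  unfolding c(2) power_mult_distrib by (rule mult_right_mono) auto
  then show ?thesis using True by (simp add: ennreal_leI)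
  qed auto
 qed
 moreover have "(\<integral>\<^sup>+om. ?g (cnt 0 om) (cnt 1 om) (Zs om) \<partial>M) = (\<integral>\<^sup>+om. (\<integral>\<^sup>+om'. ?g (cnt 0 om) (cnt 1 om) (Zs om') \<partial>M) \<partial>M)"
 proof (rule freeze_blk[of ?g])
  fix a b
  have [measurable]: "(%z. z a) : bmeas PZ" by (rule measurable_component_singleton) simp
  show "?g a b : bmeas PZ" by measurable
 qed
 moreover have "... = (\<integral>\<^sup>+om. indicator {1} (cnt 1 om - cnt 0 om) * (ennreal (exp (- 2 * tt)) * m2) \<partial>M)"
 proof -
  have "(\<integral>\<^sup>+z. ennreal (exp (- 2 * tt)) * ennreal (z^2) \<partial>F) = ennreal (exp (- 2 * tt)) * m2"
  unfolding m2_def by (rule nn_integral_cmult) (simp add: measurable_cong_sets[OF F(2) refl])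
  then show ?thesis
  by (intro nn_integral_cong, subst nn_integral_cmult, simp, subst Zs_nn[of "%z. ennreal (exp (- 2 * tt) * z^2)"])
  (auto simp: ennreal_mult)
 qed
 moreover have "... = (ennreal (exp (- 2 * tt)) * m2) * ennreal (pois lam 1)"
  by (subst cnt_nn[of 0 1 "%k. indicator {1} k * (ennreal (exp (- 2 * tt)) * m2)"], simp, simp, subst suminf_finite[of "{1}"]) auto
 ultimately have "(ennreal (exp (- 2 * tt)) * m2) * ennreal (pois lam 1) < \<infinity>" using assms(1) by simp
 moreover have "pois lam 1 > 0" using l by (simp add: pois_def)
 ultimately have "m2 < \<infinity>" by (auto simp: ennreal_mult_less_top)
 then show ?thesis by (simp add: ennreal_mult_less_top)
qed simp

section \<open>Gaussian and jump innovations along a grid, with their two filtrations\<close>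

definition gau :: "real => (nat => real) => nat => 'a => real" where
 "gau tt ta i om = Wou tt (ta i) (ta (Suc i)) om / ou_sd tt (ta (Suc i) - ta i)"

definition jmp :: "real => (nat => real) => nat => 'a => real" where
 "jmp tt ta i om = Jou tt (ta i) (ta (Suc i)) om"

text \<open>Initial value and all jumps are known from the start; only the Gaussian innovations are
  revealed step by step.\<close>

definition HG :: "real => (nat => real) => nat => 'a measure" where
 "HG tt ta i = augment M (Sig (- {IW, IZ 0})) (gau tt ta) i"

text \<open>The mirror image: initial value and Brownian path are known from the start, and the jump
  innovations are revealed step by step.\<close>

definition HJ :: "real => (nat => real) => nat => 'a measure" where
 "HJ tt ta i = augment M (Sig {IX0, IW}) (jmp tt ta) i"

definition grid :: "(nat => real) => nat => bool" where
 "grid ta n \<longleftrightarrow> ta 0 = 0 & (\<forall>i<n. ta i < ta (Suc i))"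

lemma grid_nonneg: "grid ta n ==> i <= n ==> 0 <= ta i"
 unfolding grid_def by (induction i) (auto simp: Suc_le_eq intro: order_trans less_imp_le)

lemma gridD: "grid ta n ==> i < n ==> 0 <= ta i" "grid ta n ==> i < n ==> ta i < ta (Suc i)" "grid ta n ==> ta 0 = 0"
 using grid_nonneg by (auto simp: grid_def)

lemma gau_adapted:
 assumes g: "grid ta n" and th: "tt > 0"
 shows "adapted_indep M (HG tt ta) (gau tt ta) n"
  and "i <= n ==> sets (Sig (- {IW, IZ 0})) \<subseteq> sets (HG tt ta i)"
  and "i < n ==> distr M borel (gau tt ta i) = std_normal_distribution"
proof -
 have "indep_vars (%_. borel) (%i om. Wou tt (ta i) (ta (Suc i)) om) {..<n}"
 proof (cases "n = 0")
  case False
  then show ?thesis unfolding Wou_def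
  by (intro indep_ou_int W_reg W_inc) (use gridD[OF g] in auto)
 qed (simp add: indep_vars_def2 indep_sets_def)
 then have iv: "indep_vars (%_. borel) (gau tt ta) {..<n}"
  unfolding gau_def[abs_def] by (rule indep_vars_compose2[where Y="%i x. x / ou_sd tt (ta (Suc i) - ta i)"]) auto
 have "gau tt ta l : bmeas (Sig {IW})" if "l < n" for l
  unfolding gau_def[abs_def] using Wou_measurable[OF _ gridD(1)[OF g that] gridD(2)[OF g that], of "{IW}" tt]
  by (intro borel_measurable_divide) auto
 note * = adapted_indep_augment[OF Sig_indep Sig_sub Sig_sub iv this, of "- {IW, IZ 0}"]
 show "adapted_indep M (HG tt ta) (gau tt ta) n" "i <= n ==> sets (Sig (- {IW, IZ 0})) \<subseteq> sets (HG tt ta i)"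
  unfolding HG_def[abs_def] using * by auto
 show "i < n ==> distr M borel (gau tt ta i) = std_normal_distribution"
  unfolding gau_def[abs_def] by (intro Wou_distr gridD[OF g] th)
qed

lemma jmp_adapted:
 assumes g: "grid ta n"
 shows "adapted_indep M (HJ tt ta) (jmp tt ta) n"
  and "i <= n ==> sets (Sig {IX0, IW}) \<subseteq> sets (HJ tt ta i)"
proof -
 have iv: "indep_vars (%_. borel) (jmp tt ta) {..<n}"
 proof (cases "n = 0")
  case False
  then show ?thesis unfolding jmp_def[abs_def] Jou_def
  by (intro indep_ou_int J_reg J_inc) (use gridD[OF g] in auto)
 qed (simp add: indep_vars_def2 indep_sets_def)
 have "jmp tt ta l : bmeas (Sig SJ)" if "l < n" for l
  unfolding jmp_def[abs_def] using Jou_measurable[OF order_refl gridD(1)[OF g that] gridD(2)[OF g that]] by simp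
 note * = adapted_indep_augment[OF Sig_indep Sig_sub Sig_sub iv this, of "{IX0, IW}"]
 show "adapted_indep M (HJ tt ta) (jmp tt ta) n" "i <= n ==> sets (Sig {IX0, IW}) \<subseteq> sets (HJ tt ta i)"
  unfolding HJ_def[abs_def] using * by (auto simp: SJ_def)
qed

lemma measurable_mono_sets:
 assumes "f \<in> measurable H S" "sets H \<subseteq> sets H'" "space H = space H'"
 shows "f \<in> measurable H' S"
 using assms by (intro measurable_from_subalg[of H' H]) (auto simp: subalgebra_def)

lemma adapted_space: "adapted_indep M H V k ==> i <= k ==> space (H i) = space M"
 unfolding adapted_indep_def subalgebra_def by auto

lemma X_grid_step:
 assumes "grid ta n" "i < n" "tt > 0" "om : space M"
 shows "X tt (ta (Suc i)) om = exp (- tt * (ta (Suc i) - ta i)) * X tt (ta i) om + jmp tt ta i om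
  + \<sigma> * ou_sd tt (ta (Suc i) - ta i) * gau tt ta i om"
 using X_step[OF assms(4) gridD(1,2)[OF assms(1,2)], of tt] ou_sd_pos[of tt "ta (Suc i) - ta i"] gridD(2)[OF assms(1,2)] assms(3)
 by (simp add: jmp_def gau_def)

lemma env_HG:
 assumes "grid ta n" "tt > 0" "i <= n" "f \<in> measurable (Sig (- {IW, IZ 0})) S"
 shows "f \<in> measurable (HG tt ta i) S"
 using assms gau_adapted[OF assms(1,2)] adapted_space[OF gau_adapted(1)[OF assms(1,2)]]
 by (intro measurable_mono_sets[OF assms(4)]) auto

text \<open>Innovations of later steps and for another drift are known as well, because all jumps
  lie in the initial sigma-algebra; the likelihood ratio needs both drifts at once.\<close>

lemma jmp_HG:
 assumes "grid ta n" "tt > 0" "i <= n" "l < n"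
 shows "jmp tt' ta l : bmeas (HG tt ta i)"
 unfolding jmp_def[abs_def]
 by (rule env_HG[OF assms(1-3)], rule Jou_measurable[unfolded Jou_def[symmetric]]) (use gridD(1,2)[OF assms(1,4)] in \<open>auto simp: SJ_def\<close>)

lemma X_HG:
 assumes g: "grid ta n" and th: "tt > 0"
 shows "i <= n ==> (%om. X tt (ta i) om) : bmeas (HG tt ta i)"
proof (induction i)
 case 0
 have "X0 : bmeas (HG tt ta 0)" by (rule env_HG[OF g th 0 Sig_X0]) simp
 moreover have "X0 : bmeas (HG tt ta 0) \<longleftrightarrow> (%om. X tt (ta 0) om) : bmeas (HG tt ta 0)"
  by (rule measurable_cong) (simp add: adapted_space[OF gau_adapted(1)[OF g th]] X_zero gridD(3)[OF g])
 ultimately show ?case by blast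
next
 case (Suc i)
 note ad = gau_adapted(1)[OF g th]
 have i: "i < n" using Suc by simp
 have m: "(%om. X tt (ta i) om) : bmeas (HG tt ta (Suc i))"
  by (rule adapted_indepD(4)[OF ad _ _ Suc.IH]) (use Suc in auto)
 have "(%om. exp (- tt * (ta (Suc i) - ta i)) * X tt (ta i) om + jmp tt ta i om
  + \<sigma> * ou_sd tt (ta (Suc i) - ta i) * gau tt ta i om) : bmeas (HG tt ta (Suc i))"
  using m jmp_HG[OF g th Suc.prems i] adapted_indepD(2)[OF ad i]
  by (intro borel_measurable_add borel_measurable_times borel_measurable_const)
 moreover have "?this \<longleftrightarrow> ?case"
  by (rule measurable_cong) (simp add: adapted_space[OF ad Suc.prems] X_grid_step[OF g i th])
 ultimately show ?case by blast
qed

text \<open>Adaptedness to this second filtration lets observations serve as coefficients of jump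
  innovations.\<close>

lemma X_HJ:
 assumes g: "grid ta n" and th: "tt > 0"
 shows "i <= n ==> (%om. X tt (ta i) om) : bmeas (HJ tt ta i)"
proof (induction i)
 case 0
 note ad = jmp_adapted[OF g, where tt=tt]
 have "X0 : bmeas (HJ tt ta 0)"
  by (rule measurable_mono_sets[OF Sig_X0 ad(2)]) (auto simp: adapted_space[OF ad(1)])
 moreover have "X0 : bmeas (HJ tt ta 0) \<longleftrightarrow> (%om. X tt (ta 0) om) : bmeas (HJ tt ta 0)"
  by (rule measurable_cong) (simp add: adapted_space[OF ad(1)] X_zero gridD(3)[OF g])
 ultimately show ?case by blast
next
 case (Suc i)
 note ad = jmp_adapted[OF g, where tt=tt]
 have i: "i < n" using Suc by simp
 have m: "(%om. X tt (ta i) om) : bmeas (HJ tt ta (Suc i))"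
  by (rule adapted_indepD(4)[OF ad(1) _ _ Suc.IH]) (use Suc in auto)
 have "Wou tt (ta i) (ta (Suc i)) : bmeas (HJ tt ta (Suc i))"
  by (rule measurable_mono_sets[OF Wou_measurable ad(2)]) (use gridD(1,2)[OF g i] Suc in \<open>auto simp: adapted_space[OF ad(1)]\<close>)
 then have "gau tt ta i : bmeas (HJ tt ta (Suc i))"
  unfolding gau_def[abs_def] by (intro borel_measurable_divide) auto
 then have "(%om. exp (- tt * (ta (Suc i) - ta i)) * X tt (ta i) om + jmp tt ta i om
  + \<sigma> * ou_sd tt (ta (Suc i) - ta i) * gau tt ta i om) : bmeas (HJ tt ta (Suc i))"
  using m adapted_indepD(2)[OF ad(1) i]
  by (intro borel_measurable_add borel_measurable_times borel_measurable_const)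
 moreover have "?this \<longleftrightarrow> ?case"
  by (rule measurable_cong) (simp add: adapted_space[OF ad(1) Suc.prems] X_grid_step[OF g i th])
 ultimately show ?case by blast
qed

end

section \<open>The invariant distribution\<close>

text \<open>Flow property: noise collected up to \<open>t\<close> is discounted once more over the
  remaining time, because the kernel factorises.\<close>

lemma ou_int_concat:
 assumes st: "0 <= s" "s < t" "t < r" and reg: "pw_reg f"
 shows "ou_int tt f s r = exp (- tt * (r - t)) * ou_int tt f s t + ou_int tt f t r"
proof -
 let ?F = "%u. tt * exp (- tt * (r - u)) * (f u - f s)"
 let ?G = "%u. tt * exp (- tt * (t - u)) * (f u - f s)"
 let ?H = "%u. tt * exp (- tt * (r - u)) * (f u - f t)"
 have iF: "?F integrable_on {s..r}" by (rule rs_sum_tendsto(1)) (use st reg in auto)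
 have iG: "?G integrable_on {s..t}" by (rule rs_sum_tendsto(1)) (use st reg in auto)
 have iH: "?H integrable_on {t..r}" by (rule rs_sum_tendsto(1)) (use st reg in auto)
 have e: "((%u. tt * exp (- tt * (r - u))) has_integral (1 - exp (- tt * (r - t)))) {t..r}"
  using exp_kernel_integral[of t r tt r] st by simp
 have "integral {s..r} ?F = integral {s..t} ?F + integral {t..r} ?F"
  by (rule Henstock_Kurzweil_Integration.integral_combine[OF _ _ iF, symmetric]) (use st in auto)
 also have "integral {s..t} ?F = integral {s..t} (%u. exp (- tt * (r - t)) * ?G u)"
 proof (rule Henstock_Kurzweil_Integration.integral_cong)
  fix u
  have "exp (- tt * (r - u)) = exp (- tt * (r - t)) * exp (- tt * (t - u))"
  by (simp add: exp_add[symmetric] algebra_simps)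
  then show "?F u = exp (- tt * (r - t)) * ?G u" by (simp only: mult_ac)
 qed
 also have "... = exp (- tt * (r - t)) * integral {s..t} ?G" by simp
 also have "integral {t..r} ?F = integral {t..r} (%u. ?H u + (tt * exp (- tt * (r - u))) * (f t - f s))"
  by (rule Henstock_Kurzweil_Integration.integral_cong) (simp add: algebra_simps)
 also have "... = integral {t..r} ?H + (1 - exp (- tt * (r - t))) * (f t - f s)"
  by (rule integral_unique, rule has_integral_add[OF integrable_integral[OF iH] has_integral_mult_left[OF e]])
 finally have "integral {s..r} ?F = exp (- tt * (r - t)) * integral {s..t} ?G + (integral {t..r} ?H + (1 - exp (- tt * (r - t))) * (f t - f s))" .
 moreover have "ou_int tt f s r = f r - f s - integral {s..r} ?F"
  and "ou_int tt f s t = f t - f s - integral {s..t} ?G"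
  and "ou_int tt f t r = f r - f t - integral {t..r} ?H"
  unfolding ou_int_def by (simp_all add: mult.assoc)
 ultimately show ?thesis by (simp only:) (simp add: algebra_simps)
qed

context prob_space
begin

lemma char_ou_concat:
 fixes V :: "real => 'a => real"
 assumes reg: "\<And>om. om : space M ==> pw_reg (%u. V u om)"
  and inc: "\<And>(k::nat) ta. 0 <= ta 0 ==> (\<And>i. ta i <= ta (Suc i)) ==>
  indep_vars (%_. borel) (%i om. V (ta (Suc i)) om - V (ta i) om) {..<k}"
  and V: "\<And>u. V u : bmeas M" and t: "0 < t" "t < r"
 shows "char (distr M borel (%om. ou_int tt (%u. V u om) 0 r)) u =
  char (distr M borel (%om. ou_int tt (%u. V u om) 0 t)) (exp (- tt * (r - t)) * u) * char (distr M borel (%om. ou_int tt (%u. V u om) t r)) u"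
proof -
 \<comment> \<open>Two intervals, with points \<open>0, t, r\<close>; all later points repeat
   \<open>r\<close>.\<close>
 define ta :: "nat => real" where "ta i = (if i = 0 then 0 else if i = 1 then t else r)" for i
 define c :: "nat => real" where "c i = (if i = 0 then exp (- tt * (r - t)) else 1)" for i
 have tas: "ta 0 = 0" "ta (Suc 0) = t" "ta (Suc (Suc 0)) = r" by (auto simp: ta_def)
 have "0 <= t" "0 <= r" using t by auto
 then have lt: "ta i < ta (Suc i)" "0 <= ta i" if "i < 2" for i using that t by (cases i; auto simp: ta_def)+
 have "indep_vars (%_. borel) (%i om. ou_int tt (%u. V u om) (ta i) (ta (Suc i))) {..<2::nat}"
  by (rule indep_ou_int[OF reg inc]) (use lt in auto)
 then have "indep_vars (%_. borel) (%i om. c i * ou_int tt (%u. V u om) (ta i) (ta (Suc i))) {..<2::nat}"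
  by (rule indep_vars_compose2[where Y="%i x. c i * x"]) auto
 from char_distr_sum[OF this, of u]
 have "char (distr M borel (%om. exp (- tt * (r - t)) * ou_int tt (%u. V u om) 0 t + ou_int tt (%u. V u om) t r)) u
  = char (distr M borel (%om. exp (- tt * (r - t)) * ou_int tt (%u. V u om) 0 t)) u * char (distr M borel (%om. ou_int tt (%u. V u om) t r)) u"
  by (simp add: lessThan_Suc numeral_2_eq_2 tas c_def mult.commute add.commute)
 moreover have "distr M borel (%om. ou_int tt (%u. V u om) 0 r) = distr M borel (%om. exp (- tt * (r - t)) * ou_int tt (%u. V u om) 0 t + ou_int tt (%u. V u om) t r)"
  by (rule distr_cong) (use t in \<open>auto simp: ou_int_concat reg\<close>)
 moreover have "char (distr M borel (%om. exp (- tt * (r - t)) * ou_int tt (%u. V u om) 0 t)) u = char (distr M borel (%om. ou_int tt (%u. V u om) 0 t)) (exp (- tt * (r - t)) * u)"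
  by (rule char_scale, rule ou_int_measurable[OF order_refl t(1) reg V])
 ultimately show ?thesis by simp
qed

lemma std_normal_moments:
 assumes V[measurable]: "V : bmeas M" and d: "distr M borel V = std_normal_distribution"
 shows "integrable M (%om. (V om) ^ k)" "(LINT om|M. V om) = 0" "(LINT om|M. (V om)\<^sup>2) = 1" "(LINT om|M. (V om) ^ 4) = 3"
  and "(LINT om|M. (V om) ^ (2 * p)) = fact (2 * p) / (2 ^ p * fact p)"
proof -
 have e: "(LINT om|M. (V om) ^ k) = (\<integral>x. x ^ k \<partial>std_normal_distribution)" for k
  unfolding d[symmetric] by (rule integral_distr[symmetric]) auto
 show "integrable M (%om. (V om) ^ k)" for k
  using integrable_std_normal_distribution_moment[of k] unfolding d[symmetric]
  by (subst (asm) integrable_distr_eq) auto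
 show "(LINT om|M. V om) = 0" using e[of 1] integral_std_normal_distribution_moment_odd[of 1] by simp
 show "(LINT om|M. (V om)\<^sup>2) = 1" using e[of 2] std_normal_distribution_even_moments(1)[of 1] by simp
 show "(LINT om|M. (V om) ^ 4) = 3" using e[of 4] std_normal_distribution_even_moments(1)[of 2] by (simp add: fact_numeral)
 show "(LINT om|M. (V om) ^ (2 * p)) = fact (2 * p) / (2 ^ p * fact p)" unfolding e by (rule std_normal_distribution_even_moments(1))
qed

end

lemma pair_prod_integral:
 fixes f g :: "_ => _::{real_normed_field, banach, second_countable_topology}"
 assumes "prob_space A" "prob_space B" and f[measurable]: "integrable A f" and g[measurable]: "integrable B g"
 shows "integrable (A \<Otimes>\<^sub>M B) (%(x, y). f x * g y)" "(\<integral>z. (case z of (x, y) => f x * g y) \<partial>(A \<Otimes>\<^sub>M B)) = (\<integral>x. f x \<partial>A) * (\<integral>y. g y \<partial>B)"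
proof -
 interpret A: prob_space A by fact
 interpret B: prob_space B by fact
 interpret P: pair_sigma_finite A B ..
 have [measurable]: "f : bmeas A" "g : bmeas B" using f g by auto
 show i: "integrable (A \<Otimes>\<^sub>M B) (%(x, y). f x * g y)"
  by (rule P.Fubini_integrable) (use f g in \<open>auto simp: norm_mult\<close>)
 show "(\<integral>z. (case z of (x, y) => f x * g y) \<partial>(A \<Otimes>\<^sub>M B)) = (\<integral>x. f x \<partial>A) * (\<integral>y. g y \<partial>B)"
  using P.integral_fst'[OF i] by simp
qed

lemma convolution_moments:
 assumes A: "real_distribution A" and B: "real_distribution B"
 shows "char (A \<star> B) u = char A u * char B u"
  and "integrable A (%x. x\<^sup>2) ==> integrable B (%x. x\<^sup>2) ==> (\<integral>x. x \<partial>(A \<star> B)) = (\<integral>x. x \<partial>A) + (\<integral>x. x \<partial>B)"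
  and "integrable A (%x. x\<^sup>2) ==> integrable B (%x. x\<^sup>2) ==> (\<integral>x. x\<^sup>2 \<partial>(A \<star> B)) = (\<integral>x. x\<^sup>2 \<partial>A) + 2 * (\<integral>x. x \<partial>A) * (\<integral>x. x \<partial>B) + (\<integral>x. x\<^sup>2 \<partial>B)"
proof -
 interpret A: real_distribution A by fact
 interpret B: real_distribution B by fact
 note pA = A.prob_space_axioms and pB = B.prob_space_axioms
 have m: "(%(x, y). x + y :: real) \<in> measurable (A \<Otimes>\<^sub>M B) borel" by measurable
 have iA: "integrable A (%x. iexp (u * x))" and iB: "integrable B (%x. iexp (u * x))"
  by (auto intro!: A.integrable_iexp B.integrable_iexp)
 have "char (A \<star> B) u = (\<integral>z. (case z of (x, y) => iexp (u * x) * iexp (u * y)) \<partial>(A \<Otimes>\<^sub>M B))"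
  unfolding char_def convolution_def
  by (subst integral_distr[OF m]) (auto intro!: Bochner_Integration.integral_cong simp: exp_add[symmetric] algebra_simps)
 also have "... = char A u * char B u"
  unfolding char_def by (rule pair_prod_integral(2)[OF pA pB iA iB])
 finally show "char (A \<star> B) u = char A u * char B u" .
 assume a: "integrable A (%x. x\<^sup>2)" and b: "integrable B (%x. x\<^sup>2)"
 have a1: "integrable A (%x. x)" by (rule A.square_integrable_imp_integrable[OF _ a]) simp
 have b1: "integrable B (%x. x)" by (rule B.square_integrable_imp_integrable[OF _ b]) simp
 have oA: "integrable A (%x. 1::real)" and oB: "integrable B (%x. 1::real)" by auto
 note P = pair_prod_integral[OF pA pB]
 have "(\<integral>x. x \<partial>(A \<star> B)) = (\<integral>z. (case z of (x, y) => x * 1) + (case z of (x, y) => 1 * y) \<partial>(A \<Otimes>\<^sub>M B))"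
  unfolding convolution_def by (subst integral_distr[OF m]) (auto intro!: Bochner_Integration.integral_cong)
 also have "... = (\<integral>x. x \<partial>A) + (\<integral>x. x \<partial>B)"
  by (simp only: Bochner_Integration.integral_add[OF P(1)[OF a1 oB] P(1)[OF oA b1]] P(2)[OF a1 oB] P(2)[OF oA b1])
  (simp add: A.prob_space[unfolded A.space_eq_univ] B.prob_space[unfolded B.space_eq_univ])
 finally show "(\<integral>x. x \<partial>(A \<star> B)) = (\<integral>x. x \<partial>A) + (\<integral>x. x \<partial>B)" .
 have "(\<integral>x. x\<^sup>2 \<partial>(A \<star> B)) = (\<integral>z. (case z of (x, y) => x\<^sup>2 * 1) + 2 * (case z of (x, y) => x * y) + (case z of (x, y) => 1 * y^2) \<partial>(A \<Otimes>\<^sub>M B))"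
  unfolding convolution_def by (subst integral_distr[OF m]) (auto intro!: Bochner_Integration.integral_cong simp: power2_eq_square algebra_simps)
 also have "... = (\<integral>x. x\<^sup>2 \<partial>A) + 2 * (\<integral>x. x \<partial>A) * (\<integral>x. x \<partial>B) + (\<integral>x. x\<^sup>2 \<partial>B)"
  by (simp only: Bochner_Integration.integral_add[OF Bochner_Integration.integrable_add[OF P(1)[OF a oB] integrable_mult_right[OF P(1)[OF a1 b1]]] P(1)[OF oA b]]
  Bochner_Integration.integral_add[OF P(1)[OF a oB] integrable_mult_right[OF P(1)[OF a1 b1]]] integral_mult_right_zero P(2)[OF a oB] P(2)[OF oA b] P(2)[OF a1 b1])
  (simp add: A.prob_space[unfolded A.space_eq_univ] B.prob_space[unfolded B.space_eq_univ])
 finally show "(\<integral>x. x\<^sup>2 \<partial>(A \<star> B)) = (\<integral>x. x\<^sup>2 \<partial>A) + 2 * (\<integral>x. x \<partial>A) * (\<integral>x. x \<partial>B) + (\<integral>x. x\<^sup>2 \<partial>B)" .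
qed

section \<open>Second moments and the stationary law\<close>

locale stat_ou = jump_ou M X0 W N Z F \<sigma> lam X for M :: "'a measure" and X0 W N Z F \<sigma> lam X +
 fixes a S :: real
 assumes a_pos: "a > 0" and S: "S >= 0" and X2: "\<And>s. s >= 0 ==> (\<integral>\<^sup>+om. ennreal ((X a s om)^2) \<partial>M) <= ennreal S"
begin

lemma X_meas: "s >= 0 ==> X tt s : bmeas M"
proof (cases "s = 0")
 case True
 then show ?thesis using X_zero measurable_cong[of M "X tt 0" X0 borel] by auto
next
 case False
 assume "s >= 0"
 with False have s: "0 < s" by simp
 have "(%om. exp (- tt * s) * X0 om + Jou tt 0 s om + \<sigma> * Wou tt 0 s om) : bmeas M"
  using Jou_M[OF order_refl s, of tt] Wou_M[OF order_refl s, of tt] by measurable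
 moreover have "?this \<longleftrightarrow> X tt s : bmeas M"
  by (rule measurable_cong) (use X_step[of _ 0 s tt] X_zero s in auto)
 ultimately show ?thesis by blast
qed

lemma X_sq: "s >= 0 ==> integrable M (%om. (X a s om)\<^sup>2)" "s >= 0 ==> (LINT om|M. (X a s om)\<^sup>2) <= S"
 using integrable_boundI[of "%om. (X a s om)\<^sup>2" M S] X2[of s] S X_meas[of s a] by auto

lemma X0_sq: "integrable M (%om. (X0 om)\<^sup>2)" "(LINT om|M. (X0 om)\<^sup>2) <= S"
proof -
 have "integrable M (%om. (X a 0 om)\<^sup>2) \<longleftrightarrow> integrable M (%om. (X0 om)\<^sup>2)"
  by (rule Bochner_Integration.integrable_cong) (auto simp: X_zero)
 moreover have "(LINT om|M. (X a 0 om)\<^sup>2) = (LINT om|M. (X0 om)\<^sup>2)"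
  by (rule Bochner_Integration.integral_cong) (auto simp: X_zero)
 ultimately show "integrable M (%om. (X0 om)\<^sup>2)" "(LINT om|M. (X0 om)\<^sup>2) <= S" using X_sq[of 0] by auto
qed

text \<open>The contribution of the noise, not involving \<open>X0\<close>; its law is the one
  convolved in the definition of invariance.\<close>

definition Y :: "real => 'a => real" where "Y t om = X a t om - exp (- a * t) * X0 om"

lemma Y_eq: "om : space M ==> t > 0 ==> Y t om = Jou a 0 t om + \<sigma> * Wou a 0 t om"
 using X_step[of om 0 t a] X_zero[of om a] by (simp add: Y_def)

lemma Y_meas: "t >= 0 ==> Y t : bmeas M"
 unfolding Y_def[abs_def] using X_meas[of t a] by measurable

lemma sq_sum_le: "(x + y)^2 <= 2 * x^2 + 2 * (y::real)^2"
 using sum_squares_bound[of x y] by (simp add: power2_sum)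

lemma Y_sq: assumes "t >= 0" shows "integrable M (%om. (Y t om)\<^sup>2)" "(LINT om|M. (Y t om)\<^sup>2) <= 4 * S"
proof -
 have e1: "exp (- a * t) <= 1" using assms a_pos by simp
 have b: "(Y t om)^2 <= 2 * (X a t om)^2 + 2 * (X0 om)^2" for om
 proof -
  have "(Y t om)^2 <= 2 * (X a t om)^2 + 2 * (- (exp (- a * t) * X0 om))^2"
  using sq_sum_le[of "X a t om" "- (exp (- a * t) * X0 om)"] by (simp add: Y_def)
  also have "(- (exp (- a * t) * X0 om))^2 = (exp (- a * t))^2 * (X0 om)^2" by (simp add: power_mult_distrib)
  also have "(exp (- a * t))^2 * (X0 om)^2 <= 1 * (X0 om)^2" using e1 by (intro mult_right_mono power_le_one) auto
  finally show ?thesis by simp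
 qed
 have i: "integrable M (%om. 2 * (X a t om)^2 + 2 * (X0 om)^2)" using X_sq(1)[OF assms] X0_sq(1) by simp
 show i2: "integrable M (%om. (Y t om)\<^sup>2)"
  by (rule Bochner_Integration.integrable_bound[OF i]) (use Y_meas[OF assms] b in auto)
 have "(LINT om|M. (Y t om)\<^sup>2) <= (LINT om|M. 2 * (X a t om)^2 + 2 * (X0 om)^2)" by (rule integral_mono[OF i2 i b])
 also have "... = 2 * (LINT om|M. (X a t om)\<^sup>2) + 2 * (LINT om|M. (X0 om)\<^sup>2)" using X_sq(1)[OF assms] X0_sq(1) by simp
 also have "... <= 4 * S" using X_sq(2)[OF assms] X0_sq(2) by simp
 finally show "(LINT om|M. (Y t om)\<^sup>2) <= 4 * S" .
qed

lemma Wou_sq: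
 assumes "0 <= s" "s < t" "tt > 0"
 shows "integrable M (%om. (Wou tt s t om)\<^sup>2)" "(LINT om|M. (Wou tt s t om)\<^sup>2) = (ou_sd tt (t - s))^2" "(LINT om|M. Wou tt s t om) = 0"
proof -
 have v: "ou_sd tt (t - s) > 0" using ou_sd_pos assms by simp
 have m: "(%om. Wou tt s t om / ou_sd tt (t - s)) : bmeas M" using Wou_M[OF assms(1,2)] by simp
 note * = std_normal_moments[OF m Wou_distr[OF assms]]
 have "integrable M (%om. (ou_sd tt (t - s))\<^sup>2 * (Wou tt s t om / ou_sd tt (t - s))^2)"
  by (rule integrable_mult_right) (rule *(1))
 then show "integrable M (%om. (Wou tt s t om)\<^sup>2)" using v by (simp add: power_divide)
 show "(LINT om|M. (Wou tt s t om)\<^sup>2) = (ou_sd tt (t - s))^2" using *(3) v by (simp add: power_divide)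
 show "(LINT om|M. Wou tt s t om) = 0" using *(2) v by simp
qed

text \<open>Taking the Gaussian part out of \<open>Y 1\<close> leaves a square integrable jump
  innovation over unit time, which is what the one-jump comparison starts from.\<close>

lemma m2_fin: "ennreal lam * m2 < \<infinity>"
proof (rule m2_finite[OF _ a_pos])
 have "integrable M (%om. (Jou a 0 1 om)\<^sup>2)"
 proof (rule Bochner_Integration.integrable_bound)
  show "integrable M (%om. 2 * (Y 1 om)^2 + 2 * (\<sigma>^2 * (Wou a 0 1 om)^2))"
  using Y_sq(1)[of 1] Wou_sq(1)[of 0 1 a] a_pos by simp
  have "(Jou a 0 1 om)^2 <= 2 * (Y 1 om)^2 + 2 * (\<sigma>^2 * (Wou a 0 1 om)^2)" if "om : space M" for om
  using sq_sum_le[of "Y 1 om" "- (\<sigma> * Wou a 0 1 om)"] Y_eq[OF that, of 1] by (simp add: power_mult_distrib)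
  then show "AE om in M. norm ((Jou a 0 1 om)^2) <= norm (2 * (Y 1 om)^2 + 2 * (\<sigma>^2 * (Wou a 0 1 om)^2))"
  by (intro AE_I2) auto
  show "(%om. (Jou a 0 1 om)\<^sup>2) : bmeas M" using Jou_M[of 0 1 a] by simp
 qed
 then show "(\<integral>\<^sup>+om. ennreal ((Jou a 0 1 om)^2) \<partial>M) < \<infinity>" by (simp add: nn_integral_eq_integral)
qed

definition \<psi> :: "real => real => complex" where "\<psi> t u = char (distr M borel (Y t)) u"

lemma Y_real: "t >= 0 ==> real_distribution (distr M borel (Y t))"
 by (rule real_distribution_distr) (rule Y_meas)

lemma \<psi>_factor:
 assumes t: "t > 0"
 shows "\<psi> t u = char (distr M borel (Jou a 0 t)) u * char (distr M borel (Wou a 0 t)) (\<sigma> * u)"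
proof -
 have ind: "indep_alg M (Sig SJ) borel (Wou a 0 t)"
  by (rule Sig_indep_alg[of _ "{IW}"]) (use SJ_notin Wou_measurable[OF _ order_refl t] in auto)
 have iv: "indep_var borel (Jou a 0 t) borel (%om. \<sigma> * Wou a 0 t om)"
  by (rule indep_alg_indep_var[OF ind Jou_measurable[OF order_refl order_refl t]]) simp
 have "distr M borel (Y t) = distr M borel (%om. Jou a 0 t om + \<sigma> * Wou a 0 t om)"
  by (rule distr_cong) (auto simp: Y_eq t)
 then have "\<psi> t u = char (distr M borel (Jou a 0 t)) u * char (distr M borel (%om. \<sigma> * Wou a 0 t om)) u"
  unfolding \<psi>_def by (simp add: char_distr_add[OF iv])
 also have "char (distr M borel (%om. \<sigma> * Wou a 0 t om)) u = char (distr M borel (Wou a 0 t)) (\<sigma> * u)"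
  by (rule char_scale[OF Wou_M[OF order_refl t]])
 finally show ?thesis .
qed

lemma char_Wou:
 assumes "0 <= s" "s < t"
 shows "char (distr M borel (Wou a s t)) u = char std_normal_distribution (ou_sd a (t - s) * u)"
proof -
 have v: "ou_sd a (t - s) > 0" using ou_sd_pos[OF a_pos] assms by simp
 have m: "(%om. Wou a s t om / ou_sd a (t - s)) : bmeas M" using Wou_M[OF assms] by simp
 have "char (distr M borel (Wou a s t)) u = char (distr M borel (%om. ou_sd a (t - s) * (Wou a s t om / ou_sd a (t - s)))) u"
  using v by simp
 also have "... = char std_normal_distribution (ou_sd a (t - s) * u)"
  unfolding char_scale[OF m] Wou_distr[OF assms a_pos] ..
 finally show ?thesis .
qed

text \<open>Splitting the noise at time \<open>t\<close> gives a discounted piece and an independent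
  fresh one distributed like the noise on \<open>[0, s]\<close>. This is applied to the jump part
  and to the Gaussian part separately.\<close>

lemma \<psi>_flow:
 assumes s: "s > 0" and t: "t > 0"
 shows "\<psi> (t + s) u = \<psi> t (exp (- a * s) * u) * \<psi> s u"
proof -
 have "char (distr M borel (Jou a 0 (t + s))) u = char (distr M borel (Jou a 0 t)) (exp (- a * s) * u) * char (distr M borel (Jou a t (t + s))) u"
 proof -
  have "char (distr M borel (%om. ou_int a (%u. J u om) 0 (t + s))) u =
  char (distr M borel (%om. ou_int a (%u. J u om) 0 t)) (exp (- a * (t + s - t)) * u) * char (distr M borel (%om. ou_int a (%u. J u om) t (t + s))) u"
  by (rule char_ou_concat[where V=J, OF J_reg J_inc measurable_M(6) t]) (use s in auto)
  then show ?thesis unfolding Jou_def[abs_def] by simp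
 qed
 also have "distr M borel (Jou a t (t + s)) = distr M borel (Jou a 0 s)"
  using Jou_distr[of t "t + s" a] s t by simp
 finally have J: "char (distr M borel (Jou a 0 (t + s))) u = char (distr M borel (Jou a 0 t)) (exp (- a * s) * u) * char (distr M borel (Jou a 0 s)) u" .
 have "char (distr M borel (Wou a 0 (t + s))) v = char (distr M borel (Wou a 0 t)) (exp (- a * s) * v) * char (distr M borel (Wou a t (t + s))) v" for v
 proof -
  have "char (distr M borel (%om. ou_int a (%u. W u om) 0 (t + s))) v =
  char (distr M borel (%om. ou_int a (%u. W u om) 0 t)) (exp (- a * (t + s - t)) * v) * char (distr M borel (%om. ou_int a (%u. W u om) t (t + s))) v"
  by (rule char_ou_concat[where V=W, OF W_reg W_inc measurable_M(2) t]) (use s in auto)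
  then show ?thesis unfolding Wou_def[abs_def] by simp
 qed
 also have "char (distr M borel (Wou a t (t + s))) v = char (distr M borel (Wou a 0 s)) v" for v
  using char_Wou[of t "t + s"] char_Wou[of 0 s] s t by simp
 finally have Wc: "char (distr M borel (Wou a 0 (t + s))) v = char (distr M borel (Wou a 0 t)) (exp (- a * s) * v) * char (distr M borel (Wou a 0 s)) v" for v .
 show ?thesis
  using s t by (simp add: \<psi>_factor J Wc mult_ac)
qed

lemma \<psi>_near_1:
 assumes "t >= 0"
 shows "cmod (\<psi> t u - 1) <= \<bar>u\<bar> * (1 + 4 * S)"
proof -
 note [measurable] = Y_meas[OF assms]
 have i1: "integrable M (Y t)" by (rule square_integrable_imp_integrable[OF _ Y_sq(1)[OF assms]]) simp
 have "\<psi> t u - 1 = (LINT om|M. iexp (u * Y t om) - 1)"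
  unfolding \<psi>_def char_def
  by (subst integral_distr, simp, simp, subst Bochner_Integration.integral_diff) (auto intro!: integrable_iexp simp: prob_space)
 then have "cmod (\<psi> t u - 1) = cmod (LINT om|M. iexp (u * Y t om) - 1)" by simp
 also have "... <= (LINT om|M. cmod (iexp (u * Y t om) - 1))" by (rule integral_norm_bound)
 also have "... <= (LINT om|M. \<bar>u\<bar> * (1 + (Y t om)^2))"
 proof (rule integral_mono)
  show "integrable M (%om. cmod (iexp (u * Y t om) - 1))"
  by (intro integrable_norm Bochner_Integration.integrable_diff integrable_iexp integrable_const) auto
  show "integrable M (%om. \<bar>u\<bar> * (1 + (Y t om)^2))" using Y_sq(1)[OF assms] by simp
  fix om
  have "cmod (iexp (u * Y t om) - 1) <= \<bar>u * Y t om\<bar>" using iexp_approx1[of "u * Y t om" 0] by simp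
  also have "... <= \<bar>u\<bar> * (1 + (Y t om)^2)"
  proof -
  have "\<bar>y\<bar> <= 1 + y^2" for y :: real using sum_squares_bound[of "\<bar>y\<bar>" 1] by (simp add: power2_eq_square)
  then show ?thesis unfolding abs_mult by (intro mult_left_mono) auto
  qed
  finally show "cmod (iexp (u * Y t om) - 1) <= \<bar>u\<bar> * (1 + (Y t om)^2)" .
 qed
 also have "... = \<bar>u\<bar> * (1 + (LINT om|M. (Y t om)\<^sup>2))" using Y_sq(1)[OF assms] by (simp add: prob_space)
 also have "... <= \<bar>u\<bar> * (1 + 4 * S)" using Y_sq(2)[OF assms] by (intro mult_left_mono) auto
 finally show ?thesis .
qed

lemma Y_tight: "tight (%n. distr M borel (Y (real (Suc n))))"
 unfolding tight_def
proof (intro conjI allI impI)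
 show "real_distribution (distr M borel (Y (real (Suc n))))" for n by (rule Y_real) simp
 fix e :: real assume e: "e > 0"
 \<comment> \<open>The extra 1 makes the Chebyshev bound strictly smaller than
   \<open>e\<close>.\<close>
 define K where "K = sqrt ((4 * S + 1) / e)"
 have K: "K > 0" "K^2 = (4 * S + 1) / e" using e S by (auto simp: K_def)
 show "\<exists>a b. a < b & (\<forall>n. measure (distr M borel (Y (real (Suc n)))) {a<..b} > 1 - e)"
 proof (rule exI[of _ "- K"], rule exI[of _ K], intro conjI allI)
  fix n
  let ?Y = "Y (real (Suc n))"
  have [measurable]: "?Y : bmeas M" by (rule Y_meas) simp
  have "prob {om\<in>space M. (?Y om)\<^sup>2 >= K^2} <= (LINT om|M. (?Y om)\<^sup>2) / K^2"
  by (rule integral_Markov_inequality_measure[where A="{}"]) (use Y_sq(1)[of "real (Suc n)"] K(1) in auto)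
  also have "... <= 4 * S / K^2" using Y_sq(2)[of "real (Suc n)"] K(1) by (intro divide_right_mono) auto
  also have "... < e" unfolding K(2) using e S by (simp add: field_simps)
  finally have 1: "prob {om\<in>space M. (?Y om)\<^sup>2 >= K^2} < e" .
  have ev: "{om\<in>space M. (?Y om)\<^sup>2 >= K^2} \<in> events" by measurable
  have "1 - e < prob (space M - {om\<in>space M. (?Y om)\<^sup>2 >= K^2})" using 1 by (subst prob_compl[OF ev]) simp
  also have "... <= prob (?Y -` {- K<..K} \<inter> space M)"
  proof (rule finite_measure_mono)
  show "space M - {om\<in>space M. (?Y om)\<^sup>2 >= K^2} \<subseteq> ?Y -` {- K<..K} \<inter> space M"
  proof
  fix om assume "om : space M - {om\<in>space M. (?Y om)\<^sup>2 >= K^2}"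
  then have "om : space M" "(?Y om)^2 < K^2" by auto
  moreover from this(2) have "\<bar>?Y om\<bar> < K" using power_less_imp_less_base[of "\<bar>?Y om\<bar>" 2 K] K by simp
  ultimately show "om \<in> ?Y -` {- K<..K} \<inter> space M" by auto
  qed
  qed measurable
  finally show "measure (distr M borel ?Y) {- K<..K} > 1 - e" by (simp add: measure_distr del: of_nat_Suc)
 qed (use K in auto)
qed

lemma invariant_char:
 assumes "ou_invariant M X X0 a G" "s > 0"
 shows "real_distribution G" "char G u = char G (exp (- a * s) * u) * \<psi> s u"
  and "distr G borel (%x. exp (- a * s) * x) \<star> distr M borel (Y s) = G"
proof -
 have G: "prob_space G" "sets G = sets borel" and inv: "\<And>t. t >= 0 ==> distr G borel (%x. exp (- a * t) * x) \<star> distr M borel (Y t) = G"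
  using assms(1) unfolding ou_invariant_def Y_def[abs_def] by auto
 show R: "real_distribution G" using G by (simp add: real_distribution_def real_distribution_axioms_def)
 interpret G: real_distribution G by fact
 show eq: "distr G borel (%x. exp (- a * s) * x) \<star> distr M borel (Y s) = G" using inv[of s] assms(2) by simp
 have "char G u = char (distr G borel (%x. exp (- a * s) * x)) u * char (distr M borel (Y s)) u"
  using convolution_moments(1)[of "distr G borel (%x. exp (- a * s) * x)" "distr M borel (Y s)" u] Y_real[of s] assms(2)
  unfolding eq by (auto intro!: G.real_distribution_distr)
 also have "char (distr G borel (%x. exp (- a * s) * x)) u = char (distr G borel (%x. x)) (exp (- a * s) * u)"
  by (rule G.char_scale) simp
 also have "distr G borel (%x. x) = G" by (rule distr_id2) (simp add: G(2))
 finally show "char G u = char G (exp (- a * s) * u) * \<psi> s u" unfolding \<psi>_def .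
qed

text \<open>Second moments make the laws of \<open>Y\<close> at integer times tight, and
  \<open>G\<close> is a limit along a subsequence. At times \<open>t\<close> and
  \<open>t + s\<close> the values of \<psi> differ only by the effect of a piece of noise discounted
  by \<open>exp (- a t)\<close>, so they have the same limit, and the flow relation becomes the
  fixed-point equation of invariance. Letting time tend to infinity in that equation gives
  uniqueness; truncation passes the second moment to \<open>G\<close>.\<close>

lemma invariant_exists:
 "\<exists>G. ou_invariant M X X0 a G & integrable G (%x. x\<^sup>2) & (\<forall>G'. ou_invariant M X X0 a G' --> G' = G)"
proof -
 from tight_imp_convergent_subsubsequence[OF Y_tight strict_mono_id]
 obtain r G where r: "strict_mono (r :: nat => nat)" and G: "real_distribution G"
  and wc: "weak_conv_m ((%n. distr M borel (Y (real (Suc n)))) \<circ> id \<circ> r) G" by blast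
 let ?t = "%n. real (Suc (r n))"
 have wc: "weak_conv_m (%n. distr M borel (Y (?t n))) G" using wc by (simp add: comp_def)
 interpret G: real_distribution G by fact
 have t0: "?t n >= 0" "?t n > 0" for n by auto
 have tinf: "filterlim ?t at_top sequentially"
  by (rule filterlim_compose[OF filterlim_real_sequentially], rule filterlim_compose[OF filterlim_Suc])
  (rule filterlim_subseq[OF r])
 have dec: "(%n. exp (- a * ?t n)) ---> 0"
 proof -
  have "filterlim (%n. a * ?t n) at_top sequentially"
  by (rule filterlim_tendsto_pos_mult_at_top[OF tendsto_const a_pos tinf])
  then have "filterlim (%n. - (a * ?t n)) at_bot sequentially" by (simp add: filterlim_uminus_at_bot)
  then show ?thesis using filterlim_compose[OF exp_at_bot] by simp
 qed
 have ch: "(%n. \<psi> (?t n) u) ---> char G u" for u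
  unfolding \<psi>_def by (rule levy_continuity1[OF Y_real[OF t0(1)] G wc])
 have flow: "char G u = char G (exp (- a * s) * u) * \<psi> s u" if s: "s > 0" for s u
 proof -
  have 1: "(%n. \<psi> (?t n + s) u) ---> char G (exp (- a * s) * u) * \<psi> s u"
  unfolding \<psi>_flow[OF s t0(2)] by (intro tendsto_mult ch tendsto_const)
  have "(%n. \<psi> (?t n + s) u - \<psi> (?t n) u) ---> 0"
  proof (rule Lim_null_comparison[OF always_eventually])
  show "(%n. exp (- a * ?t n) * (\<bar>u\<bar> * (1 + 4 * S))) ---> 0"
  using tendsto_mult_right[OF dec, of "\<bar>u\<bar> * (1 + 4 * S)"] by simp
  show "\<forall>n. cmod (\<psi> (?t n + s) u - \<psi> (?t n) u) <= exp (- a * ?t n) * (\<bar>u\<bar> * (1 + 4 * S))"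
  proof
  fix n
  have c1: "cmod (\<psi> (?t n) u) <= 1"
  unfolding \<psi>_def by (rule real_distribution.cmod_char_le_1[OF Y_real[OF t0(1)]])
  \<comment> \<open>The flow relation with the roles of \<open>s\<close> and \<open>?t n\<close>
    exchanged: the block of length \<open>s\<close> comes early and carries the small
    factor.\<close>
  have "\<psi> (?t n + s) u - \<psi> (?t n) u = (\<psi> s (exp (- a * ?t n) * u) - 1) * \<psi> (?t n) u"
  using \<psi>_flow[OF t0(2)[of n] s, of u] by (simp add: add.commute algebra_simps)
  then have "cmod (\<psi> (?t n + s) u - \<psi> (?t n) u) = cmod (\<psi> s (exp (- a * ?t n) * u) - 1) * cmod (\<psi> (?t n) u)"
  by (simp only: norm_mult)
  also have "... <= cmod (\<psi> s (exp (- a * ?t n) * u) - 1) * 1" by (rule mult_left_mono[OF c1 norm_ge_zero])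
  also have "... <= \<bar>exp (- a * ?t n) * u\<bar> * (1 + 4 * S)" using \<psi>_near_1[of s] s by simp
  also have "... = exp (- a * ?t n) * (\<bar>u\<bar> * (1 + 4 * S))" by (simp add: abs_mult)
  finally show "cmod (\<psi> (?t n + s) u - \<psi> (?t n) u) <= ..." .
  qed
  qed
  from tendsto_add[OF this ch[of u]] have "(%n. \<psi> (?t n + s) u) ---> char G u" by simp
  then show ?thesis using 1 by (rule LIMSEQ_unique)
 qed
 have sG: "distr G borel (%x. x) = G" by (rule distr_id2) simp
 have "distr G borel (%x. exp (- a * t) * x) \<star> distr M borel (Y t) = G" if t: "t >= 0" for t
 proof -
  let ?A = "distr G borel (%x. exp (- a * t) * x)"
  have A: "real_distribution ?A" by (rule G.real_distribution_distr) simp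
  have B: "real_distribution (distr M borel (Y t))" by (rule Y_real[OF t])
  show "?A \<star> distr M borel (Y t) = G"
  proof (rule Levy_uniqueness[OF _ G])
  interpret A: real_distribution ?A by (rule A)
  interpret B: real_distribution "distr M borel (Y t)" by (rule B)
  interpret P: pair_prob_space ?A "distr M borel (Y t)" ..
  show "real_distribution (?A \<star> distr M borel (Y t))" unfolding convolution_def
  by (rule P.real_distribution_distr) simp
  show "char (?A \<star> distr M borel (Y t)) = char G"
  proof
  fix u
  have sc: "char ?A u = char G (exp (- a * t) * u)" using G.char_scale[of "%x. x" "exp (- a * t)" u] sG by simp
  have "char G (exp (- a * t) * u) * \<psi> t u = char G u"
  proof (cases "t = 0")
  case True
  have "distr M borel (Y 0) = distr M borel (%_. 0)" by (rule distr_cong) (auto simp: Y_def X_zero)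
  then have "\<psi> 0 u = 1" by (simp add: \<psi>_def char_def integral_distr prob_space del: distr_const)
  then show ?thesis using True by simp
  next
  case False
  then show ?thesis using flow[of t u] t by simp
  qed
  then show "char (?A \<star> distr M borel (Y t)) u = char G u"
  unfolding convolution_moments(1)[OF A B] sc \<psi>_def .
  qed
  qed
 qed
 then have inv: "ou_invariant M X X0 a G"
  unfolding ou_invariant_def Y_def[abs_def] by (auto intro: G.prob_space_axioms)
 have uniq: "G' = G" if G': "ou_invariant M X X0 a G'" for G'
 proof (rule Levy_uniqueness)
  show "real_distribution G'" by (rule invariant_char(1)[OF G' zero_less_one])
  interpret G': real_distribution G' by fact
  show "char G' = char G"
  proof
  fix u
  have "(%n. exp (- a * ?t n) * u) ---> 0" using tendsto_mult_right[OF dec, of u] by simp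
  from isCont_tendsto_compose[OF G'.isCont_char this]
  have "(%n. char G' (exp (- a * ?t n) * u) * \<psi> (?t n) u) ---> 1 * char G u"
  using G'.char_zero by (intro tendsto_mult ch) simp
  moreover have "char G' (exp (- a * ?t n) * u) * \<psi> (?t n) u = char G' u" for n
  using invariant_char(2)[OF G' t0(2)[of n], of u] by (rule sym)
  ultimately show "char G' u = char G u" by (simp add: LIMSEQ_const_iff)
  qed
 qed fact
 have "(\<integral>\<^sup>+x. ennreal (x^2) \<partial>G) <= ennreal (4 * S)"
 proof -
  have b: "(\<integral>\<^sup>+x. ennreal (min (x^2) (real k)) \<partial>G) <= ennreal (4 * S)" for k
  proof -
  have lim: "(%n. \<integral>x. min (x^2) (real k) \<partial>distr M borel (Y (?t n))) ---> (\<integral>x. min (x^2) (real k) \<partial>G)"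
  by (rule weak_conv_imp_integral_bdd_continuous_conv[OF Y_real[OF t0(1)] G wc, where B="real k"]) (auto intro!: continuous_intros)
  have "(\<integral>x. min (x^2) (real k) \<partial>G) <= 4 * S"
  proof (rule LIMSEQ_le_const2[OF lim], intro exI allI impI)
  fix n
  have [measurable]: "Y (?t n) : bmeas M" by (rule Y_meas[OF t0(1)])
  have "(\<integral>x. min (x^2) (real k) \<partial>distr M borel (Y (?t n))) = (LINT om|M. min ((Y (?t n) om)^2) (real k))"
  by (rule integral_distr) (auto simp del: of_nat_Suc)
  also have "... <= (LINT om|M. (Y (?t n) om)\<^sup>2)"
  by (rule integral_mono) (auto intro!: integrable_const_bound[where B="real k"] Y_sq(1) simp del: of_nat_Suc)
  also have "... <= 4 * S" by (rule Y_sq(2)[OF t0(1)])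
  finally show "(\<integral>x. min (x^2) (real k) \<partial>distr M borel (Y (?t n))) <= 4 * S" .
  qed
  moreover have "integrable G (%x. min (x^2) (real k))" by (rule G.integrable_const_bound[where B="real k"]) auto
  ultimately show ?thesis by (simp add: nn_integral_eq_integral ennreal_leI)
  qed
  have "(\<integral>\<^sup>+x. ennreal (x^2) \<partial>G) = (\<integral>\<^sup>+x. (SUP k. ennreal (min (x^2) (real k))) \<partial>G)"
  proof (rule nn_integral_cong)
  fix x :: real
  have "(SUP k. ennreal (min (x^2) (real k))) = ennreal (x^2)"
  proof (rule antisym)
  show "(SUP k. ennreal (min (x^2) (real k))) <= ennreal (x^2)" by (rule SUP_least) (auto intro!: ennreal_leI)
  obtain k where "x^2 <= real k" using real_arch_simple by blast
  then have "ennreal (x^2) <= ennreal (min (x^2) (real k))" by simp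
  also have "... <= (SUP k. ennreal (min (x^2) (real k)))" by (rule SUP_upper) simp
  finally show "ennreal (x^2) <= (SUP k. ennreal (min (x^2) (real k)))" .
  qed
  then show "ennreal (x^2) = (SUP k. ennreal (min (x^2) (real k)))" ..
  qed
  also have "... = (SUP k. \<integral>\<^sup>+x. ennreal (min (x^2) (real k)) \<partial>G)"
  by (rule nn_integral_monotone_convergence_SUP) (auto simp: incseq_def le_fun_def intro!: ennreal_leI)
  also have "... <= ennreal (4 * S)" by (rule SUP_least) (rule b)
  finally show ?thesis .
 qed
 then have "integrable G (%x. x\<^sup>2)" by (intro integrable_boundI(1)[where c="4 * S"]) (use S in auto)
 with inv uniq show ?thesis by blast
qed

definition Ginv :: "real measure" where "Ginv = (THE G. ou_invariant M X X0 a G)"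
definition mG :: real where "mG = (\<integral>x. x \<partial>Ginv)"
definition qG :: real where "qG = ou_second_moment_inf M X X0 a"

lemma Ginv: "ou_invariant M X X0 a Ginv" "integrable Ginv (%x. x\<^sup>2)"
proof -
 obtain G where G: "ou_invariant M X X0 a G" "integrable G (%x. x\<^sup>2)" "\<And>G'. ou_invariant M X X0 a G' ==> G' = G"
  using invariant_exists by blast
 have "Ginv = G" unfolding Ginv_def by (rule the_equality, rule G(1), rule G(3))
 with G(1,2) show "ou_invariant M X X0 a Ginv" "integrable Ginv (%x. x\<^sup>2)" by auto
qed

text \<open>Moments are taken in the convolution identity of invariance and solved for those of
  \<open>Y t\<close>; the jump law does not enter.\<close>

lemma Y_moments:
 assumes t: "t > 0"
 shows "(LINT om|M. Y t om) = (1 - exp (- a * t)) * mG"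
  and "(LINT om|M. (Y t om)\<^sup>2) = (1 - exp (- a * t) ^ 2) * qG - 2 * exp (- a * t) * (1 - exp (- a * t)) * mG^2"
proof -
 let ?\<rho> = "exp (- a * t)"
 interpret G: real_distribution Ginv by (rule invariant_char(1)[OF Ginv(1) t])
 have t0: "t >= 0" using t by simp
 note [measurable] = Y_meas[OF t0]
 have q: "qG = (\<integral>x. x\<^sup>2 \<partial>Ginv)" unfolding qG_def ou_second_moment_inf_def Ginv_def ..
 let ?A = "distr Ginv borel (%x. ?\<rho> * x)" and ?B = "distr M borel (Y t)"
 have A: "real_distribution ?A" by (rule G.real_distribution_distr) simp
 note B = Y_real[OF t0]
 have iA: "integrable ?A (%x. x\<^sup>2)" using Ginv(2) by (subst integrable_distr_eq) (auto simp: power_mult_distrib)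
 have iB: "integrable ?B (%x. x\<^sup>2)" using Y_sq(1)[OF t0] by (subst integrable_distr_eq) auto
 have eA: "(\<integral>x. x \<partial>?A) = ?\<rho> * mG" "(\<integral>x. x\<^sup>2 \<partial>?A) = ?\<rho>\<^sup>2 * qG"
  unfolding mG_def q by (subst integral_distr, simp, simp, simp add: power_mult_distrib)+
 have eB: "(\<integral>x. x \<partial>?B) = (LINT om|M. Y t om)" "(\<integral>x. x\<^sup>2 \<partial>?B) = (LINT om|M. (Y t om)\<^sup>2)"
  by (auto simp: integral_distr)
 note conv = convolution_moments(2,3)[OF A B iA iB, unfolded invariant_char(3)[OF Ginv(1) t] eA eB]
 from conv(1) show 1: "(LINT om|M. Y t om) = (1 - ?\<rho>) * mG" unfolding mG_def by (simp add: algebra_simps)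
 from conv(2)[folded q] show "(LINT om|M. (Y t om)\<^sup>2) = (1 - ?\<rho> ^ 2) * qG - 2 * ?\<rho> * (1 - ?\<rho>) * mG^2"
  unfolding 1 by (simp add: algebra_simps power2_eq_square)
qed

end

section \<open>Moments of the innovations over short intervals\<close>

lemma one_minus_exp_bounds:
 fixes y :: real assumes "y >= 0"
 shows "1 - exp (- y) <= y" "y - y^2 <= 1 - exp (- y)" "\<bar>1 - exp (- y) - y\<bar> <= y^2"
proof -
 show 1: "1 - exp (- y) <= y" using exp_ge_add_one_self[of "- y"] by simp
 have "exp (- y) * (1 + y) <= exp (- y) * exp y" by (intro mult_left_mono exp_ge_add_one_self) auto
 then have "exp (- y) * (1 + y) <= 1" by (simp add: exp_minus)
 then have "exp (- y) <= 1 / (1 + y)" using assms by (simp add: pos_le_divide_eq add_nonneg_pos)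
 also have "... <= 1 - y + y^2"
 proof -
  have "0 <= y * y * y" using assms by simp
  then have "1 <= (1 - y + y^2) * (1 + y)" by (simp add: algebra_simps power2_eq_square)
  then show ?thesis using assms by (simp add: pos_divide_le_eq add_nonneg_pos)
 qed
 finally show 2: "y - y^2 <= 1 - exp (- y)" by simp
 show "\<bar>1 - exp (- y) - y\<bar> <= y^2" using 1 2 zero_le_power2[of y] by (simp add: abs_le_iff)
qed

lemma exp_neg_lipschitz:
 fixes x y :: real assumes "x >= 0" "y >= 0"
 shows "\<bar>exp (- x) - exp (- y)\<bar> <= \<bar>x - y\<bar>"
proof -
 have *: "exp (- x) - exp (- y) <= y - x" if "0 <= x" "x <= y" for x y :: real
 proof -
  have "exp (- x) - exp (- y) = exp (- x) * (1 - exp (- (y - x)))" by (simp add: algebra_simps exp_add[symmetric])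
  also have "... <= 1 * (y - x)" using one_minus_exp_bounds(1)[of "y - x"] that by (intro mult_mono) auto
  finally show ?thesis by simp
 qed
 show ?thesis using *[of x y] *[of y x] assms by (cases "x <= y") auto
qed

lemma abs_diff_sq: "\<bar>x^2 - y^2\<bar> = \<bar>x - y\<bar> * \<bar>x + (y::real)\<bar>"
 by (simp add: power2_eq_square abs_mult[symmetric] algebra_simps)

lemma ou_sd_bounds:
 assumes "tt > 0" "d > 0"
 shows "(ou_sd tt d)^2 <= d" "d - 2 * tt * d^2 <= (ou_sd tt d)^2"
proof -
 have y: "2 * tt * d >= 0" using assms by simp
 show "(ou_sd tt d)^2 <= d" using one_minus_exp_bounds(1)[OF y] assms by (simp add: ou_sd_sq field_simps)
 have "(2 * tt) * (d - 2 * tt * d^2) <= (2 * tt) * (ou_sd tt d)^2"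
 proof -
  have "(2 * tt) * (ou_sd tt d)^2 = 1 - exp (- (2 * tt * d))" using assms by (simp add: ou_sd_sq)
  moreover have "(2 * tt) * (d - 2 * tt * d^2) = 2 * tt * d - (2 * tt * d)^2" by (simp add: power2_eq_square algebra_simps)
  ultimately show ?thesis using one_minus_exp_bounds(2)[OF y] by simp
 qed
 then show "d - 2 * tt * d^2 <= (ou_sd tt d)^2" using assms by simp
qed

context stat_ou
begin

text \<open>Bounds the second moment of \<open>Avar\<close> per unit of time on intervals of length
  at most 1.\<close>

definition CA :: real where "CA = enn2real (ennreal lam * m2) * (1 + lam)"

lemma CA_nonneg: "CA >= 0" unfolding CA_def using lam by simp

lemma lam_m2: "ennreal lam * m2 = ennreal (enn2real (ennreal lam * m2))"
 using m2_fin by simp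

lemma Avar_sq:
 assumes "0 <= s" "s < t" "t <= s + 1"
 shows "integrable M (%om. (Avar s t om)\<^sup>2)" "(LINT om|M. (Avar s t om)\<^sup>2) <= CA * (t - s)"
  "integrable M (Avar s t)" "(LINT om|M. Avar s t om) <= 1 + CA"
proof -
 let ?c = "enn2real (ennreal lam * m2)"
 have st: "s <= t" and d: "0 < t - s" "t - s <= 1" using assms by auto
 have "(\<integral>\<^sup>+om. ennreal ((Avar s t om)^2) \<partial>M) <= ennreal (lam * (t - s) + (lam * (t - s))^2) * m2"
  by (rule Avar_sq_nn[OF assms(1) st])
 also have "lam * (t - s) + (lam * (t - s))^2 = ((t - s) * (1 + lam * (t - s))) * lam"
  by (simp add: power2_eq_square algebra_simps)
 also have "ennreal (((t - s) * (1 + lam * (t - s))) * lam) * m2 = ennreal ((t - s) * (1 + lam * (t - s))) * (ennreal lam * m2)"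
  using lam d by (subst ennreal_mult) (auto simp: mult.assoc)
 also have "... = ennreal ((t - s) * (1 + lam * (t - s)) * ?c)"
  using lam d by (subst lam_m2) (simp add: ennreal_mult)
 also have "... <= ennreal (CA * (t - s))"
 proof (rule ennreal_leI)
  have "lam * (t - s) <= lam" using lam d by (simp add: mult_left_le)
  then have "(t - s) * (1 + lam * (t - s)) * ?c <= (t - s) * (1 + lam) * ?c"
  using d by (intro mult_right_mono mult_left_mono) auto
  then show "(t - s) * (1 + lam * (t - s)) * ?c <= CA * (t - s)" by (simp add: CA_def mult_ac)
 qed
 finally have *: "(\<integral>\<^sup>+om. ennreal ((Avar s t om)^2) \<partial>M) <= ennreal (CA * (t - s))" .
 show 1: "integrable M (%om. (Avar s t om)\<^sup>2)" and 2: "(LINT om|M. (Avar s t om)\<^sup>2) <= CA * (t - s)"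
  using integrable_boundI[OF _ _ *] CA_nonneg d by auto
 show 3: "integrable M (Avar s t)" by (rule square_integrable_imp_integrable[OF _ 1]) simp
 have "(LINT om|M. Avar s t om) <= (LINT om|M. 1 + (Avar s t om)^2)"
 proof (rule integral_mono[OF 3])
  fix om show "Avar s t om <= 1 + (Avar s t om)^2"
  using sum_squares_bound[of "Avar s t om" 1] Avar_nonneg[of s t om] by (simp add: power2_eq_square)
 qed (use 1 in simp)
 also have "... = 1 + (LINT om|M. (Avar s t om)\<^sup>2)" using 1 by (simp add: prob_space)
 also have "... <= 1 + CA" using 2 mult_left_le[of "t - s" CA] CA_nonneg d by simp
 finally show "(LINT om|M. Avar s t om) <= 1 + CA" .
qed

lemma tail2_limit: "(%n::nat. enn2real (ennreal lam * tail2 (real n))) ---> 0"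
proof (cases "lam = 0")
 case False
 then have l: "lam > 0" using lam by simp
 have m2: "m2 < \<infinity>" using m2_fin l by (auto simp: ennreal_mult_less_top)
 interpret F: prob_space F by (rule F)
 have [measurable_cong]: "sets F = sets borel" by (rule F)
 have i2: "integrable F (%z. z\<^sup>2)" using m2 unfolding m2_def by (intro integrableI_nonneg) auto
 have "(%n. \<integral>z. (if \<bar>z\<bar> > real n then z\<^sup>2 else 0) \<partial>F) ---> (\<integral>z. 0 \<partial>F)"
 proof (rule integral_dominated_convergence[OF _ _ i2])
  show "AE z in F. (%n. if real n < \<bar>z\<bar> then z\<^sup>2 else 0) ---> 0"
  proof (intro AE_I2 tendsto_eventually)
  fix z :: real
  obtain n0 where "\<bar>z\<bar> <= real n0" using real_arch_simple by blast
  then show "EVN n. (if real n < \<bar>z\<bar> then z\<^sup>2 else 0) = 0"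
  by (intro eventually_mono[OF eventually_ge_at_top[of n0]]) auto
  qed
 qed auto
 then have lim: "(%n. \<integral>z. (if \<bar>z\<bar> > real n then z\<^sup>2 else 0) \<partial>F) ---> 0" by simp
 have "tail2 (real n) = ennreal (\<integral>z. (if \<bar>z\<bar> > real n then z\<^sup>2 else 0) \<partial>F)" for n
  unfolding tail2_def
  by (rule nn_integral_eq_integral[OF Bochner_Integration.integrable_bound[OF i2]]) auto
 moreover have "(\<integral>z. (if \<bar>z\<bar> > real n then z\<^sup>2 else 0) \<partial>F) >= 0" for n by (rule integral_nonneg_AE) auto
 ultimately have "enn2real (ennreal lam * tail2 (real n)) = lam * (\<integral>z. (if \<bar>z\<bar> > real n then z\<^sup>2 else 0) \<partial>F)" for n
  using lam by (simp add: ennreal_mult[symmetric])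
 then show ?thesis using tendsto_mult_right_zero[OF lim, of lam] by simp
qed simp

text \<open>Uniform integrability at the scale of the interval length: the truncated second moment
  is a small multiple of \<open>t - s\<close> up to a quadratic term. It stands in for fourth
  moments, which the jumps need not have.\<close>

lemma Avar_tail:
 assumes e: "e > 0"
 shows "\<exists>K>0. \<exists>C\<ge>0. \<forall>s t :: real. 0 <= s --> s < t --> t <= s + 1 \<longrightarrow>
  (LINT om|M. (if Avar s t om > K then (Avar s t om)\<^sup>2 else 0)) <= (e + C * (t - s)) * (t - s)"
proof -
 from tendstoD[OF tail2_limit e] eventually_gt_at_top[of 0]
 have "EVN n. enn2real (ennreal lam * tail2 (real n)) < e & n > 0"
  by eventually_elim (simp add: dist_real_def)
 then obtain n where n: "enn2real (ennreal lam * tail2 (real n)) < e" "n > 0"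
  by (auto simp: eventually_sequentially)
 let ?K = "real n"
 have "tail2 ?K <= m2" unfolding tail2_def m2_def by (intro nn_integral_mono ennreal_leI) auto
 then have "ennreal lam * tail2 ?K <= ennreal lam * m2" by (rule mult_left_mono) simp
 then have fin: "ennreal lam * tail2 ?K < \<infinity>" using m2_fin by (rule order_le_less_trans)
 let ?c = "enn2real (ennreal lam * m2)"
 have "(LINT om|M. (if Avar s t om > ?K then (Avar s t om)\<^sup>2 else 0)) <= (e + 2 * lam * ?c * (t - s)) * (t - s)"
  if st: "0 <= s" "s < t" "t <= s + 1" for s t
 proof (rule integrable_boundI(2))
  have d: "t - s > 0" and st': "s <= t" using st by auto
  have "(\<integral>\<^sup>+om. ennreal (if Avar s t om > ?K then (Avar s t om)\<^sup>2 else 0) \<partial>M)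
  <= ennreal (lam * (t - s)) * tail2 ?K + ennreal (2 * (lam * (t - s))^2) * m2"
  by (rule Avar_tail_nn[OF st(1) st']) (use n in auto)
  also have "ennreal (lam * (t - s)) * tail2 ?K = ennreal (t - s) * (ennreal lam * tail2 ?K)"
  using lam d by (simp add: ennreal_mult mult_ac)
  also have "... = ennreal ((t - s) * enn2real (ennreal lam * tail2 ?K))"
  using fin d by (simp add: ennreal_mult)
  also have "ennreal (2 * (lam * (t - s))^2) * m2 = ennreal (2 * lam * (t - s)^2) * (ennreal lam * m2)"
  proof -
  have e: "2 * (lam * (t - s))^2 = (2 * lam * (t - s)^2) * lam" by (simp add: power2_eq_square)
  show ?thesis unfolding e using lam by (subst ennreal_mult) (auto simp: mult.assoc)
  qed
  also have "... = ennreal (2 * lam * (t - s)^2 * ?c)"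
  using lam by (subst lam_m2) (simp add: ennreal_mult)
  also have "ennreal ((t - s) * enn2real (ennreal lam * tail2 ?K)) + ennreal (2 * lam * (t - s)^2 * ?c)
  = ennreal ((t - s) * enn2real (ennreal lam * tail2 ?K) + 2 * lam * (t - s)^2 * ?c)"
  using lam d by (intro ennreal_plus[symmetric]) auto
  also have "... <= ennreal ((e + 2 * lam * ?c * (t - s)) * (t - s))"
  proof (rule ennreal_leI)
  have "(t - s) * enn2real (ennreal lam * tail2 ?K) <= (t - s) * e" using n d by (intro mult_left_mono) auto
  then show "(t - s) * enn2real (ennreal lam * tail2 ?K) + 2 * lam * (t - s)^2 * ?c <= (e + 2 * lam * ?c * (t - s)) * (t - s)"
  by (simp add: power2_eq_square algebra_simps)
  qed
  finally show "(\<integral>\<^sup>+om. ennreal (if Avar s t om > ?K then (Avar s t om)\<^sup>2 else 0) \<partial>M) <= ennreal ((e + 2 * lam * ?c * (t - s)) * (t - s))" .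
 qed (use e lam st in auto)
 then show ?thesis using n lam by (intro exI[of _ ?K] conjI exI[of _ "2 * lam * ?c"]) auto
qed

lemma Jou_sq:
 assumes st: "0 <= s" "s < t" "t <= s + 1" and th: "0 < tt" "tt <= 2 * a"
 shows "integrable M (%om. (Jou tt s t om)\<^sup>2)" "(LINT om|M. (Jou tt s t om)\<^sup>2) <= (1 + 2 * a)^2 * CA * (t - s)"
  "integrable M (Jou tt s t)" "om : space M ==> \<bar>Jou tt s t om\<bar> <= (1 + 2 * a) * Avar s t om"
proof -
 have le: "\<bar>Jou tt s t om\<bar> <= (1 + 2 * a) * Avar s t om" if w: "om : space M" for om
 proof -
  have "\<bar>Jou tt s t om\<bar> <= (1 + tt * (t - s)) * Avar s t om" using th by (intro Jou_le w st) auto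
  also have "tt * (t - s) <= (2 * a) * 1" using st th by (intro mult_mono) auto
  then have "(1 + tt * (t - s)) * Avar s t om <= (1 + 2 * a) * Avar s t om" using Avar_nonneg by (intro mult_right_mono) auto
  finally show ?thesis .
 qed
 have le2: "(Jou tt s t om)^2 <= (1 + 2 * a)^2 * (Avar s t om)^2" if "om : space M" for om
  using power_mono[OF le[OF that], of 2] by (simp add: power_mult_distrib)
 have i: "integrable M (%om. (1 + 2 * a)\<^sup>2 * (Avar s t om)^2)" using Avar_sq(1)[OF st] by simp
 show 1: "integrable M (%om. (Jou tt s t om)\<^sup>2)"
  by (rule Bochner_Integration.integrable_bound[OF i]) (use Jou_M[OF st(1,2)] le2 in auto)
 have "(LINT om|M. (Jou tt s t om)\<^sup>2) <= (LINT om|M. (1 + 2 * a)\<^sup>2 * (Avar s t om)^2)" by (rule integral_mono[OF 1 i le2])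
 also have "... <= (1 + 2 * a)^2 * (CA * (t - s))" using Avar_sq(2)[OF st] by (simp add: mult_left_mono)
 finally show "(LINT om|M. (Jou tt s t om)\<^sup>2) <= (1 + 2 * a)^2 * CA * (t - s)" by (simp add: mult.assoc)
 show "integrable M (Jou tt s t)" by (rule square_integrable_imp_integrable[OF Jou_M[OF st(1,2)] 1])
 show "om : space M ==> \<bar>Jou tt s t om\<bar> <= (1 + 2 * a) * Avar s t om" by (rule le)
qed

text \<open>Invariance of \<open>G\<close> yields the first two moments of the innovations without computing them from the
 jump distribution.\<close>
lemma Jou_moments:
 assumes st: "0 <= s" "s < t" "t <= s + 1"
 shows "(LINT om|M. Jou a s t om) = (1 - exp (- a * (t - s))) * mG"
  and "(LINT om|M. (Jou a s t om)\<^sup>2) + \<sigma>^2 * (ou_sd a (t - s))^2 =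
  (1 - exp (- a * (t - s)) ^ 2) * qG - 2 * exp (- a * (t - s)) * (1 - exp (- a * (t - s))) * mG^2"
proof -
 let ?d = "t - s"
 have d: "?d > 0" "0 <= (0::real)" "?d <= 0 + 1" using st by auto
 note JM = Jou_M[OF st(1,2), of a] Jou_M[OF d(2,1), of a]
 have th: "0 < a" "a <= 2 * a" using a_pos by auto
 \<comment> \<open>Stationarity moves the interval to start at 0, where the innovation is the jump
   part of \<open>Y\<close>.\<close>
 have eq: "distr M borel (Jou a s t) = distr M borel (Jou a 0 ?d)" by (rule Jou_distr[OF st(1,2)])
 have tr: "(LINT om|M. f (Jou a s t om)) = (LINT om|M. f (Jou a 0 ?d om))" if "f : bmeas borel" for f :: "real => real"
 proof -
  have "(LINT om|M. f (Jou a s t om)) = (\<integral>x. f x \<partial>distr M borel (Jou a s t))" by (rule integral_distr[symmetric, OF JM(1) that])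
  also have "... = (LINT om|M. f (Jou a 0 ?d om))" unfolding eq by (rule integral_distr[OF JM(2) that])
  finally show ?thesis .
 qed
 note J1 = Jou_sq[OF d(2,1,3) th] and W1 = Wou_sq[OF d(2,1) a_pos]
 have W2: "integrable M (Wou a 0 ?d)" by (rule square_integrable_imp_integrable[OF Wou_M[OF d(2,1)] W1(1)])
 have "(LINT om|M. Y ?d om) = (LINT om|M. Jou a 0 ?d om + \<sigma> * Wou a 0 ?d om)"
  by (rule Bochner_Integration.integral_cong) (auto simp: Y_eq[OF _ d(1)])
 also have "... = (LINT om|M. Jou a 0 ?d om)" using J1(3) W2 W1(3) by simp
 finally have "(LINT om|M. Jou a 0 ?d om) = (1 - exp (- a * ?d)) * mG" using Y_moments(1)[OF d(1)] by simp
 then show "(LINT om|M. Jou a s t om) = (1 - exp (- a * (t - s))) * mG" using tr[of "%x. x"] by simp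
 have ind: "indep_alg M (Sig SJ) borel (Wou a 0 ?d)"
  by (rule Sig_indep_alg[of _ "{IW}"]) (use SJ_notin Wou_measurable[OF _ d(2,1)] in auto)
 have iv: "indep_var borel (Jou a 0 ?d) borel (%om. Wou a 0 ?d om)"
  by (rule indep_alg_indep_var[OF ind Jou_measurable[OF order_refl d(2,1)]]) simp
 have p: "integrable M (%om. Jou a 0 ?d om * Wou a 0 ?d om)" "(LINT om|M. Jou a 0 ?d om * Wou a 0 ?d om) = 0"
  using indep_var_integrable[OF iv J1(3) W2] indep_var_lebesgue_integral[OF iv J1(3) W2] W1(3) by auto
 have "(LINT om|M. (Y ?d om)\<^sup>2) = (LINT om|M. (Jou a 0 ?d om)\<^sup>2 + 2 * \<sigma> * (Jou a 0 ?d om * Wou a 0 ?d om) + \<sigma>^2 * (Wou a 0 ?d om)^2)"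
  by (rule Bochner_Integration.integral_cong) (auto simp: Y_eq[OF _ d(1)] power2_eq_square algebra_simps)
 also have "... = (LINT om|M. (Jou a 0 ?d om)\<^sup>2) + \<sigma>^2 * (ou_sd a ?d)^2" using J1(1) W1(1,2) p by simp
 finally show "(LINT om|M. (Jou a s t om)\<^sup>2) + \<sigma>^2 * (ou_sd a (t - s))^2 =
  (1 - exp (- a * (t - s)) ^ 2) * qG - 2 * exp (- a * (t - s)) * (1 - exp (- a * (t - s))) * mG^2"
  using Y_moments(2)[OF d(1)] tr[of "%x. x\<^sup>2"] by simp
qed

definition VG :: real where "VG = qG - mG^2"

text \<open>The Gaussian innovation over unit time has positive variance, and the second-moment
  identity passes this on to \<open>G\<close>.\<close>

lemma qG_pos: "qG > 0"
proof -
 have v: "ou_sd a 1 > 0" by (rule ou_sd_pos) (use a_pos in auto)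
 let ?r = "exp (- a)"
 have r: "0 < ?r" "?r < 1" using a_pos by auto
 have "0 < \<sigma>^2 * (ou_sd a 1)^2" using sigma v by simp
 also have "... <= (LINT om|M. (Jou a 0 1 om)\<^sup>2) + \<sigma>^2 * (ou_sd a 1)^2" by simp
 also have "... = (1 - ?r ^ 2) * qG - 2 * ?r * (1 - ?r) * mG^2" using Jou_moments(2)[of 0 1] by simp
 also have "... <= (1 - ?r ^ 2) * qG" using r by simp
 finally have "0 < (1 - ?r ^ 2) * qG" .
 moreover have "?r ^ 2 < 1" using r by (simp add: power_less_one_iff)
 ultimately show ?thesis by (simp add: zero_less_mult_iff)
qed

text \<open>At drift \<open>a\<close> the moments are exact. For another drift, the innovation built
  from the same jumps differs by at most \<open>|tt - a| (t - s)\<close> times the total variation,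
  so each moment moves by a multiple of that; the additional \<open>t - s\<close> in the variance
  comes from second-order terms of \<open>ou_sd\<close>.\<close>

lemma Jou_moments_near:
 "\<exists>C\<ge>0. \<forall>s t tt :: real. 0 <= s --> s < t --> t <= s + 1 --> 0 < tt --> tt <= 2 * a \<longrightarrow>
  \<bar>(LINT om|M. Jou tt s t om) - (1 - exp (- tt * (t - s))) * mG\<bar> <= C * \<bar>tt - a\<bar> * (t - s)
 & \<bar>(LINT om|M. (Jou tt s t om)\<^sup>2) - (LINT om|M. Jou tt s t om)^2 + \<sigma>^2 * (ou_sd tt (t - s))^2 - (1 - exp (- tt * (t - s)) ^ 2) * VG\<bar>
  <= C * (\<bar>tt - a\<bar> + (t - s)) * (t - s)
 & \<bar>\<integral>om. Jou tt s t om \<partial>M\<bar> <= C * (t - s)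
 & (LINT om|M. (Jou tt s t om)\<^sup>2) <= C * (t - s)"
proof -
 define c1 where "c1 = 1 + CA + \<bar>mG\<bar>"
 define c3 where "c3 = 2 * a * \<bar>mG\<bar> + a * c1"
 define c2 where "c2 = 2 * (1 + 2 * a) * CA + 2 * c3 * c1 + 4 * a * \<sigma>^2 + 2 * \<bar>VG\<bar>"
 define C where "C = c1 + c2 + c3 + (1 + 2 * a)^2 * CA"
 have pos: "c1 >= 0" "c3 >= 0" "c2 >= 0" "(1 + 2 * a)^2 * CA >= 0"
  using CA_nonneg a_pos by (auto simp: c1_def c2_def c3_def intro!: add_nonneg_nonneg mult_nonneg_nonneg)
 show ?thesis
 proof (intro exI[of _ C] conjI allI impI)
  show "C >= 0" using pos by (simp add: C_def)
  fix s t tt :: real assume st: "0 <= s" "s < t" "t <= s + 1" and th: "0 < tt" "tt <= 2 * a"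
  let ?d = "t - s" and ?e = "\<bar>tt - a\<bar>"
  let ?Ej = "\<integral>om. Jou tt s t om \<partial>M" and ?Ea = "\<integral>om. Jou a s t om \<partial>M"
  let ?Ej2 = "\<integral>om. (Jou tt s t om)\<^sup>2 \<partial>M" and ?Ea2 = "\<integral>om. (Jou a s t om)\<^sup>2 \<partial>M"
  have d: "0 < ?d" "?d <= 1" using st by auto
  have tha: "0 < a" "a <= 2 * a" using a_pos by auto
  note J = Jou_sq[OF st th] and Ja = Jou_sq[OF st tha] and A = Avar_sq[OF st] and mom = Jou_moments[OF st]
  have df: "\<bar>Jou tt s t om - Jou a s t om\<bar> <= ?e * ?d * Avar s t om" if "om : space M" for om
  by (rule Jou_diff_le[OF that st(1,2)]) (use th tha in auto)
  have ea: "?e <= a" using th by (auto simp: abs_le_iff)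
  have dE: "\<bar>?Ej - ?Ea\<bar> <= ?e * ?d * (1 + CA)"
  proof -
  have "\<bar>?Ej - ?Ea\<bar> = \<bar>\<integral>om. Jou tt s t om - Jou a s t om \<partial>M\<bar>" using J(3) Ja(3) by simp
  also have "... <= (LINT om|M. \<bar>Jou tt s t om - Jou a s t om\<bar>)" by (rule integral_abs_bound)
  also have "... <= (LINT om|M. ?e * ?d * Avar s t om)" by (rule integral_mono) (use J(3) Ja(3) A(3) df in auto)
  also have "... = ?e * ?d * (LINT om|M. Avar s t om)" using A(3) by simp
  also have "... <= ?e * ?d * (1 + CA)" using A(4) d by (intro mult_left_mono) auto
  finally show ?thesis .
  qed
  have rl: "\<bar>exp (- tt * ?d) - exp (- a * ?d)\<bar> <= ?e * ?d"
  using exp_neg_lipschitz[of "tt * ?d" "a * ?d"] th tha d by (simp add: left_diff_distrib[symmetric] abs_mult)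
  show 1: "\<bar>?Ej - (1 - exp (- tt * ?d)) * mG\<bar> <= C * ?e * ?d"
  proof -
  have "?Ej - (1 - exp (- tt * ?d)) * mG = (?Ej - ?Ea) + (exp (- tt * ?d) - exp (- a * ?d)) * mG"
  unfolding mom(1) by (simp add: algebra_simps)
  also have "\<bar>...\<bar> <= ?e * ?d * (1 + CA) + ?e * ?d * \<bar>mG\<bar>"
  using dE mult_right_mono[OF rl, of "\<bar>mG\<bar>"] by (intro order_trans[OF abs_triangle_ineq] add_mono) (auto simp: abs_mult)
  also have "... = c1 * ?e * ?d" by (simp add: c1_def algebra_simps)
  also have "... <= C * ?e * ?d" using pos d by (intro mult_right_mono) (auto simp: C_def)
  finally show ?thesis .
  qed
  have Ea: "\<bar>?Ea\<bar> <= a * \<bar>mG\<bar> * ?d"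
  proof -
  have "\<bar>1 - exp (- a * ?d)\<bar> <= a * ?d" using one_minus_exp_bounds(1)[of "a * ?d"] tha d by simp
  from mult_right_mono[OF this, of "\<bar>mG\<bar>"] show ?thesis unfolding mom(1) abs_mult by (simp only: mult_ac abs_ge_zero)
  qed
  have Ej: "\<bar>?Ej\<bar> <= c3 * ?d"
  proof -
  have "\<bar>?Ej\<bar> <= \<bar>?Ej - ?Ea\<bar> + \<bar>?Ea\<bar>" by linarith
  also have "... <= ?e * ?d * (1 + CA) + a * \<bar>mG\<bar> * ?d" using dE Ea by simp
  also have "?e * ?d * (1 + CA) <= a * ?d * c1" using ea d CA_nonneg tha by (intro mult_mono) (auto simp: c1_def)
  also have "a * ?d * c1 + a * \<bar>mG\<bar> * ?d <= c3 * ?d"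
  proof -
  have "c3 * ?d = a * ?d * c1 + a * \<bar>mG\<bar> * ?d + a * \<bar>mG\<bar> * ?d" by (simp add: c3_def algebra_simps)
  moreover have "0 <= a * \<bar>mG\<bar> * ?d" using d tha by simp
  ultimately show ?thesis by linarith
  qed
  finally show ?thesis by simp
  qed
  show "\<bar>?Ej\<bar> <= C * ?d" using Ej pos d by (elim order_trans) (auto intro!: mult_right_mono simp: C_def)
  show "?Ej2 <= C * ?d" using J(2) pos d by (elim order_trans) (auto intro!: mult_right_mono simp: C_def)
  have d2: "\<bar>?Ej2 - ?Ea2\<bar> <= ?e * ?d * (2 * (1 + 2 * a) * CA)"
  proof -
  have "\<bar>?Ej2 - ?Ea2\<bar> = \<bar>\<integral>om. (Jou tt s t om)\<^sup>2 - (Jou a s t om)^2 \<partial>M\<bar>" using J(1) Ja(1) by simp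
  also have "... <= (LINT om|M. \<bar>(Jou tt s t om)^2 - (Jou a s t om)^2\<bar>)" by (rule integral_abs_bound)
  also have "... <= (LINT om|M. ?e * ?d * (2 * (1 + 2 * a)) * (Avar s t om)^2)"
  proof (rule integral_mono)
  fix om assume w: "om : space M"
  have "\<bar>(Jou tt s t om)^2 - (Jou a s t om)^2\<bar> = \<bar>Jou tt s t om - Jou a s t om\<bar> * \<bar>Jou tt s t om + Jou a s t om\<bar>"
  by (rule abs_diff_sq)
  also have "... <= (?e * ?d * Avar s t om) * ((1 + 2 * a) * Avar s t om + (1 + 2 * a) * Avar s t om)"
  using df[OF w] J(4)[OF w] Ja(4)[OF w] Avar_nonneg[of s t om] d
  by (intro mult_mono order_trans[OF abs_triangle_ineq] add_mono) auto
  finally show "\<bar>(Jou tt s t om)^2 - (Jou a s t om)^2\<bar> <= ?e * ?d * (2 * (1 + 2 * a)) * (Avar s t om)^2"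
  by (simp add: power2_eq_square algebra_simps)
  qed (use J(1) Ja(1) A(1) in auto)
  also have "... = ?e * ?d * (2 * (1 + 2 * a)) * (LINT om|M. (Avar s t om)\<^sup>2)" using A(1) by simp
  also have "... <= ?e * ?d * (2 * (1 + 2 * a)) * CA"
  using A(2) mult_left_le[of ?d CA] CA_nonneg d tha by (intro mult_left_mono) auto
  finally show ?thesis by (simp add: mult.assoc)
  qed
  have dsq: "\<bar>?Ej\<^sup>2 - ?Ea\<^sup>2\<bar> <= ?e * ?d * (2 * c3 * c1)"
  proof -
  have "\<bar>?Ej\<^sup>2 - ?Ea\<^sup>2\<bar> = \<bar>?Ej - ?Ea\<bar> * \<bar>?Ej + ?Ea\<bar>" by (rule abs_diff_sq)
  also have "... <= (?e * ?d * c1) * (2 * c3)"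
  proof (rule mult_mono)
  show "\<bar>?Ej - ?Ea\<bar> <= ?e * ?d * c1" using dE d by (elim order_trans) (auto intro!: mult_left_mono simp: c1_def)
  have "\<bar>?Ea\<bar> <= c3"
  proof -
  have "a * \<bar>mG\<bar> * ?d <= a * \<bar>mG\<bar> * 1" using d tha by (intro mult_left_mono) auto
  also have "... <= c3" using tha pos by (simp add: c3_def)
  finally show ?thesis using Ea by simp
  qed
  moreover have "c3 * ?d <= c3" using mult_left_mono[of ?d 1 c3] d pos by simp
  ultimately show "\<bar>?Ej + ?Ea\<bar> <= 2 * c3" using Ej by linarith
  qed (use d pos in auto)
  finally show ?thesis by (simp add: mult_ac)
  qed
  have dv: "\<bar>(ou_sd tt ?d)^2 - (ou_sd a ?d)^2\<bar> <= 4 * a * ?d\<^sup>2"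
  proof -
  have "2 * tt * ?d\<^sup>2 <= 4 * a * ?d\<^sup>2" "2 * a * ?d\<^sup>2 <= 4 * a * ?d\<^sup>2" using th tha by (intro mult_right_mono; simp)+
  then show ?thesis using ou_sd_bounds[OF th(1) d(1)] ou_sd_bounds[OF tha(1) d(1)] by linarith
  qed
  have dr: "\<bar>exp (- tt * ?d) ^ 2 - exp (- a * ?d) ^ 2\<bar> <= 2 * (?e * ?d)"
  proof -
  have "\<bar>exp (- tt * ?d) ^ 2 - exp (- a * ?d) ^ 2\<bar> = \<bar>exp (- tt * ?d) - exp (- a * ?d)\<bar> * \<bar>exp (- tt * ?d) + exp (- a * ?d)\<bar>"
  by (rule abs_diff_sq)
  also have "... <= (?e * ?d) * 2"
  proof (rule mult_mono[OF rl])
  have "exp (- tt * ?d) <= 1" "exp (- a * ?d) <= 1" using th tha d by auto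
  then show "\<bar>exp (- tt * ?d) + exp (- a * ?d)\<bar> <= 2"
  using exp_gt_zero[of "- tt * ?d"] exp_gt_zero[of "- a * ?d"] by linarith
  qed (use d in auto)
  finally show ?thesis by simp
  qed
  \<comment> \<open>In variance form the terms with the mean of \<open>G\<close> combine and only
    its variance remains.\<close>
  have base: "?Ea2 - ?Ea\<^sup>2 + \<sigma>^2 * (ou_sd a ?d)^2 = (1 - exp (- a * ?d) ^ 2) * VG"
  using mom(2) unfolding mom(1) VG_def by (simp add: power2_eq_square algebra_simps)
  show "\<bar>?Ej2 - ?Ej\<^sup>2 + \<sigma>^2 * (ou_sd tt ?d)^2 - (1 - exp (- tt * ?d) ^ 2) * VG\<bar> <= C * (?e + ?d) * ?d"
  proof -
  have eq: "?Ej2 - ?Ej\<^sup>2 + \<sigma>^2 * (ou_sd tt ?d)^2 - (1 - exp (- tt * ?d) ^ 2) * VG =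
  (?Ej2 - ?Ea2) - (?Ej\<^sup>2 - ?Ea\<^sup>2) + \<sigma>^2 * ((ou_sd tt ?d)^2 - (ou_sd a ?d)^2) + (exp (- tt * ?d) ^ 2 - exp (- a * ?d) ^ 2) * VG"
  using base by (simp add: algebra_simps)
  have "\<bar>?Ej2 - ?Ej\<^sup>2 + \<sigma>^2 * (ou_sd tt ?d)^2 - (1 - exp (- tt * ?d) ^ 2) * VG\<bar>
  <= ?e * ?d * (2 * (1 + 2 * a) * CA) + ?e * ?d * (2 * c3 * c1) + \<sigma>^2 * (4 * a * ?d\<^sup>2) + 2 * (?e * ?d) * \<bar>VG\<bar>"
  unfolding eq
  proof -
  have "\<bar>\<sigma>^2 * ((ou_sd tt ?d)^2 - (ou_sd a ?d)^2)\<bar> <= \<sigma>^2 * (4 * a * ?d\<^sup>2)"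
  unfolding abs_mult using dv by (simp add: mult_left_mono)
  moreover have "\<bar>(exp (- tt * ?d) ^ 2 - exp (- a * ?d) ^ 2) * VG\<bar> <= 2 * (?e * ?d) * \<bar>VG\<bar>"
  unfolding abs_mult by (rule mult_right_mono[OF dr]) simp
  moreover have tri: "\<And>p q r w P Q R W :: real. \<bar>p\<bar> <= P ==> \<bar>q\<bar> <= Q ==> \<bar>r\<bar> <= R ==> \<bar>w\<bar> <= W ==> \<bar>p - q + r + w\<bar> <= P + Q + R + W"
  by linarith
  ultimately show "\<bar>(?Ej2 - ?Ea2) - (?Ej\<^sup>2 - ?Ea\<^sup>2) + \<sigma>^2 * ((ou_sd tt ?d)^2 - (ou_sd a ?d)^2) + (exp (- tt * ?d) ^ 2 - exp (- a * ?d) ^ 2) * VG\<bar>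
  <= ?e * ?d * (2 * (1 + 2 * a) * CA) + ?e * ?d * (2 * c3 * c1) + \<sigma>^2 * (4 * a * ?d\<^sup>2) + 2 * (?e * ?d) * \<bar>VG\<bar>"
  using d2 dsq by (intro tri)
  qed
  also have "... <= c2 * (?e + ?d) * ?d"
  proof -
  let ?k1 = "2 * (1 + 2 * a) * CA + 2 * c3 * c1 + 2 * \<bar>VG\<bar>"
  have k: "?k1 >= 0" "4 * a * \<sigma>^2 >= 0" using pos CA_nonneg tha by (auto intro!: add_nonneg_nonneg)
  have "?e * ?d * (2 * (1 + 2 * a) * CA) + ?e * ?d * (2 * c3 * c1) + \<sigma>^2 * (4 * a * ?d\<^sup>2) + 2 * (?e * ?d) * \<bar>VG\<bar>
  = ?k1 * (?e * ?d) + 4 * a * \<sigma>^2 * (?d * ?d)" by (simp add: power2_eq_square algebra_simps)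
  also have "... <= ?k1 * ((?e + ?d) * ?d) + 4 * a * \<sigma>^2 * ((?e + ?d) * ?d)"
  using k d by (intro add_mono mult_left_mono mult_right_mono) auto
  also have "... = c2 * (?e + ?d) * ?d" by (simp add: c2_def algebra_simps)
  finally show ?thesis .
  qed
  also have "... <= C * (?e + ?d) * ?d" using pos d by (intro mult_right_mono) (auto simp: C_def)
  finally show ?thesis .
  qed
 qed
qed

end

section \<open>A law of large numbers for the squared observations\<close>

lemma indep_alg_compose:
 assumes "indep_alg M H S V" "f \<in> measurable S T"
 shows "indep_alg M H T (%om. f (V om))"
 unfolding indep_alg_def
proof (intro conjI ballI)
 have V: "V \<in> measurable M S" using assms(1) by (rule indep_algD)
 show "subalgebra M H" using assms(1) by (rule indep_algD)
 show "(%om. f (V om)) \<in> measurable M T" by (rule measurable_compose[OF V assms(2)])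
 fix A B assume A: "A \<in> sets H" and B: "B \<in> sets T"
 have "(%om. f (V om)) -` B \<inter> space M = V -` (f -` B \<inter> space S) \<inter> space M"
  using measurable_space[OF V] by auto
 moreover have "f -` B \<inter> space S \<in> sets S" using assms(2) B by auto
 ultimately show "measure M (A \<inter> ((%om. f (V om)) -` B \<inter> space M)) = measure M A * measure M ((%om. f (V om)) -` B \<inter> space M)"
  using assms(1)[unfolded indep_alg_def, THEN conjunct2, THEN conjunct2, rule_format, OF A] by (simp only:)
qed

lemma adapted_indep_compose:
 assumes "adapted_indep M H V k" "\<And>i. i < k ==> f i : bmeas borel"
 shows "adapted_indep M H (%i om. f i (V i om)) k"
 using assms(1) unfolding adapted_indep_def
 by (auto intro!: indep_alg_compose[OF _ assms(2)] measurable_compose[OF _ assms(2)])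

context prob_space
begin

lemma abs_le_sq:
 fixes f :: "'a => real"
 assumes [measurable]: "f : bmeas M" and i: "integrable M (%om. (f om)\<^sup>2)"
 shows "integrable M f" "(LINT om|M. \<bar>f om\<bar>) <= 1 + (LINT om|M. (f om)\<^sup>2)"
proof -
 show 1: "integrable M f" by (rule square_integrable_imp_integrable[OF _ i]) simp
 have "(LINT om|M. \<bar>f om\<bar>) <= (LINT om|M. 1 + (f om)^2)"
 proof (rule integral_mono)
  fix om show "\<bar>f om\<bar> <= 1 + (f om)^2" using sum_squares_bound[of "\<bar>f om\<bar>" 1] by (simp add: power2_eq_square)
 qed (use 1 i in auto)
 then show "(LINT om|M. \<bar>f om\<bar>) <= 1 + (LINT om|M. (f om)\<^sup>2)" using i by (simp add: prob_space)
qed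

lemma indep_cross:
 assumes ind: "indep_alg M H borel V" and c: "c : bmeas H"
  and ci: "integrable M (%om. (c om)\<^sup>2)" and Vi: "integrable M (%om. (V om)\<^sup>2)" and V0: "(LINT om|M. V om) = (0::real)"
 shows "integrable M (%om. c om * V om)" "(LINT om|M. c om * V om) = 0"
proof -
 have cM: "c : bmeas M" and VM: "V : bmeas M" using indep_algD[OF ind] c by auto
 have iv: "indep_var borel c borel V" using indep_alg_indep_var[OF ind c, of "%x. x" borel] by simp
 note i = abs_le_sq(1)[OF cM ci] abs_le_sq(1)[OF VM Vi]
 show "integrable M (%om. c om * V om)" "(LINT om|M. c om * V om) = 0"
  using indep_var_integrable[OF iv i] indep_var_lebesgue_integral[OF iv i] V0 by auto
qed

lemma adapted_sum_oP:
 fixes c V :: "nat => nat => 'a => real"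
 assumes "EVN n. adapted_indep M (H n) (V n) n \<and>
  (\<forall>i<n. c n i : bmeas (H n i) & integrable M (%om. (c n i om)\<^sup>2) & integrable M (%om. (V n i om)\<^sup>2) \<and>
  (LINT om|M. V n i om) = 0) \<and>
  (\<Sum>i<n. (LINT om|M. (c n i om)\<^sup>2) * (LINT om|M. (V n i om)\<^sup>2)) <= b n" and "b ---> 0"
 shows "oP M (%n om. \<Sum>i<n. c n i om * V n i om)"
proof (rule oP_L2[OF _ assms(2)], use assms(1) in eventually_elim)
 case (elim n)
 then have ad: "adapted_indep M (H n) (V n) n" by blast
 from adapted_sum_L2[OF ad, of "c n"] elim show ?case by auto
qed

lemma bP_adapted_sum:
 fixes c V :: "nat => nat => 'a => real"
 assumes "EVN n. adapted_indep M (H n) (V n) n \<and>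
  (\<forall>i<n. c n i : bmeas (H n i) & integrable M (%om. (c n i om)\<^sup>2) & integrable M (%om. (V n i om)\<^sup>2) \<and>
  (LINT om|M. V n i om) = 0) \<and>
  (\<Sum>i<n. (LINT om|M. (c n i om)\<^sup>2) * (LINT om|M. (V n i om)\<^sup>2)) <= B"
 shows "bP M (%n om. \<Sum>i<n. c n i om * V n i om)"
proof (rule bP_L2[of _ B], use assms in eventually_elim)
 case (elim n)
 then have ad: "adapted_indep M (H n) (V n) n" by blast
 from adapted_sum_L2[OF ad, of "c n"] elim show ?case by auto
qed

lemma oP_sum_L1:
 fixes Y :: "nat => nat => 'a => real"
 assumes "EVN n. (\<forall>i<n. integrable M (Y n i)) & (\<Sum>i<n. \<integral>om. \<bar>Y n i om\<bar> \<partial>M) <= b n" and "b ---> 0"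
 shows "oP M (%n om. \<Sum>i<n. Y n i om)"
proof (rule oP_L1[OF _ assms(2)], use assms(1) in eventually_elim)
 case (elim n)
 have i: "integrable M (%om. \<Sum>i<n. Y n i om)" by (rule Bochner_Integration.integrable_sum) (use elim in auto)
 have "(LINT om|M. \<bar>\<Sum>i<n. Y n i om\<bar>) <= (LINT om|M. (\<Sum>i<n. \<bar>Y n i om\<bar>))"
  by (rule integral_mono) (use i elim in \<open>auto intro!: sum_abs Bochner_Integration.integrable_sum\<close>)
 also have "... = (\<Sum>i<n. \<integral>om. \<bar>Y n i om\<bar> \<partial>M)" by (rule Bochner_Integration.integral_sum) (use elim in auto)
 finally show ?case using i elim by auto
qed

text \<open>The decomposition may change with \<open>e\<close>, as truncation at an
  \<open>e\<close>-dependent level makes it do.\<close>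

lemma oP_approx:
 assumes "\<And>e. e > 0 ==> \<exists>U R. oP M U & (EVN n. integrable M (R n) & (LINT om|M. \<bar>R n om\<bar>) <= e)
  & (EVN n. \<forall>om\<in>space M. X n om = U n om + R n om)"
 shows "oP M X"
proof (rule oPI)
 fix e :: real assume e: "e > 0"
 then have "e / 2 * (e / 2) > 0" by simp
 from assms[OF this] obtain U R where U: "oP M U" and R: "EVN n. integrable M (R n) & (LINT om|M. \<bar>R n om\<bar>) <= e / 2 * (e / 2)"
  and X: "EVN n. \<forall>om\<in>space M. X n om = U n om + R n om" by blast
 have e2: "e / 2 > 0" using e by simp
 from oPD[OF U e2] R X
 show "EVN n. \<exists>A\<in>sets M. measure M A <= e & (\<forall>om\<in>space M - A. \<bar>X n om\<bar> <= e)"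
 proof eventually_elim
  case (elim n)
  then obtain A where A: "A \<in> sets M" "measure M A <= e/2" "\<And>om. om : space M - A ==> \<bar>U n om\<bar> <= e/2" by blast
  let ?B = "{om\<in>space M. \<bar>R n om\<bar> >= e / 2}"
  have "measure M ?B <= (LINT om|M. \<bar>R n om\<bar>) / (e / 2)"
  by (rule integral_Markov_inequality_measure[where A="{}"]) (use elim e in auto)
  also have "... <= e / 2" using elim(2) e by (simp add: pos_divide_le_eq)
  finally have B: "measure M ?B <= e / 2" .
  have [measurable]: "R n : bmeas M" using elim by auto
  have Bm: "?B \<in> events" by measurable
  show ?case
  proof (intro bexI[of _ "A \<union> ?B"] conjI ballI)
  show "prob (A \<union> ?B) <= e" using measure_Un_le[OF A(1) Bm] A(2) B by simp
  fix om assume w: "om : space M - (A \<union> ?B)"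
  then have "\<bar>U n om\<bar> <= e / 2" "\<bar>R n om\<bar> <= e / 2" "X n om = U n om + R n om" using A(3) elim(3) by auto
  then show "\<bar>X n om\<bar> <= e" by linarith
  qed (use A Bm in auto)
 qed
qed

end

text \<open>A discrete Gronwall argument: every level not below \<open>c / \<kappa>\<close> is
  preserved by the recursion.\<close>

lemma contraction_bound:
 fixes u d :: "nat => real"
 assumes "\<kappa> > 0" "c >= 0" "\<And>i. i < n ==> 0 <= d i & \<kappa> * d i <= 1"
  and "\<And>i. i < n ==> u (Suc i) <= (1 - \<kappa> * d i) * u i + c * d i" "u 0 <= B" "c / \<kappa> <= B"
 shows "i <= n ==> u i <= B"
proof (induction i)
 case (Suc i)
 then have i: "i < n" by simp
 have "u (Suc i) <= (1 - \<kappa> * d i) * u i + c * d i" by (rule assms(4)[OF i])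
 also have "(1 - \<kappa> * d i) * u i <= (1 - \<kappa> * d i) * B" using Suc assms(3)[OF i] by (intro mult_left_mono) auto
 also have "c * d i <= (B * \<kappa>) * d i" using assms(1,3,6) i by (intro mult_right_mono) (auto simp: pos_divide_le_eq)
 finally show ?case by (simp add: algebra_simps)
qed (use assms in simp)

text \<open>The drift is a sequence with limit \<open>a\<close>: the constant one serves the limit
  law and the likelihood expansion, local alternatives serve regularity.\<close>

locale ou_array = stat_ou M X0 W N Z F \<sigma> lam X a S for M :: "'a measure" and X0 W N Z F \<sigma> lam X a S +
 fixes t :: "nat => nat => real" and \<beta> :: real and th :: "nat => real"
 assumes grid0: "\<And>n. t n 0 = 0"
  and grid_incr: "\<And>n i. i < n ==> t n i < t n (Suc i)"
  and T_inf: "filterlim (grid_T t) at_top sequentially"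
  and mesh_0: "grid_mesh t ---> 0"
  and nmesh: "(%n. real n * grid_mesh t n / grid_T t n) \<in> O(%_. 1)"
  and small_jumps: "(%n. measure F {- 2 * grid_mesh t n powr \<beta> <..< 2 * grid_mesh t n powr \<beta>})
  \<in> o(%n. 1 / grid_T t n)"
  and beta: "0 < \<beta>" "\<beta> < 1 / 2"
  and rate: "(%n. grid_T t n * grid_mesh t n powr (min (1 - 2 * \<beta>) (1 / 2))) ---> 0"
  and th_pos: "\<And>n. th n > 0" and th_lim: "th ---> a"
begin

abbreviation "T \<equiv> grid_T t"
abbreviation "\<Delta> \<equiv> grid_mesh t"

definition d :: "nat => nat => real" where "d n i = t n (Suc i) - t n i"
definition x :: "nat => nat => 'a => real" where "x n i om = X (th n) (t n i) om"
definition jj :: "nat => nat => 'a => real" where "jj n i = jmp (th n) (t n) i"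
definition g :: "nat => nat => 'a => real" where "g n i = gau (th n) (t n) i"
definition rho :: "nat => nat => real" where "rho n i = exp (- th n * d n i)"
definition sd :: "nat => nat => real" where "sd n i = \<sigma> * ou_sd (th n) (d n i)"
definition Ej :: "nat => nat => real" where "Ej n i = (LINT om|M. jj n i om)"
definition jt :: "nat => nat => 'a => real" where "jt n i om = jj n i om - Ej n i"
text \<open>Bias in the recursion for centred observations: the centring \<open>mG\<close> belongs
  to drift \<open>a\<close>, the dynamics to \<open>th n\<close>. It vanishes when the two
  agree.\<close>

definition b :: "nat => nat => real" where "b n i = Ej n i - (1 - rho n i) * mG"
definition xt :: "nat => nat => 'a => real" where "xt n i om = x n i om - mG"
definition eps :: "nat => real" where "eps n = \<bar>th n - a\<bar> + \<Delta> n"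

abbreviation "G n \<equiv> HG (th n) (t n)"
abbreviation "K n \<equiv> HJ (th n) (t n)"

text \<open>Conditions valid for all large \<open>n\<close> under which the explicit estimates hold;
  the last one yields \<open>th n * d n i <= 1 / 2\<close>.\<close>

definition good :: "nat => bool" where
 "good n \<longleftrightarrow> 1 <= n & 1 <= T n & 0 < \<Delta> n & \<Delta> n <= 1 & a / 2 <= th n & th n <= 2 * a & 2 * a * \<Delta> n <= 1 / 2"

lemma gr: "grid (t n) n" using grid0 grid_incr by (simp add: grid_def)

lemma d_pos: "i < n ==> d n i > 0" using grid_incr by (simp add: d_def)

lemma d_le: "i < n ==> d n i <= \<Delta> n"
 unfolding grid_mesh_def d_def by (rule Max_ge) auto

lemma sum_d: "(\<Sum>i<n. d n i) = T n"
 unfolding d_def sum_lessThan_telescope by (simp add: grid_T_def grid0)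

lemma mesh_pos: "1 <= n ==> 0 < \<Delta> n" using d_pos[of 0 n] d_le[of 0 n] by simp

lemma sum_d2: "(\<Sum>i<n. (d n i)\<^sup>2) <= \<Delta> n * T n"
proof -
 have "(\<Sum>i<n. (d n i)\<^sup>2) <= (\<Sum>i<n. \<Delta> n * d n i)"
  by (rule sum_mono) (use d_pos d_le in \<open>auto simp: power2_eq_square intro!: mult_right_mono less_imp_le\<close>)
 then show ?thesis by (simp add: sum_distrib_left[symmetric] sum_d)
qed

lemma good_ev: "EVN n. good n"
proof -
 have "EVN n. 1 <= T n" using T_inf by (simp add: filterlim_at_top)
 moreover have "EVN n. \<Delta> n < min 1 (1 / (4 * a))"
  by (rule order_tendstoD(2)[OF mesh_0]) (use a_pos in auto)
 moreover have "EVN n. a / 2 < th n" by (rule order_tendstoD(1)[OF th_lim]) (use a_pos in auto)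
 moreover have "EVN n. th n < 2 * a" by (rule order_tendstoD(2)[OF th_lim]) (use a_pos in auto)
 ultimately show ?thesis using eventually_ge_at_top[of 1]
 proof eventually_elim
  case (elim n)
  then show ?case using mesh_pos[of n] a_pos by (auto simp: good_def field_simps)
 qed
qed

lemma goodD:
 assumes "good n"
 shows "1 <= n" "1 <= T n" "0 < T n" "0 < \<Delta> n" "\<Delta> n <= 1" "a / 2 <= th n" "th n <= 2 * a" "2 * a * \<Delta> n <= 1 / 2"
  and "i < n ==> d n i <= 1" "i < n ==> th n * d n i <= 1 / 2" "\<bar>th n - a\<bar> <= a"
proof -
 show "i < n ==> d n i <= 1" using assms d_le[of i n] by (auto simp: good_def)
 show "i < n ==> th n * d n i <= 1 / 2"
 proof -
  assume i: "i < n"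
  have "th n * d n i <= (2 * a) * \<Delta> n" using assms i d_le[OF i] d_pos[OF i] a_pos by (intro mult_mono) (auto simp: good_def)
  then show ?thesis using assms by (simp add: good_def)
 qed
qed (use assms a_pos in \<open>auto simp: good_def abs_le_iff\<close>)

lemma eps_lim: "eps ---> 0"
 unfolding eps_def[abs_def] using tendsto_add[OF tendsto_rabs[OF tendsto_diff[OF th_lim tendsto_const[of a]]] mesh_0] by simp

lemma eps_nonneg: "good n ==> eps n >= 0" "good n ==> eps n <= a + 1"
 using goodD[of n] by (auto simp: eps_def)

lemma inv_T: "(%n. 1 / T n) ---> 0"
 using tendsto_inverse_0_at_top[OF T_inf] by (simp add: inverse_eq_divide)

lemma step: "i < n ==> om : space M ==> x n (Suc i) om = rho n i * x n i om + jj n i om + sd n i * g n i om"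
 using X_grid_step[OF gr _ th_pos] unfolding x_def jj_def g_def rho_def sd_def d_def by simp

lemma step_t: "i < n ==> om : space M ==> xt n (Suc i) om = rho n i * xt n i om + jt n i om + sd n i * g n i om + b n i"
 using step unfolding xt_def jt_def b_def by (simp add: algebra_simps)

lemma rho_bounds: "i < n ==> 0 < rho n i" "i < n ==> rho n i < 1"
 using d_pos[of i n] th_pos[of n] by (auto simp: rho_def)

lemma rho_lin: "i < n ==> \<bar>1 - rho n i - th n * d n i\<bar> <= (th n * d n i)^2"
 using one_minus_exp_bounds(3)[of "th n * d n i"] d_pos[of i n] th_pos[of n] by (simp add: rho_def)

lemma rho2_lin: "i < n ==> \<bar>1 - (rho n i)^2 - 2 * th n * d n i\<bar> <= 4 * (th n * d n i)^2"
proof -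
 assume i: "i < n"
 have "(rho n i)^2 = exp (- (2 * th n * d n i))" by (simp add: rho_def power2_eq_square exp_add[symmetric])
 then show ?thesis using one_minus_exp_bounds(3)[of "2 * th n * d n i"] d_pos[OF i] th_pos[of n] by (simp add: power2_eq_square)
qed

lemma g_ad: "adapted_indep M (G n) (g n) n"
 unfolding g_def[abs_def] by (rule gau_adapted(1)[OF gr th_pos])

lemma j_ad: "adapted_indep M (K n) (jj n) n"
 unfolding jj_def[abs_def] by (rule jmp_adapted(1)[OF gr])

lemma jt_ad: "adapted_indep M (K n) (jt n) n"
 unfolding jt_def[abs_def] by (rule adapted_indep_compose[OF j_ad, where f="%i y. y - Ej n i"]) simp

lemma g_distr: "i < n ==> distr M borel (g n i) = std_normal_distribution"
 unfolding g_def by (rule gau_adapted(3)[OF gr th_pos])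

lemma g_M: "i < n ==> g n i : bmeas M" using indep_algD(2)[OF adapted_indepD(3)[OF g_ad]] .
lemma jj_M: "i < n ==> jj n i : bmeas M" using indep_algD(2)[OF adapted_indepD(3)[OF j_ad]] .
lemma jt_M: "i < n ==> jt n i : bmeas M" using indep_algD(2)[OF adapted_indepD(3)[OF jt_ad]] .
lemma x_G: "i <= n ==> x n i : bmeas (G n i)" unfolding x_def[abs_def] by (rule X_HG[OF gr th_pos])
lemma x_K: "i <= n ==> x n i : bmeas (K n i)" unfolding x_def[abs_def] by (rule X_HJ[OF gr th_pos])
lemma xt_G: "i <= n ==> xt n i : bmeas (G n i)" unfolding xt_def[abs_def] by (intro borel_measurable_diff x_G) auto
lemma xt_K: "i <= n ==> xt n i : bmeas (K n i)" unfolding xt_def[abs_def] by (intro borel_measurable_diff x_K) auto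
lemma x_M: "i <= n ==> x n i : bmeas M" using adapted_indep_measurable[OF g_ad _ x_G] by auto
lemma xt_M: "i <= n ==> xt n i : bmeas M" using adapted_indep_measurable[OF g_ad _ xt_G] by auto
lemma jj_G: "i <= n ==> l < n ==> jj n l : bmeas (G n i)" unfolding jj_def by (rule jmp_HG[OF gr th_pos])
lemma jt_G: "i <= n ==> l < n ==> jt n l : bmeas (G n i)" unfolding jt_def[abs_def] by (intro borel_measurable_diff jj_G) auto

lemma g_mom: assumes "i < n"
 shows "integrable M (%om. (g n i om) ^ k)" "(LINT om|M. g n i om) = 0" "(LINT om|M. (g n i om)\<^sup>2) = 1" "(LINT om|M. (g n i om) ^ 4) = 3"
  and "integrable M (g n i)"
 using std_normal_moments[OF g_M[OF assms] g_distr[OF assms]] std_normal_moments(1)[OF g_M[OF assms] g_distr[OF assms], of 1] by auto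

lemma g2_mom: assumes "i < n"
 shows "integrable M (%om. ((g n i om)^2 - 1)\<^sup>2)" "(LINT om|M. (g n i om)\<^sup>2 - 1) = 0" "(LINT om|M. ((g n i om)^2 - 1)\<^sup>2) = 2"
proof -
 note m = g_mom[OF assms]
 have e: "((g n i om)^2 - 1)^2 = (g n i om) ^ 4 - 2 * (g n i om)^2 + 1" for om
  by (simp add: power2_eq_square power4_eq_xxxx algebra_simps)
 show "integrable M (%om. ((g n i om)^2 - 1)\<^sup>2)" "(LINT om|M. (g n i om)\<^sup>2 - 1) = 0" "(LINT om|M. ((g n i om)^2 - 1)\<^sup>2) = 2"
  unfolding e using m(1)[of 4] m(1)[of 2] m(3,4) by (simp_all add: prob_space)
qed

lemma sd_bound: "i < n ==> (sd n i)\<^sup>2 <= \<sigma>^2 * d n i" "i < n ==> 0 < (sd n i)^2"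
 using ou_sd_bounds(1)[OF th_pos[of n] d_pos[of i n]] ou_sd_pos[OF th_pos[of n] d_pos[of i n]] sigma
 by (auto simp: sd_def power_mult_distrib)

text \<open>Chosen once, so that the same constant serves all \<open>n\<close> and
  \<open>i\<close>.\<close>

definition CJ :: real where "CJ = (SOME C. 0 <= C & (\<forall>s t tt :: real. 0 <= s --> s < t --> t <= s + 1 --> 0 < tt --> tt <= 2 * a \<longrightarrow>
  \<bar>(LINT om|M. Jou tt s t om) - (1 - exp (- tt * (t - s))) * mG\<bar> <= C * \<bar>tt - a\<bar> * (t - s)
 & \<bar>(LINT om|M. (Jou tt s t om)\<^sup>2) - (LINT om|M. Jou tt s t om)^2 + \<sigma>^2 * (ou_sd tt (t - s))^2 - (1 - exp (- tt * (t - s)) ^ 2) * VG\<bar>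
  <= C * (\<bar>tt - a\<bar> + (t - s)) * (t - s)
 & \<bar>\<integral>om. Jou tt s t om \<partial>M\<bar> <= C * (t - s)
 & (LINT om|M. (Jou tt s t om)\<^sup>2) <= C * (t - s)))"

lemma jj_mom:
 assumes gd: "good n" and i: "i < n"
 shows "CJ >= 0" "\<bar>b n i\<bar> <= CJ * eps n * d n i" "\<bar>Ej n i\<bar> <= CJ * d n i"
  "integrable M (%om. (jj n i om)\<^sup>2)" "integrable M (jj n i)" "(LINT om|M. (jj n i om)\<^sup>2) <= CJ * d n i"
  "integrable M (%om. (jt n i om)\<^sup>2)" "(LINT om|M. jt n i om) = 0" "(LINT om|M. (jt n i om)\<^sup>2) <= CJ * d n i"
  "\<bar>(LINT om|M. (jt n i om)\<^sup>2) + (sd n i)^2 - (1 - (rho n i)^2) * VG\<bar> <= CJ * eps n * d n i"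
proof -
 have st: "0 <= t n i" "t n i < t n (Suc i)" "t n (Suc i) <= t n i + 1"
  using gridD(1,2)[OF gr i] goodD(9)[OF gd i] by (auto simp: d_def)
 have thb: "0 < th n" "th n <= 2 * a" using th_pos goodD[OF gd] by auto
 have J: "jj n i = Jou (th n) (t n i) (t n (Suc i))" by (simp add: jj_def jmp_def fun_eq_iff)
 from someI_ex[OF Jou_moments_near[unfolded Bex_def], folded CJ_def]
 have C0: "CJ >= 0" and C: "0 <= s ==> s < t ==> t <= s + 1 ==> 0 < tt ==> tt <= 2 * a ==>
  \<bar>(LINT om|M. Jou tt s t om) - (1 - exp (- tt * (t - s))) * mG\<bar> <= CJ * \<bar>tt - a\<bar> * (t - s)
 & \<bar>(LINT om|M. (Jou tt s t om)\<^sup>2) - (LINT om|M. Jou tt s t om)^2 + \<sigma>^2 * (ou_sd tt (t - s))^2 - (1 - exp (- tt * (t - s)) ^ 2) * VG\<bar>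
  <= CJ * (\<bar>tt - a\<bar> + (t - s)) * (t - s)
 & \<bar>\<integral>om. Jou tt s t om \<partial>M\<bar> <= CJ * (t - s)
 & (LINT om|M. (Jou tt s t om)\<^sup>2) <= CJ * (t - s)" for s t tt :: real
  by blast+
 note C' = C[OF st thb, folded J d_def Ej_def rho_def]
 have EJ: "Ej n i = expectation (jj n i)" by (simp add: Ej_def)
 have RH: "rho n i = exp (- th n * d n i)" by (simp add: rho_def)
 note dp = d_pos[OF i] and dl = d_le[OF i]
 show "CJ >= 0" by (rule C0)
 have e1: "CJ * \<bar>th n - a\<bar> * d n i <= CJ * eps n * d n i"
  using C0 dp goodD(4)[OF gd] by (intro mult_right_mono mult_left_mono) (auto simp: eps_def)
 show "\<bar>b n i\<bar> <= CJ * eps n * d n i" using C' e1 unfolding b_def EJ RH by linarith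
 show "\<bar>Ej n i\<bar> <= CJ * d n i" using C' unfolding EJ by simp
 show j2: "integrable M (%om. (jj n i om)\<^sup>2)" and j1: "integrable M (jj n i)" using Jou_sq[OF st thb] by (auto simp: J)
 show j2b: "(LINT om|M. (jj n i om)\<^sup>2) <= CJ * d n i" using C' by simp
 have e: "(jt n i om)^2 = (jj n i om)^2 - 2 * Ej n i * jj n i om + (Ej n i)^2" for om
  by (simp add: jt_def power2_eq_square algebra_simps)
 show "integrable M (%om. (jt n i om)\<^sup>2)" unfolding e using j1 j2 by simp
 show "(LINT om|M. jt n i om) = 0" using j1 by (simp add: jt_def[abs_def] Ej_def prob_space)
 have v: "(LINT om|M. (jt n i om)\<^sup>2) = (LINT om|M. (jj n i om)\<^sup>2) - (Ej n i)^2"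
  unfolding e using j1 j2 by (simp add: prob_space Ej_def[symmetric]) (simp add: power2_eq_square)
 then show "(LINT om|M. (jt n i om)\<^sup>2) <= CJ * d n i" using j2b by (smt (verit) zero_le_power2)
 have "CJ * (\<bar>th n - a\<bar> + d n i) * d n i <= CJ * eps n * d n i"
  using C0 dp dl by (intro mult_right_mono mult_left_mono) (auto simp: eps_def)
 then show "\<bar>(LINT om|M. (jt n i om)\<^sup>2) + (sd n i)^2 - (1 - (rho n i)^2) * VG\<bar> <= CJ * eps n * d n i"
  using C' unfolding v sd_def power_mult_distrib EJ RH by linarith
qed

lemma CJ_nonneg: "CJ >= 0"
 using eventually_happens[OF good_ev] jj_mom(1)[of _ 0] goodD(1) by fastforce

text \<open>The larger of a bound for the initial second moment and the level
  \<open>c / \<kappa>\<close> of the one-step contraction with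
  \<open>\<kappa> = a / 4\<close>.\<close>

definition Bx :: real where
 "Bx = max (2 * S + 2 * mG^2) ((CJ + \<sigma>^2 + CJ^2 * (a + 1)^2 * (1 + 2 / a)) / (a / 4))"

text \<open>One step multiplies the second moment by at most \<open>1 - (a / 4) d\<close> and adds a
  multiple of \<open>d\<close>: the cross terms vanish, each by orthogonality in one of the two
  filtrations, and the bias \<open>b\<close> is absorbed by Young's inequality.\<close>

lemma xt_sq:
 assumes gd: "good n"
 shows "i <= n ==> integrable M (%om. (xt n i om)\<^sup>2)" "i <= n ==> (LINT om|M. (xt n i om)\<^sup>2) <= Bx"
proof -
 have z: "xt n 0 om = X0 om - mG" if "om : space M" for om using X_zero[OF that] by (simp add: xt_def x_def grid0)
 have X01: "integrable M X0" by (rule abs_le_sq(1)[OF measurable_M(1) X0_sq(1)])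
 have i0: "integrable M (%om. (xt n 0 om)\<^sup>2)"
 proof -
  have "integrable M (%om. (X0 om)\<^sup>2 - 2 * mG * X0 om + mG^2)" using X0_sq(1) X01 by simp
  moreover have "integrable M (%om. (X0 om)\<^sup>2 - 2 * mG * X0 om + mG^2) \<longleftrightarrow> integrable M (%om. (xt n 0 om)\<^sup>2)"
  by (rule Bochner_Integration.integrable_cong) (auto simp: z power2_eq_square algebra_simps)
  ultimately show ?thesis by blast
 qed
 have stepI: "integrable M (%om. (xt n (Suc i) om)\<^sup>2) \<and>
  (LINT om|M. (xt n (Suc i) om)\<^sup>2) <= (1 - a / 4 * d n i) * (LINT om|M. (xt n i om)\<^sup>2) + (CJ + \<sigma>^2 + CJ^2 * (a + 1)^2 * (1 + 2 / a)) * d n i"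
  if i: "i < n" and ii: "integrable M (%om. (xt n i om)\<^sup>2)" for i
 proof -
  define u where "u om = rho n i * xt n i om + b n i" for om
  note jm = jj_mom[OF gd i] and gm = g_mom[OF i]
  have xm: "xt n i : bmeas M" using xt_M i by simp
  have x1: "integrable M (xt n i)" by (rule abs_le_sq(1)[OF xm ii])
  have uK: "u : bmeas (K n i)" unfolding u_def using xt_K[of i n] i by (intro borel_measurable_add borel_measurable_times) auto
  have uG: "u : bmeas (G n i)" unfolding u_def using xt_G[of i n] i by (intro borel_measurable_add borel_measurable_times) auto
  have e: "(u om)^2 = (rho n i)^2 * (xt n i om)^2 + 2 * rho n i * b n i * xt n i om + (b n i)^2" for om
  by (simp add: u_def power2_eq_square algebra_simps)
  have u2: "integrable M (%om. (u om)\<^sup>2)" unfolding e using ii x1 by simp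
  have jtg: "jt n i : bmeas (G n i)" using jt_G i by simp
  have c1: "integrable M (%om. u om * jt n i om)" "(LINT om|M. u om * jt n i om) = 0"
  using indep_cross[OF adapted_indepD(3)[OF jt_ad i] uK u2 jm(7,8)] by auto
  have g2: "integrable M (%om. (g n i om)\<^sup>2)" using gm(1)[of 2] .
  have c2: "integrable M (%om. u om * g n i om)" "(LINT om|M. u om * g n i om) = 0"
  using indep_cross[OF adapted_indepD(3)[OF g_ad i] uG u2 g2 gm(2)] by auto
  have c3: "integrable M (%om. jt n i om * g n i om)" "(LINT om|M. jt n i om * g n i om) = 0"
  using indep_cross[OF adapted_indepD(3)[OF g_ad i] jtg jm(7) g2 gm(2)] by auto
  let ?R = "%om. (u om)\<^sup>2 + (jt n i om)^2 + (sd n i)^2 * (g n i om)^2 + 2 * (u om * jt n i om) + 2 * sd n i * (u om * g n i om) + 2 * sd n i * (jt n i om * g n i om)"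
  have eq: "(xt n (Suc i) om)^2 = ?R om" if "om : space M" for om
  using step_t[OF i that] by (simp add: u_def power2_eq_square algebra_simps)
  have iR: "integrable M ?R" using u2 jm(7) g2 c1 c2 c3 by simp
  have "integrable M (%om. (xt n (Suc i) om)\<^sup>2) \<longleftrightarrow> integrable M ?R" by (rule Bochner_Integration.integrable_cong) (auto simp: eq)
  with iR have I: "integrable M (%om. (xt n (Suc i) om)\<^sup>2)" by blast
  have "(LINT om|M. (xt n (Suc i) om)\<^sup>2) = (LINT om|M. ?R om)" by (rule Bochner_Integration.integral_cong) (auto simp: eq)
  also have "... = (LINT om|M. (u om)\<^sup>2) + (LINT om|M. (jt n i om)\<^sup>2) + (sd n i)^2"
  using u2 jm(7) g2 c1 c2 c3 gm(3) by simp
  also have "... <= (LINT om|M. (u om)\<^sup>2) + CJ * d n i + \<sigma>^2 * d n i" using jm(9) sd_bound(1)[OF i] by simp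
  also have "(LINT om|M. (u om)\<^sup>2) <= (1 - a / 4 * d n i) * (LINT om|M. (xt n i om)\<^sup>2) + CJ^2 * (a + 1)^2 * (1 + 2 / a) * d n i"
  proof -
  \<comment> \<open>Young's inequality with weight \<open>k\<close> costs a factor
    \<open>1 + k <= exp k\<close>, so one factor \<open>exp (- k)\<close> of the contraction
    \<open>exp (- 2 k)\<close> survives.\<close>
  define k where "k = th n * d n i"
  have k: "0 < k" "k <= 1/2" using th_pos[of n] d_pos[OF i] goodD(10)[OF gd i] by (auto simp: k_def)
  have kd: "a / 2 * d n i <= k" unfolding k_def using goodD(6)[OF gd] d_pos[OF i] by (intro mult_right_mono) auto
  have "(1 + k) * (rho n i)^2 <= exp k * (rho n i)^2" by (intro mult_right_mono exp_ge_add_one_self) auto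
  also have "... = exp (- k)" by (simp add: rho_def k_def power2_eq_square exp_add[symmetric])
  also have "... <= 1 - k + k^2" using one_minus_exp_bounds(2)[of k] k by simp
  also have "k^2 <= k / 2" using k mult_left_mono[of k "1/2" k] by (simp add: power2_eq_square)
  finally have r: "(1 + k) * (rho n i)^2 <= 1 - a / 4 * d n i" using kd by simp
  have pt: "(u om)^2 <= (1 - a / 4 * d n i) * (xt n i om)^2 + (1 + 1 / k) * (b n i)^2" for om
  proof -
  let ?p = "rho n i * xt n i om"
  have "2 * (k * ?p) * b n i <= (k * ?p)^2 + (b n i)^2" by (rule sum_squares_bound)
  then have "2 * ?p * b n i <= k * ?p\<^sup>2 + (b n i)^2 / k" using k by (simp add: field_simps power2_eq_square)
  then have "(u om)^2 <= (1 + k) * ?p\<^sup>2 + (1 + 1 / k) * (b n i)^2" unfolding u_def power2_sum by (simp add: algebra_simps)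
  also have "(1 + k) * ?p\<^sup>2 = ((1 + k) * (rho n i)^2) * (xt n i om)^2" by (simp add: power_mult_distrib)
  also have "... <= (1 - a / 4 * d n i) * (xt n i om)^2" by (rule mult_right_mono[OF r]) simp
  finally show ?thesis by simp
  qed
  have "(LINT om|M. (u om)\<^sup>2) <= (LINT om|M. (1 - a / 4 * d n i) * (xt n i om)^2 + (1 + 1 / k) * (b n i)^2)"
  by (rule integral_mono) (use u2 ii pt in auto)
  also have "... = (1 - a / 4 * d n i) * (LINT om|M. (xt n i om)\<^sup>2) + (1 + 1 / k) * (b n i)^2" using ii by (simp add: prob_space)
  also have "(1 + 1 / k) * (b n i)^2 <= CJ^2 * (a + 1)^2 * (1 + 2 / a) * d n i"
  proof -
  have "\<bar>b n i\<bar> <= CJ * eps n * d n i" by (rule jm)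
  also have "... <= CJ * (a + 1) * d n i" using jm(1) eps_nonneg[OF gd] d_pos[OF i] by (intro mult_right_mono mult_left_mono) auto
  finally have "(b n i)^2 <= (CJ * (a + 1) * d n i)^2" by (rule abs_le_square_iff[THEN iffD1, OF order_trans]) simp
  then have "(1 + 1 / k) * (b n i)^2 <= (1 + 1 / k) * (CJ * (a + 1) * d n i)^2" using k by (intro mult_left_mono) auto
  also have "... = CJ^2 * (a + 1)^2 * ((1 + 1 / k) * d n i) * d n i" by (simp add: power2_eq_square algebra_simps)
  also have "(1 + 1 / k) * d n i <= 1 + 2 / a"
  proof -
  have "d n i / k <= 2 / a" using kd k a_pos d_pos[OF i] by (simp add: field_simps)
  moreover have "(1 + 1 / k) * d n i = d n i + d n i / k" by (simp add: algebra_simps)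
  ultimately show ?thesis using goodD(9)[OF gd i] by simp
  qed
  then have "CJ^2 * (a + 1)^2 * ((1 + 1 / k) * d n i) * d n i <= CJ^2 * (a + 1)^2 * (1 + 2 / a) * d n i"
  using d_pos[OF i] by (intro mult_right_mono mult_left_mono) auto
  finally show ?thesis .
  qed
  finally show ?thesis by simp
  qed
  finally show ?thesis using I by (simp add: algebra_simps)
 qed
 have I: "i <= n ==> integrable M (%om. (xt n i om)\<^sup>2)" for i
  by (induction i) (use i0 stepI in auto)
 show "i <= n ==> integrable M (%om. (xt n i om)\<^sup>2)" by (rule I)
 show "i <= n ==> (LINT om|M. (xt n i om)\<^sup>2) <= Bx"
 proof (rule contraction_bound[where \<kappa>="a/4" and d="d n" and n=n and c="CJ + \<sigma>^2 + CJ^2 * (a + 1)^2 * (1 + 2 / a)" and u="%i. \<integral>om. (xt n i om)\<^sup>2 \<partial>M"])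
  show "0 <= CJ + \<sigma>^2 + CJ^2 * (a + 1)^2 * (1 + 2 / a)" using CJ_nonneg a_pos by auto
  show "0 <= d n i & a / 4 * d n i <= 1" if "i < n" for i
  proof -
  have "a * d n i <= a * \<Delta> n" using d_le[OF that] a_pos by (intro mult_left_mono) auto
  then show ?thesis using d_pos[OF that] goodD(8)[OF gd] by simp
  qed
  show "(LINT om|M. (xt n 0 om)\<^sup>2) <= Bx"
  proof -
  have "(LINT om|M. (xt n 0 om)\<^sup>2) <= (LINT om|M. 2 * (X0 om)^2 + 2 * mG^2)"
  proof (rule integral_mono[OF i0])
  fix om assume "om : space M"
  then show "(xt n 0 om)^2 <= 2 * (X0 om)^2 + 2 * mG^2" using sq_sum_le[of "X0 om" "- mG"] by (simp add: z)
  qed (use X0_sq(1) in simp)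
  also have "... <= 2 * S + 2 * mG^2" using X0_sq by (simp add: prob_space)
  finally show ?thesis by (simp add: Bx_def)
  qed
 qed (use a_pos stepI I in \<open>auto simp: Bx_def\<close>)
qed

lemma x_sq:
 assumes gd: "good n" and i: "i <= n"
 shows "integrable M (%om. (x n i om)\<^sup>2)" "(LINT om|M. (x n i om)\<^sup>2) <= 2 * Bx + 2 * mG^2"
proof -
 note m = xt_M[OF i] and q = xt_sq[OF gd i]
 note i1 = abs_le_sq(1)[OF m q(1)]
 have e: "(x n i om)^2 = (xt n i om)^2 + 2 * mG * xt n i om + mG^2" for om by (simp add: xt_def power2_eq_square algebra_simps)
 show I: "integrable M (%om. (x n i om)\<^sup>2)" unfolding e using q(1) i1 by simp
 have "(LINT om|M. (x n i om)\<^sup>2) <= (LINT om|M. 2 * (xt n i om)^2 + 2 * mG^2)"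
 proof (rule integral_mono[OF I])
  show "(x n i om)^2 <= 2 * (xt n i om)^2 + 2 * mG^2" for om using sq_sum_le[of "xt n i om" mG] by (simp add: xt_def)
 qed (use q in simp)
 also have "... <= 2 * Bx + 2 * mG^2" using q by (simp add: prob_space)
 finally show "(LINT om|M. (x n i om)\<^sup>2) <= 2 * Bx + 2 * mG^2" .
qed

end

context ou_array
begin

section \<open>Negligible terms of the linear and squared recursions\<close>

lemma ev_good: "(\<And>n. good n ==> P n) ==> EVN n. P n"
 using good_ev by (rule eventually_mono)

lemma tend0_T: "(%n. c / T n) ---> 0"
 using tendsto_mult_right_zero[OF inv_T, of c] by simp

lemma tend0_eps: "(%n. c * eps n) ---> 0" and tend0_mesh: "(%n. c * \<Delta> n) ---> 0"
 using tendsto_mult_right_zero[OF eps_lim, of c] tendsto_mult_right_zero[OF mesh_0, of c] by auto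

lemma sum_le_T:
 assumes "good n" "\<And>i. i < n ==> f i <= c * d n i / T n"
 shows "(\<Sum>i<n. f i) <= c"
proof -
 have "(\<Sum>i<n. f i) <= (\<Sum>i<n. c / T n * d n i)" by (rule sum_mono) (use assms(2) in auto)
 also have "... = c" unfolding sum_distrib_left[symmetric] sum_d using goodD(3)[OF assms(1)] by simp
 finally show ?thesis .
qed

lemma sum_le_T2:
 assumes "good n" "\<And>i. i < n ==> f i <= c * d n i / (T n)^2"
 shows "(\<Sum>i<n. f i) <= c / T n"
proof -
 have "(\<Sum>i<n. f i) <= (\<Sum>i<n. c / (T n)^2 * d n i)" by (rule sum_mono) (use assms(2) in auto)
 also have "... = c / T n" unfolding sum_distrib_left[symmetric] sum_d using goodD(3)[OF assms(1)] by (simp add: power2_eq_square)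
 finally show ?thesis .
qed

lemma Bx_nonneg: "Bx >= 0" using S by (simp add: Bx_def max.coboundedI1)

lemma xt_end_oP:
 assumes "\<And>n. k n <= n"
 shows "oP M (%n om. xt n (k n) om / T n)" "oP M (%n om. (xt n (k n) om)\<^sup>2 / T n)"
proof -
 show "oP M (%n om. (xt n (k n) om)\<^sup>2 / T n)"
 proof (rule oP_L1[OF ev_good tend0_T[of Bx]])
  fix n assume gd: "good n"
  note q = xt_sq[OF gd assms] and p = goodD(3)[OF gd]
  show "integrable M (%om. (xt n (k n) om)\<^sup>2 / T n) & (LINT om|M. \<bar>(xt n (k n) om)^2 / T n\<bar>) <= Bx / T n"
  using q p by (simp add: divide_right_mono)
 qed
 show "oP M (%n om. xt n (k n) om / T n)"
 proof (rule oP_L2[OF ev_good tend0_T[of Bx]])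
  fix n assume gd: "good n"
  note q = xt_sq[OF gd assms] and p = goodD(2,3)[OF gd]
  have "(LINT om|M. (xt n (k n) om)\<^sup>2) / (T n)^2 <= Bx / T n"
  using q(2) p Bx_nonneg by (intro frac_le) (auto simp: power2_eq_square mult_le_cancel_left1)
  then show "integrable M (%om. (xt n (k n) om / T n)\<^sup>2) & (LINT om|M. (xt n (k n) om / T n)\<^sup>2) <= Bx / T n"
  using q(1) by (simp add: power_divide)
 qed
qed

lemma jt_sum_oP: "oP M (%n om. \<Sum>i<n. 1 / T n * jt n i om)"
proof (rule adapted_sum_oP[OF ev_good tend0_T[of CJ], where H=K], intro conjI allI impI)
 fix n assume gd: "good n"
 show "adapted_indep M (K n) (jt n) n" by (rule jt_ad)
 show "(\<Sum>i<n. (LINT om|M. (1 / T n)\<^sup>2) * (LINT om|M. (jt n i om)\<^sup>2)) <= CJ / T n"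
  by (rule sum_le_T2[OF gd]) (use jj_mom(9)[OF gd] in \<open>auto simp: prob_space power_divide intro!: divide_right_mono\<close>)
qed (use jj_mom in auto)

lemma sg_sum_oP: "oP M (%n om. \<Sum>i<n. sd n i / T n * g n i om)"
proof (rule adapted_sum_oP[OF ev_good tend0_T[of "\<sigma>^2"], where H=G], intro conjI allI impI)
 fix n assume gd: "good n"
 show "adapted_indep M (G n) (g n) n" by (rule g_ad)
 show "(\<Sum>i<n. (LINT om|M. (sd n i / T n)\<^sup>2) * (LINT om|M. (g n i om)\<^sup>2)) <= \<sigma>^2 / T n"
  by (rule sum_le_T2[OF gd]) (use sd_bound(1) g_mom(3) in \<open>auto simp: prob_space power_divide intro!: divide_right_mono\<close>)
qed (use g_mom in auto)

lemma xt_L1: "good n ==> i <= n ==> integrable M (xt n i)" "good n ==> i <= n ==> (LINT om|M. \<bar>xt n i om\<bar>) <= 1 + Bx"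
 using abs_le_sq[OF xt_M xt_sq(1), of i n] xt_sq(2)[of n i] by auto

lemma th_d_sq: "good n ==> i < n ==> (th n * d n i)\<^sup>2 <= 4 * a^2 * \<Delta> n * d n i"
proof -
 assume gd: "good n" and i: "i < n"
 have "(th n * d n i)^2 = (th n)^2 * (d n i * d n i)" by (simp add: power2_eq_square)
 also have "... <= (2 * a)^2 * (\<Delta> n * d n i)"
  using goodD[OF gd] th_pos[of n] d_le[OF i] d_pos[OF i] by (intro mult_mono power_mono) auto
 finally show ?thesis by (simp add: power2_eq_square)
qed

lemma rho_err_oP: "oP M (%n om. \<Sum>i<n. (1 - rho n i - th n * d n i) / T n * xt n i om)"
proof (rule oP_sum_L1[OF ev_good tend0_mesh[of "4 * a^2 * (1 + Bx)"]], intro conjI allI impI)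
 fix n assume gd: "good n"
 show "integrable M (%om. (1 - rho n i - th n * d n i) / T n * xt n i om)" if "i < n" for i
  using xt_L1(1)[OF gd] that by simp
 show "(\<Sum>i<n. \<integral>om. \<bar>(1 - rho n i - th n * d n i) / T n * xt n i om\<bar> \<partial>M) <= 4 * a^2 * (1 + Bx) * \<Delta> n"
 proof (rule sum_le_T[OF gd])
  fix i assume i: "i < n"
  have "(LINT om|M. \<bar>(1 - rho n i - th n * d n i) / T n * xt n i om\<bar>) = \<bar>1 - rho n i - th n * d n i\<bar> / T n * (LINT om|M. \<bar>xt n i om\<bar>)"
  using goodD(3)[OF gd] by (simp add: abs_mult)
  also have "... <= (4 * a^2 * \<Delta> n * d n i) / T n * (1 + Bx)"
  using rho_lin[OF i] th_d_sq[OF gd i] xt_L1(2)[OF gd, of i] i goodD(3,4)[OF gd] d_pos[OF i]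
  by (intro mult_mono divide_right_mono) auto
  finally show "(LINT om|M. \<bar>(1 - rho n i - th n * d n i) / T n * xt n i om\<bar>) <= 4 * a^2 * (1 + Bx) * \<Delta> n * d n i / T n"
  by (simp add: mult_ac)
 qed
qed

lemma th_inv_bounded: "EVN n. \<bar>1 / th n\<bar> <= 2 / a"
proof (rule ev_good)
 fix n assume "good n"
 then show "\<bar>1 / th n\<bar> <= 2 / a" using goodD(6)[of n] th_pos[of n] a_pos by (simp add: field_simps)
qed

text \<open>Summing the recursion telescopes the observations to boundary terms, and the drift
  isolates their time average; the remaining sums are orthogonal or of smaller order.\<close>

lemma linear_lln: "oP M (%n om. (\<Sum>i<n. d n i * xt n i om) / T n)"
proof -
 let ?P5 = "%n. (\<Sum>i<n. b n i) / T n"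
 have P5: "?P5 ---> 0"
 proof (rule Lim_null_comparison[OF ev_good tend0_eps[of CJ]])
  fix n assume gd: "good n"
  have "\<bar>\<Sum>i<n. b n i\<bar> <= (\<Sum>i<n. CJ * eps n * d n i)"
  by (intro order_trans[OF sum_abs] sum_mono) (use jj_mom(2)[OF gd] in auto)
  also have "... = CJ * eps n * T n" by (simp add: sum_distrib_left[symmetric] sum_d)
  finally show "norm (?P5 n) <= CJ * eps n" using goodD(3)[OF gd] by (simp add: pos_divide_le_eq)
 qed
 have *: "oP M (%n om. (xt n 0 om / T n - xt n n om / T n) + (\<Sum>i<n. 1 / T n * jt n i om) + (\<Sum>i<n. sd n i / T n * g n i om) + ?P5 n
  - (\<Sum>i<n. (1 - rho n i - th n * d n i) / T n * xt n i om))"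
  by (intro oP_diff oP_add xt_end_oP jt_sum_oP sg_sum_oP rho_err_oP oP_const P5) auto
 have "oP M (%n om. 1 / th n * ((xt n 0 om / T n - xt n n om / T n) + (\<Sum>i<n. 1 / T n * jt n i om) + (\<Sum>i<n. sd n i / T n * g n i om) + ?P5 n
  - (\<Sum>i<n. (1 - rho n i - th n * d n i) / T n * xt n i om)))"
  by (rule oP_cmult[OF * th_inv_bounded])
 then show ?thesis
 proof (rule oP_cong_eventually, intro ev_good ballI)
  fix n om assume gd: "good n" and w: "om : space M"
  have tp: "th n ~= 0" "T n ~= 0" using th_pos[of n] goodD(3)[OF gd] by auto
  have "xt n 0 om - xt n n om = (\<Sum>i<n. xt n i om - xt n (Suc i) om)" by (rule sum_lessThan_telescope'[symmetric])
  also have "... = (\<Sum>i<n. th n * (d n i * xt n i om) + (1 - rho n i - th n * d n i) * xt n i om - jt n i om - sd n i * g n i om - b n i)"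
  by (intro sum.cong refl) (use step_t[OF _ w] in \<open>simp add: algebra_simps\<close>)
  also have "... = th n * (\<Sum>i<n. d n i * xt n i om) + (\<Sum>i<n. (1 - rho n i - th n * d n i) * xt n i om) - (\<Sum>i<n. jt n i om) - (\<Sum>i<n. sd n i * g n i om) - (\<Sum>i<n. b n i)"
  by (simp add: sum.distrib sum_subtractf sum_distrib_left)
  finally have E: "xt n 0 om - xt n n om = th n * (\<Sum>i<n. d n i * xt n i om) + (\<Sum>i<n. (1 - rho n i - th n * d n i) * xt n i om) - (\<Sum>i<n. jt n i om) - (\<Sum>i<n. sd n i * g n i om) - (\<Sum>i<n. b n i)" .
  have s: "(\<Sum>i<n. 1 / T n * jt n i om) = (\<Sum>i<n. jt n i om) / T n" "(\<Sum>i<n. sd n i / T n * g n i om) = (\<Sum>i<n. sd n i * g n i om) / T n"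
  "(\<Sum>i<n. (1 - rho n i - th n * d n i) / T n * xt n i om) = (\<Sum>i<n. (1 - rho n i - th n * d n i) * xt n i om) / T n"
  by (auto simp: sum_divide_distrib)
  show "(\<Sum>i<n. d n i * xt n i om) / T n = 1 / th n * ((xt n 0 om / T n - xt n n om / T n) + (\<Sum>i<n. 1 / T n * jt n i om) + (\<Sum>i<n. sd n i / T n * g n i om) + ?P5 n
  - (\<Sum>i<n. (1 - rho n i - th n * d n i) / T n * xt n i om))"
  unfolding s diff_divide_distrib[symmetric] add_divide_distrib[symmetric] using tp E by (simp add: field_simps)
 qed
qed

definition trunc :: "real => real => real" where "trunc L y = (if \<bar>y\<bar> <= L then y\<^sup>2 else 0)"

lemma trunc_M [measurable]: "trunc L : bmeas borel" unfolding trunc_def[abs_def] by measurable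

lemma trunc_bounds: "0 <= trunc L y" "trunc L y <= y^2" "(trunc L y)^2 <= L^2 * y^2"
proof -
 show "0 <= trunc L y" "trunc L y <= y^2" by (auto simp: trunc_def)
 show "(trunc L y)^2 <= L^2 * y^2"
 proof (cases "\<bar>y\<bar> <= L")
  case True
  then have "y^2 <= L^2" by (simp add: abs_le_square_iff[symmetric])
  then have "y^2 * y^2 <= L^2 * y^2" by (rule mult_right_mono) simp
  then show ?thesis using True by (simp add: trunc_def power2_eq_square)
 qed (simp add: trunc_def)
qed

lemma centered_sq:
 fixes V :: "'a => real"
 assumes "V : bmeas M" "integrable M (%om. (V om)\<^sup>2)"
 shows "integrable M (%om. (V om - (LINT om|M. V om))\<^sup>2)" "(LINT om|M. V om - (LINT om|M. V om)) = 0"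
  "(LINT om|M. (V om - (LINT om|M. V om))\<^sup>2) <= (LINT om|M. (V om)\<^sup>2)"
proof -
 let ?e = "\<integral>om. V om \<partial>M"
 have i: "integrable M V" by (rule abs_le_sq(1)[OF assms])
 have e: "(V om - ?e)^2 = (V om)^2 - 2 * ?e * V om + ?e\<^sup>2" for om by (simp add: power2_eq_square algebra_simps)
 show "integrable M (%om. (V om - ?e)\<^sup>2)" unfolding e using assms i by simp
 show "(LINT om|M. V om - ?e) = 0" using i by (simp add: prob_space)
 have "(LINT om|M. (V om - ?e)\<^sup>2) = (LINT om|M. (V om)\<^sup>2) - ?e\<^sup>2"
  unfolding e using assms i by (simp add: prob_space) (simp add: power2_eq_square)
 then show "(LINT om|M. (V om - ?e)\<^sup>2) <= (LINT om|M. (V om)\<^sup>2)" by simp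
qed

text \<open>Squares of jump innovations are only integrable, so they are truncated: below
  \<open>L\<close> they have variance of order \<open>L^2 d\<close>, and the remainders are small in
  mean by uniform integrability of \<open>Avar\<close>.\<close>

lemma jt_sq_lln: "oP M (%n om. \<Sum>i<n. 1 / T n * ((jt n i om)^2 - (LINT om|M. (jt n i om)\<^sup>2)))"
proof (rule oP_approx)
 fix e :: real assume e: "e > 0"
 \<comment> \<open>The square of the factor in \<open>|jt| <= 2 (1 + 2 a) Avar\<close>, valid where
   the truncation acts. With \<open>e'\<close> below, remainder and mean together give
   \<open>2 * (c * (2 * e')) = e\<close>.\<close>
 define c where "c = 4 * (1 + 2 * a)^2"
 have c: "c > 0" using a_pos by (simp add: c_def)
 define e' where "e' = e / (4 * c)"
 have e': "e' > 0" using e c by (simp add: e'_def)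
 obtain K0 C0 where K0: "K0 > 0" and C0: "C0 >= 0" and tail: "\<And>s t. 0 <= s ==> s < t ==> t <= s + 1 ==>
  (LINT om|M. (if Avar s t om > K0 then (Avar s t om)\<^sup>2 else 0)) <= (e' + C0 * (t - s)) * (t - s)"
  using Avar_tail[OF e'] by blast
 \<comment> \<open>Above this level the mean of \<open>jj\<close> is at most half of
   \<open>|jt|\<close>, and the total variation must exceed \<open>K0\<close>.\<close>
 define L where "L = 2 * CJ + 2 * (1 + 2 * a) * K0"
 let ?f = "%n i om. trunc L (jt n i om)" and ?r = "%n i om. (jt n i om)\<^sup>2 - trunc L (jt n i om)"
 let ?U = "%n om. \<Sum>i<n. 1 / T n * (?f n i om - (LINT om|M. ?f n i om))"
 let ?R = "%n om. \<Sum>i<n. 1 / T n * (?r n i om - (LINT om|M. ?r n i om))"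
 have fi: "integrable M (%om. (?f n i om)\<^sup>2)" "integrable M (?f n i)" "(LINT om|M. (?f n i om)\<^sup>2) <= L^2 * CJ * d n i" "?f n i : bmeas M"
  "integrable M (?r n i)"
  if gd: "good n" and i: "i < n" for n i
 proof -
  note [measurable] = jt_M[OF i] and j = jj_mom[OF gd i]
  show m: "?f n i : bmeas M" by measurable
  show 1: "integrable M (%om. (?f n i om)\<^sup>2)"
  by (rule Bochner_Integration.integrable_bound[of _ "%om. L\<^sup>2 * (jt n i om)^2"]) (use j trunc_bounds(3) in auto)
  show 2: "integrable M (?f n i)" by (rule abs_le_sq(1)[OF m 1])
  show "integrable M (?r n i)" using 2 j by simp
  have "(LINT om|M. (?f n i om)\<^sup>2) <= (LINT om|M. L\<^sup>2 * (jt n i om)^2)" by (rule integral_mono[OF 1]) (use j trunc_bounds(3) in auto)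
  also have "... <= L^2 * (CJ * d n i)" using j by (simp add: mult_left_mono)
  finally show "(LINT om|M. (?f n i om)\<^sup>2) <= L^2 * CJ * d n i" by (simp add: mult.assoc)
 qed
 have U: "oP M ?U"
 proof (rule adapted_sum_oP[OF ev_good tend0_T[of "L^2 * CJ"], where H=K], intro conjI allI impI)
  fix n assume gd: "good n"
  show "adapted_indep M (K n) (%i om. ?f n i om - (LINT om|M. ?f n i om)) n"
  by (rule adapted_indep_compose[OF jt_ad, where f="%i y. trunc L y - (LINT om|M. ?f n i om)"]) simp
  show "(\<Sum>i<n. (LINT om|M. (1 / T n)\<^sup>2) * (LINT om|M. (?f n i om - (LINT om|M. ?f n i om))\<^sup>2)) <= L^2 * CJ / T n"
  proof (rule sum_le_T2[OF gd])
  fix i assume i: "i < n"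
  have "(LINT om|M. (?f n i om - (LINT om|M. ?f n i om))\<^sup>2) <= L^2 * CJ * d n i"
  using centered_sq(3)[OF fi(4)[OF gd i] fi(1)[OF gd i]] fi(3)[OF gd i] by simp
  then show "(LINT om|M. (1 / T n)\<^sup>2) * (LINT om|M. (?f n i om - (LINT om|M. ?f n i om))\<^sup>2) <= L^2 * CJ * d n i / (T n)^2"
  by (simp add: prob_space power_divide divide_right_mono)
  qed
  fix i assume i: "i < n"
  show "integrable M (%om. (?f n i om - (LINT om|M. ?f n i om))\<^sup>2)" "(LINT om|M. ?f n i om - (LINT om|M. ?f n i om)) = 0"
  using centered_sq[OF fi(4)[OF gd i] fi(1)[OF gd i]] by auto
 qed auto
 have Cd: "EVN n. C0 * \<Delta> n < e'"
  using order_tendstoD(2)[OF tend0_mesh e'] .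
 have R: "EVN n. integrable M (?R n) & (LINT om|M. \<bar>?R n om\<bar>) <= e"
  using good_ev Cd
 proof eventually_elim
  case (elim n)
  note gd = elim(1)
  have iR: "integrable M (?R n)"
  by (intro Bochner_Integration.integrable_sum integrable_mult_right Bochner_Integration.integrable_diff integrable_const) (use fi[OF gd] jj_mom(7)[OF gd] in auto)
  have r0: "?r n i om >= 0" for i om using trunc_bounds(2) by simp
  have rE: "(LINT om|M. ?r n i om) <= c * (2 * e') * d n i" if i: "i < n" for i
  proof -
  have st: "0 <= t n i" "t n i < t n (Suc i)" "t n (Suc i) <= t n i + 1"
  using gridD(1,2)[OF gr i] goodD(9)[OF gd i] by (auto simp: d_def)
  have thb: "0 < th n" "th n <= 2 * a" using th_pos goodD[OF gd] by auto
  let ?A = "Avar (t n i) (t n (Suc i))"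
  have iA: "integrable M (%om. if ?A om > K0 then (?A om)\<^sup>2 else 0)"
  by (rule Bochner_Integration.integrable_bound[OF Avar_sq(1)[OF st]]) auto
  have pt: "?r n i om <= c * (if ?A om > K0 then (?A om)\<^sup>2 else 0)" if w: "om : space M" for om
  proof (cases "\<bar>jt n i om\<bar> <= L")
  case True
  then show ?thesis using c by (simp add: trunc_def)
  next
  case False
  have Eb: "\<bar>Ej n i\<bar> <= CJ"
  using jj_mom(3)[OF gd i] mult_left_le[of "d n i" CJ] jj_mom(1)[OF gd i] goodD(9)[OF gd i] by simp
  have "K0 * (1 + 2 * a) >= 0" using K0 a_pos by simp
  then have "\<bar>jt n i om\<bar> >= 2 * CJ" using False by (simp add: L_def algebra_simps)
  then have h: "\<bar>jt n i om\<bar> <= 2 * \<bar>jj n i om\<bar>" using Eb unfolding jt_def by linarith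
  have jA: "\<bar>jj n i om\<bar> <= (1 + 2 * a) * ?A om" using Jou_sq(4)[OF st thb w] by (simp add: jj_def jmp_def)
  have "2 * (1 + 2 * a) * K0 < 2 * ((1 + 2 * a) * ?A om)" using False h jA jj_mom(1)[OF gd i] by (simp add: L_def)
  then have "(1 + 2 * a) * K0 < (1 + 2 * a) * ?A om" by (simp only: mult.assoc)
  then have AK: "?A om > K0" using a_pos mult_less_cancel_left_pos[of "1 + 2 * a" K0] by simp
  have "\<bar>jt n i om\<bar> <= 2 * ((1 + 2 * a) * ?A om)" using h jA by simp
  from power_mono[OF this, of 2] have "(jt n i om)^2 <= c * (?A om)^2" by (simp add: c_def power_mult_distrib)
  then show ?thesis using AK False by (simp add: trunc_def)
  qed
  have "(LINT om|M. ?r n i om) <= (LINT om|M. c * (if ?A om > K0 then (?A om)\<^sup>2 else 0))"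
  by (rule integral_mono[OF fi(5)[OF gd i] integrable_mult_right[OF iA] pt])
  also have "... = c * (LINT om|M. (if ?A om > K0 then (?A om)\<^sup>2 else 0))" by (rule integral_mult_right_zero)
  also have "... <= c * ((e' + C0 * d n i) * d n i)" using tail[OF st] c by (simp add: d_def)
  also have "... <= c * ((2 * e') * d n i)"
  proof -
  have "C0 * d n i <= e'" using mult_left_mono[OF d_le[OF i] C0] elim(2) by simp
  then show ?thesis using c d_pos[OF i] by (intro mult_left_mono mult_right_mono) auto
  qed
  finally show ?thesis by (simp add: mult.assoc)
  qed
  have "(LINT om|M. \<bar>?R n om\<bar>) <= (LINT om|M. (\<Sum>i<n. 1 / T n * (?r n i om + (LINT om|M. ?r n i om))))"
  proof (rule integral_mono)
  show "integrable M (%om. \<bar>?R n om\<bar>)" using iR by simp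
  show "integrable M (%om. \<Sum>i<n. 1 / T n * (?r n i om + (LINT om|M. ?r n i om)))"
  by (intro Bochner_Integration.integrable_sum integrable_mult_right Bochner_Integration.integrable_add integrable_const) (use fi[OF gd] jj_mom(7)[OF gd] in auto)
  fix om
  show "\<bar>?R n om\<bar> <= (\<Sum>i<n. 1 / T n * (?r n i om + (LINT om|M. ?r n i om)))"
  proof (intro order_trans[OF sum_abs] sum_mono)
  fix i
  have E0: "(LINT om|M. ?r n i om) >= 0" by (rule integral_nonneg_AE) (use r0 in auto)
  have "\<bar>?r n i om - (LINT om|M. ?r n i om)\<bar> <= ?r n i om + (LINT om|M. ?r n i om)" using r0[of i om] E0 by linarith
  then show "\<bar>1 / T n * (?r n i om - (LINT om|M. ?r n i om))\<bar> <= 1 / T n * (?r n i om + (LINT om|M. ?r n i om))"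
  using goodD(3)[OF gd] unfolding abs_mult by (intro mult_mono) auto
  qed
  qed
  also have "... = (\<Sum>i<n. \<integral>om. 1 / T n * (?r n i om + (LINT om|M. ?r n i om)) \<partial>M)"
  by (rule Bochner_Integration.integral_sum)
  (intro integrable_mult_right Bochner_Integration.integrable_add integrable_const, use fi[OF gd] in auto)
  also have "... = (\<Sum>i<n. 2 * (LINT om|M. ?r n i om) / T n)"
  proof (intro sum.cong refl)
  fix i assume "i \<in> {..<n}"
  then have "integrable M (?r n i)" using fi(5)[OF gd] by simp
  then show "(LINT om|M. 1 / T n * (?r n i om + (LINT om|M. ?r n i om))) = 2 * (LINT om|M. ?r n i om) / T n"
  unfolding integral_mult_right_zero
  by (subst Bochner_Integration.integral_add) (simp_all add: prob_space del: Bochner_Integration.integral_diff)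
  qed
  also have "... <= e"
  proof (rule sum_le_T[OF gd])
  fix i assume i: "i < n"
  have "2 * (LINT om|M. ?r n i om) <= 2 * (c * (2 * e') * d n i)" using rE[OF i] by simp
  also have "... = e * d n i" using c by (simp add: e'_def)
  finally show "2 * (LINT om|M. ?r n i om) / T n <= e * d n i / T n" using goodD(3)[OF gd] by (simp add: divide_right_mono)
  qed
  finally show ?case using iR by blast
 qed
 have X: "EVN n. \<forall>om\<in>space M. (\<Sum>i<n. 1 / T n * ((jt n i om)^2 - (LINT om|M. (jt n i om)\<^sup>2))) = ?U n om + ?R n om"
 proof (intro ev_good ballI)
  fix n om assume gd: "good n"
  have "(LINT om|M. ?r n i om) = (LINT om|M. (jt n i om)\<^sup>2) - (LINT om|M. ?f n i om)" if "i < n" for i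
  by (rule Bochner_Integration.integral_diff) (use jj_mom(7)[OF gd that] fi[OF gd that] in auto)
  then show "(\<Sum>i<n. 1 / T n * ((jt n i om)^2 - (LINT om|M. (jt n i om)\<^sup>2))) = ?U n om + ?R n om"
  unfolding sum.distrib[symmetric] by (intro sum.cong refl) (simp add: add_divide_distrib[symmetric])
 qed
 show "\<exists>U R. oP M U & (EVN n. integrable M (R n) & (LINT om|M. \<bar>R n om\<bar>) <= e) \<and>
  (EVN n. \<forall>om\<in>space M. (\<Sum>i<n. 1 / T n * ((jt n i om)^2 - (LINT om|M. (jt n i om)\<^sup>2))) = U n om + R n om)"
  by (rule exI[of _ ?U], rule exI[of _ ?R]) (rule conjI[OF U conjI[OF R X]])
qed

text \<open>Products with the current jump innovation are orthogonal in \<open>HJ\<close>. The cross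
  terms that follow contain a Gaussian factor and use \<open>HG\<close>, where jump innovations
  count as known coefficients.\<close>

lemma cross_jt_oP: "oP M (%n om. \<Sum>i<n. 2 * rho n i * xt n i om / T n * jt n i om)"
proof (rule adapted_sum_oP[OF ev_good tend0_T[of "4 * Bx * CJ"], where H=K], intro conjI allI impI)
 fix n assume gd: "good n"
 show "adapted_indep M (K n) (jt n) n" by (rule jt_ad)
 have E: "(2 * rho n i * xt n i om / T n)^2 = 4 * (rho n i)^2 / (T n)^2 * (xt n i om)^2" for i om
  by (simp add: power2_eq_square)
 show "(\<Sum>i<n. (LINT om|M. (2 * rho n i * xt n i om / T n)\<^sup>2) * (LINT om|M. (jt n i om)\<^sup>2)) <= 4 * Bx * CJ / T n"
 proof (rule sum_le_T2[OF gd])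
  fix i assume i: "i < n"
  have r: "(rho n i)^2 <= 1" using rho_bounds[OF i] by (intro power_le_one) auto
  have "(LINT om|M. (2 * rho n i * xt n i om / T n)\<^sup>2) * (LINT om|M. (jt n i om)\<^sup>2) <= (4 * 1 / (T n)^2 * Bx) * (CJ * d n i)"
  unfolding E integral_mult_right_zero using xt_sq(2)[OF gd, of i] i jj_mom(9)[OF gd i] r Bx_nonneg
  by (intro mult_mono divide_right_mono) auto
  then show "(LINT om|M. (2 * rho n i * xt n i om / T n)\<^sup>2) * (LINT om|M. (jt n i om)\<^sup>2) <= 4 * Bx * CJ * d n i / (T n)^2" by simp
 qed
 fix i assume i: "i < n"
 show "integrable M (%om. (2 * rho n i * xt n i om / T n)\<^sup>2)" unfolding E using xt_sq(1)[OF gd, of i] i by simp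
 show "(%om. 2 * rho n i * xt n i om / T n) : bmeas (K n i)"
  using xt_K[of i n] i by (intro borel_measurable_divide borel_measurable_times borel_measurable_const) auto
qed (use jj_mom in auto)

lemma cross_g_oP: "oP M (%n om. \<Sum>i<n. 2 * rho n i * sd n i * xt n i om / T n * g n i om)"
proof (rule adapted_sum_oP[OF ev_good tend0_T[of "4 * Bx * \<sigma>^2"], where H=G], intro conjI allI impI)
 fix n assume gd: "good n"
 show "adapted_indep M (G n) (g n) n" by (rule g_ad)
 have E: "(2 * rho n i * sd n i * xt n i om / T n)^2 = 4 * (rho n i)^2 * (sd n i)^2 / (T n)^2 * (xt n i om)^2" for i om
  by (simp add: power2_eq_square)
 show "(\<Sum>i<n. (LINT om|M. (2 * rho n i * sd n i * xt n i om / T n)\<^sup>2) * (LINT om|M. (g n i om)\<^sup>2)) <= 4 * Bx * \<sigma>^2 / T n"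
 proof (rule sum_le_T2[OF gd])
  fix i assume i: "i < n"
  have r: "(rho n i)^2 <= 1" using rho_bounds[OF i] by (intro power_le_one) auto
  have "(LINT om|M. (2 * rho n i * sd n i * xt n i om / T n)\<^sup>2) * (LINT om|M. (g n i om)\<^sup>2) <= (4 * 1 * (\<sigma>^2 * d n i) / (T n)^2 * Bx) * 1"
  unfolding E integral_mult_right_zero using xt_sq(2)[OF gd, of i] i g_mom(3)[OF i] r Bx_nonneg sd_bound[OF i] d_pos[OF i]
  by (intro mult_mono divide_right_mono) auto
  then show "(LINT om|M. (2 * rho n i * sd n i * xt n i om / T n)\<^sup>2) * (LINT om|M. (g n i om)\<^sup>2) <= 4 * Bx * \<sigma>^2 * d n i / (T n)^2" by (simp add: mult_ac)
 qed
 fix i assume i: "i < n"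
 show "integrable M (%om. (2 * rho n i * sd n i * xt n i om / T n)\<^sup>2)" unfolding E using xt_sq(1)[OF gd, of i] i by simp
 show "(%om. 2 * rho n i * sd n i * xt n i om / T n) : bmeas (G n i)"
  using xt_G[of i n] i by (intro borel_measurable_divide borel_measurable_times borel_measurable_const) auto
qed (use g_mom in auto)

lemma jt_g_oP: "oP M (%n om. \<Sum>i<n. 2 * sd n i * jt n i om / T n * g n i om)"
proof (rule adapted_sum_oP[OF ev_good tend0_T[of "4 * CJ * \<sigma>^2"], where H=G], intro conjI allI impI)
 fix n assume gd: "good n"
 show "adapted_indep M (G n) (g n) n" by (rule g_ad)
 have E: "(2 * sd n i * jt n i om / T n)^2 = 4 * (sd n i)^2 / (T n)^2 * (jt n i om)^2" for i om
  by (simp add: power2_eq_square)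
 show "(\<Sum>i<n. (LINT om|M. (2 * sd n i * jt n i om / T n)\<^sup>2) * (LINT om|M. (g n i om)\<^sup>2)) <= 4 * CJ * \<sigma>^2 / T n"
 proof (rule sum_le_T2[OF gd])
  fix i assume i: "i < n"
  have c: "(LINT om|M. (jt n i om)\<^sup>2) <= CJ"
  using jj_mom(9)[OF gd i] mult_left_le[of "d n i" CJ] jj_mom(1)[OF gd i] goodD(9)[OF gd i] by simp
  have "(LINT om|M. (2 * sd n i * jt n i om / T n)\<^sup>2) * (LINT om|M. (g n i om)\<^sup>2) <= (4 * (\<sigma>^2 * d n i) / (T n)^2 * CJ) * 1"
  unfolding E integral_mult_right_zero using c g_mom(3)[OF i] sd_bound[OF i] d_pos[OF i] CJ_nonneg
  by (intro mult_mono divide_right_mono) auto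
  then show "(LINT om|M. (2 * sd n i * jt n i om / T n)\<^sup>2) * (LINT om|M. (g n i om)\<^sup>2) <= 4 * CJ * \<sigma>^2 * d n i / (T n)^2" by (simp add: mult_ac)
 qed
 fix i assume i: "i < n"
 show "integrable M (%om. (2 * sd n i * jt n i om / T n)\<^sup>2)" unfolding E using jj_mom(7)[OF gd i] by simp
 show "(%om. 2 * sd n i * jt n i om / T n) : bmeas (G n i)"
  using jt_G[of i n] i by (intro borel_measurable_divide borel_measurable_times borel_measurable_const) auto
qed (use g_mom in auto)

lemma g_sq_oP: "oP M (%n om. \<Sum>i<n. (sd n i)\<^sup>2 / T n * ((g n i om)^2 - 1))"
proof (rule adapted_sum_oP[OF ev_good tend0_T[of "2 * (\<sigma>^2)^2"], where H=G], intro conjI allI impI)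
 fix n assume gd: "good n"
 show "adapted_indep M (G n) (%i om. (g n i om)\<^sup>2 - 1) n"
  by (rule adapted_indep_compose[OF g_ad, where f="%i y. y\<^sup>2 - 1"]) simp
 show "(\<Sum>i<n. (LINT om|M. ((sd n i)^2 / T n)\<^sup>2) * (LINT om|M. ((g n i om)^2 - 1)\<^sup>2)) <= 2 * (\<sigma>^2)^2 / T n"
 proof (rule sum_le_T2[OF gd])
  fix i assume i: "i < n"
  have "((sd n i)^2)^2 <= (\<sigma>^2 * d n i)^2" using sd_bound[OF i] by (intro power_mono) auto
  also have "... <= (\<sigma>^2)^2 * d n i" using d_pos[OF i] goodD(9)[OF gd i] by (auto simp: power_mult_distrib power2_eq_square[of "d n i"] intro!: mult_left_mono mult_left_le)
  finally show "(LINT om|M. ((sd n i)^2 / T n)\<^sup>2) * (LINT om|M. ((g n i om)^2 - 1)\<^sup>2) <= 2 * (\<sigma>^2)^2 * d n i / (T n)^2"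
  by (simp add: g2_mom[OF i] prob_space power_divide divide_right_mono)
 qed
qed (use g2_mom in auto)

lemma b_terms_oP: "oP M (%n om. \<Sum>i<n. b n i / T n * (2 * rho n i * xt n i om + 2 * jt n i om + 2 * sd n i * g n i om + b n i))"
proof -
 define Cb where "Cb = 2 * (1 + Bx) + 2 * (1 + CJ) + 2 * \<bar>\<sigma>\<bar> * 2 + CJ * (a + 1)"
 have Cb: "Cb >= 0" using Bx_nonneg CJ_nonneg a_pos by (auto simp: Cb_def intro!: add_nonneg_nonneg)
 show ?thesis
 proof (rule oP_sum_L1[OF ev_good tend0_eps[of "CJ * Cb"]], intro conjI allI impI)
  fix n assume gd: "good n"
  let ?Y = "%i om. 2 * rho n i * xt n i om + 2 * jt n i om + 2 * sd n i * g n i om + b n i"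
  have jti: "integrable M (jt n i)" "(LINT om|M. \<bar>jt n i om\<bar>) <= 1 + CJ" if i: "i < n" for i
  proof -
  note m = abs_le_sq[OF jt_M[OF i] jj_mom(7)[OF gd i]]
  show "integrable M (jt n i)" by (rule m)
  show "(LINT om|M. \<bar>jt n i om\<bar>) <= 1 + CJ"
  using m(2) jj_mom(9)[OF gd i] mult_left_le[of "d n i" CJ] jj_mom(1)[OF gd i] goodD(9)[OF gd i] by simp
  qed
  have gi: "(LINT om|M. \<bar>g n i om\<bar>) <= 2" if i: "i < n" for i
  using abs_le_sq(2)[OF g_M[OF i] g_mom(1)[OF i, of 2]] g_mom(3)[OF i] by simp
  have Yi: "integrable M (?Y i)" if i: "i < n" for i
  using xt_L1(1)[OF gd, of i] jti(1)[OF i] g_mom(5)[OF i] i by simp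
  show "integrable M (%om. b n i / T n * ?Y i om)" if i: "i < n" for i using Yi[OF i] by simp
  have YE: "(LINT om|M. \<bar>?Y i om\<bar>) <= Cb" if i: "i < n" for i
  proof -
  have sdb: "\<bar>sd n i\<bar> <= \<bar>\<sigma>\<bar>"
  proof -
  have "(sd n i)^2 <= \<sigma>^2 * 1" using order_trans[OF sd_bound(1)[OF i] mult_left_mono[OF goodD(9)[OF gd i] zero_le_power2]] .
  then show ?thesis by (simp add: abs_le_square_iff)
  qed
  have bb: "\<bar>b n i\<bar> <= CJ * (a + 1)"
  proof -
  have "\<bar>b n i\<bar> <= CJ * eps n * d n i" by (rule jj_mom(2)[OF gd i])
  also have "... <= CJ * (a + 1) * 1" using CJ_nonneg eps_nonneg[OF gd] goodD(9)[OF gd i] d_pos[OF i] a_pos by (intro mult_mono) auto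
  finally show ?thesis by simp
  qed
  have "(LINT om|M. \<bar>?Y i om\<bar>) <= (LINT om|M. 2 * \<bar>xt n i om\<bar> + 2 * \<bar>jt n i om\<bar> + 2 * \<bar>\<sigma>\<bar> * \<bar>g n i om\<bar> + CJ * (a + 1))"
  proof (rule integral_mono)
  fix om
  have "\<bar>2 * rho n i * xt n i om\<bar> <= 2 * \<bar>xt n i om\<bar>" using rho_bounds[OF i] mult_right_mono[of "rho n i" 1 "\<bar>xt n i om\<bar>"] by (simp add: abs_mult)
  moreover have "\<bar>2 * sd n i * g n i om\<bar> <= 2 * \<bar>\<sigma>\<bar> * \<bar>g n i om\<bar>" using sdb by (simp add: abs_mult mult_right_mono)
  ultimately show "\<bar>?Y i om\<bar> <= 2 * \<bar>xt n i om\<bar> + 2 * \<bar>jt n i om\<bar> + 2 * \<bar>\<sigma>\<bar> * \<bar>g n i om\<bar> + CJ * (a + 1)" using bb by linarith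
  qed (use xt_L1(1)[OF gd, of i] jti(1)[OF i] g_mom(5)[OF i] i Yi[OF i] in auto)
  also have "... = 2 * (LINT om|M. \<bar>xt n i om\<bar>) + 2 * (LINT om|M. \<bar>jt n i om\<bar>) + 2 * \<bar>\<sigma>\<bar> * (LINT om|M. \<bar>g n i om\<bar>) + CJ * (a + 1)"
  using xt_L1(1)[OF gd, of i] jti(1)[OF i] g_mom(5)[OF i] i by (simp add: prob_space)
  also have "... <= Cb" unfolding Cb_def using xt_L1(2)[OF gd, of i] jti(2)[OF i] gi[OF i] i CJ_nonneg
  by (intro add_mono mult_left_mono) auto
  finally show ?thesis .
  qed
  show "(\<Sum>i<n. \<integral>om. \<bar>b n i / T n * ?Y i om\<bar> \<partial>M) <= CJ * Cb * eps n"
  proof (rule sum_le_T[OF gd])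
  fix i assume i: "i < n"
  have "(LINT om|M. \<bar>b n i / T n * ?Y i om\<bar>) = \<bar>b n i\<bar> / T n * (LINT om|M. \<bar>?Y i om\<bar>)"
  using goodD(3)[OF gd] unfolding abs_mult integral_mult_right_zero by simp
  also have "... <= (CJ * eps n * d n i) / T n * Cb"
  using jj_mom(2)[OF gd i] YE[OF i] Cb goodD(3)[OF gd] CJ_nonneg eps_nonneg[OF gd] d_pos[OF i] by (intro mult_mono divide_right_mono) auto
  finally show "(LINT om|M. \<bar>b n i / T n * ?Y i om\<bar>) <= CJ * Cb * eps n * d n i / T n" by (simp add: mult_ac)
  qed
 qed
qed

lemma rho2_err_oP: "oP M (%n om. \<Sum>i<n. (1 - (rho n i)^2 - 2 * th n * d n i) / T n * ((xt n i om)^2 - VG))"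
proof (rule oP_sum_L1[OF ev_good tend0_mesh[of "4 * (4 * a^2) * (Bx + \<bar>VG\<bar>)"]], intro conjI allI impI)
 fix n assume gd: "good n"
 show "integrable M (%om. (1 - (rho n i)^2 - 2 * th n * d n i) / T n * ((xt n i om)^2 - VG))" if "i < n" for i
  using xt_sq(1)[OF gd, of i] that by simp
 show "(\<Sum>i<n. \<integral>om. \<bar>(1 - (rho n i)^2 - 2 * th n * d n i) / T n * ((xt n i om)^2 - VG)\<bar> \<partial>M) <= 4 * (4 * a^2) * (Bx + \<bar>VG\<bar>) * \<Delta> n"
 proof (rule sum_le_T[OF gd])
  fix i assume i: "i < n"
  have q: "integrable M (%om. (xt n i om)\<^sup>2)" "(LINT om|M. (xt n i om)\<^sup>2) <= Bx" using xt_sq[OF gd, of i] i by auto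
  have "(LINT om|M. \<bar>(xt n i om)^2 - VG\<bar>) <= (LINT om|M. (xt n i om)\<^sup>2 + \<bar>VG\<bar>)"
  proof (rule integral_mono)
  show "\<bar>(xt n i om)^2 - VG\<bar> <= (xt n i om)^2 + \<bar>VG\<bar>" for om using zero_le_power2[of "xt n i om"] by linarith
  qed (use q in auto)
  also have "... <= Bx + \<bar>VG\<bar>" using q by (simp add: prob_space)
  finally have v: "(LINT om|M. \<bar>(xt n i om)^2 - VG\<bar>) <= Bx + \<bar>VG\<bar>" .
  have "(LINT om|M. \<bar>(1 - (rho n i)^2 - 2 * th n * d n i) / T n * ((xt n i om)^2 - VG)\<bar>) = \<bar>1 - (rho n i)^2 - 2 * th n * d n i\<bar> / T n * (LINT om|M. \<bar>(xt n i om)^2 - VG\<bar>)"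
  using goodD(3)[OF gd] unfolding abs_mult integral_mult_right_zero by simp
  also have "... <= (4 * (4 * a^2 * \<Delta> n * d n i)) / T n * (Bx + \<bar>VG\<bar>)"
  using rho2_lin[OF i] th_d_sq[OF gd i] v goodD(3,4)[OF gd] d_pos[OF i] Bx_nonneg
  by (intro mult_mono divide_right_mono) auto
  finally show "(LINT om|M. \<bar>(1 - (rho n i)^2 - 2 * th n * d n i) / T n * ((xt n i om)^2 - VG)\<bar>) <= 4 * (4 * a^2) * (Bx + \<bar>VG\<bar>) * \<Delta> n * d n i / T n"
  by (simp add: mult_ac)
 qed
qed

text \<open>The energy identity: summing the recursion for \<open>xt\<^sup>2\<close> expresses the empirical second moment through
 boundary terms, orthogonal sums and the innovation variances.\<close>
lemma quadratic_lln: "oP M (%n om. (\<Sum>i<n. d n i * ((xt n i om)^2 - VG)) / T n)"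
proof -
 define v where "v n i = (LINT om|M. (jt n i om)\<^sup>2)" for n i
 \<comment> \<open>The total innovation variance against the loss \<open>(1 - rho^2) VG\<close> by
   contraction; stationarity balances the two up to a multiple of \<open>eps n\<close>.\<close>
 let ?P8 = "%n. (\<Sum>i<n. v n i + (sd n i)^2 - (1 - (rho n i)^2) * VG) / T n"
 have P8: "?P8 ---> 0"
 proof (rule Lim_null_comparison[OF ev_good tend0_eps[of CJ]])
  fix n assume gd: "good n"
  have "\<bar>\<Sum>i<n. v n i + (sd n i)^2 - (1 - (rho n i)^2) * VG\<bar> <= (\<Sum>i<n. CJ * eps n * d n i)"
  by (intro order_trans[OF sum_abs] sum_mono) (use jj_mom(10)[OF gd] in \<open>auto simp: v_def\<close>)
  also have "... = CJ * eps n * T n" by (simp add: sum_distrib_left[symmetric] sum_d)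
  finally show "norm (?P8 n) <= CJ * eps n" using goodD(3)[OF gd] by (simp add: pos_divide_le_eq)
 qed
 let ?tot = "%n om. ((xt n 0 om)^2 / T n - (xt n n om)^2 / T n) + (\<Sum>i<n. 2 * rho n i * xt n i om / T n * jt n i om)
  + (\<Sum>i<n. 2 * rho n i * sd n i * xt n i om / T n * g n i om) + (\<Sum>i<n. 2 * sd n i * jt n i om / T n * g n i om)
  + (\<Sum>i<n. 1 / T n * ((jt n i om)^2 - (LINT om|M. (jt n i om)\<^sup>2))) + (\<Sum>i<n. (sd n i)\<^sup>2 / T n * ((g n i om)^2 - 1)) + ?P8 n
  + (\<Sum>i<n. b n i / T n * (2 * rho n i * xt n i om + 2 * jt n i om + 2 * sd n i * g n i om + b n i))
  - (\<Sum>i<n. (1 - (rho n i)^2 - 2 * th n * d n i) / T n * ((xt n i om)^2 - VG))"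
 have *: "oP M ?tot"
  by (intro oP_diff oP_add xt_end_oP cross_jt_oP cross_g_oP jt_g_oP jt_sq_lln g_sq_oP b_terms_oP rho2_err_oP oP_const P8) auto
 have "oP M (%n om. (1 / th n) * ?tot n om)" by (rule oP_cmult[OF * th_inv_bounded])
 then have "oP M (%n om. 1 / 2 * ((1 / th n) * ?tot n om))" by (rule oP_cmult[where C="1/2"]) simp
 then show ?thesis
 proof (rule oP_cong_eventually, intro ev_good ballI)
  fix n om assume gd: "good n" and w: "om : space M"
  have tp: "th n ~= 0" "T n ~= 0" using th_pos[of n] goodD(3)[OF gd] by auto
  have "(xt n 0 om)^2 - (xt n n om)^2 = (\<Sum>i<n. (xt n i om)\<^sup>2 - (xt n (Suc i) om)^2)" by (rule sum_lessThan_telescope'[symmetric])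
  then have A: "(xt n 0 om)^2 / T n - (xt n n om)^2 / T n = (\<Sum>i<n. ((xt n i om)^2 - (xt n (Suc i) om)^2) / T n)"
  by (simp add: diff_divide_distrib[symmetric] sum_divide_distrib)
  have "?tot n om = (\<Sum>i<n. 2 * th n / T n * (d n i * ((xt n i om)^2 - VG)))"
  unfolding A sum_divide_distrib sum.distrib[symmetric] sum_subtractf[symmetric]
  proof (intro sum.cong refl)
  fix i assume "i \<in> {..<n}"
  then have st: "xt n (Suc i) om = rho n i * xt n i om + jt n i om + sd n i * g n i om + b n i" using step_t[OF _ w] by simp
  show "((xt n i om)^2 - (xt n (Suc i) om)^2) / T n + 2 * rho n i * xt n i om / T n * jt n i om + 2 * rho n i * sd n i * xt n i om / T n * g n i om +
  2 * sd n i * jt n i om / T n * g n i om + 1 / T n * ((jt n i om)^2 - (LINT om|M. (jt n i om)\<^sup>2)) + (sd n i)^2 / T n * ((g n i om)^2 - 1) +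
  (v n i + (sd n i)^2 - (1 - (rho n i)^2) * VG) / T n + b n i / T n * (2 * rho n i * xt n i om + 2 * jt n i om + 2 * sd n i * g n i om + b n i) -
  (1 - (rho n i)^2 - 2 * th n * d n i) / T n * ((xt n i om)^2 - VG) = 2 * th n / T n * (d n i * ((xt n i om)^2 - VG))"
  unfolding st v_def[symmetric] using tp(2) by (simp add: divide_simps) (simp add: power2_eq_square algebra_simps)
  qed
  also have "... = 2 * th n / T n * (\<Sum>i<n. d n i * ((xt n i om)^2 - VG))" by (simp add: sum_distrib_left)
  finally show "(\<Sum>i<n. d n i * ((xt n i om)^2 - VG)) / T n = 1 / 2 * ((1 / th n) * ?tot n om)"
  using tp by simp
 qed
qed

text \<open>Expansion of the squares about \<open>mG\<close>, using
  \<open>qG = VG + mG^2\<close>.\<close>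

theorem lln: "oP M (%n om. (\<Sum>i<n. d n i * (x n i om)^2) / T n - qG)"
proof -
 have "oP M (%n om. (\<Sum>i<n. d n i * ((xt n i om)^2 - VG)) / T n + 2 * mG * ((\<Sum>i<n. d n i * xt n i om) / T n))"
  by (intro oP_add quadratic_lln oP_cmult[OF linear_lln, where C="\<bar>2 * mG\<bar>"]) simp
 then show ?thesis
 proof (rule oP_cong_eventually, intro ev_good ballI)
  fix n om assume gd: "good n"
  have T0: "T n ~= 0" using goodD(3)[OF gd] by simp
  have "(\<Sum>i<n. d n i * (x n i om)^2) = (\<Sum>i<n. d n i * ((xt n i om)^2 - VG) + 2 * mG * (d n i * xt n i om) + qG * d n i)"
  by (intro sum.cong refl) (simp add: xt_def VG_def power2_eq_square algebra_simps)
  also have "... = (\<Sum>i<n. d n i * ((xt n i om)^2 - VG)) + 2 * mG * (\<Sum>i<n. d n i * xt n i om) + qG * T n"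
  by (simp add: sum.distrib sum_distrib_left[symmetric] sum_d)
  finally show "(\<Sum>i<n. d n i * (x n i om)^2) / T n - qG = (\<Sum>i<n. d n i * ((xt n i om)^2 - VG)) / T n + 2 * mG * ((\<Sum>i<n. d n i * xt n i om) / T n)"
  using T0 by (simp add: add_divide_distrib)
 qed
qed

end

section \<open>The limit law of the estimator\<close>

definition filtered_sum :: "real => nat => (nat => real) => real" where
 "filtered_sum v n y = (\<Sum>i<n. y i * (y (Suc i) - y i) * indicator {z. \<bar>z\<bar> <= v} (y (Suc i) - y i))"

lemma (in prob_space) prob_union_le:
 fixes n :: nat
 assumes "\<And>i. i < n ==> Measurable.pred M (P i)" "\<And>i. i < n ==> prob {om\<in>space M. P i om} <= f i"
 shows "prob {om\<in>space M. \<exists>i<n. P i om} <= (\<Sum>i<n. f i)"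
proof -
 have "{om\<in>space M. \<exists>i<n. P i om} = (\<Union>i<n. {om\<in>space M. P i om})" by auto
 also have "prob ... <= (\<Sum>i<n. prob {om\<in>space M. P i om})"
  using assms(1) by (intro finite_measure_subadditive_finite) (auto simp: pred_def)
 also have "... <= (\<Sum>i<n. f i)" by (rule sum_mono) (use assms(2) in auto)
 finally show ?thesis .
qed

text \<open>The normal law is identified as the image of the standard one under scaling.\<close>

lemma normal_char:
 assumes "s > 0"
 shows "real_distribution (density lborel (normal_density 0 s))"
  and "char (density lborel (normal_density 0 s)) u = exp (- complex_of_real (u^2 * s^2 / 2))"
proof -
 interpret S: real_distribution std_normal_distribution by (rule real_dist_normal_dist)
 have "distributed std_normal_distribution lborel (%x. x) (std_normal_density)"
  unfolding distributed_def by (auto simp: distr_id2)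
 from S.normal_density_affine[OF this _ , of s 0]
 have "distributed std_normal_distribution lborel (%x. 0 + s * x) (normal_density 0 s)" using assms by simp
 then have "distr std_normal_distribution lborel (%x. 0 + s * x) = density lborel (normal_density 0 s)" by (rule distributed_distr_eq_density)
 moreover have "distr std_normal_distribution borel (%x. s * x) = distr std_normal_distribution lborel (%x. 0 + s * x)" by (rule distr_cong) auto
 ultimately have e: "density lborel (normal_density 0 s) = distr std_normal_distribution borel (%x. s * x)" by (simp only:)
 show "real_distribution (density lborel (normal_density 0 s))"
  unfolding e by (intro real_distribution.intro S.prob_space_distr real_distribution_axioms.intro) auto
 show "char (density lborel (normal_density 0 s)) u = exp (- complex_of_real (u^2 * s^2 / 2))"
 proof -
  have "char (density lborel (normal_density 0 s)) u = char std_normal_distribution (u * s)"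
  unfolding e char_def by (subst integral_distr) (auto simp: mult_ac)
  then show ?thesis by (simp only: char_std_normal_distribution power_mult_distrib exp_of_real[symmetric] of_real_minus[symmetric] minus_divide_left)
 qed
qed

context ou_array
begin

section \<open>The filter singles out the intervals with jumps\<close>

lemma rate_powr:
 assumes "min (1 - 2 * \<beta>) (1 / 2) <= q"
 shows "(%n. T n * \<Delta> n powr q) ---> 0"
proof (rule Lim_null_comparison[OF ev_good rate])
 fix n assume gd: "good n"
 have "\<Delta> n powr q <= \<Delta> n powr (min (1 - 2 * \<beta>) (1 / 2))" by (rule powr_mono'[OF assms]) (use goodD[OF gd] in auto)
 then show "norm (T n * \<Delta> n powr q) <= T n * \<Delta> n powr min (1 - 2 * \<beta>) (1 / 2)"
  using goodD(3)[OF gd] by (simp add: mult_left_mono)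
qed

lemma rates: "(%n. T n * \<Delta> n) ---> 0" "(%n. sqrt (T n) * sqrt (\<Delta> n)) ---> 0" "(%n. T n * \<Delta> n powr (1 - 2 * \<beta>)) ---> 0"
proof -
 show "(%n. T n * \<Delta> n) ---> 0"
 proof (rule Lim_transform_eventually[OF rate_powr[of 1] ev_good])
  show "good n ==> T n * \<Delta> n powr 1 = T n * \<Delta> n" for n using goodD(4)[of n] by simp
 qed (use beta in auto)
 from tendsto_real_sqrt[OF this] show "(%n. sqrt (T n) * sqrt (\<Delta> n)) ---> 0" by (simp add: real_sqrt_mult)
qed (rule rate_powr, simp)

lemma n_mesh: "\<exists>C>0. EVN n. real n * \<Delta> n <= C * T n"
proof -
 from landau_o.bigE[OF nmesh] obtain C where C: "C > 0" "EVN n. norm (real n * \<Delta> n / T n) <= C * norm (1::real)" by blast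
 from C(2) good_ev have "EVN n. real n * \<Delta> n <= C * T n"
 proof eventually_elim
  case (elim n)
  have "real n * \<Delta> n / T n <= C" using elim(1) by (simp only: real_norm_def abs_le_iff) simp
  then show ?case using goodD(3)[OF elim(2)] by (simp add: pos_divide_le_eq)
 qed
 with C(1) show ?thesis by blast
qed

abbreviation "v n \<equiv> \<Delta> n powr \<beta>"

lemma v_sq: "\<Delta> n > 0 ==> \<Delta> n / (v n)^2 = \<Delta> n powr (1 - 2 * \<beta>)"
 using powr_add[of "\<Delta> n" \<beta> \<beta>] by (simp add: powr_diff power2_eq_square)

text \<open>Three ways for the filter to err: large drift, large Gaussian part, small jump. Off
  these events drift and Gaussian part together stay below \<open>v / 2\<close>; an interval without
  jump innovation is then kept, and one with an innovation above \<open>3/2 v\<close> moves by more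
  than \<open>v\<close> and is dropped.\<close>

definition bad1 where "bad1 n = {om\<in>space M. \<exists>i<n. 2 * a * \<Delta> n * \<bar>x n i om\<bar> >= v n / 4}"
definition bad2 where "bad2 n = {om\<in>space M. \<exists>i<n. \<bar>sd n i * g n i om\<bar> >= v n / 4}"
definition bad3 where "bad3 n = {om\<in>space M. \<exists>i<n. jj n i om ~= 0 & \<bar>jj n i om\<bar> <= 3/2 * v n}"

lemma bad_sets: "bad1 n \<union> bad2 n \<union> bad3 n \<in> events"
proof -
 have [measurable]: "i \<in> {..<n} ==> x n i : bmeas M" "i \<in> {..<n} ==> g n i : bmeas M" "i \<in> {..<n} ==> jj n i : bmeas M" for i
  using x_M[of i n] g_M[of i n] jj_M[of i n] by auto
 have e: "bad1 n = {om\<in>space M. \<exists>i\<in>{..<n}. 2 * a * \<Delta> n * \<bar>x n i om\<bar> >= v n / 4}" "bad2 n = {om\<in>space M. \<exists>i\<in>{..<n}. \<bar>sd n i * g n i om\<bar> >= v n / 4}"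
  "bad3 n = {om\<in>space M. \<exists>i\<in>{..<n}. jj n i om ~= 0 & \<bar>jj n i om\<bar> <= 3/2 * v n}" by (auto simp: bad1_def bad2_def bad3_def)
 show ?thesis unfolding e by measurable
qed

text \<open>Chebyshev over \<open>n\<close> intervals gives \<open>n \<Delta>^2 / v^2\<close>, that
  is \<open>n \<Delta>\<close> times \<open>\<Delta> powr (1 - 2 \<beta>)\<close>, and
  \<open>n \<Delta>\<close> is of order \<open>T\<close>.\<close>

lemma bad1_lim: "(%n. prob (bad1 n)) ---> 0"
proof -
 obtain C where C: "C > 0" "EVN n. real n * \<Delta> n <= C * T n" using n_mesh by blast
 define B where "B = 2 * Bx + 2 * mG^2"
 show ?thesis
 proof (rule Lim_null_comparison)
  show "(%n. 64 * a^2 * B * C * (T n * \<Delta> n powr (1 - 2 * \<beta>))) ---> 0"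
  using tendsto_mult_right_zero[OF rates(3)] .
  show "EVN n. norm (prob (bad1 n)) <= 64 * a^2 * B * C * (T n * \<Delta> n powr (1 - 2 * \<beta>))"
  using C(2) good_ev
  proof eventually_elim
  case (elim n)
  note gd = elim(2) and D = goodD(4)[OF elim(2)]
  have v0: "v n > 0" using D by simp
  have "prob (bad1 n) <= (\<Sum>i<n. 64 * a^2 * B * (\<Delta> n)^2 / (v n)^2)"
  unfolding bad1_def
  proof (rule prob_union_le)
  fix i assume i: "i < n"
  have [measurable]: "x n i : bmeas M" using x_M i by simp
  show "Measurable.pred M (%om. 2 * a * \<Delta> n * \<bar>x n i om\<bar> >= v n / 4)" by measurable
  have q: "integrable M (%om. (x n i om)\<^sup>2)" "(LINT om|M. (x n i om)\<^sup>2) <= B" using x_sq[OF gd, of i] i by (auto simp: B_def)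
  let ?c = "v n / (8 * a * \<Delta> n)"
  have c: "?c > 0" using v0 a_pos D by simp
  have eq: "(2 * a * \<Delta> n * \<bar>x n i om\<bar> >= v n / 4) = ((x n i om)^2 >= ?c\<^sup>2)" for om
  proof -
  have "(2 * a * \<Delta> n * \<bar>x n i om\<bar> >= v n / 4) = (?c <= \<bar>x n i om\<bar>)" using a_pos D by (simp add: field_simps)
  also have "... = ((x n i om)^2 >= ?c\<^sup>2)" using c by (metis abs_le_square_iff abs_of_pos)
  finally show ?thesis .
  qed
  have "prob {om\<in>space M. (x n i om)\<^sup>2 >= ?c\<^sup>2} <= (LINT om|M. (x n i om)\<^sup>2) / ?c\<^sup>2"
  by (rule integral_Markov_inequality_measure[where A="{}"]) (use q c in auto)
  also have "... <= B / ?c\<^sup>2" using q c by (intro divide_right_mono) auto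
  also have "... = 64 * a^2 * B * (\<Delta> n)^2 / (v n)^2" by (simp add: power_divide power_mult_distrib)
  finally show "prob {om\<in>space M. 2 * a * \<Delta> n * \<bar>x n i om\<bar> >= v n / 4} <= 64 * a^2 * B * (\<Delta> n)^2 / (v n)^2" unfolding eq .
  qed
  also have "... = 64 * a^2 * B * ((real n * \<Delta> n) * (\<Delta> n / (v n)^2))" by (simp add: power2_eq_square)
  also have "\<Delta> n / (v n)^2 = \<Delta> n powr (1 - 2 * \<beta>)" by (rule v_sq) (rule D)
  also have "64 * a^2 * B * ((real n * \<Delta> n) * \<Delta> n powr (1 - 2 * \<beta>)) <= 64 * a^2 * B * ((C * T n) * \<Delta> n powr (1 - 2 * \<beta>))"
  using elim(1) Bx_nonneg by (intro mult_left_mono mult_right_mono) (auto simp: B_def)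
  finally show ?case by (simp add: mult_ac)
  qed
 qed
qed

text \<open>Gaussian variables have moments of every order: with
  \<open>p (1 - 2 \<beta>) >= 2\<close> the moment of order \<open>2 p\<close> makes each
  probability of order \<open>\<Delta>^2\<close>, in total \<open>T \<Delta>\<close>.\<close>

lemma bad2_lim: "(%n. prob (bad2 n)) ---> 0"
proof -
 obtain C where C: "C > 0" "EVN n. real n * \<Delta> n <= C * T n" using n_mesh by blast
 obtain p :: nat where p: "2 <= real p * (1 - 2 * \<beta>)"
  using reals_Archimedean3[of "1 - 2 * \<beta>"] beta by (metis diff_gt_0_iff_gt less_divide_eq_numeral1(1) mult.commute order_less_imp_le)
 define cp where "cp = (fact (2 * p) / (2 ^ p * fact p) :: real)"
 have cp: "cp >= 0" by (simp add: cp_def)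
 show ?thesis
 proof (rule Lim_null_comparison)
  show "(%n. (16 * \<sigma>^2) ^ p * cp * C * (T n * \<Delta> n)) ---> 0"
  using tendsto_mult_right_zero[OF rates(1)] .
  show "EVN n. norm (prob (bad2 n)) <= (16 * \<sigma>^2) ^ p * cp * C * (T n * \<Delta> n)"
  using C(2) good_ev
  proof eventually_elim
  case (elim n)
  note gd = elim(2) and D = goodD(4,5)[OF elim(2)]
  have v0: "v n > 0" using D by simp
  have "prob (bad2 n) <= (\<Sum>i<n. (16 * \<sigma>^2) ^ p * cp * (\<Delta> n)^2)"
  unfolding bad2_def
  proof (rule prob_union_le)
  fix i assume i: "i < n"
  have [measurable]: "g n i : bmeas M" using g_M[OF i] .
  show "Measurable.pred M (%om. \<bar>sd n i * g n i om\<bar> >= v n / 4)" by measurable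
  note gm = std_normal_moments(1,5)[OF g_M[OF i] g_distr[OF i]]
  let ?c = "(v n / 4) ^ (2 * p)"
  have c: "?c > 0" using v0 by simp
  have "prob {om\<in>space M. \<bar>sd n i * g n i om\<bar> >= v n / 4} <= prob {om\<in>space M. (sd n i * g n i om) ^ (2 * p) >= ?c}"
  proof (rule finite_measure_mono)
  show "{om\<in>space M. \<bar>sd n i * g n i om\<bar> >= v n / 4} \<subseteq> {om\<in>space M. (sd n i * g n i om) ^ (2 * p) >= ?c}"
  proof safe
  fix om assume "v n / 4 <= \<bar>sd n i * g n i om\<bar>"
  from power_mono[OF this, of "2 * p"] show "?c <= (sd n i * g n i om) ^ (2 * p)" using v0 by (simp add: power_even_abs)
  qed
  qed measurable
  also have "... <= (LINT om|M. (sd n i * g n i om) ^ (2 * p)) / ?c"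
  by (rule integral_Markov_inequality_measure[where A="{}"]) (use gm c in \<open>auto simp: power_mult_distrib\<close>)
  also have "(LINT om|M. (sd n i * g n i om) ^ (2 * p)) = ((sd n i)^2) ^ p * cp"
  using gm(2)[of p] by (simp add: power_mult_distrib cp_def power_mult)
  also have "... / ?c <= (\<sigma>^2 * \<Delta> n) ^ p * cp / ?c"
  using sd_bound(1)[OF i] mult_left_mono[OF d_le[OF i], of "\<sigma>^2"] cp c by (intro divide_right_mono mult_right_mono power_mono) auto
  also have "... = (16 * \<sigma>^2) ^ p * cp * (\<Delta> n / (v n)^2) ^ p"
  by (simp add: power_divide power_mult_distrib power_mult)
  also have "\<Delta> n / (v n)^2 = \<Delta> n powr (1 - 2 * \<beta>)" by (rule v_sq) (rule D)
  also have "(\<Delta> n powr (1 - 2 * \<beta>)) ^ p = \<Delta> n powr (real p * (1 - 2 * \<beta>))" using D by (simp add: powr_power mult.commute)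
  also have "(16 * \<sigma>^2) ^ p * cp * \<Delta> n powr (real p * (1 - 2 * \<beta>)) <= (16 * \<sigma>^2) ^ p * cp * \<Delta> n powr 2"
  using cp D p by (intro mult_left_mono powr_mono') auto
  finally show "prob {om\<in>space M. \<bar>sd n i * g n i om\<bar> >= v n / 4} <= (16 * \<sigma>^2) ^ p * cp * (\<Delta> n)^2" using D by simp
  qed
  also have "... = (16 * \<sigma>^2) ^ p * cp * ((real n * \<Delta> n) * \<Delta> n)" by (simp add: power2_eq_square)
  also have "... <= (16 * \<sigma>^2) ^ p * cp * ((C * T n) * \<Delta> n)"
  using elim(1) cp D by (intro mult_left_mono mult_right_mono) auto
  finally show ?case by (simp add: mult_ac)
  qed
 qed
qed

text \<open>Multiple jumps sum to \<open>lam^2 T \<Delta>\<close>, small single jumps to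
  \<open>lam T\<close> times the mass of \<open>F\<close> near 0; here the hypothesis on small jump
  heights is used.\<close>

lemma bad3_lim: "(%n. prob (bad3 n)) ---> 0"
proof -
 let ?F = "%n. measure F {- 2 * v n <..< 2 * v n}"
 have TF: "(%n. T n * ?F n) ---> 0"
 proof -
  have "(%n. ?F n / (1 / T n)) ---> 0" by (rule smalloD_tendsto[OF small_jumps])
  then show ?thesis by (simp add: mult.commute)
 qed
 have ex: "EVN n. 3 / 2 * exp (2 * a * \<Delta> n) < 2"
 proof (rule order_tendstoD(2))
  show "(%n. 3 / 2 * exp (2 * a * \<Delta> n)) ---> 3 / 2 * exp (2 * a * 0)" by (intro tendsto_intros mesh_0)
 qed simp
 show ?thesis
 proof (rule Lim_null_comparison)
  show "(%n. lam\<^sup>2 * (T n * \<Delta> n) + lam * (T n * ?F n)) ---> 0"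
  using tendsto_add[OF tendsto_mult_right_zero[OF rates(1), of "lam^2"] tendsto_mult_right_zero[OF TF, of lam]] by simp
  show "EVN n. norm (prob (bad3 n)) <= lam^2 * (T n * \<Delta> n) + lam * (T n * ?F n)"
  using ex good_ev
  proof eventually_elim
  case (elim n)
  note gd = elim(2) and D = goodD(4,5)[OF elim(2)]
  have "prob (bad3 n) <= (\<Sum>i<n. (lam * d n i)\<^sup>2 + lam * d n i * ?F n)"
  unfolding bad3_def
  proof (rule prob_union_le)
  fix i assume i: "i < n"
  have [measurable]: "jj n i : bmeas M" using jj_M[OF i] .
  show "Measurable.pred M (%om. jj n i om ~= 0 & \<bar>jj n i om\<bar> <= 3/2 * v n)" by measurable
  have "th n * d n i <= 2 * a * \<Delta> n" using goodD(7)[OF gd] d_le[OF i] d_pos[OF i] a_pos by (intro mult_mono) auto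
  then have "3 / 2 * exp (th n * d n i) <= 3 / 2 * exp (2 * a * \<Delta> n)" by simp
  also note elim(1)
  finally have e: "3 / 2 * exp (th n * (t n (Suc i) - t n i)) < 2" by (simp add: d_def)
  show "prob {om\<in>space M. jj n i om ~= 0 & \<bar>jj n i om\<bar> <= 3/2 * v n} <= (lam * d n i)^2 + lam * d n i * ?F n"
  using Jou_small_prob[OF gridD(1)[OF gr i] grid_incr[OF i] th_pos _ e, of "v n"] D unfolding jj_def jmp_def d_def by simp
  qed
  also have "... = lam^2 * (\<Sum>i<n. (d n i)\<^sup>2) + lam * ?F n * T n"
  by (simp add: sum.distrib power_mult_distrib sum_distrib_left[symmetric] sum_distrib_right[symmetric] sum_d[symmetric] mult_ac)
  also have "... <= lam^2 * (\<Delta> n * T n) + lam * ?F n * T n" using mult_left_mono[OF sum_d2[of n], of "lam^2"] by simp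
  finally show ?case by (simp add: mult_ac)
  qed
 qed
qed

lemma bad_lim: "(%n. prob (bad1 n \<union> bad2 n \<union> bad3 n)) ---> 0"
proof (rule Lim_null_comparison[OF always_eventually])
 show "(%n. prob (bad1 n) + prob (bad2 n) + prob (bad3 n)) ---> 0"
  using tendsto_add[OF tendsto_add[OF bad1_lim bad2_lim] bad3_lim] by simp
 have m[measurable]: "i \<in> {..<n} ==> x n i : bmeas M" "i \<in> {..<n} ==> g n i : bmeas M" "i \<in> {..<n} ==> jj n i : bmeas M" for i n
  using x_M[of i n] g_M[of i n] jj_M[of i n] by auto
 have e: "bad1 n = {om\<in>space M. \<exists>i\<in>{..<n}. 2 * a * \<Delta> n * \<bar>x n i om\<bar> >= v n / 4}" "bad2 n = {om\<in>space M. \<exists>i\<in>{..<n}. \<bar>sd n i * g n i om\<bar> >= v n / 4}"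
  "bad3 n = {om\<in>space M. \<exists>i\<in>{..<n}. jj n i om ~= 0 & \<bar>jj n i om\<bar> <= 3/2 * v n}" for n by (auto simp: bad1_def bad2_def bad3_def)
 have s: "bad1 n \<in> events" "bad2 n \<in> events" "bad3 n \<in> events" for n unfolding e by measurable
 show "\<forall>n. norm (prob (bad1 n \<union> bad2 n \<union> bad3 n)) <= prob (bad1 n) + prob (bad2 n) + prob (bad3 n)"
 proof
  fix n
  show "norm (prob (bad1 n \<union> bad2 n \<union> bad3 n)) <= prob (bad1 n) + prob (bad2 n) + prob (bad3 n)"
  using measure_Un_le[OF s(1) s(2), of n n] measure_Un_le[of "bad1 n \<union> bad2 n" M "bad3 n"] s by auto
 qed
qed

lemma filter_exact:
 assumes gd: "good n" and w: "om : space M - (bad1 n \<union> bad2 n \<union> bad3 n)" and i: "i < n"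
 shows "indicator {z. \<bar>z\<bar> <= v n} (x n (Suc i) om - x n i om) = (if jj n i om = 0 then 1 else 0 :: real)"
proof -
 have st: "x n (Suc i) om - x n i om = (rho n i - 1) * x n i om + jj n i om + sd n i * g n i om" using step[OF i] w by (simp add: algebra_simps)
 have b: "2 * a * \<Delta> n * \<bar>x n i om\<bar> < v n / 4" "\<bar>sd n i * g n i om\<bar> < v n / 4" "jj n i om = 0 \<or> \<bar>jj n i om\<bar> > 3/2 * v n"
  using w i by (force simp: bad1_def bad2_def bad3_def)+
 have "1 - rho n i <= th n * d n i" using exp_ge_add_one_self[of "- th n * d n i"] by (simp add: rho_def)
 also have "... <= 2 * a * \<Delta> n" using goodD(7)[OF gd] d_le[OF i] d_pos[OF i] a_pos by (intro mult_mono) auto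
 finally have "\<bar>(rho n i - 1) * x n i om\<bar> <= 2 * a * \<Delta> n * \<bar>x n i om\<bar>"
  using rho_bounds[OF i] unfolding abs_mult by (intro mult_right_mono) auto
 then show ?thesis unfolding st using b by (auto simp: indicator_def)
qed

lemma jump_prob:
 assumes i: "i < n" shows "prob {om\<in>space M. jj n i om ~= 0} <= lam * d n i"
 using Jou_nonzero_prob[OF gridD(1)[OF gr i] grid_incr[OF i], of "th n"] by (simp add: jj_def jmp_def d_def)

text \<open>The variances differ by order \<open>d^2\<close>; dividing by the sum of the two roots
  leaves \<open>d * sqrt d\<close>.\<close>

lemma sd_approx: "good n ==> i < n ==> \<bar>sd n i - \<sigma> * sqrt (d n i)\<bar> <= 4 * a * \<bar>\<sigma>\<bar> * (d n i * sqrt (\<Delta> n))"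
proof -
 assume gd: "good n" and i: "i < n"
 note dp = d_pos[OF i] and tp = th_pos[of n]
 define s where "s = ou_sd (th n) (d n i)"
 have s: "s > 0" unfolding s_def by (rule ou_sd_pos[OF tp dp])
 have b: "s^2 <= d n i" "d n i - 2 * th n * (d n i)^2 <= s^2" using ou_sd_bounds[OF tp dp] by (auto simp: s_def)
 have sq: "s <= sqrt (d n i)" using b(1) s by (simp add: real_le_rsqrt)
 have "(sqrt (d n i) - s) * sqrt (d n i) <= (sqrt (d n i) - s) * (sqrt (d n i) + s)" using sq s by (intro mult_left_mono) auto
 also have "... = d n i - s^2" using dp by (simp add: algebra_simps power2_eq_square)
 also have "... <= (2 * th n * (d n i * sqrt (d n i))) * sqrt (d n i)" using b dp by (simp add: power2_eq_square algebra_simps)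
 finally have "sqrt (d n i) - s <= 2 * th n * (d n i * sqrt (d n i))" using dp by (simp add: mult_le_cancel_right)
 also have "... <= 2 * (2 * a) * (d n i * sqrt (\<Delta> n))"
  using goodD(7)[OF gd] dp d_le[OF i] tp a_pos by (intro mult_mono) auto
 finally have "\<bar>s - sqrt (d n i)\<bar> <= 4 * a * (d n i * sqrt (\<Delta> n))" using sq by simp
 then have "\<bar>\<sigma>\<bar> * \<bar>s - sqrt (d n i)\<bar> <= \<bar>\<sigma>\<bar> * (4 * a * (d n i * sqrt (\<Delta> n)))" by (rule mult_left_mono) simp
 then show ?thesis by (simp add: sd_def s_def[symmetric] abs_mult[symmetric] algebra_simps)
qed

text \<open>Discrete form of the integral of \<open>X\<close> against the Brownian motion, divided
  by \<open>sqrt T\<close>; its bracket is the time average of the squared observations.\<close>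

definition zeta :: "nat => 'a => real" where
 "zeta n om = (\<Sum>i<n. (sqrt (d n i) / sqrt (T n) * x n i om) * g n i om)"

text \<open>Divided by the time average of squares, this is the negative of
  \<open>sqrt T (abar - th)\<close>.\<close>

definition Asc :: "nat => 'a => real" where
 "Asc n om = (filtered_sum (v n) n (%i. x n i om) + th n * (\<Sum>i<n. d n i * (x n i om)^2)) / sqrt (T n)"

text \<open>On one interval \<open>q\<close> is what separates the filtered numerator from \<sigma>
  times the Gaussian sum: linearisation of the drift, linearisation of the standard deviation, and
  the terms lost by dropping an interval with a jump. The jump is independent of \<open>x\<close>
  and the Gaussian of both, so the lost part carries the jump probability, at most
  \<open>lam d\<close>.\<close>

lemma filtered_err_L1:
 assumes gd: "good n" and i: "i < n"
 defines "q \<equiv> %om. (rho n i - 1 + th n * d n i) * (x n i om)^2 + (sd n i - \<sigma> * sqrt (d n i)) * (x n i om * g n i om)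
  - indicator {om\<in>space M. jj n i om ~= 0} om * ((rho n i - 1) * (x n i om)^2 + sd n i * (x n i om * g n i om))"
 shows "integrable M q" "(LINT om|M. \<bar>q om\<bar>) \<le>
  ((4 * a^2 + 2 * a * lam) * (2 * Bx + 2 * mG^2) + (4 * a * \<bar>\<sigma>\<bar> + 2 * \<bar>\<sigma>\<bar> * lam) * (2 * Bx + 2 * mG^2 + 1)) * (sqrt (\<Delta> n) * d n i)"
proof -
 define B where "B = 2 * Bx + 2 * mG^2"
 have B0: "B >= 0" using Bx_nonneg by (simp add: B_def)
 note dp = d_pos[OF i] and dl = d_le[OF i] and gm = g_mom[OF i] and D = goodD(4,5)[OF gd]
 let ?x = "x n i" and ?g = "g n i" and ?I = "indicator {om\<in>space M. jj n i om ~= 0} :: 'a => real"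
 have [measurable]: "?x : bmeas M" "?g : bmeas M" "jj n i : bmeas M"
  using x_M g_M jj_M i by auto
 have Dl: "\<Delta> n <= sqrt (\<Delta> n)" using D by (intro real_le_rsqrt) (auto simp: power2_eq_square mult_left_le)
 have xq: "integrable M (%om. (?x om)\<^sup>2)" "(LINT om|M. (?x om)\<^sup>2) <= B" using x_sq[OF gd, of i] i by (auto simp: B_def)
 have ig: "integrable M (%om. (?g om)\<^sup>2)" using gm(1)[of 2] .
 have x1: "integrable M ?x" "(LINT om|M. \<bar>?x om\<bar>) <= 1 + B" using abs_le_sq[of ?x] xq by auto
 have g1: "(LINT om|M. \<bar>?g om\<bar>) <= 2" using abs_le_sq[OF _ ig] gm(3) by simp
 have ivxg: "indep_var borel ?x borel ?g" using indep_alg_indep_var[OF adapted_indepD(3)[OF g_ad i] x_G, of "%x. x" borel] i by simp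
 have ixg: "integrable M (%om. ?x om * ?g om)" by (rule indep_var_integrable[OF ivxg x1(1) gm(5)])
 have absxg: "(LINT om|M. \<bar>?x om * ?g om\<bar>) <= B + 1"
 proof -
  have "(LINT om|M. \<bar>?x om * ?g om\<bar>) <= (LINT om|M. (?x om)\<^sup>2 + (?g om)^2)"
  proof (rule integral_mono)
  show "\<bar>?x om * ?g om\<bar> <= (?x om)^2 + (?g om)^2" for om
  proof -
  have "2 * (\<bar>?x om\<bar> * \<bar>?g om\<bar>) <= (?x om)^2 + (?g om)^2" using sum_squares_bound[of "\<bar>?x om\<bar>" "\<bar>?g om\<bar>"] by simp
  moreover have "0 <= \<bar>?x om\<bar> * \<bar>?g om\<bar>" by simp
  ultimately show ?thesis unfolding abs_mult by linarith
  qed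
  qed (use ixg xq ig in auto)
  also have "... <= B + 1" using xq ig gm(3) by simp
  finally show ?thesis .
 qed
 have pI: "prob {om\<in>space M. jj n i om ~= 0} <= lam * d n i" by (rule jump_prob[OF i])
 have EI: "(LINT om|M. ?I om) <= lam * d n i" using pI by simp
 have iI: "integrable M ?I" by (rule integrable_real_indicator) (auto simp: emeasure_eq_measure)
 have Ij: "?I om = (%y. if y ~= 0 then 1 else 0) (jj n i om)" if "om : space M" for om using that by (simp add: indicator_def)
 \<comment> \<open>Present value and coming jump are independent by the filtration that reveals the
   Brownian path first.\<close>
 have jc: "indep_var borel (%om. f (?x om)) borel (%om. if jj n i om ~= 0 then 1 else (0::real))"
  if [measurable]: "f : bmeas borel" for f :: "real => real"
  by (rule indep_alg_indep_var[OF adapted_indepD(3)[OF j_ad i] measurable_compose[OF x_K that], of "%y. if y ~= 0 then 1 else 0" borel]) (use i in auto)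
 have iv1: "indep_var borel (%om. (?x om)\<^sup>2) borel (%om. if jj n i om ~= 0 then 1 else (0::real))"
  using jc[of "%y. y\<^sup>2"] by simp
 let ?J = "%om. if jj n i om ~= 0 then 1 else (0::real)"
 have iJ: "integrable M ?J" "(LINT om|M. ?J om) <= lam * d n i"
 proof -
  have "integrable M ?I = integrable M ?J" by (rule Bochner_Integration.integrable_cong) (auto simp: Ij)
  moreover have "(LINT om|M. ?I om) = (LINT om|M. ?J om)" by (rule Bochner_Integration.integral_cong) (auto simp: Ij)
  ultimately show "integrable M ?J" "(LINT om|M. ?J om) <= lam * d n i" using iI EI by auto
 qed
 have c1: "integrable M (%om. (?x om)\<^sup>2 * ?J om)" "(LINT om|M. (?x om)\<^sup>2 * ?J om) <= B * (lam * d n i)"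
 proof -
  show "integrable M (%om. (?x om)\<^sup>2 * ?J om)" by (rule indep_var_integrable[OF iv1 xq(1) iJ(1)])
  show "(LINT om|M. (?x om)\<^sup>2 * ?J om) <= B * (lam * d n i)"
  unfolding indep_var_lebesgue_integral[OF iv1 xq(1) iJ(1)] using xq iJ B0 by (intro mult_mono) auto
 qed
 have iv2: "indep_var borel (%om. \<bar>?x om\<bar>) borel ?J"
  using jc[of "%y. \<bar>y\<bar>"] by simp
 have x1': "integrable M (%om. \<bar>?x om\<bar>)" "integrable M (%om. \<bar>?g om\<bar>)" using x1 gm(5) by auto
 have xJ: "integrable M (%om. \<bar>?x om\<bar> * ?J om)" "(LINT om|M. \<bar>?x om\<bar> * ?J om) <= (1 + B) * (lam * d n i)"
 proof -
  show "integrable M (%om. \<bar>?x om\<bar> * ?J om)" by (rule indep_var_integrable[OF iv2 x1'(1) iJ(1)])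
  show "(LINT om|M. \<bar>?x om\<bar> * ?J om) <= (1 + B) * (lam * d n i)"
  unfolding indep_var_lebesgue_integral[OF iv2 x1'(1) iJ(1)] using x1 iJ B0 by (intro mult_mono) auto
 qed
 \<comment> \<open>In the other filtration the jump is already known, so the Gaussian is independent
   of this product.\<close>
 have xJG: "(%om. \<bar>?x om\<bar> * ?J om) : bmeas (G n i)"
 proof -
  have [measurable]: "?x : bmeas (G n i)" "jj n i : bmeas (G n i)" using x_G jj_G i by auto
  show ?thesis by measurable
 qed
 have iv3: "indep_var borel (%om. \<bar>?x om\<bar> * ?J om) borel (%om. \<bar>?g om\<bar>)"
  by (rule indep_alg_indep_var[OF adapted_indepD(3)[OF g_ad i] xJG, of abs borel]) simp
 have c2: "integrable M (%om. (\<bar>?x om\<bar> * ?J om) * \<bar>?g om\<bar>)" "(LINT om|M. (\<bar>?x om\<bar> * ?J om) * \<bar>?g om\<bar>) <= ((1 + B) * (lam * d n i)) * 2"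
 proof -
  show "integrable M (%om. (\<bar>?x om\<bar> * ?J om) * \<bar>?g om\<bar>)" by (rule indep_var_integrable[OF iv3 xJ(1) x1'(2)])
  show "(LINT om|M. (\<bar>?x om\<bar> * ?J om) * \<bar>?g om\<bar>) <= ((1 + B) * (lam * d n i)) * 2"
  unfolding indep_var_lebesgue_integral[OF iv3 xJ(1) x1'(2)] using xJ g1 B0 lam dp by (intro mult_mono) auto
 qed
 let ?k1 = "4 * a^2 * \<Delta> n * d n i" and ?k2 = "4 * a * \<bar>\<sigma>\<bar> * (d n i * sqrt (\<Delta> n))" and ?k3 = "2 * a * \<Delta> n" and ?k4 = "\<bar>\<sigma>\<bar> * sqrt (\<Delta> n)"
 have r1: "\<bar>rho n i - 1 + th n * d n i\<bar> <= ?k1" using rho_lin[OF i] th_d_sq[OF gd i] by linarith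
 have r2: "\<bar>rho n i - 1\<bar> <= ?k3"
 proof -
  have "1 - rho n i <= th n * d n i" using exp_ge_add_one_self[of "- th n * d n i"] by (simp add: rho_def)
  also have "... <= 2 * a * \<Delta> n" using goodD(7)[OF gd] dl dp a_pos by (intro mult_mono) auto
  finally show ?thesis using rho_bounds[OF i] by simp
 qed
 have r3: "\<bar>sd n i\<bar> <= ?k4"
 proof -
  have "(sd n i)^2 <= \<sigma>^2 * \<Delta> n" using sd_bound(1)[OF i] mult_left_mono[OF dl, of "\<sigma>^2"] by simp
  then have "sqrt ((sd n i)^2) <= sqrt (\<sigma>^2 * \<Delta> n)" by (rule real_sqrt_le_mono)
  then show ?thesis by (simp add: real_sqrt_mult)
 qed
 let ?bd = "%om. ?k1 * (?x om)^2 + ?k2 * \<bar>?x om * ?g om\<bar> + ?k3 * ((?x om)^2 * ?J om) + ?k4 * ((\<bar>?x om\<bar> * ?J om) * \<bar>?g om\<bar>)"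
 have bd: "\<bar>q om\<bar> <= ?bd om" if w: "om : space M" for om
 proof -
  have 1: "\<bar>(rho n i - 1 + th n * d n i) * (?x om)^2\<bar> <= ?k1 * (?x om)^2" unfolding abs_mult using r1 D dp by (intro mult_mono) auto
  have 2: "\<bar>(sd n i - \<sigma> * sqrt (d n i)) * (?x om * ?g om)\<bar> <= ?k2 * \<bar>?x om * ?g om\<bar>" unfolding abs_mult[of "sd n i - \<sigma> * sqrt (d n i)"]
  using sd_approx[OF gd i] by (rule mult_right_mono) simp
  have 3: "\<bar>?J om * ((rho n i - 1) * (?x om)^2)\<bar> <= ?k3 * ((?x om)^2 * ?J om)"
  using mult_right_mono[OF r2, of "(?x om)^2"] by (simp add: abs_mult)
  have 4: "\<bar>?J om * (sd n i * (?x om * ?g om))\<bar> <= ?k4 * ((\<bar>?x om\<bar> * ?J om) * \<bar>?g om\<bar>)"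
  using mult_right_mono[OF r3, of "\<bar>?x om\<bar> * \<bar>?g om\<bar>"] by (simp add: abs_mult mult.assoc)
  have q: "q om = (rho n i - 1 + th n * d n i) * (?x om)^2 + (sd n i - \<sigma> * sqrt (d n i)) * (?x om * ?g om)
  - ?J om * ((rho n i - 1) * (?x om)^2) - ?J om * (sd n i * (?x om * ?g om))"
  using w by (simp add: q_def indicator_def)
  have tri: "\<bar>p + r - s - u\<bar> <= P + R + S + U" if "\<bar>p\<bar> <= P" "\<bar>r\<bar> <= R" "\<bar>s\<bar> <= S" "\<bar>u\<bar> <= U" for p r s u P R S U :: real using that by linarith
  show ?thesis unfolding q by (rule tri[OF 1 2 3 4])
 qed
 have ib: "integrable M ?bd" using xq ixg c1 c2 by simp
 have qm: "q : bmeas M" unfolding q_def by measurable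
 show iq: "integrable M q" by (rule Bochner_Integration.integrable_bound[OF ib qm], rule AE_I2, unfold real_norm_def, rule order_trans[OF bd abs_ge_self])
 have "(LINT om|M. \<bar>q om\<bar>) <= (LINT om|M. ?bd om)" by (rule integral_mono[OF integrable_abs[OF iq] ib bd])
 also have "... = ?k1 * (LINT om|M. (?x om)\<^sup>2) + ?k2 * (LINT om|M. \<bar>?x om * ?g om\<bar>) + ?k3 * (LINT om|M. (?x om)\<^sup>2 * ?J om)
  + ?k4 * (LINT om|M. (\<bar>?x om\<bar> * ?J om) * \<bar>?g om\<bar>)"
 proof -
  have ii: "integrable M (%om. \<bar>?x om * ?g om\<bar>)" using ixg by simp
  have lin: "(LINT om|M. k1 * f1 om + k2 * f2 om + k3 * f3 om + k4 * f4 om) = k1 * (LINT om|M. f1 om) + k2 * (LINT om|M. f2 om) + k3 * (LINT om|M. f3 om) + k4 * (LINT om|M. f4 om)"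
  if "integrable M f1" "integrable M f2" "integrable M f3" "integrable M f4" for f1 f2 f3 f4 and k1 k2 k3 k4 :: real
  using that by simp
  show ?thesis by (rule lin[OF xq(1) ii c1(1) c2(1)])
 qed
 also have "... <= ?k1 * B + ?k2 * (B + 1) + ?k3 * (B * (lam * d n i)) + ?k4 * (((1 + B) * (lam * d n i)) * 2)"
  using xq absxg c1 c2 D dp a_pos by (intro add_mono mult_left_mono) auto
 also have "... = ((4 * a^2 + 2 * a * lam) * B) * (\<Delta> n * d n i) + ((4 * a * \<bar>\<sigma>\<bar> + 2 * \<bar>\<sigma>\<bar> * lam) * (B + 1)) * (sqrt (\<Delta> n) * d n i)"
  by (simp add: algebra_simps)
 also have "... <= ((4 * a^2 + 2 * a * lam) * B) * (sqrt (\<Delta> n) * d n i) + ((4 * a * \<bar>\<sigma>\<bar> + 2 * \<bar>\<sigma>\<bar> * lam) * (B + 1)) * (sqrt (\<Delta> n) * d n i)"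
  using Dl dp B0 a_pos lam by (intro add_mono mult_left_mono mult_right_mono) auto
 finally show "(LINT om|M. \<bar>q om\<bar>) <= ((4 * a^2 + 2 * a * lam) * (2 * Bx + 2 * mG^2) + (4 * a * \<bar>\<sigma>\<bar> + 2 * \<bar>\<sigma>\<bar> * lam) * (2 * Bx + 2 * mG^2 + 1)) * (sqrt (\<Delta> n) * d n i)"
  unfolding B_def by (simp only: distrib_right)
qed

lemma Asc_oP: "oP M (%n om. Asc n om - \<sigma> * zeta n om)"
proof -
 define q where "q n i om = (rho n i - 1 + th n * d n i) * (x n i om)^2 + (sd n i - \<sigma> * sqrt (d n i)) * (x n i om * g n i om)
  - indicator {om\<in>space M. jj n i om ~= 0} om * ((rho n i - 1) * (x n i om)^2 + sd n i * (x n i om * g n i om))" for n i om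
 define C where "C = (4 * a^2 + 2 * a * lam) * (2 * Bx + 2 * mG^2) + (4 * a * \<bar>\<sigma>\<bar> + 2 * \<bar>\<sigma>\<bar> * lam) * (2 * Bx + 2 * mG^2 + 1)"
 have C: "integrable M (q n i) & (LINT om|M. \<bar>q n i om\<bar>) <= C * (sqrt (\<Delta> n) * d n i)" if "good n" "i < n" for n i
  unfolding q_def[abs_def] C_def by (rule conjI filtered_err_L1[OF that])+
 have o: "oP M (%n om. \<Sum>i<n. 1 / sqrt (T n) * q n i om)"
 proof (rule oP_sum_L1[OF ev_good tendsto_mult_right_zero[OF rates(2), of C]], intro conjI allI impI)
  fix n assume gd: "good n"
  show "integrable M (%om. 1 / sqrt (T n) * q n i om)" if "i < n" for i using C[OF gd that] by simp
  have sT: "sqrt (T n) > 0" using goodD(3)[OF gd] by simp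
  have "(\<Sum>i<n. \<integral>om. \<bar>1 / sqrt (T n) * q n i om\<bar> \<partial>M) = (\<Sum>i<n. 1 / sqrt (T n) * (LINT om|M. \<bar>q n i om\<bar>))"
  using sT unfolding abs_mult integral_mult_right_zero by simp
  also have "... <= (\<Sum>i<n. 1 / sqrt (T n) * (C * (sqrt (\<Delta> n) * d n i)))"
  by (intro sum_mono mult_left_mono) (use C[OF gd] sT in auto)
  also have "... = 1 / sqrt (T n) * (C * (sqrt (\<Delta> n) * T n))" by (simp only: sum_distrib_left[symmetric] sum_d)
  also have "... = C * (sqrt (T n) * sqrt (\<Delta> n))" using goodD(3)[OF gd] by (simp add: field_simps)
  finally show "(\<Sum>i<n. \<integral>om. \<bar>1 / sqrt (T n) * q n i om\<bar> \<partial>M) <= C * (sqrt (T n) * sqrt (\<Delta> n))" .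
 qed
 show ?thesis
 proof (rule oP_except[OF o always_eventually bad_lim])
  show "\<forall>n. bad1 n \<union> bad2 n \<union> bad3 n \<in> events" using bad_sets by blast
  show "EVN n. \<forall>om\<in>space M - (bad1 n \<union> bad2 n \<union> bad3 n). \<bar>Asc n om - \<sigma> * zeta n om\<bar> <= \<bar>\<Sum>i<n. 1 / sqrt (T n) * q n i om\<bar>"
  proof (intro ev_good ballI)
  fix n om assume gd: "good n" and w': "om : space M - (bad1 n \<union> bad2 n \<union> bad3 n)"
  then have w: "om : space M" by simp
  have "filtered_sum (v n) n (%i. x n i om) + th n * (\<Sum>i<n. d n i * (x n i om)^2) - \<sigma> * (\<Sum>i<n. sqrt (d n i) * (x n i om * g n i om)) = (\<Sum>i<n. q n i om)"
  unfolding filtered_sum_def sum_distrib_left sum.distrib[symmetric] sum_subtractf[symmetric]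
  proof (intro sum.cong refl)
  fix i assume "i \<in> {..<n}"
  then have i: "i < n" by simp
  have F: "indicator {z. \<bar>z\<bar> <= v n} (x n (Suc i) om - x n i om) = (if jj n i om = 0 then 1 else 0 :: real)"
  by (rule filter_exact[OF gd w' i])
  show "x n i om * (x n (Suc i) om - x n i om) * indicator {z. \<bar>z\<bar> <= v n} (x n (Suc i) om - x n i om) + th n * (d n i * (x n i om)^2)
  - \<sigma> * (sqrt (d n i) * (x n i om * g n i om)) = q n i om"
  proof (cases "jj n i om = 0")
  case True
  have e: "x n (Suc i) om - x n i om = (rho n i - 1) * x n i om + sd n i * g n i om"
  using step[OF i w] True by (simp add: algebra_simps)
  show ?thesis unfolding F using True by (simp add: q_def e) (simp add: power2_eq_square algebra_simps)
  next
  case False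
  then show ?thesis unfolding F using w by (simp add: q_def) (simp add: power2_eq_square algebra_simps)
  qed
  qed
  moreover have "zeta n om = (\<Sum>i<n. sqrt (d n i) * (x n i om * g n i om)) / sqrt (T n)"
  unfolding zeta_def sum_divide_distrib by (intro sum.cong refl) simp
  ultimately have "Asc n om - \<sigma> * zeta n om = (\<Sum>i<n. q n i om) / sqrt (T n)"
  unfolding Asc_def by (simp add: diff_divide_distrib[symmetric])
  then show "\<bar>Asc n om - \<sigma> * zeta n om\<bar> <= \<bar>\<Sum>i<n. 1 / sqrt (T n) * q n i om\<bar>" by (simp add: sum_divide_distrib)
  qed
 qed
qed

lemma filtered_sum_M: "(%om. filtered_sum (v n) n (%i. x n i om)) : bmeas M"
 unfolding filtered_sum_def
proof (rule borel_measurable_sum)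
 fix i assume "i \<in> {..<n}"
 then have [measurable]: "x n i : bmeas M" "x n (Suc i) : bmeas M" using x_M[of i n] x_M[of "Suc i" n] by auto
 show "(%om. x n i om * (x n (Suc i) om - x n i om) * indicator {z. \<bar>z\<bar> <= v n} (x n (Suc i) om - x n i om)) : bmeas M" by measurable
qed

lemma sq_sum_M: "(%om. \<Sum>i<n. d n i * (x n i om)^2) : bmeas M"
 by (intro borel_measurable_sum borel_measurable_times borel_measurable_const borel_measurable_power x_M) auto

lemma zeta_M: "zeta n : bmeas M"
 unfolding zeta_def[abs_def] by (intro borel_measurable_sum borel_measurable_times borel_measurable_const x_M g_M) auto

lemma zeta_coeff_sq: "good n ==> i < n ==> (sqrt (d n i) / sqrt (T n) * x n i om)\<^sup>2 = d n i * (x n i om)^2 / T n"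
 using d_pos[of i n] goodD(3)[of n] by (simp add: power_mult_distrib power_divide)

lemma zeta_coeff_G: "i <= n ==> (%om. sqrt (d n i) / sqrt (T n) * x n i om) : bmeas (G n i)"
 by (intro borel_measurable_times borel_measurable_const x_G)

lemma zeta_bP: "bP M zeta"
 unfolding zeta_def[abs_def]
proof (rule bP_adapted_sum[where H=G and B="2 * Bx + 2 * mG^2"], intro ev_good conjI allI impI)
 fix n assume gd: "good n"
 show "adapted_indep M (G n) (g n) n" by (rule g_ad)
 show "(\<Sum>i<n. (LINT om|M. (sqrt (d n i) / sqrt (T n) * x n i om)\<^sup>2) * (LINT om|M. (g n i om)\<^sup>2)) <= 2 * Bx + 2 * mG^2"
 proof (rule sum_le_T[OF gd])
  fix i assume i: "i < n"
  have "d n i / T n * (LINT om|M. (x n i om)\<^sup>2) <= d n i / T n * (2 * Bx + 2 * mG^2)"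
  using x_sq(2)[OF gd, of i] i d_pos[OF i] goodD(3)[OF gd] by (intro mult_left_mono) auto
  then show "(LINT om|M. (sqrt (d n i) / sqrt (T n) * x n i om)\<^sup>2) * (LINT om|M. (g n i om)\<^sup>2) <= (2 * Bx + 2 * mG^2) * d n i / T n"
  unfolding zeta_coeff_sq[OF gd i] g_mom(3)[OF i] by (simp add: mult_ac)
 qed
 fix i assume i: "i < n"
 show "integrable M (%om. (sqrt (d n i) / sqrt (T n) * x n i om)\<^sup>2)" unfolding zeta_coeff_sq[OF gd i] using x_sq(1)[OF gd, of i] i by simp
qed (use zeta_coeff_G g_mom in auto)

lemma zeta_bracket: "oP M (%n om. (\<Sum>i<n. (sqrt (d n i) / sqrt (T n) * x n i om)\<^sup>2) - qG)"
proof (rule oP_cong_eventually[OF lln], intro ev_good ballI)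
 fix n om assume gd: "good n"
 show "(\<Sum>i<n. (sqrt (d n i) / sqrt (T n) * x n i om)\<^sup>2) - qG = (\<Sum>i<n. d n i * (x n i om)^2) / T n - qG"
  using zeta_coeff_sq[OF gd] by (simp add: sum_divide_distrib)
qed

text \<open>Whatever is within a vanishing error of a multiple of \<open>zeta\<close> inherits its
  normal limit; applied to the estimator and to the score.\<close>

lemma weak_conv_zeta:
 assumes c: "c ~= 0" and B: "\<And>n. B n : bmeas M" and o: "oP M (%n om. B n om - c * zeta n om)"
 shows "weak_conv_m (%n. distr M borel (B n)) (density lborel (normal_density 0 (sqrt (c^2 * qG))))"
proof (rule weak_conv_oP[where A="%n om. c * zeta n om"])
 have s: "sqrt (c^2 * qG) > 0" using c qG_pos by simp
 show "real_distribution (density lborel (normal_density 0 (sqrt (c^2 * qG))))" by (rule normal_char(1)[OF s])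
 fix u
 have "(%n. \<integral>om. iexp ((u * c) * zeta n om) \<partial>M) ---> exp (- complex_of_real ((u * c)^2 * qG / 2))"
  unfolding zeta_def
  by (rule gaussian_sum_char[where H=G]) (use g_ad g_distr zeta_coeff_G zeta_bracket qG_pos in auto)
 moreover have "char (density lborel (normal_density 0 (sqrt (c^2 * qG)))) u = exp (- complex_of_real ((u * c)^2 * qG / 2))"
  unfolding normal_char(2)[OF s] using qG_pos by (simp add: power_mult_distrib mult.assoc)
 ultimately show "(%n. \<integral>om. iexp (u * (c * zeta n om)) \<partial>M) ---> char (density lborel (normal_density 0 (sqrt (c^2 * qG)))) u"
  by (simp only: mult.assoc)
qed (use B o zeta_M in auto)

text \<open>Off an event of vanishing probability the normalised error is \<open>- Asc / U\<close>,
  with \<open>U\<close> the time average of squares; \<open>Asc\<close> is replaced by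
  \<open>\<sigma> zeta\<close> and \<open>U\<close> by its limit \<open>qG\<close>.\<close>

theorem estimator_clt:
 "weak_conv_m (%n. distr M borel (%om. sqrt (T n) * (abar t v n (%i. x n i om) - th n)))
  (density lborel (normal_density 0 (sqrt (\<sigma>^2 / qG))))"
proof -
 define U where "U n om = (\<Sum>i<n. d n i * (x n i om)^2) / T n" for n om
 define E where "E n om = sqrt (T n) * (abar t v n (%i. x n i om) - th n)" for n om
 have ab: "abar t v n (%i. x n i om) = - filtered_sum (v n) n (%i. x n i om) / (\<Sum>i<n. d n i * (x n i om)^2)" for n om
  by (simp add: abar_def filtered_sum_def d_def mult.commute)
 have oU: "oP M (%n om. U n om - qG)" using lln by (simp add: U_def)
 have inv: "oP M (%n om. inverse (U n om) - inverse qG)" by (rule oP_cont[OF oU]) (use qG_pos in \<open>auto intro!: continuous_intros\<close>)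
 have invb: "bP M (%n om. inverse (U n om))"
 proof -
  have "\<exists>L. EVN n. \<exists>A\<in>events. prob A <= e & (\<forall>om\<in>space M - A. \<bar>inverse (U n om)\<bar> <= L)" if e: "e > 0" for e
  proof (rule exI[of _ "\<bar>inverse qG\<bar> + e"], use oPD[OF inv e] in eventually_elim)
  case (elim n)
  then obtain A where A: "A \<in> events" "prob A <= e" "\<And>om. om : space M - A ==> \<bar>inverse (U n om) - inverse qG\<bar> <= e" by blast
  have "\<bar>inverse (U n om)\<bar> <= \<bar>inverse qG\<bar> + e" if "om : space M - A" for om using A(3)[OF that] by linarith
  with A(1,2) show ?case by blast
  qed
  then show ?thesis unfolding bP_def by blast
 qed
 have o1: "oP M (%n om. (Asc n om - \<sigma> * zeta n om) * inverse (U n om))" by (rule oP_bP_mult[OF Asc_oP invb])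
 have o2: "oP M (%n om. \<sigma> * ((inverse (U n om) - inverse qG) * zeta n om))"
  by (rule oP_cmult[OF oP_bP_mult[OF inv zeta_bP], where C="\<bar>\<sigma>\<bar>"]) simp
 have o3: "oP M (%n om. - ((Asc n om - \<sigma> * zeta n om) * inverse (U n om) + \<sigma> * ((inverse (U n om) - inverse qG) * zeta n om)))"
  by (rule oP_uminus[OF oP_add[OF o1 o2]])
 have Um: "U n : bmeas M" for n unfolding U_def[abs_def] using sq_sum_M by (intro borel_measurable_divide) auto
 have Em: "E n : bmeas M" for n unfolding E_def[abs_def] ab using sq_sum_M filtered_sum_M by (intro borel_measurable_times borel_measurable_diff borel_measurable_divide borel_measurable_uminus borel_measurable_const) auto
 have oE: "oP M (%n om. E n om - (- \<sigma> / qG) * zeta n om)"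
 \<comment> \<open>The removed event keeps \<open>U\<close> away from 0. For a vanishing
   denominator, division returns 0 and \<open>abar - th\<close> would not have the form used
   here.\<close>
 proof (rule oP_except[OF o3 always_eventually oP_prob[OF oU, of "qG / 2"]])
  show "\<forall>n. {om\<in>space M. \<bar>U n om - qG\<bar> > qG / 2} \<in> events"
  proof
  fix n
  note [measurable] = Um[of n]
  show "{om\<in>space M. \<bar>U n om - qG\<bar> > qG / 2} \<in> events" by measurable
  qed
  show "EVN n. \<forall>om\<in>space M - {om\<in>space M. \<bar>U n om - qG\<bar> > qG / 2}. \<bar>E n om - (- \<sigma> / qG) * zeta n om\<bar>
  <= \<bar>- ((Asc n om - \<sigma> * zeta n om) * inverse (U n om) + \<sigma> * ((inverse (U n om) - inverse qG) * zeta n om))\<bar>"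
  proof (intro ev_good ballI)
  fix n om assume gd: "good n" and w: "om : space M - {om\<in>space M. \<bar>U n om - qG\<bar> > qG / 2}"
  have Tp: "T n > 0" using goodD(3)[OF gd] .
  have U0: "U n om ~= 0" using w qG_pos by auto
  define Q where "Q = (\<Sum>i<n. d n i * (x n i om)^2)"
  define s where "s = sqrt (T n)"
  have s: "s > 0" "T n = s * s" using Tp by (auto simp: s_def)
  have Q: "Q ~= 0" "U n om = Q / (s * s)" using U0 s by (auto simp: U_def Q_def)
  have "E n om = - (Asc n om * inverse (U n om))"
  unfolding E_def ab Asc_def Q(2) Q_def[symmetric] s_def[symmetric] using Q(1) s(1) by (simp add: field_simps)
  then have "E n om - (- \<sigma> / qG) * zeta n om = - ((Asc n om - \<sigma> * zeta n om) * inverse (U n om) + \<sigma> * ((inverse (U n om) - inverse qG) * zeta n om))"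
  by (simp add: algebra_simps divide_inverse)
  then show "\<bar>E n om - (- \<sigma> / qG) * zeta n om\<bar> <= \<bar>- ((Asc n om - \<sigma> * zeta n om) * inverse (U n om) + \<sigma> * ((inverse (U n om) - inverse qG) * zeta n om))\<bar>" by simp
  qed
 qed (use qG_pos in simp)
 have c: "- \<sigma> / qG ~= 0" "(- \<sigma> / qG)^2 * qG = \<sigma>^2 / qG" using qG_pos sigma by (auto simp: power_divide power2_eq_square)
 show ?thesis using weak_conv_zeta[OF c(1) Em oE] unfolding c(2) E_def .
qed

end

section \<open>Change of the drift parameter\<close>

text \<open>Density of the normal law with mean \<open>m'\<close> and scale \<open>s'\<close>
  relative to that with \<open>m\<close> and \<open>s\<close>, at the point \<open>m + s y\<close>.
  Absolute values occur because \<sigma>, known only through \<open>\<sigma>^2 > 0\<close>, may be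
  negative.\<close>

definition gratio :: "real => real => real => real => real => real" where
 "gratio m s m' s' y = \<bar>s\<bar> / \<bar>s'\<bar> * exp (y^2 / 2 - ((m + s * y - m') / s')^2 / 2)"

lemma gratio_measurable [measurable (raw)]:
 assumes [measurable]: "f : bmeas H" "g : bmeas H" "y : bmeas H"
 shows "(%om. gratio (f om) s (g om) s' (y om)) : bmeas H"
 unfolding gratio_def by measurable

text \<open>Both sides are multiples of one Lebesgue integral, reached by the substitutions
  \<open>u = m' + s' y\<close> and \<open>u = m + s y\<close>.\<close>

lemma gaussian_change:
 fixes G :: "real => ennreal"
 assumes [measurable]: "G : bmeas borel" and s: "s ~= 0" "s' ~= 0"
 shows "(\<integral>\<^sup>+y. G (m' + s' * y) \<partial>std_normal_distribution) = (\<integral>\<^sup>+y. G (m + s * y) * ennreal (gratio m s m' s' y) \<partial>std_normal_distribution)"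
proof -
 define f where "f u = G u * ennreal (std_normal_density ((u - m') / s'))" for u
 have [measurable]: "f : bmeas borel" unfolding f_def by measurable
 define Q where "Q = (\<integral>\<^sup>+y. f (m + s * y) \<partial>lborel)"
 have "(\<integral>\<^sup>+u. f u \<partial>lborel) = ennreal \<bar>s'\<bar> * (\<integral>\<^sup>+y. f (m' + s' * y) \<partial>lborel)"
  by (rule nn_integral_real_affine) (use s in auto)
 moreover have "(\<integral>\<^sup>+u. f u \<partial>lborel) = ennreal \<bar>s\<bar> * Q"
  unfolding Q_def by (rule nn_integral_real_affine) (use s in auto)
 moreover have "(\<integral>\<^sup>+y. f (m' + s' * y) \<partial>lborel) = (\<integral>\<^sup>+y. G (m' + s' * y) \<partial>std_normal_distribution)"
  using s by (subst nn_integral_density) (auto simp: f_def mult.commute)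
 ultimately have 1: "ennreal \<bar>s'\<bar> * (\<integral>\<^sup>+y. G (m' + s' * y) \<partial>std_normal_distribution) = ennreal \<bar>s\<bar> * Q" by simp
 have "(\<integral>\<^sup>+y. G (m + s * y) * ennreal (gratio m s m' s' y) \<partial>std_normal_distribution)
  = (\<integral>\<^sup>+y. ennreal (std_normal_density y) * (G (m + s * y) * ennreal (gratio m s m' s' y)) \<partial>lborel)"
  by (subst nn_integral_density) auto
 also have "... = (\<integral>\<^sup>+y. ennreal (\<bar>s\<bar> / \<bar>s'\<bar>) * f (m + s * y) \<partial>lborel)"
 proof (rule nn_integral_cong)
  fix y
  have "std_normal_density y * gratio m s m' s' y = \<bar>s\<bar> / \<bar>s'\<bar> * std_normal_density ((m + s * y - m') / s')"
  by (simp add: gratio_def normal_density_def exp_add[symmetric] mult.assoc field_simps)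
  then have "ennreal (std_normal_density y) * ennreal (gratio m s m' s' y) = ennreal (\<bar>s\<bar> / \<bar>s'\<bar>) * ennreal (std_normal_density ((m + s * y - m') / s'))"
  by (simp add: ennreal_mult[symmetric] gratio_def)
  then show "ennreal (std_normal_density y) * (G (m + s * y) * ennreal (gratio m s m' s' y)) = ennreal (\<bar>s\<bar> / \<bar>s'\<bar>) * f (m + s * y)"
  unfolding f_def by (metis mult.left_commute)
 qed
 also have "... = ennreal (\<bar>s\<bar> / \<bar>s'\<bar>) * Q" unfolding Q_def by (rule nn_integral_cmult) measurable
 also have "... = ennreal (1 / \<bar>s'\<bar>) * (ennreal \<bar>s\<bar> * Q)" by (simp add: mult.assoc[symmetric] ennreal_mult[symmetric])
 also have "... = ennreal (1 / \<bar>s'\<bar>) * ennreal \<bar>s'\<bar> * (\<integral>\<^sup>+y. G (m' + s' * y) \<partial>std_normal_distribution)" by (simp only: 1[symmetric] mult.assoc)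
 also have "ennreal (1 / \<bar>s'\<bar>) * ennreal \<bar>s'\<bar> = 1" using s by (simp add: ennreal_mult[symmetric])
 finally show ?thesis by simp
qed

context jump_ou
begin

text \<open>Zero beyond \<open>k\<close>, so that initial segments of all lengths live in one
  product space.\<close>

definition path :: "real => (nat => real) => nat => 'a => nat => real" where
 "path tt ta k om i = (if i <= k then X tt (ta i) om else 0)"

definition pmean :: "real => (nat => real) => nat => 'a => real => real" where
 "pmean tt ta i om y = exp (- tt * (ta (Suc i) - ta i)) * y + jmp tt ta i om"

definition psd :: "real => (nat => real) => nat => real" where
 "psd tt ta i = \<sigma> * ou_sd tt (ta (Suc i) - ta i)"

text \<open>Density ratio of one transition given the jumps; each drift has its own jump innovation,
  computed from the same jumps.\<close>

definition lratio :: "real => real => (nat => real) => nat => 'a => real" where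
 "lratio tt tt' ta i om = gratio (pmean tt ta i om (X tt (ta i) om)) (psd tt ta i) (pmean tt' ta i om (X tt (ta i) om)) (psd tt' ta i) (gau tt ta i om)"

lemma path_Suc:
 assumes "grid ta n" "k < n" "tt > 0" "om : space M"
 shows "path tt ta (Suc k) om = (path tt ta k om)(Suc k := pmean tt ta k om (path tt ta k om k) + psd tt ta k * gau tt ta k om)"
 using X_grid_step[OF assms] by (auto simp: path_def pmean_def psd_def fun_eq_iff)

lemma path_HG:
 assumes "grid ta n" "k <= n" "tt > 0"
 shows "path tt ta k \<in> measurable (HG tt ta k) (Pi\<^sub>M UNIV (%_. borel))"
proof (rule measurable_PiM_single')
 fix i
 have "(%om. X tt (ta i) om) : bmeas (HG tt ta k)" if "i <= k"
  using adapted_indepD(4)[OF gau_adapted(1)[OF assms(1,3)] that assms(2) X_HG[OF assms(1,3)]] that assms(2) by simp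
 then show "(%om. path tt ta k om i) : bmeas (HG tt ta k)" unfolding path_def by (cases "i <= k") auto
qed (auto simp: space_PiM)

lemma lratio_HG:
 assumes "grid ta n" "tt > 0" "i < k" "k <= n"
 shows "lratio tt tt' ta i : bmeas (HG tt ta k)"
proof -
 note ad = gau_adapted(1)[OF assms(1,2)]
 have [measurable]: "gau tt ta i : bmeas (HG tt ta k)"
  using adapted_indepD(4)[OF ad _ assms(4) adapted_indepD(2)[OF ad]] assms(3,4) by simp
 have [measurable]: "(%om. X tt (ta i) om) : bmeas (HG tt ta k)"
  using adapted_indepD(4)[OF ad _ assms(4) X_HG[OF assms(1,2)], of i] assms(3,4) by simp
 have [measurable]: "jmp q ta i : bmeas (HG tt ta k)" for q
  using jmp_HG[OF assms(1,2,4)] assms(3,4) by simp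
 show ?thesis unfolding lratio_def[abs_def] pmean_def by measurable
qed

text \<open>Induction on the length: the last Gaussian is integrated out under \<open>tt'\<close>,
  the induction hypothesis changes the drift of the shorter path, the Gaussian change of variables
  handles the last step, and the Gaussian for \<open>tt\<close> is put back. The test function may
  depend on initial value and jumps, common to both drifts; the induction needs this because the
  last conditional mean depends on the jumps.\<close>

lemma path_change:
 assumes gr: "grid ta n" and th: "tt > 0" "tt' > 0"
 shows "k <= n ==> f : bmeas (Sig (- {IW, IZ 0}) \<Otimes>\<^sub>M Pi\<^sub>M UNIV (%_. borel)) ==>
  (\<integral>\<^sup>+om. f (om, path tt' ta k om) \<partial>M) = (\<integral>\<^sup>+om. f (om, path tt ta k om) * (\<Prod>i<k. ennreal (lratio tt tt' ta i om)) \<partial>M)"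
proof (induction k arbitrary: f)
 case 0
 have "path tt' ta 0 om = path tt ta 0 om" if "om : space M" for om
  using X_zero[OF that] gridD(3)[OF gr] by (auto simp: path_def fun_eq_iff)
 then show ?case by (intro nn_integral_cong) simp
next
 case (Suc k)
 let ?E = "Sig (- {IW, IZ 0})" and ?P = "Pi\<^sub>M UNIV (%_. borel) :: (nat => real) measure" and ?N = "std_normal_distribution"
 have k: "k < n" "k <= n" using Suc by auto
 note f[measurable] = Suc.prems(2)
 let ?m = "%q. pmean q ta k" and ?s = "%q. psd q ta k"
 let ?\<Phi> = "%q om z y. f (om, z(Suc k := ?m q om (z k) + ?s q * y))"
 have s0: "?s q ~= 0" if "q > 0" for q
  using ou_sd_pos[OF that, of "ta (Suc k) - ta k"] gridD(2)[OF gr k(1)] sigma by (auto simp: psd_def)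
 have jE[measurable]: "jmp q ta k : bmeas ?E" for q
  unfolding jmp_def[abs_def] by (rule Jou_measurable) (use gridD(1,2)[OF gr k(1)] in \<open>auto simp: SJ_def\<close>)
 have upd[measurable]: "(%p. (snd (fst p))(Suc k := ?m q (fst (fst p)) (snd (fst p) k) + ?s q * snd p)) \<in> measurable ((?E \<Otimes>\<^sub>M ?P) \<Otimes>\<^sub>M borel) ?P" for q
 proof (rule measurable_PiM_single')
  fix i
  have "(%p. ?m q (fst (fst p)) (snd (fst p) k) + ?s q * snd p) : bmeas ((?E \<Otimes>\<^sub>M ?P) \<Otimes>\<^sub>M borel)"
  unfolding pmean_def by measurable
  then show "(%p. ((snd (fst p))(Suc k := ?m q (fst (fst p)) (snd (fst p) k) + ?s q * snd p)) i) : bmeas ((?E \<Otimes>\<^sub>M ?P) \<Otimes>\<^sub>M borel)"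
  by (cases "i = Suc k") auto
 qed (auto simp: space_PiM)
 have \<Phi>M: "(%p. ?\<Phi> q (fst (fst p)) (snd (fst p)) (snd p)) : bmeas ((?E \<Otimes>\<^sub>M ?P) \<Otimes>\<^sub>M borel)" for q
  by measurable
 have emb: "(%p. ((fst p, path q ta k (fst p)), snd p)) \<in> measurable (HG q ta k \<Otimes>\<^sub>M borel) ((?E \<Otimes>\<^sub>M ?P) \<Otimes>\<^sub>M borel)" if q: "q > 0" for q
 proof -
  have [measurable]: "(%om. om) \<in> measurable (HG q ta k) ?E" by (rule env_HG[OF gr q k(2)]) (rule measurable_ident_sets[OF refl])
  note [measurable] = path_HG[OF gr k(2) q]
  show ?thesis by measurable
 qed
 define F1 where "F1 p = (\<integral>\<^sup>+y. ?\<Phi> tt' (fst p) (snd p) y \<partial>?N)" for p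
 interpret N: prob_space ?N by (rule prob_space_normal_density) simp
 have F1M: "F1 : bmeas (?E \<Otimes>\<^sub>M ?P)"
  unfolding F1_def[abs_def] by (rule N.borel_measurable_nn_integral) (use \<Phi>M[of tt'] in \<open>simp add: case_prod_beta'\<close>)
 have "(\<integral>\<^sup>+om. f (om, path tt' ta (Suc k) om) \<partial>M) = (\<integral>\<^sup>+om. ?\<Phi> tt' om (path tt' ta k om) (gau tt' ta k om) \<partial>M)"
  by (intro nn_integral_cong) (simp add: path_Suc[OF gr k(1) th(2)])
 also have "... = (\<integral>\<^sup>+om. (\<integral>\<^sup>+y. ?\<Phi> tt' om (path tt' ta k om) y \<partial>distr M borel (gau tt' ta k)) \<partial>M)"
  using freezing_nn[OF adapted_indepD(3)[OF gau_adapted(1)[OF gr th(2)] k(1)] measurable_compose[OF emb[OF th(2)] \<Phi>M[of tt']]] by simp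
 also have "... = (\<integral>\<^sup>+om. F1 (om, path tt' ta k om) \<partial>M)" unfolding gau_adapted(3)[OF gr th(2) k(1)] F1_def by simp
 also have "... = (\<integral>\<^sup>+om. F1 (om, path tt ta k om) * (\<Prod>i<k. ennreal (lratio tt tt' ta i om)) \<partial>M)" by (rule Suc.IH[OF k(2) F1M])
 also have "... = (\<integral>\<^sup>+om. (\<integral>\<^sup>+y. ?\<Phi> tt om (path tt ta k om) y *
  ennreal (gratio (?m tt om (path tt ta k om k)) (?s tt) (?m tt' om (path tt ta k om k)) (?s tt') y) * (\<Prod>i<k. ennreal (lratio tt tt' ta i om)) \<partial>?N) \<partial>M)"
 proof (rule nn_integral_cong)
  fix om assume w: "om : space M"
  let ?z = "path tt ta k om"
  have gm: "(%u. f (om, ?z(Suc k := u))) : bmeas borel"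
  proof -
  have "(%u. ?z(Suc k := u)) \<in> measurable borel ?P"
  proof (rule measurable_PiM_single')
  show "(%u. (?z(Suc k := u)) i) : bmeas borel" for i by (cases "i = Suc k") auto
  qed (auto simp: space_PiM)
  moreover have "om \<in> space ?E" using w by (simp add: Sig_def)
  ultimately show ?thesis by measurable
  qed
  have mm: "(%y. ?\<Phi> tt om ?z y) : bmeas ?N" by (rule measurable_compose[OF _ gm]) measurable
  have "F1 (om, ?z) = (\<integral>\<^sup>+y. ?\<Phi> tt om ?z y * ennreal (gratio (?m tt om (?z k)) (?s tt) (?m tt' om (?z k)) (?s tt') y) \<partial>?N)"
  unfolding F1_def fst_conv snd_conv by (rule gaussian_change[OF gm s0[OF th(1)] s0[OF th(2)]])
  then show "F1 (om, ?z) * (\<Prod>i<k. ennreal (lratio tt tt' ta i om)) = (\<integral>\<^sup>+y. ?\<Phi> tt om ?z y * ennreal (gratio (?m tt om (?z k)) (?s tt) (?m tt' om (?z k)) (?s tt') y) * (\<Prod>i<k. ennreal (lratio tt tt' ta i om)) \<partial>?N)"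
  by (simp only:) (rule nn_integral_multc[symmetric], rule borel_measurable_times_ennreal[OF mm], measurable)
 qed
 also have "... = (\<integral>\<^sup>+om. ?\<Phi> tt om (path tt ta k om) (gau tt ta k om) *
  ennreal (gratio (?m tt om (path tt ta k om k)) (?s tt) (?m tt' om (path tt ta k om k)) (?s tt') (gau tt ta k om)) * (\<Prod>i<k. ennreal (lratio tt tt' ta i om)) \<partial>M)"
 proof -
  let ?f = "%p. ?\<Phi> tt (fst p) (path tt ta k (fst p)) (snd p) *
  ennreal (gratio (?m tt (fst p) (path tt ta k (fst p) k)) (?s tt) (?m tt' (fst p) (path tt ta k (fst p) k)) (?s tt') (snd p)) * (\<Prod>i<k. ennreal (lratio tt tt' ta i (fst p)))"
  have fM: "?f : bmeas (HG tt ta k \<Otimes>\<^sub>M borel)"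
  proof (intro borel_measurable_times_ennreal)
  show "(%p. ?\<Phi> tt (fst p) (path tt ta k (fst p)) (snd p)) : bmeas (HG tt ta k \<Otimes>\<^sub>M borel)"
  using measurable_compose[OF emb[OF th(1)] \<Phi>M[of tt]] by simp
  have [measurable]: "jmp q ta k : bmeas (HG tt ta k)" for q by (rule jmp_HG[OF gr th(1) k(2) k(1)])
  have [measurable]: "(%om. path tt ta k om k) : bmeas (HG tt ta k)" using X_HG[OF gr th(1) k(2)] by (simp add: path_def)
  show "(%p. ennreal (gratio (?m tt (fst p) (path tt ta k (fst p) k)) (?s tt) (?m tt' (fst p) (path tt ta k (fst p) k)) (?s tt') (snd p))) : bmeas (HG tt ta k \<Otimes>\<^sub>M borel)"
  unfolding pmean_def by measurable
  show "(%p. \<Prod>i<k. ennreal (lratio tt tt' ta i (fst p))) : bmeas (HG tt ta k \<Otimes>\<^sub>M borel)"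
  proof (rule borel_measurable_prod_ennreal)
  fix i assume "i \<in> {..<k}"
  then have [measurable]: "lratio tt tt' ta i : bmeas (HG tt ta k)" using lratio_HG[OF gr th(1) _ k(2)] by simp
  show "(%p. ennreal (lratio tt tt' ta i (fst p))) : bmeas (HG tt ta k \<Otimes>\<^sub>M borel)" by measurable
  qed
  qed
  from freezing_nn[OF adapted_indepD(3)[OF gau_adapted(1)[OF gr th(1)] k(1)] fM] show ?thesis
  unfolding gau_adapted(3)[OF gr th(1) k(1)] by simp
 qed
 also have "... = (\<integral>\<^sup>+om. f (om, path tt ta (Suc k) om) * (\<Prod>i<Suc k. ennreal (lratio tt tt' ta i om)) \<partial>M)"
 proof (rule nn_integral_cong)
  fix om assume w: "om : space M"
  have p: "path tt ta k om k = X tt (ta k) om" by (simp add: path_def)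
  show "?\<Phi> tt om (path tt ta k om) (gau tt ta k om) *
  ennreal (gratio (?m tt om (path tt ta k om k)) (?s tt) (?m tt' om (path tt ta k om k)) (?s tt') (gau tt ta k om)) * (\<Prod>i<k. ennreal (lratio tt tt' ta i om))
  = f (om, path tt ta (Suc k) om) * (\<Prod>i<Suc k. ennreal (lratio tt tt' ta i om))"
  unfolding path_Suc[OF gr k(1) th(1) w] p lratio_def by (simp add: mult.assoc mult.commute[of "ennreal _"])
 qed
 finally show ?case .
qed

text \<open>The product acts as a density on events of the observations although it also depends on
  the unobserved jumps; the actual density is its projection onto the observations.\<close>

lemma obs_law_change:
 assumes gr: "grid (t n) n" and th: "tt > 0" "tt' > 0" and B: "B \<in> sets (Pi\<^sub>M {..n} (%_. borel))"
 shows "emeasure (obs_law M X t n tt') B =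
  (\<integral>\<^sup>+om. indicator B (\<lambda>i\<in>{..n}. X tt (t n i) om) * ennreal (\<Prod>i<n. lratio tt tt' (t n) i om) \<partial>M)"
proof -
 have r: "restrict (path q (t n) n om) {..n} = (\<lambda>i\<in>{..n}. X q (t n i) om)" for q om by (auto simp: path_def fun_eq_iff)
 have m: "(%om. \<lambda>i\<in>{..n}. X tt' (t n i) om) \<in> measurable M (Pi\<^sub>M {..n} (%_. borel))"
  by (intro measurable_restrict adapted_indep_measurable[OF gau_adapted(1)[OF gr th(2)] _ X_HG[OF gr th(2)]]) auto
 have [measurable]: "B \<in> sets (Pi\<^sub>M {..n} (%_. borel))" by (rule B)
 have fM: "(%p. indicator B (restrict (snd p) {..n}) :: ennreal) : bmeas (Sig (- {IW, IZ 0}) \<Otimes>\<^sub>M Pi\<^sub>M UNIV (%_. borel))"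
 proof -
  have [measurable]: "(%z. restrict z {..n}) \<in> measurable (Pi\<^sub>M UNIV (%_. borel :: real measure)) (Pi\<^sub>M {..n} (%_. borel))"
  by (rule measurable_restrict_subset) simp
  show ?thesis by measurable
 qed
 have "emeasure (obs_law M X t n tt') B = (\<integral>\<^sup>+om. indicator B (\<lambda>i\<in>{..n}. X tt' (t n i) om) \<partial>M)"
  unfolding obs_law_def using m B
  by (subst nn_integral_indicator[symmetric]) (simp, subst nn_integral_distr, auto)
 also have "... = (\<integral>\<^sup>+om. indicator B (\<lambda>i\<in>{..n}. X tt (t n i) om) * (\<Prod>i<n. ennreal (lratio tt tt' (t n) i om)) \<partial>M)"
  using path_change[OF gr th order_refl fM] by (simp add: r)
 also have "(%om. \<Prod>i<n. ennreal (lratio tt tt' (t n) i om)) = (%om. ennreal (\<Prod>i<n. lratio tt tt' (t n) i om))"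
  by (intro ext prod_ennreal) (auto simp: lratio_def gratio_def)
 finally show ?thesis .
qed

end

section \<open>From the complete likelihood to the density of the observed laws\<close>

lemma (in prob_space) bP_add_oP:
 assumes "bP M X" "oP M Y"
 shows "bP M (%n om. X n om + Y n om)"
 unfolding bP_def
proof (intro allI impI)
 fix e :: real assume "e > 0"
 then have e: "e / 2 > 0" by simp
 obtain L where L: "EVN n. \<exists>A\<in>events. prob A <= e / 2 & (\<forall>om\<in>space M - A. \<bar>X n om\<bar> <= L)"
  using assms(1) e unfolding bP_def by blast
 show "\<exists>K. EVN n. \<exists>A\<in>events. prob A <= e & (\<forall>om\<in>space M - A. \<bar>X n om + Y n om\<bar> <= K)"
 proof (rule exI[of _ "L + e / 2"], use L oPD[OF assms(2) e] in eventually_elim)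
  case (elim n)
  then obtain A B where A: "A \<in> events" "prob A <= e / 2" "\<And>om. om : space M - A ==> \<bar>X n om\<bar> <= L"
  and B: "B \<in> events" "prob B <= e / 2" "\<And>om. om : space M - B ==> \<bar>Y n om\<bar> <= e / 2" by blast
  show ?case
  proof (intro bexI[of _ "A \<union> B"] conjI ballI)
  show "prob (A \<union> B) <= e" using measure_Un_le[OF A(1) B(1)] A(2) B(2) by simp
  fix om assume "om : space M - (A \<union> B)"
  then show "\<bar>X n om + Y n om\<bar> <= L + e / 2" using A(3)[of om] B(3)[of om] by (simp add: abs_le_iff) linarith
  qed (use A B in auto)
 qed
qed

text \<open>A density of the observations and the complete likelihood \<open>L\<close> have the same integrals over
 events of the observations; testing with the sign of \<open>rho - W\<close> compares their distances to \<open>W\<close>.\<close>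
lemma (in prob_space) RN_deriv_L1:
 assumes x: "x \<in> measurable M N" and P: "prob_space P'" "sets P' = sets N"
  and L[measurable]: "L : bmeas M" and L0: "\<And>om. om : space M ==> 0 < L om"
  and ch: "\<And>B. B \<in> sets N ==> emeasure P' B = (\<integral>\<^sup>+om. indicator B (x om) * ennreal (L om) \<partial>M)"
  and W[measurable]: "W : bmeas N" and W0: "\<And>y. 0 <= W y" "\<And>y. W y <= (K::real)"
 defines "R \<equiv> %y. enn2real (RN_deriv (distr M N x) P' y)"
 shows "absolutely_continuous (distr M N x) P'"
  and "integrable M (%om. R (x om))" "R : bmeas N"
  and "(LINT om|M. \<bar>R (x om) - W (x om)\<bar>) <= 1 - (LINT om|M. W (x om)) + 2 * (LINT om|M. max 0 (W (x om) - L om))"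
proof -
 note x[measurable]
 let ?D = "distr M N x"
 interpret D: prob_space ?D by (rule prob_space_distr) fact
 interpret P': prob_space P' by fact
 show ac: "absolutely_continuous ?D P'"
  unfolding absolutely_continuous_def
 proof
  fix B assume "B \<in> null_sets ?D"
  then have B: "B \<in> sets N" "emeasure M (x -` B \<inter> space M) = 0" by (auto simp: null_sets_def emeasure_distr)
  have "AE om in M. om \<notin> x -` B \<inter> space M" using B by (intro AE_not_in) (auto simp: null_sets_def)
  then have "AE om in M. indicator B (x om) * ennreal (L om) = 0" by (rule AE_mp) (auto simp: indicator_def)
  then have "(\<integral>\<^sup>+om. indicator B (x om) * ennreal (L om) \<partial>M) = (\<integral>\<^sup>+om. 0 \<partial>M)" by (rule nn_integral_cong_AE)
  then show "B \<in> null_sets P'" using ch[OF B(1)] B(1) P(2) by (simp add: null_sets_def)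
 qed
 let ?r = "RN_deriv ?D P'"
 have rm[measurable]: "?r : bmeas N" using borel_measurable_RN_deriv[of ?D P'] by simp
 show Rm[measurable]: "R : bmeas N" unfolding R_def by measurable
 have sD: "sets P' = sets ?D" using P(2) by simp
 have fin: "AE y in ?D. ?r y ~= \<infinity>" by (rule D.RN_deriv_finite[OF P'.sigma_finite_measure_axioms ac sD])
 have key: "(\<integral>\<^sup>+om. indicator B (x om) * ennreal (R (x om)) \<partial>M) = (\<integral>\<^sup>+om. indicator B (x om) * ennreal (L om) \<partial>M)" if B[measurable]: "B \<in> sets N" for B
 proof -
  have "emeasure P' B = emeasure (density ?D ?r) B" by (simp only: D.density_RN_deriv[OF ac sD])
  also have "... = (\<integral>\<^sup>+y. ?r y * indicator B y \<partial>?D)" using B by (intro emeasure_density) auto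
  also have "... = (\<integral>\<^sup>+y. indicator B y * ennreal (R y) \<partial>?D)"
  by (rule nn_integral_cong_AE) (use fin in \<open>eventually_elim, simp add: R_def less_top mult.commute\<close>)
  also have "... = (\<integral>\<^sup>+om. indicator B (x om) * ennreal (R (x om)) \<partial>M)" by (rule nn_integral_distr) measurable
  finally show ?thesis using ch[OF B] by simp
 qed
 have sp: "space N \<in> sets N" by simp
 have xs: "om : space M ==> x om \<in> space N" for om using measurable_space[OF x] .
 have "(\<integral>\<^sup>+om. ennreal (L om) \<partial>M) = (\<integral>\<^sup>+om. indicator (space N) (x om) * ennreal (L om) \<partial>M)" by (rule nn_integral_cong) (simp add: xs)
 also have "... = 1" using ch[OF sp] P'.emeasure_space_1 sets_eq_imp_space_eq[OF P(2)] by simp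
 finally have L1: "(\<integral>\<^sup>+om. ennreal (L om) \<partial>M) = 1" .
 have "(\<integral>\<^sup>+om. ennreal (R (x om)) \<partial>M) = (\<integral>\<^sup>+om. indicator (space N) (x om) * ennreal (R (x om)) \<partial>M)" by (rule nn_integral_cong) (simp add: xs)
 also have "... = (\<integral>\<^sup>+om. indicator (space N) (x om) * ennreal (L om) \<partial>M)" by (rule key[OF sp])
 also have "... = (\<integral>\<^sup>+om. ennreal (L om) \<partial>M)" by (rule nn_integral_cong) (simp add: xs)
 finally have R1: "(\<integral>\<^sup>+om. ennreal (R (x om)) \<partial>M) = 1" using L1 by simp
 have R0: "R y >= 0" for y by (simp add: R_def)
 have Li: "integrable M L" by (rule integrableI_nn_integral_finite[where x=1]) (use L1 L0 in \<open>auto intro!: AE_I2 less_imp_le\<close>)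
 show Ri: "integrable M (%om. R (x om))" by (rule integrableI_nn_integral_finite[where x=1]) (use R1 R0 in auto)
 have "(LINT om|M. L om) = enn2real (\<integral>\<^sup>+om. ennreal (L om) \<partial>M)" by (rule integral_eq_nn_integral) (use L0 in \<open>auto intro!: AE_I2 less_imp_le\<close>)
 then have EL: "(LINT om|M. L om) = 1" using L1 by simp
 have Wi: "integrable M (%om. W (x om))" by (rule integrable_const_bound[where B=K]) (use W0 in auto)
 \<comment> \<open>\<open>B\<close> is an event of the observations, so \<open>R\<close> may be
   exchanged for \<open>L\<close> in integrals over it.\<close>
 define B where "B = {y\<in>space N. W y < R y}"
 have B[measurable]: "B \<in> sets N" unfolding B_def by measurable
 have iB: "integrable M (%om. indicator B (x om) * f om)" if "integrable M f" for f :: "'a => real"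
  by (rule Bochner_Integration.integrable_bound[OF that]) (use that borel_measurable_integrable[OF that] in \<open>measurable, auto simp: indicator_def\<close>)
 have EB: "(LINT om|M. indicator B (x om) * R (x om)) = (LINT om|M. indicator B (x om) * L om)"
 proof -
  have "(LINT om|M. indicator B (x om) * f om) = enn2real (\<integral>\<^sup>+om. indicator B (x om) * ennreal (f om) \<partial>M)" if f: "integrable M f" "\<And>om. om : space M ==> f om >= 0" for f :: "'a => real"
  proof -
  have "(LINT om|M. indicator B (x om) * f om) = enn2real (\<integral>\<^sup>+om. ennreal (indicator B (x om) * f om) \<partial>M)"
  by (rule integral_eq_nn_integral) (use borel_measurable_integrable[OF iB[OF f(1)]] f(2) in auto)
  also have "(\<integral>\<^sup>+om. ennreal (indicator B (x om) * f om) \<partial>M) = (\<integral>\<^sup>+om. indicator B (x om) * ennreal (f om) \<partial>M)"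
  by (rule nn_integral_cong) (auto simp: indicator_def)
  finally show ?thesis .
  qed
  from this[OF Ri] this[OF Li] show ?thesis using key[OF B] R0 L0 by (simp add: less_imp_le)
 qed
 have ER: "(LINT om|M. R (x om)) = 1"
 proof -
  have "(LINT om|M. R (x om)) = enn2real (\<integral>\<^sup>+om. ennreal (R (x om)) \<partial>M)" by (rule integral_eq_nn_integral) (use R0 in auto)
  then show ?thesis using R1 by simp
 qed
 have mi: "integrable M (%om. max 0 (W (x om) - L om))" using Wi Li by simp
 note ints = Ri Li Wi iB[OF Ri] iB[OF Li] iB[OF Wi]
 have "(LINT om|M. \<bar>R (x om) - W (x om)\<bar>) = (LINT om|M. 2 * (indicator B (x om) * R (x om)) - 2 * (indicator B (x om) * W (x om)) - R (x om) + W (x om))"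
  by (rule Bochner_Integration.integral_cong) (use xs in \<open>auto simp: B_def indicator_def\<close>)
 also have "... = 2 * (LINT om|M. indicator B (x om) * L om) - 2 * (LINT om|M. indicator B (x om) * W (x om)) - 1 + (LINT om|M. W (x om))"
  using ints by (simp add: EB ER)
 also have "... = (LINT om|M. 2 * (indicator B (x om) * L om) - 2 * (indicator B (x om) * W (x om)) - L om + W (x om))" using ints by (simp add: EL)
 \<comment> \<open>On \<open>B\<close> the integrand equals \<open>L - W\<close>; off
   \<open>B\<close> it equals \<open>W - L\<close>, that is \<open>L - W\<close> plus twice
   \<open>W - L\<close>.\<close>
 also have "... <= (LINT om|M. L om - W (x om) + 2 * max 0 (W (x om) - L om))"
 proof (rule integral_mono)
  show "2 * (indicator B (x om) * L om) - 2 * (indicator B (x om) * W (x om)) - L om + W (x om) <= L om - W (x om) + 2 * max 0 (W (x om) - L om)" for om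
  by (auto simp: indicator_def max_def)
 qed (use ints mi in simp_all)
 also have "... = 1 - (LINT om|M. W (x om)) + 2 * (LINT om|M. max 0 (W (x om) - L om))" using ints mi by (simp add: EL)
 finally show "(LINT om|M. \<bar>R (x om) - W (x om)\<bar>) <= 1 - (LINT om|M. W (x om)) + 2 * (LINT om|M. max 0 (W (x om) - L om))" .
qed

text \<open>The limiting likelihood ratio as a function of the score, truncated to be bounded and
  continuous so that weak convergence of the score controls its mean.\<close>

definition lnt :: "real => real => real => real => real" where
 "lnt h I K s = min (exp (h * s - h^2 * I / 2)) K"

lemma lnt_bounds: "K >= 0 ==> 0 <= lnt h I K s" "lnt h I K s <= K" by (auto simp: lnt_def)

text \<open>Tilting \<open>N(0, I)\<close> by \<open>exp (h s - h^2 I / 2)\<close> gives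
  \<open>N(h I, I)\<close>, of total mass 1; dominated convergence removes the truncation.\<close>

lemma lnt_limit:
 assumes I: "I > 0"
 shows "(%k. \<integral>s. lnt h I (real k) s \<partial>density lborel (normal_density 0 (sqrt I))) ---> 1"
proof -
 let ?N = "density lborel (normal_density 0 (sqrt I))" and ?e = "%s. exp (h * s - h^2 * I / 2)"
 have sI: "sqrt I > 0" "(sqrt I)^2 = I" using I by auto
 have e: "normal_density 0 (sqrt I) s * ?e s = normal_density (h * I) (sqrt I) s" for s
 proof -
  have "- (s - 0)\<^sup>2 / (2 * I) + (h * s - h^2 * I / 2) = - (s - h * I)\<^sup>2 / (2 * I)" using I by (simp add: field_simps power2_eq_square)
  then show ?thesis by (simp add: normal_density_def sI exp_add[symmetric])
 qed
 have i: "integrable ?N ?e" "(\<integral>s. ?e s \<partial>?N) = 1"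
 proof -
  show "integrable ?N ?e" by (subst integrable_density) (use sI in \<open>auto simp: e\<close>)
  show "(\<integral>s. ?e s \<partial>?N) = 1" by (subst integral_density) (use sI in \<open>auto simp: e\<close>)
 qed
 have "(%k. \<integral>s. lnt h I (real k) s \<partial>?N) ---> (\<integral>s. ?e s \<partial>?N)"
 proof (rule integral_dominated_convergence[where w="?e"])
  show "AE s in ?N. (%k. lnt h I (real k) s) ---> ?e s"
  proof (rule AE_I2, rule tendsto_eventually)
  fix s
  obtain k0 :: nat where "?e s <= real k0" using real_arch_simple by blast
  then show "EVN k. lnt h I (real k) s = ?e s"
  by (intro eventually_sequentiallyI[of k0]) (simp add: lnt_def min_def)
  qed
 qed (use i in \<open>auto simp: lnt_def[abs_def]\<close>)
 then show ?thesis using i by simp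
qed

text \<open>Turns an absolute error into a logarithmic one when the reference \<open>exp y\<close>
  is at least \<open>exp (- l)\<close>; the upper side rests on
  \<open>2 - exp (- e) <= exp e\<close>.\<close>

lemma ln_close:
 fixes y :: real
 assumes "\<bar>y\<bar> <= l" "\<bar>r - exp y\<bar> < exp (- l) * (1 - exp (- e))" "e > 0"
 shows "\<bar>ln r - y\<bar> <= e"
proof -
 have "exp (- l) * (1 - exp (- e)) <= exp y * (1 - exp (- e))" using assms by (intro mult_right_mono) auto
 with assms(2) have r: "\<bar>r - exp y\<bar> < exp y - exp (y - e)" by (simp add: algebra_simps exp_diff exp_minus divide_inverse)
 have lo: "exp (y - e) < r" using r by linarith
 have "2 - exp (- e) <= exp e" using exp_ge_add_one_self[of e] exp_ge_add_one_self[of "- e"] by linarith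
 then have "exp y * (2 - exp (- e)) <= exp y * exp e" by (intro mult_left_mono) auto
 then have hi: "r < exp (y + e)" using r by (simp add: algebra_simps exp_diff exp_add exp_minus divide_inverse)
 have r0: "r > 0" using lo by (rule less_trans[rotated]) simp
 have "y - e < ln r" "ln r < y + e" using lo hi r0 ln_less_cancel_iff[of "exp (y - e)" r] ln_less_cancel_iff[of r "exp (y + e)"] by auto
 then show ?thesis by linarith
qed

text \<open>The truncated limit \<open>W\<close> is a function of the observations. It exceeds
  \<open>L\<close> only little in mean, because \<open>L\<close> divided by the untruncated limit
  tends to 1 and \<open>W\<close> is bounded, and its mean is close to 1 for a high truncation
  level. The sign test then puts the density of the observations close to \<open>W\<close> in mean,
  and tightness of the score turns this into closeness of logarithms.\<close>

lemma (in prob_space) likelihood_ratio_approx: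
 fixes x :: "nat => 'a => 'b" and L :: "nat => 'a => real"
 assumes x: "\<And>n. x n \<in> measurable M (N n)" and P: "\<And>n. prob_space (P' n)" "\<And>n. sets (P' n) = sets (N n)"
  and S: "\<And>n. S n : bmeas (N n)"
  and L: "\<And>n. L n : bmeas M" "\<And>n om. om : space M ==> 0 < L n om"
  and ch: "EVN n. \<forall>B\<in>sets (N n). emeasure (P' n) B = (\<integral>\<^sup>+om. indicator B (x n om) * ennreal (L n om) \<partial>M)"
  and o: "oP M (%n om. ln (L n om) - h * S n (x n om) + h^2 * I / 2)" and I: "I > 0"
  and wc: "weak_conv_m (%n. distr M borel (%om. S n (x n om))) (density lborel (normal_density 0 (sqrt I)))"
  and bS: "bP M (%n om. S n (x n om))"
 shows "EVN n. absolutely_continuous (distr M (N n) (x n)) (P' n)"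
  and "\<epsilon> > 0 ==> (%n. measure (distr M (N n) (x n)) {y\<in>space (distr M (N n) (x n)).
  \<bar>ln (enn2real (RN_deriv (distr M (N n) (x n)) (P' n) y)) - h * S n y + h^2 * I / 2\<bar> > \<epsilon>}) ---> 0"
proof -
 define R where "R n y = enn2real (RN_deriv (distr M (N n) (x n)) (P' n) y)" for n y
 define W where "W k n y = lnt h I (real k) (S n y)" for k n y
 have lm[measurable]: "lnt h I k : bmeas borel" for k unfolding lnt_def[abs_def] by measurable
 have Wm: "W k n : bmeas (N n)" for k n unfolding W_def[abs_def] by (rule measurable_compose[OF S lm])
 have W0: "0 <= W k n y" "W k n y <= real k" for k n y using lnt_bounds by (auto simp: W_def)
 have key: "EVN n. absolutely_continuous (distr M (N n) (x n)) (P' n) & integrable M (%om. R n (x n om)) & R n : bmeas (N n) \<and>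
  (LINT om|M. \<bar>R n (x n om) - W k n (x n om)\<bar>) <= 1 - (LINT om|M. W k n (x n om)) + 2 * (LINT om|M. max 0 (W k n (x n om) - L n om))" for k
  using ch
 proof eventually_elim
  case (elim n)
  have c: "\<And>B. B \<in> sets (N n) ==> emeasure (P' n) B = (\<integral>\<^sup>+om. indicator B (x n om) * ennreal (L n om) \<partial>M)" using elim by blast
  from RN_deriv_L1[OF x[of n] P(1)[of n] P(2)[of n] L(1)[of n] L(2)[of _ n] c Wm[of k n] W0] show ?case unfolding R_def by blast
 qed
 show "EVN n. absolutely_continuous (distr M (N n) (x n)) (P' n)"
  using key[of 0] by (rule eventually_mono) simp
 define c where "c k = (\<integral>s. lnt h I (real k) s \<partial>density lborel (normal_density 0 (sqrt I)))" for k :: nat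
 show "(%n. measure (distr M (N n) (x n)) {y\<in>space (distr M (N n) (x n)).
  \<bar>ln (enn2real (RN_deriv (distr M (N n) (x n)) (P' n) y)) - h * S n y + h^2 * I / 2\<bar> > \<epsilon>}) ---> 0" if eps: "\<epsilon> > 0"
 proof (rule tendstoI)
  fix e :: real assume e: "e > 0"
  obtain l0 where l0: "EVN n. \<exists>A\<in>events. prob A <= e / 4 & (\<forall>om\<in>space M - A. \<bar>S n (x n om)\<bar> <= l0)"
  using bS[unfolded bP_def, rule_format, of "e / 4"] e by auto
  \<comment> \<open>Bounds \<open>|h S - h^2 I / 2|\<close> wherever
    \<open>|S| <= l0\<close>.\<close>
  define l where "l = \<bar>h\<bar> * l0 + h^2 * I / 2"
  define \<delta> where "\<delta> = exp (- l) * (1 - exp (- \<epsilon>))"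
  have d: "\<delta> > 0" using eps by (simp add: \<delta>_def)
  have ed: "e * \<delta> / 8 > 0" using e d by simp
  have "EVN k. 1 - e * \<delta> / 8 < c k"
  using order_tendstoD(1)[OF lnt_limit[OF I, of h], of "1 - e * \<delta> / 8"] ed unfolding c_def by simp
  moreover have "EVN k. exp l <= real k"
  proof -
  obtain k0 :: nat where "exp l <= real k0" using real_arch_simple by blast
  then show ?thesis by (intro eventually_sequentiallyI[of k0]) simp
  qed
  ultimately have "EVN k. 1 - e * \<delta> / 8 < c k & exp l <= real k" by (rule eventually_conj)
  then obtain k where k: "1 - e * \<delta> / 8 < c k" "exp l <= real k" using eventually_happens[of _ sequentially] by auto
  have sx: "(%om. S n (x n om)) : bmeas M" for n by (rule measurable_compose[OF x S])
  have Wx: "(%om. W k n (x n om)) : bmeas M" for n by (rule measurable_compose[OF x Wm])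
  have "(%n. \<integral>s. lnt h I (real k) s \<partial>distr M borel (%om. S n (x n om))) ---> c k"
  unfolding c_def
  proof (rule weak_conv_imp_integral_bdd_continuous_conv[OF _ _ wc, where B="real k"])
  show "real_distribution (density lborel (normal_density 0 (sqrt I)))" by (rule normal_char(1)) (use I in simp)
  show "isCont (lnt h I (real k)) s" for s unfolding lnt_def[abs_def] by (intro continuous_intros)
  show "norm (lnt h I (real k) s) <= real k" for s using lnt_bounds(1)[of "real k" h I s] lnt_bounds(2)[of h I "real k" s] by simp
  qed (rule real_distribution_distr[OF sx])
  then have "(%n. \<integral>om. W k n (x n om) \<partial>M) ---> c k" by (simp add: integral_distr[OF sx lm] W_def)
  from order_tendstoD(1)[OF this k(1)] have e1: "EVN n. 1 - e * \<delta> / 8 < (LINT om|M. W k n (x n om))" .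
  define D where "D n om = ln (L n om) - h * S n (x n om) + h^2 * I / 2" for n om
  \<comment> \<open>The positive part of \<open>W - L\<close> is at most \<open>k\<close> times that
    of \<open>1 - exp D\<close>, where \<open>D\<close> is the logarithmic error.\<close>
  have "oP M (%n om. max 0 (1 - exp (D n om)) - max 0 (1 - exp 0))"
  by (rule oP_cont[where g="%z. max 0 (1 - exp z)"]) (use o in \<open>auto simp: D_def intro!: continuous_intros\<close>)
  then have "oP M (%n om. real k * max 0 (1 - exp (D n om)))" by (intro oP_cmult[where C="real k"]) auto
  then have "oP M (%n om. max 0 (W k n (x n om) - L n om))"
  proof (rule oP_mono, intro always_eventually allI ballI)
  fix n om assume w: "om : space M"
  have "L n om = exp (h * S n (x n om) - h^2 * I / 2) * exp (D n om)" using L(2)[OF w] by (simp add: D_def exp_add[symmetric])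
  also have "... >= W k n (x n om) * exp (D n om)" by (simp add: W_def lnt_def mult_right_mono)
  finally have "W k n (x n om) - L n om <= W k n (x n om) * (1 - exp (D n om))" by (simp add: algebra_simps)
  also have "... <= W k n (x n om) * max 0 (1 - exp (D n om))" using W0(1) by (intro mult_left_mono) auto
  also have "... <= real k * max 0 (1 - exp (D n om))" using W0(2) by (intro mult_right_mono) auto
  finally show "\<bar>max 0 (W k n (x n om) - L n om)\<bar> <= \<bar>real k * max 0 (1 - exp (D n om))\<bar>" by (simp add: abs_of_nonneg)
  qed
  then have "(%n. \<integral>om. \<bar>max 0 (W k n (x n om) - L n om)\<bar> \<partial>M) ---> 0"
  proof (rule oP_bounded_integral[where B="real k"])
  show "(%om. max 0 (W k n (x n om) - L n om)) : bmeas M" for n using Wx[of n] L(1)[of n] by measurable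
  show "\<bar>max 0 (W k n (x n om) - L n om)\<bar> <= real k" if "om : space M" for n om using W0(2)[of k n "x n om"] L(2)[OF that, of n] by simp
  qed
  then have "(%n. \<integral>om. max 0 (W k n (x n om) - L n om) \<partial>M) ---> 0" by simp
  from order_tendstoD(2)[OF this, of "e * \<delta> / 16"] ed have e2: "EVN n. (LINT om|M. max 0 (W k n (x n om) - L n om)) < e * \<delta> / 16" by simp
  show "EVN n. dist (measure (distr M (N n) (x n)) {y\<in>space (distr M (N n) (x n)).
  \<bar>ln (enn2real (RN_deriv (distr M (N n) (x n)) (P' n) y)) - h * S n y + h^2 * I / 2\<bar> > \<epsilon>}) 0 < e"
  using l0 e1 e2 key[of k]
  proof eventually_elim
  case (elim n)
  obtain A where A: "A \<in> events" "prob A <= e / 4" "\<And>om. om : space M - A ==> \<bar>S n (x n om)\<bar> <= l0" using elim(1) by blast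
  have Ri: "integrable M (%om. R n (x n om))" and [measurable]: "R n : bmeas (N n)" using elim(4) by auto
  note [measurable] = S[of n] x[of n]
  have Wi: "integrable M (%om. W k n (x n om))" by (rule integrable_const_bound[where B="real k", OF _ Wx]) (use W0 in auto)
  define B where "B = {y\<in>space (N n). \<bar>ln (R n y) - h * S n y + h^2 * I / 2\<bar> > \<epsilon>}"
  have B[measurable]: "B \<in> sets (N n)" unfolding B_def by measurable
  let ?G = "{om\<in>space M. \<bar>R n (x n om) - W k n (x n om)\<bar> >= \<delta>}"
  have G: "?G \<in> events" using borel_measurable_integrable[OF Ri] Wx[of n] by measurable
  have sub: "x n -` B \<inter> space M \<subseteq> A \<union> ?G"
  proof
  fix om assume w: "om \<in> x n -` B \<inter> space M"
  show "om \<in> A \<union> ?G"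
  proof (rule ccontr)
  assume n: "om \<notin> A \<union> ?G"
  then have s: "\<bar>S n (x n om)\<bar> <= l0" and g: "\<bar>R n (x n om) - W k n (x n om)\<bar> < \<delta>" using A(3) w by auto
  define y where "y = h * S n (x n om) - h^2 * I / 2"
  have "\<bar>h * S n (x n om)\<bar> <= \<bar>h\<bar> * l0" unfolding abs_mult using s by (rule mult_left_mono) simp
  moreover have "h^2 * I / 2 >= 0" using I by simp
  ultimately have y: "\<bar>y\<bar> <= l" unfolding y_def l_def by linarith
  then have "exp y <= exp l" by simp
  then have "exp y <= real k" using k(2) by (rule order_trans)
  then have "W k n (x n om) = exp y" by (simp add: W_def lnt_def y_def)
  then have "\<bar>ln (R n (x n om)) - y\<bar> <= \<epsilon>" using ln_close[OF y _ eps] g by (simp add: \<delta>_def)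
  moreover have "\<epsilon> < \<bar>ln (R n (x n om)) - h * S n (x n om) + h^2 * I / 2\<bar>" using w by (simp add: B_def)
  ultimately show False unfolding y_def by linarith
  qed
  qed
  have "prob ?G <= (LINT om|M. \<bar>R n (x n om) - W k n (x n om)\<bar>) / \<delta>"
  by (rule integral_Markov_inequality_measure[where A="{}"]) (use Ri Wi d in auto)
  \<comment> \<open>\<open>e \<delta> / 8\<close> from the mean of \<open>W\<close>, and twice
    \<open>e \<delta> / 16\<close> from the excess of \<open>W\<close> over
    \<open>L\<close>.\<close>
  also have "... <= (e * \<delta> / 4) / \<delta>" using elim(2,3,4) d by (intro divide_right_mono) auto
  finally have PG: "prob ?G <= e / 4" using d by simp
  have "prob (x n -` B \<inter> space M) <= prob (A \<union> ?G)" by (rule finite_measure_mono[OF sub]) (use A G in auto)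
  also have "... <= e / 4 + e / 4" using measure_Un_le[OF A(1) G] A(2) PG by simp
  finally have "measure (distr M (N n) (x n)) B < e" using e by (simp add: measure_distr)
  then show ?case by (simp add: B_def R_def)
  qed
 qed
qed

section \<open>Local asymptotic normality\<close>

lemma sq_minus_one: "0 < w ==> \<bar>w^2 - 1\<bar> = \<bar>w - 1\<bar> * (w + 1)" for w :: real
proof -
 assume "0 < w"
 then have "\<bar>w - 1\<bar> * (w + 1) = \<bar>(w - 1) * (w + 1)\<bar>" by (simp add: abs_mult)
 then show ?thesis by (simp add: power2_eq_square algebra_simps)
qed

section \<open>Transitions under a local alternative\<close>

locale lan_array = ou_array M X0 W N Z F \<sigma> lam X a S t \<beta> th
 for M :: "'a measure" and X0 W N Z F \<sigma> lam X a S t \<beta> th + fixes h :: real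
begin

definition thp where "thp n = th n + h / sqrt (T n)"
text \<open>The last condition gives \<open>4 a d^2 <= d / 4\<close>, so that for both drifts the
  squared \<open>ou_sd\<close> lies between \<open>d / 2\<close> and \<open>d\<close>.\<close>

definition good2 where "good2 n \<longleftrightarrow> good n & 0 < thp n & thp n <= 2 * a & 16 * a * \<Delta> n <= 1"
definition sp where "sp n i = ou_sd (thp n) (d n i)"
text \<open>\<open>kap\<close> compares the standard deviations under the two drifts and
  \<open>drf\<close> the conditional means given the jumps; \<open>e\<close> is the mean shift in
  units of the alternative's standard deviation, and \<open>p\<close> its leading term.\<close>

definition kap where "kap n i = ou_sd (th n) (d n i) / sp n i"
definition drf where "drf n i om = (rho n i - exp (- thp n * d n i)) * x n i om + (jj n i om - jmp (thp n) (t n) i om)"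
definition e where "e n i om = drf n i om / (\<sigma> * sp n i)"
definition p where "p n i om = h / \<sigma> * (sqrt (d n i) / sqrt (T n) * x n i om)"
definition BX where "BX = 2 * Bx + 2 * mG^2"

definition C0 where "C0 = 16 * a^2 + 8 * a * \<bar>h\<bar> + 2 * \<bar>h\<bar>"
definition Ce where "Ce = 2 * C0^2 / \<sigma>^2 * (BX + CA)"

lemma BX: "BX >= 0" using Bx_nonneg by (simp add: BX_def)

lemma ev_good2: "(\<And>n. good2 n ==> P n) ==> EVN n. P n"
proof -
 assume P: "\<And>n. good2 n ==> P n"
 have "filterlim (%n. sqrt (T n)) at_top sequentially" by (rule filterlim_compose[OF sqrt_at_top T_inf])
 from tendsto_mult_right_zero[OF tendsto_inverse_0_at_top[OF this], of h] have "(%n. h / sqrt (T n)) ---> 0" by (simp add: divide_inverse)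
 from tendsto_add[OF th_lim this] have t: "thp ---> a" by (simp add: thp_def[abs_def])
 have 1: "EVN n. 0 < thp n" by (rule order_tendstoD(1)[OF t a_pos])
 have 2: "EVN n. thp n < 2 * a" by (rule order_tendstoD(2)[OF t]) (use a_pos in simp)
 have 3: "EVN n. 16 * a * \<Delta> n < 1" by (rule order_tendstoD(2)[OF tend0_mesh]) simp
 show ?thesis using good_ev 1 2 3 by eventually_elim (rule P, simp add: good2_def)
qed

context
 fixes n i assumes g2: "good2 n" and i: "i < n"
begin

lemma basics: "good n" "0 < thp n" "thp n <= 2 * a" "0 < th n" "th n <= 2 * a" "0 < d n i" "d n i <= 1" "16 * a * d n i <= 1" "0 < sp n i"
 "0 < kap n i" "\<sigma> ~= 0" "T n >= 1"
proof -
 show gd: "good n" and t: "0 < thp n" "thp n <= 2 * a" using g2 by (auto simp: good2_def)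
 show t': "0 < th n" "th n <= 2 * a" "T n >= 1" using th_pos goodD[OF gd] by auto
 show d: "0 < d n i" "d n i <= 1" using d_pos[OF i] goodD(9)[OF gd i] by auto
 have "16 * a * d n i <= 16 * a * \<Delta> n" using d_le[OF i] a_pos by (intro mult_left_mono) auto
 then show "16 * a * d n i <= 1" by (rule order_trans) (use g2 in \<open>simp add: good2_def\<close>)
 show "0 < sp n i" unfolding sp_def by (rule ou_sd_pos[OF t(1) d(1)])
 then show "0 < kap n i" unfolding kap_def using ou_sd_pos[OF t'(1) d(1)] by simp
 show "\<sigma> ~= 0" using sigma by auto
qed

lemma var_bounds:
 assumes "0 < tt" "tt <= 2 * a"
 shows "(ou_sd tt (d n i))^2 <= d n i" "d n i - 4 * a * (d n i)^2 <= (ou_sd tt (d n i))^2" "d n i / 2 <= (ou_sd tt (d n i))^2"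
proof -
 note b = ou_sd_bounds[OF assms(1) basics(6)]
 show "(ou_sd tt (d n i))^2 <= d n i" using b by simp
 have "2 * tt * (d n i)^2 <= 2 * (2 * a) * (d n i)^2" using assms by (intro mult_right_mono mult_left_mono) auto
 then show 1: "d n i - 4 * a * (d n i)^2 <= (ou_sd tt (d n i))^2" using b by simp
 have "4 * a * (d n i)^2 = (16 * a * d n i) * (d n i / 4)" by (simp add: power2_eq_square)
 also have "... <= 1 * (d n i / 4)" using basics by (intro mult_right_mono) auto
 finally show "d n i / 2 <= (ou_sd tt (d n i))^2" using 1 basics(6) by simp
qed

lemma ratio_le:
 assumes "d n i - 4 * a * (d n i)^2 <= y" "y <= d n i" and z: "d n i - 4 * a * (d n i)^2 <= z" "z <= d n i" "d n i / 2 <= z"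
 shows "\<bar>y / z - 1\<bar> <= 8 * a * d n i"
proof -
 have z0: "z > 0" using z basics(6) by simp
 have "y / z - 1 = (y - z) / z" using z0 by (simp add: diff_divide_distrib)
 then have "\<bar>y / z - 1\<bar> = \<bar>y - z\<bar> / z" using z0 by simp
 also have "... <= (4 * a * (d n i)^2) / (d n i / 2)" using assms basics(6) by (intro frac_le) auto
 also have "... = 8 * a * d n i" using basics(6) by (simp add: power2_eq_square)
 finally show ?thesis .
qed

lemma kap_bounds: "\<bar>(kap n i)^2 - 1\<bar> <= 8 * a * d n i" "\<bar>kap n i - 1\<bar> <= 8 * a * d n i" "(kap n i)^2 <= 2"
proof -
 show 1: "\<bar>(kap n i)^2 - 1\<bar> <= 8 * a * d n i" unfolding kap_def power_divide sp_def
  by (rule ratio_le) (use var_bounds basics in auto)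
 have "\<bar>(kap n i)^2 - 1\<bar> = \<bar>kap n i - 1\<bar> * (kap n i + 1)" by (rule sq_minus_one[OF basics(10)])
 moreover have "\<bar>kap n i - 1\<bar> * 1 <= \<bar>kap n i - 1\<bar> * (kap n i + 1)" using basics(10) by (intro mult_left_mono) auto
 ultimately show "\<bar>kap n i - 1\<bar> <= 8 * a * d n i" using 1 by simp
 show "(kap n i)^2 <= 2" using 1 basics(8) by linarith
qed

abbreviation "A \<equiv> Avar (t n i) (t n (Suc i))"

text \<open>The drifts differ by \<open>h / sqrt T\<close>. Linearising the exponentials leaves an
  error of order \<open>d^2 |x|\<close>, and the jump innovations for the two drifts differ by order
  \<open>d\<close> times the total variation; division by a standard deviation of order
  \<open>sqrt d\<close> leaves one factor \<open>d\<close> in the square.\<close>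

lemma e_p_le:
 assumes w: "om : space M"
 shows "(e n i om - p n i om)^2 <= 2 * C0^2 / \<sigma>^2 * d n i * ((d n i)^2 * (x n i om)^2 + (A om)^2)"
proof -
 note bs = basics
 \<comment> \<open>Correction for using \<open>sqrt d\<close> as standard deviation; it is
   \<open>1 + O(d)\<close>.\<close>
 define wi where "wi = sqrt (d n i) / sp n i"
 define r where "r = 1 / sqrt (T n)"
 have r: "0 < r" "r <= 1" using bs by (auto simp: r_def)
 have wi2: "wi^2 = d n i / (sp n i)^2" using bs by (simp add: wi_def power_divide)
 have w1: "wi > 0" using bs by (simp add: wi_def)
 have "\<bar>wi^2 - 1\<bar> <= 8 * a * d n i" unfolding wi2 sp_def by (rule ratio_le) (use var_bounds bs a_pos in auto)
 moreover have "\<bar>wi^2 - 1\<bar> = \<bar>wi - 1\<bar> * (wi + 1)" by (rule sq_minus_one[OF w1])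
 moreover have "\<bar>wi - 1\<bar> * 1 <= \<bar>wi - 1\<bar> * (wi + 1)" using w1 by (intro mult_left_mono) auto
 ultimately have wi: "\<bar>wi - 1\<bar> <= 8 * a * d n i" by simp
 then have wi3: "wi <= 2" using bs(8) by linarith
 define q where "q = h * r * d n i * x n i om"
 have thd: "thp n - th n = h * r" by (simp add: thp_def r_def)
 have D: "\<bar>drf n i om - q\<bar> <= 8 * a^2 * (d n i)^2 * \<bar>x n i om\<bar> + \<bar>h\<bar> * d n i * A om"
 proof -
  have c1: "\<bar>1 - rho n i - th n * d n i\<bar> <= (th n * d n i)^2" by (rule rho_lin[OF i])
  have c2: "\<bar>1 - exp (- thp n * d n i) - thp n * d n i\<bar> <= (thp n * d n i)^2" using one_minus_exp_bounds(3)[of "thp n * d n i"] bs by simp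
  have c3: "(tt * d n i)^2 <= 4 * a^2 * (d n i)^2" if "0 < tt" "tt <= 2 * a" for tt
  using power_mono[OF that(2), of 2] that by (simp add: power_mult_distrib mult_right_mono)
  have eq: "rho n i - exp (- thp n * d n i) - h * r * d n i = (1 - exp (- thp n * d n i) - thp n * d n i) - (1 - rho n i - th n * d n i)"
  unfolding thd[symmetric] by (simp add: algebra_simps)
  have 1: "\<bar>rho n i - exp (- thp n * d n i) - h * r * d n i\<bar> <= 8 * a^2 * (d n i)^2"
  unfolding eq using c1 c2 c3[OF bs(2,3)] c3[OF bs(4,5)] by linarith
  have "\<bar>jj n i om - jmp (thp n) (t n) i om\<bar> <= \<bar>th n - thp n\<bar> * d n i * A om"
  using Jou_diff_le[OF w gridD(1,2)[OF gr i], of "th n" "thp n"] bs by (simp add: jj_def jmp_def d_def)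
  also have "... <= \<bar>h\<bar> * d n i * A om"
  proof -
  have "\<bar>th n - thp n\<bar> = \<bar>h * r\<bar>" using abs_minus_commute[of "th n" "thp n"] thd by simp
  also have "... = \<bar>h\<bar> * r" using r by (simp add: abs_mult)
  also have "... <= \<bar>h\<bar>" using r by (simp add: mult_left_le)
  finally show ?thesis using bs Avar_nonneg by (intro mult_right_mono) auto
  qed
  finally have 2: "\<bar>jj n i om - jmp (thp n) (t n) i om\<bar> <= \<bar>h\<bar> * d n i * A om" .
  have eq2: "drf n i om - q = (rho n i - exp (- thp n * d n i) - h * r * d n i) * x n i om + (jj n i om - jmp (thp n) (t n) i om)"
  by (simp add: drf_def q_def algebra_simps)
  have 3: "\<bar>(rho n i - exp (- thp n * d n i) - h * r * d n i) * x n i om\<bar> <= 8 * a^2 * (d n i)^2 * \<bar>x n i om\<bar>"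
  unfolding abs_mult using 1 by (rule mult_right_mono) simp
  show ?thesis unfolding eq2 by (rule order_trans[OF abs_triangle_ineq add_mono[OF 3 2]])
 qed
 have q: "\<bar>q\<bar> <= \<bar>h\<bar> * d n i * \<bar>x n i om\<bar>"
 proof -
  have "\<bar>q\<bar> = r * (\<bar>h\<bar> * d n i * \<bar>x n i om\<bar>)" using r bs by (simp add: q_def abs_mult)
  also have "... <= 1 * (\<bar>h\<bar> * d n i * \<bar>x n i om\<bar>)" using r bs by (intro mult_right_mono) auto
  finally show ?thesis by simp
 qed
 have "\<bar>drf n i om * wi - q\<bar> <= \<bar>(drf n i om - q) * wi\<bar> + \<bar>q * (wi - 1)\<bar>"
  using abs_triangle_ineq[of "(drf n i om - q) * wi" "q * (wi - 1)"] by (simp add: algebra_simps)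
 also have "... <= (8 * a^2 * (d n i)^2 * \<bar>x n i om\<bar> + \<bar>h\<bar> * d n i * A om) * 2 + (\<bar>h\<bar> * d n i * \<bar>x n i om\<bar>) * (8 * a * d n i)"
  unfolding abs_mult using D q wi wi3 w1 bs Avar_nonneg by (intro add_mono mult_mono) auto
 also have "... = d n i * ((16 * a^2 + 8 * a * \<bar>h\<bar>) * (d n i * \<bar>x n i om\<bar>) + 2 * \<bar>h\<bar> * A om)" by (simp add: algebra_simps power2_eq_square)
 also have "... <= d n i * (C0 * (d n i * \<bar>x n i om\<bar>) + C0 * A om)"
 proof -
  have c: "16 * a^2 + 8 * a * \<bar>h\<bar> <= C0" "2 * \<bar>h\<bar> <= C0" using a_pos by (auto simp: C0_def)
  show ?thesis using bs Avar_nonneg by (intro mult_left_mono add_mono mult_right_mono c) auto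
 qed
 finally have m: "\<bar>drf n i om * wi - q\<bar> <= d n i * (C0 * (d n i * \<bar>x n i om\<bar> + A om))" by (simp add: algebra_simps)
 have ep: "e n i om - p n i om = (drf n i om * wi - q) / (\<sigma> * sqrt (d n i))"
 proof -
  have "sqrt (d n i) * sqrt (d n i) = d n i" using bs by simp
  then have "p n i om = q / (\<sigma> * sqrt (d n i))" using bs unfolding p_def q_def r_def by (simp add: field_simps)
  moreover have "e n i om = drf n i om * wi / (\<sigma> * sqrt (d n i))" using bs by (simp add: e_def wi_def)
  ultimately show ?thesis by (simp add: diff_divide_distrib)
 qed
 have "(e n i om - p n i om)^2 = (drf n i om * wi - q)^2 / (\<sigma>^2 * d n i)" unfolding ep using bs by (simp add: power_divide power_mult_distrib)
 also have "... <= (d n i * (C0 * (d n i * \<bar>x n i om\<bar> + A om)))^2 / (\<sigma>^2 * d n i)"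
  using power_mono[OF m, of 2] bs by (intro divide_right_mono) auto
 also have "... = C0^2 / \<sigma>^2 * d n i * (d n i * \<bar>x n i om\<bar> + A om)^2" using bs by (simp add: power_mult_distrib power2_eq_square[of "d n i"])
 also have "... <= C0^2 / \<sigma>^2 * d n i * (2 * (d n i * \<bar>x n i om\<bar>)^2 + 2 * (A om)^2)"
  using bs sq_sum_le by (intro mult_left_mono) auto
 finally show ?thesis by (simp add: power_mult_distrib algebra_simps)
qed


lemma e_G: "e n i : bmeas (G n i)"
proof -
 have "jmp (thp n) (t n) i : bmeas (G n i)" by (rule jmp_HG[OF gr th_pos _ i]) (use i in simp)
 then show ?thesis unfolding e_def[abs_def] drf_def using x_G[of i n] jj_G[of i n i] i
  by (intro borel_measurable_divide borel_measurable_add borel_measurable_diff borel_measurable_times borel_measurable_const) auto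
qed

lemma p_G: "p n i : bmeas (G n i)"
 unfolding p_def[abs_def] by (intro borel_measurable_times borel_measurable_const x_G) (use i in simp)

lemma e_M: "e n i : bmeas M" "p n i : bmeas M"
 using adapted_indep_measurable[OF g_ad _ e_G] adapted_indep_measurable[OF g_ad _ p_G] i by auto

text \<open>The second moment of the total variation contributes another factor \<open>d\<close>, so
  these errors sum to order \<open>T \<Delta>\<close>.\<close>

lemma ep_mom: "integrable M (%om. (e n i om - p n i om)\<^sup>2)" "(LINT om|M. (e n i om - p n i om)\<^sup>2) <= Ce * (d n i)^2"
proof -
 note bs = basics
 have st: "0 <= t n i" "t n i < t n (Suc i)" "t n (Suc i) <= t n i + 1" using gridD(1,2)[OF gr i] bs by (auto simp: d_def)
 note Av = Avar_sq(1,2)[OF st]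
 have xq: "integrable M (%om. (x n i om)\<^sup>2)" "(LINT om|M. (x n i om)\<^sup>2) <= BX" using x_sq[OF bs(1), of i] i by (auto simp: BX_def)
 let ?b = "%om. 2 * C0^2 / \<sigma>^2 * d n i * ((d n i)^2 * (x n i om)^2 + (A om)^2)"
 have ib: "integrable M ?b" using xq Av by simp
 have m: "(%om. (e n i om - p n i om)\<^sup>2) : bmeas M" using e_M by (intro borel_measurable_power borel_measurable_diff)
 show 1: "integrable M (%om. (e n i om - p n i om)\<^sup>2)"
  by (rule Bochner_Integration.integrable_bound[OF ib m], rule AE_I2, unfold real_norm_def abs_power2, rule order_trans[OF e_p_le abs_ge_self])
 have "(LINT om|M. (e n i om - p n i om)\<^sup>2) <= (LINT om|M. ?b om)" by (rule integral_mono[OF 1 ib e_p_le])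
 also have "... = 2 * C0^2 / \<sigma>^2 * d n i * ((d n i)^2 * (LINT om|M. (x n i om)\<^sup>2) + (LINT om|M. (A om)\<^sup>2))" using xq Av by simp
 also have "... <= 2 * C0^2 / \<sigma>^2 * d n i * (d n i * BX + CA * d n i)"
 proof -
  have "(d n i)^2 <= d n i" using bs by (simp add: power2_eq_square mult_left_le)
  then have "(d n i)^2 * (LINT om|M. (x n i om)\<^sup>2) <= d n i * BX" using xq BX bs by (intro mult_mono) auto
  then show ?thesis using Av(2) bs by (intro mult_left_mono add_mono) (auto simp: d_def)
 qed
 also have "... = Ce * (d n i)^2" by (simp add: Ce_def power2_eq_square algebra_simps add_divide_distrib)
 finally show "(LINT om|M. (e n i om - p n i om)\<^sup>2) <= Ce * (d n i)^2" .
qed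

lemma p_mom: "integrable M (%om. (p n i om)\<^sup>2)" "(LINT om|M. (p n i om)\<^sup>2) <= h^2 / \<sigma>^2 * BX * d n i / T n"
proof -
 note bs = basics
 have xq: "integrable M (%om. (x n i om)\<^sup>2)" "(LINT om|M. (x n i om)\<^sup>2) <= BX" using x_sq[OF bs(1), of i] i by (auto simp: BX_def)
 have eq: "(p n i om)^2 = h^2 / \<sigma>^2 * (d n i / T n) * (x n i om)^2" for om
  unfolding p_def power_mult_distrib[of "h / \<sigma>"] zeta_coeff_sq[OF bs(1) i] by (simp add: power_divide)
 show "integrable M (%om. (p n i om)\<^sup>2)" unfolding eq using xq by simp
 have "h^2 / \<sigma>^2 * (d n i / T n) * (LINT om|M. (x n i om)\<^sup>2) <= h^2 / \<sigma>^2 * (d n i / T n) * BX" using xq bs by (intro mult_left_mono) auto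
 then show "(LINT om|M. (p n i om)\<^sup>2) <= h^2 / \<sigma>^2 * BX * d n i / T n" unfolding eq by (simp add: mult_ac)
qed

text \<open>The standardised residual under the alternative is \<open>e + kap g\<close>. Its square
  is expanded and \<open>p g\<close> added and subtracted, so that after summation only
  \<open>- p g\<close> and \<open>- e^2 / 2\<close> matter.\<close>

lemma ln_lratio:
 "lratio (th n) (thp n) (t n) i om > 0"
 "ln (lratio (th n) (thp n) (t n) i om) = (ln ((kap n i)^2) + 1 - (kap n i)^2) / 2 + (1 - (kap n i)^2) / 2 * ((g n i om)^2 - 1)
  + (p n i om - kap n i * e n i om) * g n i om - p n i om * g n i om - (e n i om)^2 / 2"
proof -
 note bs = basics
 have k: "\<bar>psd (th n) (t n) i\<bar> / \<bar>psd (thp n) (t n) i\<bar> = kap n i"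
  using bs ou_sd_pos[OF bs(4,6)] by (simp add: psd_def kap_def sp_def d_def[symmetric] abs_mult)
 have m: "(pmean (th n) (t n) i om (X (th n) (t n i) om) + psd (th n) (t n) i * gau (th n) (t n) i om - pmean (thp n) (t n) i om (X (th n) (t n i) om)) / psd (thp n) (t n) i
  = e n i om + kap n i * g n i om"
  using bs by (simp add: pmean_def psd_def d_def[symmetric] x_def[symmetric] jj_def[symmetric] g_def[symmetric] rho_def[symmetric] e_def drf_def kap_def sp_def[symmetric])
  (simp add: field_simps rho_def)
 have L: "lratio (th n) (thp n) (t n) i om = kap n i * exp ((g n i om)^2 / 2 - (e n i om + kap n i * g n i om)^2 / 2)"
  unfolding lratio_def gratio_def k m by (simp add: g_def)
 show "lratio (th n) (thp n) (t n) i om > 0" unfolding L using bs by simp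
 have "ln ((kap n i)^2) = 2 * ln (kap n i)" using bs by (simp add: ln_realpow)
 then show "ln (lratio (th n) (thp n) (t n) i om) = (ln ((kap n i)^2) + 1 - (kap n i)^2) / 2 + (1 - (kap n i)^2) / 2 * ((g n i om)^2 - 1)
  + (p n i om - kap n i * e n i om) * g n i om - p n i om * g n i om - (e n i om)^2 / 2"
  unfolding L using bs by (simp add: ln_mult power2_eq_square field_simps)
qed

end

lemma Ce: "Ce >= 0" using BX CA_nonneg by (simp add: Ce_def)

lemma sum_le_d2:
 assumes "\<And>i. i < n ==> f i <= C * (d n i)^2" "C >= 0"
 shows "(\<Sum>i<n. f i) <= C * (T n * \<Delta> n)"
proof -
 have "(\<Sum>i<n. f i) <= (\<Sum>i<n. C * (d n i)^2)" by (rule sum_mono) (use assms in auto)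
 also have "... <= C * (\<Delta> n * T n)" unfolding sum_distrib_left[symmetric] by (rule mult_left_mono[OF sum_d2 assms(2)])
 finally show ?thesis by (simp add: mult_ac)
qed

lemma lim_TD: "(%n. C * (T n * \<Delta> n)) ---> 0" using tendsto_mult_right_zero[OF rates(1)] .

text \<open>To first order in \<open>kap^2 - 1\<close> the logarithm of the variance ratio cancels
  the mean of the quadratic Gaussian term, leaving order \<open>d^2\<close> per step.\<close>

lemma log_term: "(%n. \<Sum>i<n. (ln ((kap n i)^2) + 1 - (kap n i)^2) / 2) ---> 0"
proof (rule Lim_null_comparison[OF ev_good2 lim_TD[of "64 * a^2"]])
 fix n assume g2: "good2 n"
 have "\<bar>\<Sum>i<n. (ln ((kap n i)^2) + 1 - (kap n i)^2) / 2\<bar> <= (\<Sum>i<n. \<bar>(ln ((kap n i)^2) + 1 - (kap n i)^2) / 2\<bar>)" by (rule sum_abs)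
 also have "... <= 64 * a^2 * (T n * \<Delta> n)"
 proof (rule sum_le_d2)
  fix i assume i: "i < n"
  define y where "y = (kap n i)^2 - 1"
  have y: "\<bar>y\<bar> <= 8 * a * d n i" "\<bar>y\<bar> <= 1 / 2" using kap_bounds(1)[OF g2 i] basics(8)[OF g2 i] unfolding y_def by linarith+
  have "\<bar>ln (1 + y) - y\<bar> <= 2 * y^2" by (rule abs_ln_one_plus_x_minus_x_bound[OF y(2)])
  moreover have "y^2 <= (8 * a * d n i)^2" using power_mono[OF y(1), of 2] by simp
  ultimately show "\<bar>(ln ((kap n i)^2) + 1 - (kap n i)^2) / 2\<bar> <= 64 * a^2 * (d n i)^2" by (simp add: y_def power_mult_distrib)
 qed simp
 finally show "norm (\<Sum>i<n. (ln ((kap n i)^2) + 1 - (kap n i)^2) / 2) <= 64 * a^2 * (T n * \<Delta> n)" by simp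
qed

lemma g2_term: "oP M (%n om. \<Sum>i<n. (1 - (kap n i)^2) / 2 * ((g n i om)^2 - 1))"
proof (rule adapted_sum_oP[OF ev_good2 lim_TD[of "32 * a^2"], where H=G], intro conjI allI impI)
 fix n assume g2: "good2 n"
 show "adapted_indep M (G n) (%i om. (g n i om)\<^sup>2 - 1) n"
  by (rule adapted_indep_compose[OF g_ad, where f="%i y. y\<^sup>2 - 1"]) simp
 show "(\<Sum>i<n. (LINT om|M. ((1 - (kap n i)^2) / 2)\<^sup>2) * (LINT om|M. ((g n i om)^2 - 1)\<^sup>2)) <= 32 * a^2 * (T n * \<Delta> n)"
 proof (rule sum_le_d2)
  fix i assume i: "i < n"
  have "((kap n i)^2 - 1)^2 <= (8 * a * d n i)^2" using power_mono[OF kap_bounds(1)[OF g2 i], of 2] by simp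
  then show "(LINT om|M. ((1 - (kap n i)^2) / 2)\<^sup>2) * (LINT om|M. ((g n i om)^2 - 1)\<^sup>2) <= 32 * a^2 * (d n i)^2"
  by (simp add: prob_space g2_mom[OF i] power_divide power_mult_distrib power2_commute[of 1])
 qed simp
qed (use g2_mom in auto)

lemma cross_term: "oP M (%n om. \<Sum>i<n. (p n i om - kap n i * e n i om) * g n i om)"
proof (rule adapted_sum_oP[OF ev_good2 lim_TD[of "4 * Ce + 128 * a^2 * (h^2 / \<sigma>^2 * BX)"], where H=G], intro conjI allI impI)
 fix n assume g2: "good2 n"
 show "adapted_indep M (G n) (g n) n" by (rule g_ad)
 have c: "integrable M (%om. (p n i om - kap n i * e n i om)\<^sup>2)" "(LINT om|M. (p n i om - kap n i * e n i om)\<^sup>2) <= (4 * Ce + 128 * a^2 * (h^2 / \<sigma>^2 * BX)) * (d n i)^2"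
  if i: "i < n" for i
 proof -
  note bs = basics[OF g2 i] and kb = kap_bounds[OF g2 i] and em = ep_mom[OF g2 i] and pm = p_mom[OF g2 i]
  let ?b = "%om. 4 * (e n i om - p n i om)^2 + 128 * a^2 * (d n i)^2 * (p n i om)^2"
  have k2: "(kap n i - 1)^2 <= 64 * a^2 * (d n i)^2" using power_mono[OF kb(2), of 2] by (simp add: power_mult_distrib)
  have bd: "(p n i om - kap n i * e n i om)^2 <= ?b om" for om
  proof -
  have "(p n i om - kap n i * e n i om)^2 = (kap n i * (e n i om - p n i om) + (kap n i - 1) * p n i om)^2" by (simp add: power2_eq_square algebra_simps)
  also have "... <= 2 * ((kap n i)^2 * (e n i om - p n i om)^2) + 2 * ((kap n i - 1)^2 * (p n i om)^2)"
  using sq_sum_le[of "kap n i * (e n i om - p n i om)" "(kap n i - 1) * p n i om"] by (simp add: power_mult_distrib)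
  also have "... <= 2 * (2 * (e n i om - p n i om)^2) + 2 * ((64 * a^2 * (d n i)^2) * (p n i om)^2)"
  by (intro add_mono mult_left_mono mult_right_mono kb(3) k2) auto
  finally show ?thesis by simp
  qed
  have ib: "integrable M ?b" using em pm by simp
  have m: "(%om. (p n i om - kap n i * e n i om)\<^sup>2) : bmeas M"
  using e_M[OF g2 i] by (intro borel_measurable_power borel_measurable_diff borel_measurable_times borel_measurable_const)
  show 1: "integrable M (%om. (p n i om - kap n i * e n i om)\<^sup>2)"
  by (rule Bochner_Integration.integrable_bound[OF ib m], rule AE_I2, unfold real_norm_def abs_power2, rule order_trans[OF bd abs_ge_self])
  have "(LINT om|M. (p n i om - kap n i * e n i om)\<^sup>2) <= (LINT om|M. ?b om)" by (rule integral_mono[OF 1 ib bd])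
  also have "... = 4 * (LINT om|M. (e n i om - p n i om)\<^sup>2) + 128 * a^2 * (d n i)^2 * (LINT om|M. (p n i om)\<^sup>2)" using em pm by simp
  also have "... <= 4 * (Ce * (d n i)^2) + 128 * a^2 * (d n i)^2 * (h^2 / \<sigma>^2 * BX)"
  proof -
  have "h^2 / \<sigma>^2 * BX * d n i / T n <= (h^2 / \<sigma>^2 * BX * 1) / 1" using bs BX by (intro frac_le mult_left_mono) auto
  then show ?thesis using em(2) pm(2) by (intro add_mono mult_left_mono) auto
  qed
  finally show "(LINT om|M. (p n i om - kap n i * e n i om)\<^sup>2) <= (4 * Ce + 128 * a^2 * (h^2 / \<sigma>^2 * BX)) * (d n i)^2" by (simp add: algebra_simps)
 qed
 show "(\<Sum>i<n. (LINT om|M. (p n i om - kap n i * e n i om)\<^sup>2) * (LINT om|M. (g n i om)\<^sup>2)) <= (4 * Ce + 128 * a^2 * (h^2 / \<sigma>^2 * BX)) * (T n * \<Delta> n)"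
  by (rule sum_le_d2) (use c g_mom(3) Ce BX in auto)
 fix i assume i: "i < n"
 show "integrable M (%om. (p n i om - kap n i * e n i om)\<^sup>2)" by (rule c(1)[OF i])
 show "(%om. p n i om - kap n i * e n i om) : bmeas (G n i)"
  using e_G[OF g2 i] p_G[OF g2 i] by (intro borel_measurable_diff borel_measurable_times borel_measurable_const)
qed (use g_mom in auto)

text \<open>\<open>|e^2 - p^2| <= (1 + 1 / k) (e - p)^2 + k p^2\<close> with
  \<open>k = sqrt \<Delta>\<close>. The part with \<open>1 / k\<close> sums to order
  \<open>T sqrt \<Delta>\<close>, where the exponent \<open>1 / 2\<close> of the rate condition is
  used.\<close>

lemma square_term: "oP M (%n om. \<Sum>i<n. (e n i om)\<^sup>2 - (p n i om)^2)"
proof (rule oP_sum_L1[OF ev_good2], intro conjI allI impI)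
 have rt: "(%n. T n * sqrt (\<Delta> n)) ---> 0"
 proof (rule Lim_transform_eventually[OF rate_powr[OF min.cobounded2] ev_good])
  show "T n * \<Delta> n powr (1/2) = T n * sqrt (\<Delta> n)" if "good n" for n using goodD(4)[OF that] by (simp add: powr_half_sqrt)
 qed
 have "(%n. sqrt (\<Delta> n)) ---> 0" using tendsto_real_sqrt[OF mesh_0] by simp
 from tendsto_add[OF tendsto_add[OF lim_TD[of Ce] tendsto_mult_right_zero[OF rt, of Ce]] tendsto_mult_right_zero[OF this, of "h^2 / \<sigma>^2 * BX"]]
 show "(%n. Ce * (T n * \<Delta> n) + Ce * (T n * sqrt (\<Delta> n)) + h^2 / \<sigma>^2 * BX * sqrt (\<Delta> n)) ---> 0" by simp
 fix n assume g2: "good2 n"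
 define k where "k = sqrt (\<Delta> n)"
 have D: "\<Delta> n > 0" "T n > 0" and gd: "good n" using g2 goodD(3,4)[of n] by (auto simp: good2_def)
 have k: "k > 0" "\<Delta> n / k = k" using D by (auto simp: k_def real_div_sqrt)
 have c: "integrable M (%om. (e n i om)\<^sup>2 - (p n i om)^2)" "(LINT om|M. \<bar>(e n i om)^2 - (p n i om)^2\<bar>) <= (1 + 1 / k) * (Ce * (d n i)^2) + k * (h^2 / \<sigma>^2 * BX * d n i / T n)"
  if i: "i < n" for i
 proof -
  note em = ep_mom[OF g2 i] and pm = p_mom[OF g2 i]
  let ?b = "%om. (1 + 1 / k) * (e n i om - p n i om)^2 + k * (p n i om)^2"
  have bd: "\<bar>(e n i om)^2 - (p n i om)^2\<bar> <= ?b om" for om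
  proof -
  define u where "u = e n i om - p n i om"
  have "2 * (k * \<bar>p n i om\<bar>) * \<bar>u\<bar> <= (k * \<bar>p n i om\<bar>)^2 + \<bar>u\<bar>\<^sup>2" by (rule sum_squares_bound)
  then have "2 * \<bar>p n i om\<bar> * \<bar>u\<bar> <= k * (p n i om)^2 + u^2 / k" using k(1) by (simp add: field_simps power2_eq_square)
  moreover have "(e n i om)^2 - (p n i om)^2 = u^2 + 2 * p n i om * u" by (simp add: u_def power2_eq_square algebra_simps)
  moreover have "\<bar>u^2 + 2 * p n i om * u\<bar> <= u^2 + 2 * \<bar>p n i om\<bar> * \<bar>u\<bar>" using abs_triangle_ineq[of "u^2" "2 * p n i om * u"] by (simp add: abs_mult)
  ultimately show ?thesis by (simp add: u_def[symmetric] algebra_simps)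
  qed
  have ib: "integrable M ?b" using em pm by simp
  have m: "(%om. (e n i om)\<^sup>2 - (p n i om)^2) : bmeas M" using e_M[OF g2 i] by (intro borel_measurable_power borel_measurable_diff)
  show 1: "integrable M (%om. (e n i om)\<^sup>2 - (p n i om)^2)"
  by (rule Bochner_Integration.integrable_bound[OF ib m], rule AE_I2, unfold real_norm_def, rule order_trans[OF bd abs_ge_self])
  have "(LINT om|M. \<bar>(e n i om)^2 - (p n i om)^2\<bar>) <= (LINT om|M. ?b om)" by (rule integral_mono[OF integrable_abs[OF 1] ib bd])
  also have "... = (1 + 1 / k) * (LINT om|M. (e n i om - p n i om)\<^sup>2) + k * (LINT om|M. (p n i om)\<^sup>2)" using em pm by simp
  also have "... <= (1 + 1 / k) * (Ce * (d n i)^2) + k * (h^2 / \<sigma>^2 * BX * d n i / T n)"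
  using em(2) pm(2) k(1) by (intro add_mono mult_left_mono) auto
  finally show "(LINT om|M. \<bar>(e n i om)^2 - (p n i om)^2\<bar>) <= (1 + 1 / k) * (Ce * (d n i)^2) + k * (h^2 / \<sigma>^2 * BX * d n i / T n)" .
 qed
 show "integrable M (%om. (e n i om)\<^sup>2 - (p n i om)^2)" if "i < n" for i by (rule c(1)[OF that])
 have "(\<Sum>i<n. \<integral>om. \<bar>(e n i om)^2 - (p n i om)^2\<bar> \<partial>M) <= (\<Sum>i<n. (1 + 1 / k) * (Ce * (d n i)^2) + k * (h^2 / \<sigma>^2 * BX * d n i / T n))"
  by (rule sum_mono) (use c(2) in simp)
 also have "... = (\<Sum>i<n. (1 + 1 / k) * Ce * (d n i)^2) + (\<Sum>i<n. (h^2 / \<sigma>^2 * BX * k) * d n i / T n)" by (simp add: sum.distrib mult_ac)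
 also have "... <= (1 + 1 / k) * Ce * (T n * \<Delta> n) + h^2 / \<sigma>^2 * BX * k"
  by (intro add_mono sum_le_d2 sum_le_T[OF gd]) (use k Ce in auto)
 also have "... = Ce * (T n * \<Delta> n) + Ce * (T n * (\<Delta> n / k)) + h^2 / \<sigma>^2 * BX * k" by (simp add: algebra_simps)
 finally show "(\<Sum>i<n. \<integral>om. \<bar>(e n i om)^2 - (p n i om)^2\<bar> \<partial>M) <= Ce * (T n * \<Delta> n) + Ce * (T n * sqrt (\<Delta> n)) + h^2 / \<sigma>^2 * BX * sqrt (\<Delta> n)"
  unfolding k(2) by (simp only: k_def)
qed

text \<open>The value 1 outside \<open>good2\<close> keeps it positive and measurable for every
  \<open>n\<close>.\<close>

definition Lam where "Lam n om = (if good2 n then \<Prod>i<n. lratio (th n) (thp n) (t n) i om else 1)"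

text \<open>The sum of \<open>p g\<close> is \<open>h / \<sigma>\<close> times \<open>zeta\<close>,
  and the sum of \<open>p^2\<close> tends to \<open>h^2 qG / \<sigma>^2\<close>. Exchanging
  \<open>\<sigma> zeta\<close> for \<open>Asc\<close> makes the linear term a function of the
  observations.\<close>

lemma lan_expansion: "oP M (%n om. ln (Lam n om) + h / \<sigma>^2 * Asc n om + h^2 * (qG / \<sigma>^2) / 2)"
proof -
 have s0: "\<sigma> ~= 0" using sigma by auto
 have o: "oP M (%n om. (\<Sum>i<n. (ln ((kap n i)^2) + 1 - (kap n i)^2) / 2) + (\<Sum>i<n. (1 - (kap n i)^2) / 2 * ((g n i om)^2 - 1))
  + (\<Sum>i<n. (p n i om - kap n i * e n i om) * g n i om) - 1 / 2 * (\<Sum>i<n. (e n i om)\<^sup>2 - (p n i om)^2)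
  - (h^2 / \<sigma>^2 / 2) * ((\<Sum>i<n. (sqrt (d n i) / sqrt (T n) * x n i om)\<^sup>2) - qG) + h / \<sigma>^2 * (Asc n om - \<sigma> * zeta n om))"
  by (intro oP_add oP_diff oP_const[OF log_term] g2_term cross_term oP_cmult[OF square_term, where C="1/2"]
  oP_cmult[OF zeta_bracket, where C="\<bar>h^2 / \<sigma>^2 / 2\<bar>"] oP_cmult[OF Asc_oP, where C="\<bar>h / \<sigma>^2\<bar>"]) auto
 show ?thesis
 proof (rule oP_cong_eventually[OF o], intro ev_good2 ballI)
  fix n om assume g2: "good2 n"
  have "ln (Lam n om) = (\<Sum>i<n. ln (lratio (th n) (thp n) (t n) i om))"
  unfolding Lam_def if_P[OF g2] by (rule ln_prod) (simp, rule less_imp_neq[OF ln_lratio(1)[OF g2], symmetric], simp)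
  also have "... = (\<Sum>i<n. (ln ((kap n i)^2) + 1 - (kap n i)^2) / 2) + (\<Sum>i<n. (1 - (kap n i)^2) / 2 * ((g n i om)^2 - 1))
  + (\<Sum>i<n. (p n i om - kap n i * e n i om) * g n i om) - (\<Sum>i<n. p n i om * g n i om) - (\<Sum>i<n. (e n i om)\<^sup>2 / 2)"
  unfolding sum.distrib[symmetric] sum_subtractf[symmetric] by (intro sum.cong refl ln_lratio(2)[OF g2]) simp
  also have "(\<Sum>i<n. p n i om * g n i om) = h / \<sigma> * zeta n om"
  unfolding zeta_def sum_distrib_left p_def by (intro sum.cong refl) (simp only: mult.assoc)
  also have "(\<Sum>i<n. (e n i om)\<^sup>2 / 2) = 1 / 2 * (\<Sum>i<n. (e n i om)\<^sup>2 - (p n i om)^2) + 1 / 2 * (\<Sum>i<n. (p n i om)\<^sup>2)"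
  by (simp add: sum_subtractf sum_divide_distrib diff_divide_distrib)
  also have "(\<Sum>i<n. (p n i om)\<^sup>2) = h^2 / \<sigma>^2 * (\<Sum>i<n. (sqrt (d n i) / sqrt (T n) * x n i om)\<^sup>2)"
  unfolding sum_distrib_left p_def by (intro sum.cong refl) (simp only: power_mult_distrib[of "h / \<sigma>"] power_divide[of h])
  finally have L: "ln (Lam n om) = (\<Sum>i<n. (ln ((kap n i)^2) + 1 - (kap n i)^2) / 2) + (\<Sum>i<n. (1 - (kap n i)^2) / 2 * ((g n i om)^2 - 1))
  + (\<Sum>i<n. (p n i om - kap n i * e n i om) * g n i om) - h / \<sigma> * zeta n om
  - (1 / 2 * (\<Sum>i<n. (e n i om)\<^sup>2 - (p n i om)^2) + 1 / 2 * (h^2 / \<sigma>^2 * (\<Sum>i<n. (sqrt (d n i) / sqrt (T n) * x n i om)\<^sup>2)))" .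
  have z: "h / \<sigma>^2 * (\<sigma> * zeta n om) = h / \<sigma> * zeta n om" using s0 by (simp add: power2_eq_square)
  have alg: "A1 + A2 + A3 - Z - (1/2 * E + 1/2 * (H * Q)) + B + H * q / 2 = A1 + A2 + A3 - 1/2 * E - H / 2 * (Q - q) + (B - Z)" for A1 A2 A3 Z E H Q B q :: real
  by (simp add: field_simps)
  show "ln (Lam n om) + h / \<sigma>^2 * Asc n om + h^2 * (qG / \<sigma>^2) / 2 = (\<Sum>i<n. (ln ((kap n i)^2) + 1 - (kap n i)^2) / 2) + (\<Sum>i<n. (1 - (kap n i)^2) / 2 * ((g n i om)^2 - 1))
  + (\<Sum>i<n. (p n i om - kap n i * e n i om) * g n i om) - 1 / 2 * (\<Sum>i<n. (e n i om)\<^sup>2 - (p n i om)^2)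
  - (h^2 / \<sigma>^2 / 2) * ((\<Sum>i<n. (sqrt (d n i) / sqrt (T n) * x n i om)\<^sup>2) - qG) + h / \<sigma>^2 * (Asc n om - \<sigma> * zeta n om)"
  unfolding L right_diff_distrib[of "h / \<sigma>^2" "Asc n om"] z
  using alg[of _ _ _ "h / \<sigma> * zeta n om" _ "h^2 / \<sigma>^2" _ "h / \<sigma>^2 * Asc n om" qG] by simp
 qed
qed

end

section \<open>Estimator and score as functions on the observation space\<close>

lemma abar_eq: "abar t v n y = - filtered_sum (v n) n y / (\<Sum>i<n. (y i)\<^sup>2 * (t n (Suc i) - t n i))"
 by (simp add: abar_def filtered_sum_def)

lemma filtered_sum_PiM: "filtered_sum v n : bmeas (Pi\<^sub>M {..n} (%_. borel))"
 unfolding filtered_sum_def[abs_def]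
proof (rule borel_measurable_sum)
 fix i assume "i \<in> {..<n}"
 then have [measurable]: "(%y. y i) : bmeas (Pi\<^sub>M {..n} (%_. borel :: real measure))" "(%y. y (Suc i)) : bmeas (Pi\<^sub>M {..n} (%_. borel :: real measure))"
  by (auto intro!: measurable_component_singleton)
 show "(%y. y i * (y (Suc i) - y i) * indicator {z. \<bar>z\<bar> <= v} (y (Suc i) - y i)) : bmeas (Pi\<^sub>M {..n} (%_. borel :: real measure))" by measurable
qed

lemma square_sum_PiM: "(%y. \<Sum>i<(n::nat). (y i)\<^sup>2 * (c i :: real)) : bmeas (Pi\<^sub>M {..n} (%_. borel))"
 by (intro borel_measurable_sum borel_measurable_times borel_measurable_power borel_measurable_const measurable_component_singleton) auto

lemma abar_PiM: "abar t v n : bmeas (Pi\<^sub>M {..n} (%_. borel))"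
 unfolding abar_eq[abs_def]
 by (intro borel_measurable_divide borel_measurable_uminus filtered_sum_PiM square_sum_PiM)

lemma filtered_sum_restrict: "filtered_sum v n (\<lambda>i\<in>{..n}. y i) = filtered_sum v n y"
 unfolding filtered_sum_def by (intro sum.cong refl) auto

lemma abar_restrict: "abar t v n (\<lambda>i\<in>{..n}. y i) = abar t v n y"
 unfolding abar_eq filtered_sum_restrict by (intro arg_cong2[where f="(/)"] refl sum.cong) auto

lemma weak_conv_m_eventually:
 assumes "weak_conv_m A \<mu>" "EVN n. A n = B n"
 shows "weak_conv_m B \<mu>"
 unfolding weak_conv_m_def weak_conv_def
proof (intro allI impI)
 fix x assume "isCont (cdf \<mu>) x"
 with assms(1) have "(%n. cdf (A n) x) ---> cdf \<mu> x" unfolding weak_conv_m_def weak_conv_def by blast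
 moreover have "EVN n. cdf (A n) x = cdf (B n) x" using assms(2) by (rule eventually_mono) simp
 ultimately show "(%n. cdf (B n) x) ---> cdf \<mu> x" by (rule Lim_transform_eventually)
qed

context ou_array
begin

definition obs where "obs tt n om = (\<lambda>i\<in>{..n}. X tt (t n i) om)"

text \<open>The central sequence of the expansion, \<open>- Asc / \<sigma>^2\<close>, written on the
  observation space.\<close>

definition score where
 "score n y = - 1 / \<sigma>^2 * ((filtered_sum (v n) n y + th n * (\<Sum>i<n. (y i)\<^sup>2 * d n i)) / sqrt (T n))"

lemma obs_measurable: "obs tt n \<in> measurable M (Pi\<^sub>M {..n} (%_. borel))"
 unfolding obs_def[abs_def] by (intro measurable_restrict X_meas grid_nonneg[OF gr]) simp

lemma obs_law_eq: "obs_law M X t n tt = distr M (Pi\<^sub>M {..n} (%_. borel)) (obs tt n)"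
 unfolding obs_law_def obs_def[abs_def] ..

lemma score_PiM: "score n : bmeas (Pi\<^sub>M {..n} (%_. borel))"
 unfolding score_def[abs_def]
 by (intro borel_measurable_times borel_measurable_divide borel_measurable_add borel_measurable_const filtered_sum_PiM square_sum_PiM)

lemma score_obs: "score n (obs (th n) n om) = - 1 / \<sigma>^2 * Asc n om"
proof -
 have "(\<Sum>i<n. (obs (th n) n om i)\<^sup>2 * d n i) = (\<Sum>i<n. d n i * (x n i om)^2)"
  by (intro sum.cong refl) (simp add: obs_def x_def)
 then show ?thesis unfolding score_def Asc_def obs_def filtered_sum_restrict x_def by simp
qed

lemma score_conv: "weak_conv_m (%n. distr M borel (%om. score n (obs (th n) n om))) (density lborel (normal_density 0 (sqrt (qG / \<sigma>^2))))"
 and score_bP: "bP M (%n om. score n (obs (th n) n om))"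
proof -
 have s0: "\<sigma> ~= 0" using sigma by auto
 have c: "- 1 / \<sigma> ~= 0" "(- 1 / \<sigma>)^2 * qG = qG / \<sigma>^2" using s0 by (auto simp: power_divide)
 have "oP M (%n om. - 1 / \<sigma>^2 * (Asc n om - \<sigma> * zeta n om))" by (rule oP_cmult[OF Asc_oP, where C="\<bar>- 1 / \<sigma>^2\<bar>"]) simp
 then have o: "oP M (%n om. score n (obs (th n) n om) - - 1 / \<sigma> * zeta n om)"
  unfolding score_obs using s0 by (simp add: right_diff_distrib power2_eq_square)
 show "weak_conv_m (%n. distr M borel (%om. score n (obs (th n) n om))) (density lborel (normal_density 0 (sqrt (qG / \<sigma>^2))))"
  using weak_conv_zeta[OF c(1) measurable_compose[OF obs_measurable score_PiM] o] unfolding c(2) .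
 have "bP M (%n om. - 1 / \<sigma> * zeta n om)" by (rule bP_mult[OF bP_const[where C="\<bar>- 1 / \<sigma>\<bar>"] zeta_bP]) simp
 from bP_add_oP[OF this o] show "bP M (%n om. score n (obs (th n) n om))" by simp
qed

lemma lan:
 shows "EVN n. absolutely_continuous (obs_law M X t n (th n)) (obs_law M X t n (th n + h / sqrt (T n)))"
  and "\<epsilon> > 0 ==> (%n. measure (obs_law M X t n (th n)) {y\<in>space (obs_law M X t n (th n)).
  \<bar>ln (enn2real (RN_deriv (obs_law M X t n (th n)) (obs_law M X t n (th n + h / sqrt (T n))) y)) - h * score n y + h^2 * (qG / \<sigma>^2) / 2\<bar> > \<epsilon>}) ---> 0"
proof -
 interpret lan_array M X0 W N Z F \<sigma> lam X a S t \<beta> th h by unfold_locales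
 have tp: "thp n = th n + h / sqrt (T n)" for n by (rule thp_def)
 have L0: "0 < Lam n om" for n om unfolding Lam_def using ln_lratio(1) by (auto intro!: prod_pos)
 have LM: "Lam n : bmeas M" for n
 proof (cases "good2 n")
  case True
  show ?thesis unfolding Lam_def[abs_def] if_P[OF True]
  by (intro borel_measurable_prod adapted_indep_measurable[OF g_ad order_refl lratio_HG[OF gr th_pos]]) auto
 qed (simp add: Lam_def[abs_def])
 have ch: "EVN n. \<forall>B\<in>sets (Pi\<^sub>M {..n} (%_. borel)). emeasure (obs_law M X t n (thp n)) B = (\<integral>\<^sup>+om. indicator B (obs (th n) n om) * ennreal (Lam n om) \<partial>M)"
 proof (intro ev_good2 ballI)
  fix n B assume g2: "good2 n" and B: "B \<in> sets (Pi\<^sub>M {..n} (%_. borel :: real measure))"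
  have "0 < thp n" using g2 by (simp add: good2_def)
  from obs_law_change[where t=t and n=n and tt="th n" and tt'="thp n", OF gr th_pos this B] show "emeasure (obs_law M X t n (thp n)) B = (\<integral>\<^sup>+om. indicator B (obs (th n) n om) * ennreal (Lam n om) \<partial>M)"
  unfolding obs_def Lam_def if_P[OF g2] .
 qed
 have o: "oP M (%n om. ln (Lam n om) - h * score n (obs (th n) n om) + h^2 * (qG / \<sigma>^2) / 2)"
  using lan_expansion unfolding score_obs by simp
 have I: "qG / \<sigma>^2 > 0" using qG_pos sigma by simp
 have pr: "prob_space (obs_law M X t n (thp n))" "sets (obs_law M X t n (thp n)) = sets (Pi\<^sub>M {..n} (%_. borel))" for n
  unfolding obs_law_eq by (rule prob_space_distr[OF obs_measurable]) simp
 note r = likelihood_ratio_approx[where x="%n. obs (th n) n" and N="%n. Pi\<^sub>M {..n} (%_. borel)" and P'="%n. obs_law M X t n (thp n)" and S=score and L=Lam and h=h and I="qG / \<sigma>^2",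
  OF obs_measurable pr score_PiM LM L0 ch o I score_conv score_bP, folded obs_law_eq, unfolded tp]
 show "EVN n. absolutely_continuous (obs_law M X t n (th n)) (obs_law M X t n (th n + h / sqrt (T n)))"
  by (rule r(1))
 show "\<epsilon> > 0 ==> (%n. measure (obs_law M X t n (th n)) {y\<in>space (obs_law M X t n (th n)).
  \<bar>ln (enn2real (RN_deriv (obs_law M X t n (th n)) (obs_law M X t n (th n + h / sqrt (T n))) y)) - h * score n y + h^2 * (qG / \<sigma>^2) / 2\<bar> > \<epsilon>}) ---> 0"
  by (rule r(2))
qed

end

theorem theorem3p1:
  fixes M :: "'a measure"
    and X0 :: "'a \<Rightarrow> real"
    and W N :: "real \<Rightarrow> 'a \<Rightarrow> real"
    and Z :: "nat \<Rightarrow> 'a \<Rightarrow> real"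
    and F :: "real measure"
    and \<sigma> lam a \<beta> :: real
    and X :: "real \<Rightarrow> real \<Rightarrow> 'a \<Rightarrow> real"
    and t :: "nat \<Rightarrow> nat \<Rightarrow> real"
  assumes M: "prob_space M"
    and sigma: "\<sigma>\<^sup>2 > 0"
    and lam: "lam \<ge> 0"
    and F: "prob_space F" "sets F = sets borel"
    and X0: "X0 \<in> borel_measurable M"
    and W: "brownian_motion M W"
    and N: "poisson_process M lam N"
    and Z: "\<And>k. k \<ge> 1 \<Longrightarrow> distr M borel (Z k) = F"
    and Zmeas: "\<And>k. Z k \<in> borel_measurable M"
    and indep: "prob_space.indep_vars M (\<lambda>_. Pi\<^sub>M UNIV (\<lambda>_. borel))
                  (ingredients X0 W N Z) (UNIV - {IZ 0})"
    and X_ou: "\<And>\<theta> \<omega> s. \<omega> \<in> space M \<Longrightarrow> 0 \<le> s \<Longrightarrow>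
                 (\<lambda>u. X \<theta> u \<omega>) integrable_on {0..s} \<and>
                 X \<theta> s \<omega> = X0 \<omega> - \<theta> * integral {0..s} (\<lambda>u. X \<theta> u \<omega>) + levy_L \<sigma> W N Z s \<omega>"
    and grid0: "\<And>n. t n 0 = 0"
    and grid_incr: "\<And>n i. i < n \<Longrightarrow> t n i < t n (Suc i)"
    and T_inf: "filterlim (grid_T t) at_top sequentially"
    and mesh_dec: "decseq (\<lambda>n. grid_mesh t (Suc n))"
    and mesh_0: "grid_mesh t \<longlonglongrightarrow> 0"
    and nmesh: "(\<lambda>n. real n * grid_mesh t n / grid_T t n) \<in> O(\<lambda>_. 1)"
    and a_pos: "a > 0"
    and log_moment: "ennreal lam * (\<integral>\<^sup>+ x. indicator {x. \<bar>x\<bar> > 1} x * ennreal (ln \<bar>x\<bar>) \<partial>F) < \<infinity>"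
    and sup_moment: "(SUP s\<in>{0..}. \<integral>\<^sup>+ \<omega>. ennreal ((X a s \<omega>)\<^sup>2) \<partial>M) < \<infinity>"
    and small_jumps: "(\<lambda>n. measure F {- 2 * grid_mesh t n powr \<beta> <..< 2 * grid_mesh t n powr \<beta>})
                        \<in> o(\<lambda>n. 1 / grid_T t n)"
    and beta: "0 < \<beta>" "\<beta> < 1 / 2"
    and rate: "(\<lambda>n. grid_T t n * grid_mesh t n powr (min (1 - 2 * \<beta>) (1 / 2))) \<longlonglongrightarrow> 0"
  shows "weak_conv_m
           (\<lambda>n. distr M borel (\<lambda>\<omega>. sqrt (grid_T t n) *
              (abar t (\<lambda>m. grid_mesh t m powr \<beta>) n (\<lambda>i. X a (t n i) \<omega>) - a)))
           (density lborel (normal_density 0 (sqrt (\<sigma>\<^sup>2 / ou_second_moment_inf M X X0 a))))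
       \<and> hajek_lecam_efficient (obs_law M X t) (abar t (\<lambda>m. grid_mesh t m powr \<beta>)) a
           (\<lambda>n. 1 / sqrt (grid_T t n))"
proof -
 interpret prob_space M by fact
 interpret jump_ou M X0 W N Z F \<sigma> lam X
  by (rule jump_ou.intro[OF M], rule jump_ou_axioms.intro)
  (rule sigma lam F X0 W N Zmeas indep | (rule Z, assumption) | (rule X_ou, assumption, assumption))+
 define S where "S = enn2real (SUP s\<in>{0..}. \<integral>\<^sup>+ om. ennreal ((X a s om)^2) \<partial>M)"
 have X2: "(\<integral>\<^sup>+ om. ennreal ((X a s om)^2) \<partial>M) <= ennreal S" if "s >= 0" for s
 proof -
  have "(\<integral>\<^sup>+ om. ennreal ((X a s om)^2) \<partial>M) <= (SUP s\<in>{0..}. \<integral>\<^sup>+ om. ennreal ((X a s om)^2) \<partial>M)" by (rule SUP_upper) (use that in simp)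
  then show ?thesis using sup_moment by (simp add: S_def less_top)
 qed
 interpret stat_ou M X0 W N Z F \<sigma> lam X a S
  by unfold_locales (rule a_pos | (rule X2, assumption) | simp add: S_def)+
 have arr: "ou_array M X0 W N Z F \<sigma> lam X a S t \<beta> th" if "\<And>n. th n > 0" "th ---> a" for th
  by unfold_locales (rule grid0 T_inf mesh_0 nmesh small_jumps beta rate that | (rule grid_incr, assumption))+
 let ?v = "%m. grid_mesh t m powr \<beta>" and ?r = "%n. 1 / sqrt (grid_T t n)" and ?Q = "density lborel (normal_density 0 (sqrt (\<sigma>^2 / qG)))"
 interpret base: ou_array M X0 W N Z F \<sigma> lam X a S t \<beta> "%_. a" by (rule arr) (use a_pos in auto)
 have first: "weak_conv_m (%n. distr M borel (%om. sqrt (grid_T t n) * (abar t ?v n (%i. X a (t n i) om) - a))) ?Q"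
  using base.estimator_clt unfolding base.x_def .
 have I: "0 < qG / \<sigma>^2" using qG_pos sigma by simp
 have LAN: "LAN (obs_law M X t) a ?r (qG / \<sigma>^2)"
  unfolding LAN_def
 proof (intro conjI exI[of _ base.score] allI impI)
  fix n
  show "base.score n : bmeas (obs_law M X t n a)" unfolding base.obs_law_eq using base.score_PiM by simp
 next
  have "distr (obs_law M X t n a) borel (base.score n) = distr M borel (%om. base.score n (base.obs a n om))" for n
  unfolding base.obs_law_eq using distr_distr[OF base.score_PiM base.obs_measurable] by (simp add: comp_def)
  then show "weak_conv_m (%n. distr (obs_law M X t n a) borel (base.score n)) (density lborel (normal_density 0 (sqrt (qG / \<sigma>^2))))"
  using base.score_conv by simp
 next
  fix h
  show "EVN n. absolutely_continuous (obs_law M X t n a) (obs_law M X t n (a + h * ?r n))" using base.lan(1)[of h] by simp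
  fix \<epsilon> :: real assume "\<epsilon> > 0"
  from base.lan(2)[OF this, of h] show "(%n. measure (obs_law M X t n a) {x\<in>space (obs_law M X t n a).
  \<bar>ln (enn2real (RN_deriv (obs_law M X t n a) (obs_law M X t n (a + h * ?r n)) x)) - h * base.score n x + h^2 * (qG / \<sigma>^2) / 2\<bar> > \<epsilon>}) ---> 0" by simp
 qed (rule I)
 have reg: "regular_estimator (obs_law M X t) (abar t ?v) a ?r ?Q"
  unfolding regular_estimator_def
 proof
  fix h
  \<comment> \<open>For small \<open>n\<close> the local alternative may fail to be positive;
    \<open>a\<close> is substituted there, since the array asks for positive drifts at every
    \<open>n\<close>.\<close>
  define th where "th n = (if a + h * ?r n > 0 then a + h * ?r n else a)" for n
  have "filterlim (%n. sqrt (grid_T t n)) at_top sequentially" by (rule filterlim_compose[OF sqrt_at_top T_inf])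
  from tendsto_mult_right_zero[OF tendsto_inverse_0_at_top[OF this], of h]
  have lim: "(%n. a + h * ?r n) ---> a" using tendsto_add[OF tendsto_const[of a]] by (fastforce simp: divide_inverse)
  have ev: "EVN n. a + h * ?r n > 0" by (rule order_tendstoD(1)[OF lim a_pos])
  have thl: "th ---> a" by (rule Lim_transform_eventually[OF lim]) (use ev in \<open>eventually_elim, simp add: th_def\<close>)
  interpret per: ou_array M X0 W N Z F \<sigma> lam X a S t \<beta> th by (rule arr) (use thl a_pos in \<open>auto simp: th_def\<close>)
  have "EVN n. distr M borel (%om. sqrt (grid_T t n) * (abar t ?v n (%i. per.x n i om) - th n))
  = distr (obs_law M X t n (a + h * ?r n)) borel (%y. (abar t ?v n y - (a + h * ?r n)) / ?r n)"
  using ev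
  proof eventually_elim
  case (elim n)
  have th: "th n = a + h * ?r n" using elim by (simp add: th_def)
  have m: "(%y. (abar t ?v n y - th n) / ?r n) : bmeas (Pi\<^sub>M {..n} (%_. borel))"
  by (intro borel_measurable_divide borel_measurable_diff abar_PiM borel_measurable_const)
  have "distr (obs_law M X t n (th n)) borel (%y. (abar t ?v n y - th n) / ?r n) = distr M borel (%om. (abar t ?v n (per.obs (th n) n om) - th n) / ?r n)"
  unfolding per.obs_law_eq using distr_distr[OF m per.obs_measurable] by (simp add: comp_def)
  also have "... = distr M borel (%om. sqrt (grid_T t n) * (abar t ?v n (%i. per.x n i om) - th n))"
  unfolding per.obs_def abar_restrict per.x_def by (simp add: mult.commute)
  finally show ?case unfolding th by simp
  qed
  from weak_conv_m_eventually[OF per.estimator_clt this]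
  show "weak_conv_m (%n. distr (obs_law M X t n (a + h * ?r n)) borel (%y. (abar t ?v n y - (a + h * ?r n)) / ?r n)) ?Q" .
 qed
 have q: "1 / (qG / \<sigma>^2) = \<sigma>^2 / qG" by simp
 show ?thesis
  unfolding hajek_lecam_efficient_def qG_def[symmetric]
  using first LAN reg[folded q] by blast
qed

end
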